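(* Let $n\ge2$, let $F$ be a Minkowski norm on $\mathbb{R}^{n+1}$, and let $\omega_0\in(-F(E_{n+1}),F(-E_{n+1}))$. Let $\Sigma\subset\overline{\mathbb{R}^{n+1}_+}$ be a compact, embedded $C^2$-hypersurface with boundary $\partial\Sigma\subset\partial\mathbb{R}^{n+1}_+$ intersecting $\partial\mathbb{R}^{n+1}_+$ transversally such that $$\langle\nu_F(x),-E_{n+1}\rangle=\omega(x)\ge\omega_0\quad\text{for any }x\in\partial\Sigma,$$ where $\nu$ is the outward unit normal to $\Sigma$ with respect to the bounded domain $\Omega$ enclosed by $\Sigma$ and $\partial\mathbb{R}^{n+1}_+$. Then $$\frac{1}{n+1}\int_\Sigma\bigl(F(\nu)+\omega_0\langle\nu,E^F_{n+1}\rangle\bigr)|H^F|^n\,dA\ \ge\ |\mathcal{W}^F_{1,\omega_0}|,$$ where $\mathcal{W}^F_{1,\omega_0}=\mathcal{W}^F_1(\omega_0E^F_{n+1})\cap\mathbb{R}^{n+1}_+$. Moreover, equality holds if and only if $\Sigma$ is an anisotropic $\omega_0$-capillary Wulff shape in $\overline{\mathbb{R}^{n+1}_+}$.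
   Context: Minkowski norm: a smooth positive function $F$ on the round sphere $(\mathbb{S}^n,\sigma)$ with $A_F=\nabla^2F+F\sigma$ positive definite, extended one-homogeneously to $\mathbb{R}^{n+1}$ ($F(\xi)=|\xi|F(\xi/|\xi|)$, $F(0)=0$); not assumed even. $\Phi(z)=DF(z)=\nabla F(z)+F(z)z$ for $z\in\mathbb{S}^n$. Dual norm: $F^o(x)=\sup\{\langle x,z\rangle/F(z):z\in\mathbb{S}^n\}$. $\mathcal{W}^F_r(x_0)=\{x:F^o(x-x_0)<r\}$; its boundary $\partial\mathcal{W}^F_r(x_0)$ is the Wulff shape of radius $r$ centered at $x_0$. For a $C^2$-hypersurface with unit normal $\nu$: $\nu_F=\Phi(\nu)$, the anisotropic principal curvatures $\kappa^F_i$ are the eigenvalues of $d\nu_F=A_F(\nu)\circ d\nu$ on $T_p\Sigma$, and $H^F=\frac1n\sum_{i=1}^n\kappa^F_i$. $E_1,\dots,E_{n+1}$ is the coordinate basis; $\mathbb{R}^{n+1}_+=\{x_{n+1}>0\}$. The constant vector $E^F_{n+1}$ is $$E^F_{n+1}=-\tfrac{\Phi(-E_{n+1})}{F(-E_{n+1})}\ \text{if }\omega_0>0,\qquad \tfrac{\Phi(E_{n+1})}{F(E_{n+1})}\ \text{if }\omega_0<0,\qquad E_{n+1}\ \text{if }\omega_0=0.$$ A hypersurface in $\overline{\mathbb{R}^{n+1}_+}$ is anisotropic $\omega_0$-capillary if it intersects $\partial\mathbb{R}^{n+1}_+$ transversally with $\langle\nu_F,-E_{n+1}\rangle\equiv\omega_0$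 along its boundary. An anisotropic $\omega_0$-capillary Wulff shape is an anisotropic $\omega_0$-capillary hypersurface of the form $\partial\mathcal{W}^F_r(x_0)\cap\overline{\mathbb{R}^{n+1}_+}$, with $\nu$ the outward normal of the Wulff ball. $|\cdot|$ of an open set is Lebesgue measure. *)

theory Defs
  imports "HOL-Analysis.Analysis"
begin

text \<open>
  The ambient space of dimension \<open>n + 1\<close> is written as the product of \<open>real ^ 'n\<close>, where
  \<open>n = CARD('n)\<close>, and of the last coordinate axis.  The library equips the product with the
  Euclidean inner product, norm and Lebesgue measure.
\<close>

type_synonym 'n ambient = "(real ^ 'n) \<times> real"

definition E_last :: "'n::finite ambient" where
  "E_last = (0, 1)"

definition open_half_space :: "'n::finite ambient set" where
  "open_half_space = {x. x \<bullet> E_last > 0}"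

definition closed_half_space :: "'n::finite ambient set" where
  "closed_half_space = {x. x \<bullet> E_last \<ge> 0}"

definition bounding_plane :: "'n::finite ambient set" where
  "bounding_plane = {x. x \<bullet> E_last = 0}"


section \<open>Differentiability classes\<close>

text \<open>The class \<open>C\<^sup>k\<close>; only meaningful for open \<open>U\<close>.\<close>

primrec C_k_on ::
  "nat \<Rightarrow> 'a::real_normed_vector set \<Rightarrow> ('a \<Rightarrow> 'b::real_normed_vector) \<Rightarrow> bool" where
  "C_k_on 0 U f \<longleftrightarrow> continuous_on U f"
| "C_k_on (Suc k) U f \<longleftrightarrow>
     (\<forall>x\<in>U. f differentiable (at x)) \<and> (\<forall>v. C_k_on k U (\<lambda>x. frechet_derivative f (at x) v))"

definition smooth_on :: "'a::real_normed_vector set \<Rightarrow> ('a \<Rightarrow> 'b::real_normed_vector) \<Rightarrow> bool" where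
  "smooth_on U f \<longleftrightarrow> (\<forall>k. C_k_on k U f)"

definition grad :: "('a::real_inner \<Rightarrow> real) \<Rightarrow> 'a \<Rightarrow> 'a" where
  "grad f x = (THE D. GDERIV f x :> D)"


section \<open>Minkowski norms\<close>

text \<open>
  Calculus on the round unit sphere is expressed through the zero-homogeneous extension
  \<open>radial_ext f\<close> of a function \<open>f\<close> on the sphere.  Its Euclidean gradient at a point of the sphere
  is tangential, hence is the intrinsic gradient; the Levi-Civita connection of the sphere is the
  tangential part of the Euclidean derivative, so that for \<open>X\<close>, \<open>Y\<close> orthogonal to \<open>z\<close>,
  \<open>sphere_hessian f z X Y\<close> is the covariant Hessian.
\<close>

definition radial_ext :: "('a::real_inner \<Rightarrow> real) \<Rightarrow> 'a \<Rightarrow> real" where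
  "radial_ext f x = f (x /\<^sub>R norm x)"

definition smooth_on_sphere :: "('a::real_inner \<Rightarrow> real) \<Rightarrow> bool" where
  "smooth_on_sphere f \<longleftrightarrow> smooth_on (- {0}) (radial_ext f)"

definition sphere_hessian :: "('a::real_inner \<Rightarrow> real) \<Rightarrow> 'a \<Rightarrow> 'a \<Rightarrow> 'a \<Rightarrow> real" where
  "sphere_hessian f z X Y = frechet_derivative (grad (radial_ext f)) (at z) X \<bullet> Y"

definition A_form :: "('a::real_inner \<Rightarrow> real) \<Rightarrow> 'a \<Rightarrow> 'a \<Rightarrow> 'a \<Rightarrow> real" where
  "A_form F z X Y = sphere_hessian F z X Y + F z * (X \<bullet> Y)"

definition minkowski_norm :: "('a::euclidean_space \<Rightarrow> real) \<Rightarrow> bool" where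
  "minkowski_norm F \<longleftrightarrow>
     smooth_on_sphere F \<and>
     (\<forall>z\<in>sphere 0 1. F z > 0) \<and>
     (\<forall>z\<in>sphere 0 1. \<forall>X. X \<bullet> z = 0 \<longrightarrow> X \<noteq> 0 \<longrightarrow> A_form F z X X > 0) \<and>
     F 0 = 0 \<and> (\<forall>\<xi>. \<xi> \<noteq> 0 \<longrightarrow> F \<xi> = norm \<xi> * F (\<xi> /\<^sub>R norm \<xi>))"

text \<open>\<open>Phi F z\<close> is the Euclidean gradient of the one-homogeneous extension.\<close>

definition Phi :: "('a::real_inner \<Rightarrow> real) \<Rightarrow> 'a \<Rightarrow> 'a" where
  "Phi F z = grad F z"

definition dual_norm :: "('a::euclidean_space \<Rightarrow> real) \<Rightarrow> 'a \<Rightarrow> real" where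
  "dual_norm F x = (SUP z\<in>sphere 0 1. (x \<bullet> z) / F z)"

definition wulff_ball :: "('a::euclidean_space \<Rightarrow> real) \<Rightarrow> real \<Rightarrow> 'a \<Rightarrow> 'a set" where
  "wulff_ball F r x0 = {x. dual_norm F (x - x0) < r}"

definition E_F :: "('n::finite ambient \<Rightarrow> real) \<Rightarrow> real \<Rightarrow> 'n ambient" where
  "E_F F \<omega>0 =
     (if \<omega>0 > 0 then - (Phi F (- E_last) /\<^sub>R F (- E_last))
      else if \<omega>0 < 0 then Phi F E_last /\<^sub>R F E_last
      else E_last)"


section \<open>Embedded hypersurfaces with boundary\<close>

text \<open>
  A chart \<open>\<psi>\<close> (with inverse \<open>g\<close>) of the ambient space straightens \<open>S\<close>: it maps \<open>S \<inter> U\<close> to the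
  part in \<open>V\<close> of \<open>W \<times> {0}\<close>, where \<open>W\<close> is all of \<open>real ^ 'n\<close> or a closed coordinate half-space.
\<close>

definition model_half :: "'n::finite \<Rightarrow> (real ^ 'n) set" where
  "model_half i = {y. y $ i \<ge> 0}"

definition models :: "(real ^ 'n::finite) set set" where
  "models = insert UNIV (range model_half)"

definition adapted_chart ::
  "'n::finite ambient set \<Rightarrow> (real ^ 'n) set \<Rightarrow> 'n ambient set \<Rightarrow> 'n ambient set \<Rightarrow>
   ('n ambient \<Rightarrow> 'n ambient) \<Rightarrow> ('n ambient \<Rightarrow> 'n ambient) \<Rightarrow> bool" where
  "adapted_chart S W U V \<psi> g \<longleftrightarrow>
     W \<in> models \<and> open U \<and> open V \<and> homeomorphism U V \<psi> g \<and>
     C_k_on 2 U \<psi> \<and> C_k_on 2 V g \<and> \<psi> ` (S \<inter> U) = V \<inter> (W \<times> {0})"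

definition C2_hypersurface :: "'n::finite ambient set \<Rightarrow> bool" where
  "C2_hypersurface S \<longleftrightarrow> (\<forall>p\<in>S. \<exists>W U V \<psi> g. adapted_chart S W U V \<psi> g \<and> p \<in> U)"

definition hs_boundary :: "'n::finite ambient set \<Rightarrow> 'n ambient set" where
  "hs_boundary S =
     {p \<in> S. \<exists>i U V \<psi> g. adapted_chart S (model_half i) U V \<psi> g \<and> p \<in> U \<and> fst (\<psi> p) $ i = 0}"

text \<open>The full \<open>n\<close>-dimensional tangent space, also at boundary points.\<close>

definition tangent_space :: "'n::finite ambient set \<Rightarrow> 'n ambient \<Rightarrow> 'n ambient set" where
  "tangent_space S p =
     {v. \<exists>W U V \<psi> g. adapted_chart S W U V \<psi> g \<and> p \<in> U \<and> snd (frechet_derivative \<psi> (at p) v) = 0}"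

text \<open>
  At a boundary point the line through \<open>p\<close> in direction \<open>\<nu> p\<close> need not meet the domain, so the
  sidedness condition is imposed at interior points and determines \<open>\<nu>\<close> on the boundary by
  continuity.
\<close>

definition outward_unit_normal ::
  "'n::finite ambient set \<Rightarrow> 'n ambient set \<Rightarrow> ('n ambient \<Rightarrow> 'n ambient) \<Rightarrow> bool" where
  "outward_unit_normal S \<Omega> \<nu> \<longleftrightarrow>
     continuous_on S \<nu> \<and>
     (\<forall>p\<in>S. norm (\<nu> p) = 1 \<and> (\<forall>v\<in>tangent_space S p. \<nu> p \<bullet> v = 0)) \<and>
     (\<forall>p\<in>S - hs_boundary S.
        \<forall>\<^sub>F t in at_right 0. p - t *\<^sub>R \<nu> p \<in> \<Omega> \<and> p + t *\<^sub>R \<nu> p \<notin> \<Omega>)"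

definition intersects_plane_transversally :: "'n::finite ambient set \<Rightarrow> bool" where
  "intersects_plane_transversally S \<longleftrightarrow>
     S \<inter> bounding_plane \<noteq> {} \<and>
     (\<forall>p\<in>S \<inter> bounding_plane.
        {u + w | u w. u \<in> tangent_space S p \<and> w \<in> bounding_plane} = UNIV)"

text \<open>\<open>\<Omega>\<close> is a bounded domain enclosed by \<open>S\<close> and the bounding plane.\<close>

definition enclosed_domain :: "'n::finite ambient set \<Rightarrow> 'n ambient set \<Rightarrow> bool" where
  "enclosed_domain S \<Omega> \<longleftrightarrow>
     open \<Omega> \<and> connected \<Omega> \<and> bounded \<Omega> \<and> \<Omega> \<noteq> {} \<and> \<Omega> \<subseteq> open_half_space \<and>
     frontier \<Omega> \<inter> open_half_space = S \<inter> open_half_space"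


section \<open>Area measure\<close>

definition gram_jacobian :: "(real ^ 'n::finite \<Rightarrow> 'n ambient) \<Rightarrow> real ^ 'n \<Rightarrow> real" where
  "gram_jacobian \<phi> y =
     sqrt (det (\<chi> i j. frechet_derivative \<phi> (at y) (axis i 1) \<bullet> frechet_derivative \<phi> (at y) (axis j 1)))"

text \<open>
  The Riemannian area of a hypersurface: the unique Borel measure concentrated on \<open>S\<close> that in all
  local coordinates \<open>y\<close> has density \<open>sqrt (det (g\<^sub>i\<^sub>j))\<close> with respect to Lebesgue measure, \<open>g\<^sub>i\<^sub>j\<close> being
  the induced metric.
\<close>

definition is_area_measure :: "'n::finite ambient set \<Rightarrow> 'n ambient measure \<Rightarrow> bool" where
  "is_area_measure S \<mu> \<longleftrightarrow>
     sets \<mu> = sets borel \<and> emeasure \<mu> (- S) = 0 \<and>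
     (\<forall>W U V \<psi> g B. adapted_chart S W U V \<psi> g \<longrightarrow> B \<in> sets borel \<longrightarrow> B \<subseteq> W \<longrightarrow> B \<times> {0} \<subseteq> V \<longrightarrow>
        emeasure \<mu> ((\<lambda>y. g (y, 0)) ` B) =
        (\<integral>\<^sup>+ y\<in>B. ennreal (gram_jacobian (\<lambda>y. g (y, 0)) y) \<partial>lborel))"

definition area_measure :: "'n::finite ambient set \<Rightarrow> 'n ambient measure" where
  "area_measure S = (THE \<mu>. is_area_measure S \<mu>)"


section \<open>Anisotropic curvature and capillarity\<close>

text \<open>
  \<open>\<kappa>\<close> lists the eigenvalues, with multiplicity, of the differential of the anisotropic Gauss map on
  the tangent space, relative to a basis of eigenvectors.  Such a basis exists because the
  differential is the product of a positive definite and a symmetric operator.  The values of the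
  derivative within \<open>S\<close> outside the tangent space are irrelevant.
\<close>

definition aniso_principal_curvatures ::
  "('n::finite ambient \<Rightarrow> real) \<Rightarrow> 'n ambient set \<Rightarrow> ('n ambient \<Rightarrow> 'n ambient) \<Rightarrow> 'n ambient \<Rightarrow>
   ('n \<Rightarrow> real) \<Rightarrow> bool" where
  "aniso_principal_curvatures F S \<nu> p \<kappa> \<longleftrightarrow>
     (\<exists>D b. ((\<lambda>x. Phi F (\<nu> x)) has_derivative D) (at p within S) \<and>
            inj b \<and> independent (range b) \<and> span (range b) = tangent_space S p \<and>
            (\<forall>i. D (b i) = \<kappa> i *\<^sub>R b i))"

definition aniso_mean_curvature ::
  "('n::finite ambient \<Rightarrow> real) \<Rightarrow> 'n ambient set \<Rightarrow> ('n ambient \<Rightarrow> 'n ambient) \<Rightarrow> 'n ambient \<Rightarrow> real" where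
  "aniso_mean_curvature F S \<nu> p =
     (THE h. \<exists>\<kappa>. aniso_principal_curvatures F S \<nu> p \<kappa> \<and> h = (\<Sum>i\<in>UNIV. \<kappa> i) / real CARD('n))"

definition aniso_capillary ::
  "('n::finite ambient \<Rightarrow> real) \<Rightarrow> real \<Rightarrow> 'n ambient set \<Rightarrow> ('n ambient \<Rightarrow> 'n ambient) \<Rightarrow> bool" where
  "aniso_capillary F \<omega>0 S \<nu> \<longleftrightarrow>
     C2_hypersurface S \<and> S \<subseteq> closed_half_space \<and> hs_boundary S \<subseteq> bounding_plane \<and>
     intersects_plane_transversally S \<and>
     (\<forall>p\<in>hs_boundary S. Phi F (\<nu> p) \<bullet> (- E_last) = \<omega>0)"

definition capillary_wulff_shape ::
  "('n::finite ambient \<Rightarrow> real) \<Rightarrow> real \<Rightarrow> 'n ambient set \<Rightarrow> bool" where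
  "capillary_wulff_shape F \<omega>0 S \<longleftrightarrow>
     (\<exists>r x0 \<nu>. r > 0 \<and> S = frontier (wulff_ball F r x0) \<inter> closed_half_space \<and>
        outward_unit_normal (frontier (wulff_ball F r x0)) (wulff_ball F r x0) \<nu> \<and>
        aniso_capillary F \<omega>0 S \<nu>)"

definition truncated_wulff_ball :: "('n::finite ambient \<Rightarrow> real) \<Rightarrow> real \<Rightarrow> 'n ambient set" where
  "truncated_wulff_ball F \<omega>0 = wulff_ball F 1 (\<omega>0 *\<^sub>R E_F F \<omega>0) \<inter> open_half_space"

definition willmore_integral ::
  "('n::finite ambient \<Rightarrow> real) \<Rightarrow> real \<Rightarrow> 'n ambient set \<Rightarrow> ('n ambient \<Rightarrow> 'n ambient) \<Rightarrow> real" where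
  "willmore_integral F \<omega>0 S \<nu> =
     (LINT x:S|area_measure S.
        (F (\<nu> x) + \<omega>0 * (\<nu> x \<bullet> E_F F \<omega>0)) * \<bar>aniso_mean_curvature F S \<nu> x\<bar> ^ CARD('n))"

end

theory Submission
  imports Defs
begin

text \<open>
  The proof is by the anisotropic normal map \<open>p \<mapsto> \<Phi> (\<nu> p)\<close>, shifted by \<open>\<omega>0 *\<^sub>R E_F F \<omega>0\<close> so that the
  truncated Wulff ball becomes the cone over the normals \<open>z\<close> with \<open>- \<Phi> z \<bullet> E < \<omega>0\<close>.  Translating a
  hyperplane with such a normal towards \<open>\<Omega>\<close> from infinity, first contact takes place at a point above
  the plane: at a point of the plane, the contact angle condition and the monotonicity of \<open>\<Phi>\<close> in the
  direction \<open>E\<close> would be violated.  So the cone is covered by the cone over the normal image of the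
  contact points, whose volume is at most \<open>1/(n+1)\<close> times the integral of
  \<open>(F (\<nu>) + \<omega>0 \<langle>\<nu>, E\<^sup>F\<rangle>) K\<close>, with \<open>K\<close> the anisotropic Gauss-Kronecker curvature.  The surface is convex
  at contact points, hence \<open>K \<le> H ^ n\<close> there.

  In case of equality every interior point with \<open>H \<noteq> 0\<close> is an umbilic contact point, so that near it
  \<open>H\<close> is constant and \<open>p - \<Phi> (\<nu> p) / H\<close> is a fixed centre.  By an open and closed argument each such
  piece is the whole part of a Wulff shape above the plane; two pieces share their top point, and a
  component without such points is excluded by touching it with a large sphere.
\<close>

text \<open>The vertex of all cones is the origin. It lies on the bounding plane, so the half-space
  is itself a cone from it, and \<open>F_shift_pos\<close> places it strictly inside the Wulff ball
  about \<open>shift\<close>. Hence each ray from the origin into the half-space leaves that ball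
  exactly once, and the leaving point names the normal. The factor in front of K is the distance
  from the origin to the tangent plane of the shifted Wulff shape, the height of an infinitesimal
  cone. \<open>enclosed_domain\<close> prescribes the frontier of \<Omega> above the plane only, and
  the surface may be disconnected, so everything near the plane is obtained by approaching it from
  above. The surface is only of class \<open>C\<^sup>2\<close>: its curvature is merely continuous,
  and the Codazzi equations cannot be used to make an umbilic piece spherical. Comparing the
  anisotropic normal along two parallel lines takes their place; the lines are orthogonal to a given
  tangent vector, which is where n \<ge> 2 enters. In the equality case the contact set also admits
  the angle \<omega>0 itself, so that violating the angle condition is an open condition.\<close>

text \<open>The library proves the change of variables formula on \<open>real ^ 'm\<close> for well-ordered \<open>'m\<close>.  The type
  \<open>'a bidx\<close> of indices for an orthonormal basis transports it to any Euclidean space \<open>'a\<close>.\<close>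

typedef (overloaded) 'a::euclidean_space bidx = "{..<DIM('a)}"
  by (auto intro!: exI[of _ 0])

instantiation bidx :: (euclidean_space) wellorder
begin

definition less_eq_bidx :: "'a bidx \<Rightarrow> 'a bidx \<Rightarrow> bool" where
  "i \<le> j \<longleftrightarrow> Rep_bidx i \<le> Rep_bidx j"

definition less_bidx :: "'a bidx \<Rightarrow> 'a bidx \<Rightarrow> bool" where
  "i < j \<longleftrightarrow> Rep_bidx i < Rep_bidx j"

instance
proof
  fix P :: "'a bidx \<Rightarrow> bool" and a
  assume step: "\<And>x. (\<And>y. y < x \<Longrightarrow> P y) \<Longrightarrow> P x"
  show "P a"
  proof (induction a rule: measure_induct_rule[of Rep_bidx])
    case (less x)
    show ?case by (rule step, rule less) (simp add: less_bidx_def)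
  qed
qed (auto simp: less_eq_bidx_def less_bidx_def Rep_bidx_inject)

end

instance bidx :: (euclidean_space) finite
proof
  have "inj (Rep_bidx :: 'a bidx \<Rightarrow> nat)"
    by (simp add: inj_on_def Rep_bidx_inject)
  moreover have "finite (range (Rep_bidx :: 'a bidx \<Rightarrow> nat))"
    by (rule finite_subset[of _ "{..<DIM('a)}"]) (use Rep_bidx in auto)
  ultimately show "finite (UNIV :: 'a bidx set)"
    using finite_imageD by blast
qed

lemma CARD_bidx: "CARD('a::euclidean_space bidx) = DIM('a)"
  by (metis type_definition.card type_definition_bidx card_lessThan)

definition basis_enum :: "'a::euclidean_space bidx \<Rightarrow> 'a" where
  "basis_enum = (SOME f. bij_betw f UNIV Basis)"

lemma bij_basis_enum: "bij_betw (basis_enum :: 'a::euclidean_space bidx \<Rightarrow> 'a) UNIV Basis"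
proof -
  have "\<exists>f :: 'a bidx \<Rightarrow> 'a. bij_betw f UNIV Basis"
    by (rule finite_same_card_bij) (auto simp: CARD_bidx)
  then show ?thesis unfolding basis_enum_def by (rule someI_ex)
qed

lemma basis_enum_in_Basis [simp]: "basis_enum i \<in> Basis"
  using bij_basis_enum by (auto simp: bij_betw_def)

lemma inner_basis_enum [simp]:
  "basis_enum i \<bullet> basis_enum j = (if i = j then 1 else 0)"
  using bij_basis_enum[where 'a='a] by (auto simp: inner_Basis bij_betw_def inj_on_def)

section \<open>Coordinates in an orthonormal basis, and Lebesgue measure\<close>

definition to_vec :: "'a::euclidean_space \<Rightarrow> real ^ 'a bidx" where
  "to_vec x = (\<chi> i. x \<bullet> basis_enum i)"

definition of_vec :: "real ^ 'a bidx \<Rightarrow> 'a::euclidean_space" where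
  "of_vec v = (\<Sum>i\<in>UNIV. (v $ i) *\<^sub>R basis_enum i)"

lemma to_vec_of_vec [simp]: "to_vec (of_vec v) = v"
  by (simp add: to_vec_def of_vec_def vec_eq_iff inner_sum_left if_distrib cong: if_cong)

lemma of_vec_to_vec [simp]: "of_vec (to_vec x) = x"
proof -
  have "(\<Sum>i\<in>UNIV. (x \<bullet> basis_enum i) *\<^sub>R basis_enum i) = (\<Sum>b\<in>Basis. (x \<bullet> b) *\<^sub>R b)"
    using sum.reindex_bij_betw[OF bij_basis_enum, of "\<lambda>b. (x \<bullet> b) *\<^sub>R b"] by simp
  then show ?thesis
    by (simp add: to_vec_def of_vec_def euclidean_representation)
qed

lemma linear_to_vec: "linear to_vec"
  by (rule linearI) (auto simp: to_vec_def vec_eq_iff inner_add_left)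

lemma linear_of_vec: "linear of_vec"
  by (rule linearI) (auto simp: of_vec_def scaleR_add_left sum.distrib scaleR_sum_right)

lemma continuous_to_vec: "continuous_on S to_vec"
  by (simp add: linear_continuous_on linear_conv_bounded_linear[THEN iffD1, OF linear_to_vec])

lemma continuous_of_vec: "continuous_on S of_vec"
  by (simp add: linear_continuous_on linear_conv_bounded_linear[THEN iffD1, OF linear_of_vec])

text \<open>Coordinates along an orthonormal basis carry boxes to boxes with the same side lengths,
  and Lebesgue measure is characterised by its values on boxes.\<close>

lemma lborel_distr_to_vec: "distr lborel borel to_vec = (lborel :: (real ^ 'a::euclidean_space bidx) measure)"
proof (rule lborel_eqI[symmetric])
  have [measurable]: "to_vec \<in> borel_measurable (borel :: 'a measure)"
    by (rule borel_measurable_continuous_onI[OF continuous_to_vec])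
  fix l u :: "real ^ 'a bidx"
  assume lu: "\<And>b. b \<in> Basis \<Longrightarrow> l \<bullet> b \<le> u \<bullet> b"
  have le: "l $ i \<le> u $ i" for i
    using lu[of "axis i 1"] by (simp add: inner_axis)
  have of_vec_inner: "of_vec w \<bullet> basis_enum i = w $ i" for w :: "real ^ 'a bidx" and i
    using to_vec_of_vec[of w] unfolding to_vec_def by (metis vec_lambda_beta)
  have enum: "b \<in> Basis \<Longrightarrow> \<exists>i. b = basis_enum i" for b :: 'a
    using bij_basis_enum[where 'a='a] by (metis bij_betw_imp_surj_on imageE)
  have vimage: "to_vec -` box l u = box (of_vec l) (of_vec u :: 'a)"
  proof -
    have "to_vec x \<in> box l u \<longleftrightarrow> (\<forall>i. l $ i < x \<bullet> basis_enum i \<and> x \<bullet> basis_enum i < u $ i)" for x :: 'a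
      by (simp add: mem_box_cart to_vec_def)
    also have "\<dots> x \<longleftrightarrow> x \<in> box (of_vec l) (of_vec u)" for x :: 'a
      unfolding mem_box using enum of_vec_inner basis_enum_in_Basis by metis
    finally show ?thesis by auto
  qed
  have "emeasure (distr lborel borel to_vec) (box l u) = emeasure lborel (box (of_vec l) (of_vec u :: 'a))"
    by (subst emeasure_distr) (auto simp: vimage)
  also have "\<dots> = ennreal (\<Prod>b\<in>Basis. (of_vec u - of_vec l :: 'a) \<bullet> b)"
  proof (rule emeasure_lborel_box)
    fix b :: 'a assume "b \<in> Basis"
    with enum obtain i where "b = basis_enum i" by blast
    then show "of_vec l \<bullet> b \<le> of_vec u \<bullet> b" using le by (simp add: of_vec_inner)
  qed
  also have "(\<Prod>b\<in>Basis. (of_vec u - of_vec l :: 'a) \<bullet> b) = (\<Prod>i\<in>UNIV. u $ i - l $ i)"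
    using prod.reindex_bij_betw[OF bij_basis_enum, of "\<lambda>b. (of_vec u - of_vec l :: 'a) \<bullet> b"]
    by (simp add: inner_diff_left of_vec_inner)
  also have "\<dots> = (\<Prod>b\<in>Basis. (u - l) \<bullet> b)"
  proof -
    have B: "(Basis :: (real ^ 'a bidx) set) = (\<lambda>i. axis i 1) ` UNIV"
      by (auto simp: Basis_vec_def)
    have inj: "inj (\<lambda>i :: 'a bidx. axis i (1::real))"
      by (simp add: inj_on_def axis_eq_axis)
    have "prod ((\<bullet>) (u - l)) Basis = (\<Prod>i\<in>UNIV. (u - l) \<bullet> axis i 1)"
      unfolding B by (simp add: prod.reindex[OF inj] o_def)
    then show ?thesis by (simp add: inner_axis)
  qed
  finally show "emeasure (distr lborel borel to_vec) (box l u) = ennreal (\<Prod>b\<in>Basis. (u - l) \<bullet> b)" .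
qed auto

lemma to_vec_image_vimage: "to_vec ` S = of_vec -` S"
  by (auto simp: image_iff) (metis to_vec_of_vec)

lemma measurable_to_vec [measurable]: "to_vec \<in> borel_measurable borel"
  by (rule borel_measurable_continuous_onI[OF continuous_to_vec])

lemma measurable_of_vec [measurable]: "of_vec \<in> borel_measurable borel"
  by (rule borel_measurable_continuous_onI[OF continuous_of_vec])

lemma to_vec_image_borel: "S \<in> sets borel \<Longrightarrow> to_vec ` S \<in> sets borel"
  using measurable_sets[OF measurable_of_vec, of S] by (simp add: to_vec_image_vimage)

lemma to_vec_vimage_image: "to_vec -` (to_vec ` S) = S"
  by (auto simp: image_iff) (metis of_vec_to_vec)

lemma emeasure_to_vec_image_borel:
  "S \<in> sets borel \<Longrightarrow> emeasure lborel (to_vec ` S) = emeasure lborel S"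
  using to_vec_image_borel[of S]
  by (subst lborel_distr_to_vec[symmetric], subst emeasure_distr) (auto simp: to_vec_vimage_image)

text \<open>A Lebesgue set is a Borel set up to a subset of a Borel null set, and both parts are
  transported by the Borel case.\<close>

lemma to_vec_image_lebesgue:
  fixes S :: "'a::euclidean_space set"
  assumes "S \<in> sets lebesgue"
  shows "to_vec ` S \<in> sets lebesgue" and "emeasure lebesgue (to_vec ` S) = emeasure lebesgue S"
proof -
  from assms obtain B N N' where BN: "S = B \<union> N" "N \<subseteq> N'" "N' \<in> null_sets lborel" "B \<in> sets lborel"
    unfolding sets_completion by (rule completionE)
  have null: "to_vec ` N' \<in> null_sets lborel"
    using BN emeasure_to_vec_image_borel[of N'] to_vec_image_borel[of N'] by (auto simp: null_sets_def)
  have im: "to_vec ` S = to_vec ` B \<union> to_vec ` N"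
    using BN by auto
  have [simp]: "to_vec ` B \<in> sets borel" using BN to_vec_image_borel[of B] by auto
  show "to_vec ` S \<in> sets lebesgue"
    using null BN(2) unfolding im sets_completion by (intro completionI[OF refl _ null]) (auto intro: image_mono)
  have 1: "to_vec ` N \<in> null_sets lebesgue"
    by (rule null_sets_completion_subset[OF image_mono[OF BN(2)]]) (rule null_sets_completionI[OF null])
  have 2: "N \<in> null_sets lebesgue"
    by (rule null_sets_completion_subset[OF BN(2)]) (rule null_sets_completionI[OF BN(3)])
  have "emeasure lebesgue (to_vec ` S) = emeasure lebesgue (to_vec ` B)"
    unfolding im by (rule emeasure_Un_null_set[OF _ 1]) (simp add: sets_completionI_sets)
  also have "\<dots> = emeasure lebesgue B"
    using emeasure_to_vec_image_borel[of B] BN by simp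
  also have "\<dots> = emeasure lebesgue S"
    unfolding BN(1) using emeasure_Un_null_set[OF _ 2, of B] BN(4) by (simp add: sets_completionI_sets)
  finally show "emeasure lebesgue (to_vec ` S) = emeasure lebesgue S" .
qed

lemma lebesgue_of_to_vec_image:
  fixes S :: "'a::euclidean_space set"
  assumes "to_vec ` S \<in> sets lebesgue" shows "S \<in> sets lebesgue"
proof -
  from assms obtain B N N' where BN: "to_vec ` S = B \<union> N" "N \<subseteq> N'" "N' \<in> null_sets lborel" "B \<in> sets lborel"
    unfolding sets_completion by (rule completionE)
  have S: "S = to_vec -` B \<union> to_vec -` N"
    using BN(1) to_vec_vimage_image by blast
  have "emeasure lborel (to_vec -` N' :: 'a set) = emeasure (distr lborel borel to_vec :: (real ^ 'a bidx) measure) N'"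
    using BN by (subst emeasure_distr) auto
  then have "(to_vec -` N' :: 'a set) \<in> null_sets lborel"
    using BN measurable_sets[OF measurable_to_vec, of N'] unfolding lborel_distr_to_vec by (auto simp: null_sets_def)
  with BN(2) measurable_sets[OF measurable_to_vec, of B] BN(4) show ?thesis
    unfolding S sets_completion by (intro completionI[OF refl]) auto
qed

lemma nn_integral_of_vec:
  "f \<in> borel_measurable borel \<Longrightarrow> (\<integral>\<^sup>+v. f (of_vec v) \<partial>lborel) = (\<integral>\<^sup>+x. f x \<partial>lborel)"
  by (subst lborel_distr_to_vec[symmetric], subst nn_integral_distr) auto

section \<open>Jacobians of endomorphisms of a Euclidean space\<close>

text \<open>Only volume factors occur below, so the sign of the determinant is discarded. This makes
  reflections harmless as changes of frame.\<close>

definition jac :: "('a::euclidean_space \<Rightarrow> 'a) \<Rightarrow> real" where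
  "jac L = \<bar>det (matrix (to_vec \<circ> L \<circ> of_vec))\<bar>"

lemma jac_nonneg [simp]: "jac L \<ge> 0"
  by (simp add: jac_def)

lemma jac_compose:
  assumes "linear L" "linear M"
  shows "jac (L \<circ> M) = jac L * jac M"
proof -
  have "to_vec \<circ> (L \<circ> M) \<circ> of_vec = (to_vec \<circ> L \<circ> of_vec) \<circ> (to_vec \<circ> M \<circ> of_vec)"
    by (auto simp: fun_eq_iff)
  moreover have "linear (to_vec \<circ> L \<circ> of_vec)" "linear (to_vec \<circ> M \<circ> of_vec)"
    using assms by (auto intro!: linear_compose linear_to_vec linear_of_vec)
  ultimately show ?thesis
    unfolding jac_def by (simp add: matrix_compose det_mul abs_mult)
qed

lemma jac_id: "jac id = 1"
  by (simp add: jac_def o_def id_def matrix_id[unfolded id_def] det_I)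

lemma jac_inverse:
  assumes "linear L" "linear M" "L \<circ> M = id"
  shows "jac L * jac M = 1"
  by (metis jac_compose[OF assms(1,2)] assms(3) jac_id)

lemma jac_pos:
  assumes "linear L" "inj L"
  shows "jac L > 0"
proof -
  obtain M where "linear M" "L \<circ> M = id"
    using linear_surjective_right_inverse[OF assms(1) linear_inj_imp_surj[OF assms]] by blast
  then have "jac L * jac M = 1" using jac_inverse assms by blast
  then show ?thesis using jac_nonneg[of L] by (cases "jac L = 0") (auto simp del: jac_nonneg)
qed

lemma jac_image:
  fixes L :: "'a::euclidean_space \<Rightarrow> 'a"
  assumes L: "linear L" and S: "S \<in> lmeasurable"
  shows "measure lebesgue (L ` S) = jac L * measure lebesgue S"
proof -
  have lin: "linear (to_vec \<circ> L \<circ> of_vec)"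
    using assms by (auto intro!: linear_compose linear_to_vec linear_of_vec)
  have S': "to_vec ` S \<in> lmeasurable"
    using S to_vec_image_lebesgue[of S] by (auto simp: fmeasurable_def)
  have im: "(to_vec \<circ> L \<circ> of_vec) ` (to_vec ` S) = to_vec ` (L ` S)"
    by (auto simp: image_iff)
  have mm: "to_vec ` (L ` S) \<in> lmeasurable"
    using measurable_linear_image[OF lin S'] unfolding im .
  then have "L ` S \<in> sets lebesgue"
    by (auto intro: lebesgue_of_to_vec_image simp: fmeasurable_def)
  then have "measure lebesgue (L ` S) = measure lebesgue (to_vec ` (L ` S))"
    using to_vec_image_lebesgue(2)[of "L ` S"] by (simp add: measure_def)
  also have "\<dots> = jac L * measure lebesgue (to_vec ` S)"
    using measure_linear_image[OF lin S'] unfolding im jac_def .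
  also have "\<dots> = jac L * measure lebesgue S"
    using to_vec_image_lebesgue(2)[of "S"] S by (simp add: measure_def fmeasurable_def)
  finally show ?thesis .
qed

text \<open>Conjugation with \<beta> is a sign preserving bijection between the permutations of the
  two index types and matches the Leibniz sums term by term.\<close>

lemma det_relabel:
  fixes A :: "'c::comm_ring_1 ^ 'n ^ 'n" and \<beta> :: "'m::finite \<Rightarrow> 'n::finite"
  assumes \<beta>: "bij \<beta>"
  shows "det (\<chi> i j. A $ \<beta> i $ \<beta> j) = det A"
proof -
  let ?h = "map_permutation UNIV \<beta>"
  have inj: "inj \<beta>" using \<beta> by (simp add: bij_def)
  have "bij_betw ?h {p. p permutes UNIV} {p. p permutes (UNIV :: 'n set)}"
  proof (rule bij_betw_byWitness[where f' = "map_permutation UNIV (inv \<beta>)"])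
    have b2: "bij (inv \<beta>)" using \<beta> by (simp add: bij_imp_bij_inv)
    show "\<forall>p\<in>{p. p permutes UNIV}. map_permutation UNIV (inv \<beta>) (?h p) = p"
      using \<beta> b2 by (auto simp: map_permutation_def bij_is_surj bij_is_inj fun_eq_iff inv_inv_eq restrict_id_def)
    show "\<forall>p\<in>{p. p permutes UNIV}. ?h (map_permutation UNIV (inv \<beta>) p) = p"
      using \<beta> b2 by (auto simp: map_permutation_def bij_is_surj bij_is_inj fun_eq_iff inv_inv_eq restrict_id_def surj_f_inv_f)
    show "?h ` {p. p permutes UNIV} \<subseteq> {p. p permutes UNIV}"
      using map_permutation_permutes[of \<beta> UNIV UNIV] \<beta> by (auto simp: bij_betw_def)
    show "map_permutation UNIV (inv \<beta>) ` {p. p permutes UNIV} \<subseteq> {p. p permutes UNIV}"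
      using map_permutation_permutes[of "inv \<beta>" UNIV UNIV] b2 by (auto simp: bij_betw_def)
  qed
  then have "det A = (\<Sum>p\<in>{p. p permutes UNIV}. of_int (sign (?h p)) * (\<Prod>i\<in>UNIV. A $ i $ ?h p i))"
    unfolding det_def by (rule sum.reindex_bij_betw[symmetric])
  also have "\<dots> = (\<Sum>p\<in>{p. p permutes UNIV}. of_int (sign p) * (\<Prod>i\<in>UNIV. A $ \<beta> i $ \<beta> (p i)))"
  proof (rule sum.cong[OF refl])
    fix p :: "'m \<Rightarrow> 'm" assume "p \<in> {p. p permutes UNIV}"
    then have p: "p permutes UNIV" by simp
    have "(\<Prod>i\<in>UNIV. A $ i $ ?h p i) = (\<Prod>i\<in>UNIV. A $ \<beta> i $ ?h p (\<beta> i))"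
      by (rule prod.reindex_bij_betw[symmetric, OF \<beta>])
    also have "\<dots> = (\<Prod>i\<in>UNIV. A $ \<beta> i $ \<beta> (p i))"
      by (simp add: map_permutation_apply[OF inj])
    finally show "of_int (sign (?h p)) * (\<Prod>i\<in>UNIV. A $ i $ ?h p i)
        = of_int (sign p) * (\<Prod>i\<in>UNIV. A $ \<beta> i $ \<beta> (p i))"
      by (simp add: sign_map_permutation[OF inj p])
  qed
  finally show ?thesis by (simp add: det_def)
qed

text \<open>On \<open>real ^ 'n\<close> the enumeration of the basis is a relabelling \<beta> of the
  axes, so \<open>det_relabel\<close> applies.\<close>

lemma jac_vec:
  fixes L :: "real ^ 'n::finite \<Rightarrow> real ^ 'n"
  assumes "linear L"
  shows "jac L = \<bar>det (matrix L)\<bar>"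
proof -
  define \<beta> where "\<beta> i = (THE k. (basis_enum i :: real ^ 'n) = axis k 1)" for i
  have ax: "\<exists>!k. (basis_enum i :: real ^ 'n) = axis k 1" for i :: "(real ^ 'n) bidx"
    using basis_enum_in_Basis[of i] by (auto simp: Basis_vec_def axis_eq_axis)
  have \<beta>: "basis_enum i = axis (\<beta> i) 1" for i
    unfolding \<beta>_def by (rule theI'[OF ax])
  have bij: "bij \<beta>"
  proof (rule bijI)
    show "inj \<beta>"
      using bij_basis_enum[where 'a = "real ^ 'n"] \<beta> by (metis bij_betw_imp_inj_on inj_on_def)
    show "surj \<beta>"
      unfolding surj_def
    proof
      fix k :: 'n
      have "axis k (1::real) \<in> Basis" by (auto simp: Basis_vec_def)
      then obtain i where "axis k (1::real) = basis_enum i"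
        using bij_basis_enum[where 'a = "real ^ 'n"] by (metis bij_betw_imp_surj_on imageE)
      then show "\<exists>i. k = \<beta> i" using \<beta>[of i] by (auto simp: axis_eq_axis intro!: exI[of _ i])
    qed
  qed
  have of: "of_vec (axis j 1) = (basis_enum j :: real ^ 'n)" for j
  proof -
    have "of_vec (axis j 1) = (\<Sum>i\<in>UNIV. if i = j then basis_enum i else (0 :: real ^ 'n))"
      unfolding of_vec_def by (rule sum.cong) (auto simp: axis_def)
    then show ?thesis by simp
  qed
  have "matrix (to_vec \<circ> L \<circ> of_vec) = (\<chi> i j. matrix L $ \<beta> i $ \<beta> j)"
    by (simp add: matrix_def vec_eq_iff of to_vec_def \<beta> inner_axis)
  then show ?thesis by (simp add: jac_def det_relabel[OF bij])
qed

text \<open>The factorisation is read off from volumes, since the image of a unit box is again a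
  product set. No determinant over the index type of the product has to be expanded.\<close>

lemma jac_prod:
  fixes M :: "'a::euclidean_space \<Rightarrow> 'a" and a :: real
  assumes M: "linear M"
  shows "jac (\<lambda>(w, s). (M w, a * s)) = jac M * \<bar>a\<bar>"
proof -
  let ?L = "\<lambda>(w, s). (M w, a * s)" and ?C = "cbox 0 One :: 'a set"
  have lin: "linear ?L"
    using M by (intro linearI) (auto simp: linear_add linear_scale algebra_simps)
  have C: "measure lebesgue ?C = 1"
    by (simp add: content_cbox_if box_eq_empty)
  have lm: "?C \<times> {0..1::real} \<in> lmeasurable"
    by (intro lmeasurable_compact compact_Times) auto
  have split: "emeasure lebesgue (X \<times> Y) = emeasure lebesgue X * emeasure lebesgue Y"
    if "compact X" "compact Y" for X :: "'a set" and Y :: "real set"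
  proof -
    have "X \<times> Y \<in> sets borel" using compact_Times[OF that] by (simp add: borel_compact)
    then have "emeasure lebesgue (X \<times> Y) = emeasure (lborel \<Otimes>\<^sub>M lborel) (X \<times> Y)"
      by (simp add: lborel_prod)
    also have "\<dots> = emeasure lborel X * emeasure lborel Y"
      using that by (intro lborel.emeasure_pair_measure_Times) (auto simp: borel_compact)
    finally show ?thesis using that by (simp add: borel_compact)
  qed
  have "jac ?L = measure lebesgue (?L ` (?C \<times> {0..1}))"
  proof -
    have "measure lebesgue (?C \<times> {0..1::real}) = measure lebesgue ?C * measure lebesgue {0..1::real}"
      unfolding measure_def by (subst split) (auto simp: enn2real_mult simp del: cbox_interval)
    then have "measure lebesgue (?C \<times> {0..1::real}) = 1" using C by simp
    then show ?thesis using jac_image[OF lin lm] by simp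
  qed
  also have "?L ` (?C \<times> {0..1}) = (M ` ?C) \<times> ((*) a ` {0..1})"
    by auto
  also have "measure lebesgue \<dots> = measure lebesgue (M ` ?C) * measure lebesgue ((*) a ` {0..1::real})"
    unfolding measure_def
    by (subst split)
      (auto simp: enn2real_mult intro!: compact_continuous_image continuous_on_mult_left linear_continuous_on
        M[THEN linear_conv_bounded_linear[THEN iffD1]] bounded_linear_mult_right)
  also have "measure lebesgue (M ` ?C) = jac M"
    using jac_image[OF M, of ?C] C by (simp add: lmeasurable_compact)
  also have "measure lebesgue ((*) a ` {0..1::real}) = \<bar>a\<bar>"
    by (cases "a \<ge> 0") (auto simp: image_mult_atLeastAtMost_if)
  finally show ?thesis .
qed

text \<open>Conjugation with w \<mapsto> -w turns the shear by c into the shear by -c, which is its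
  inverse; the Jacobian therefore equals its own reciprocal.\<close>

lemma jac_shear:
  "jac (\<lambda>(w :: 'a::euclidean_space, s :: real). (w + s *\<^sub>R c, s)) = 1"
proof -
  let ?S = "\<lambda>c (w :: 'a, s :: real). (w + s *\<^sub>R c, s)"
  let ?R = "\<lambda>(w :: 'a, s :: real). (- w, 1 * s)"
  have lin: "linear (?S c)" for c
    by (intro linearI) (auto simp: algebra_simps)
  have linR: "linear ?R" by (intro linearI) (auto simp: algebra_simps)
  have "?R \<circ> ?R = id" by (auto simp: fun_eq_iff)
  then have R: "jac ?R * jac ?R = 1" using jac_inverse[OF linR linR] by simp
  have "?S (- c) = ?R \<circ> (?S c \<circ> ?R)" by (auto simp: fun_eq_iff)
  then have "jac (?S (- c)) = jac ?R * (jac (?S c) * jac ?R)"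
    using jac_compose[OF linR linear_compose[OF linR lin]] jac_compose[OF lin linR] by simp
  with R have "jac (?S (- c)) = jac (?S c)" by (simp add: mult.commute mult.left_commute)
  moreover have "?S c \<circ> ?S (- c) = id" by (auto simp: fun_eq_iff)
  then have "jac (?S c) * jac (?S (- c)) = 1" by (rule jac_inverse[OF lin lin])
  ultimately have "(jac (?S c))\<^sup>2 = 1" by (simp add: power2_eq_square)
  then show ?thesis using jac_nonneg[of "?S c"] by (simp add: power2_eq_1_iff)
qed

text \<open>A reflection is an involution, so its Jacobian is 1.\<close>

lemma exists_reflection:
  fixes a b :: "'a::euclidean_space"
  assumes "norm a = norm b"
  obtains Q where "linear Q" "Q a = b" "jac Q = 1" "\<And>x y. Q x \<bullet> Q y = x \<bullet> y"
proof -
  define c where "c = a - b"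
  define Q where "Q x = x - (2 * (x \<bullet> c) / (c \<bullet> c)) *\<^sub>R c" for x
  have lin: "linear Q"
    by (intro linearI) (auto simp: Q_def inner_add_left algebra_simps add_divide_distrib)
  have inner: "Q x \<bullet> Q y = x \<bullet> y" for x y
    by (cases "c = 0") (auto simp: Q_def inner_diff_left inner_diff_right inner_commute field_simps)
  have inv: "Q \<circ> Q = id"
    by (cases "c = 0") (auto simp: Q_def fun_eq_iff inner_diff_left algebra_simps)
  have "jac Q * jac Q = 1" by (rule jac_inverse[OF lin lin inv])
  then have J: "jac Q = 1" using jac_nonneg[of Q] by (metis abs_of_nonneg power2_eq_square power2_eq_1_iff abs_1 abs_minus)
  have "a \<bullet> a = b \<bullet> b" using assms by (simp add: dot_square_norm)
  then have "c \<bullet> c = 2 * (a \<bullet> c)"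
    by (simp add: c_def inner_diff_left inner_diff_right inner_commute)
  then have "Q a = b"
    by (cases "c = 0") (auto simp: Q_def c_def)
  with that lin J inner show ?thesis by blast
qed

section \<open>Change of variables\<close>

lemma has_derivative_to_vec_of_vec:
  assumes "(g has_derivative g') (at x within S)"
  shows "((to_vec \<circ> g \<circ> of_vec) has_derivative (to_vec \<circ> g' \<circ> of_vec)) (at (to_vec x) within to_vec ` S)"
proof -
  have im: "of_vec ` (to_vec ` S) = S" by (auto simp: image_iff)
  have 1: "(of_vec has_derivative of_vec) (at (to_vec x) within to_vec ` S)"
    by (rule linear_imp_has_derivative[OF linear_of_vec])
  have 2: "((g \<circ> of_vec) has_derivative (g' \<circ> of_vec)) (at (to_vec x) within to_vec ` S)"
    by (rule diff_chain_within[OF 1]) (simp add: im assms)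
  have 3: "(to_vec has_derivative to_vec) F" for F
    by (rule linear_imp_has_derivative[OF linear_to_vec])
  show ?thesis
    using diff_chain_within[OF 2 3] by (simp add: o_assoc)
qed

text \<open>Bridge between the gauge integral, in which change of variables on
  \<open>real ^ 'm\<close> is formulated, and the nonnegative Lebesgue integral used for areas and
  volumes.\<close>

lemma jac_integral_vec:
  fixes g' :: "'a::euclidean_space \<Rightarrow> 'a \<Rightarrow> 'a"
  assumes S: "S \<in> sets borel" and meas: "(\<lambda>x. jac (g' x) * indicator S x) \<in> borel_measurable borel"
  shows "((\<lambda>v. \<bar>det (matrix (to_vec \<circ> g' (of_vec v) \<circ> of_vec))\<bar>) has_integral m) (to_vec ` S)
          \<longleftrightarrow> (\<integral>\<^sup>+x\<in>S. ennreal (jac (g' x)) \<partial>lborel) = ennreal m \<and> 0 \<le> m"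
proof -
  let ?f = "\<lambda>v. jac (g' (of_vec v)) * indicator S (of_vec v)"
  have f: "?f = (\<lambda>v. if v \<in> to_vec ` S then \<bar>det (matrix (to_vec \<circ> g' (of_vec v) \<circ> of_vec))\<bar> else 0)"
    by (auto simp: fun_eq_iff jac_def to_vec_image_vimage)
  have mf: "?f \<in> borel_measurable borel"
    using measurable_compose[OF measurable_of_vec meas] by simp
  have "integral\<^sup>N lebesgue (\<lambda>v. ennreal (?f v)) = integral\<^sup>N lborel (\<lambda>v. ennreal (?f v))"
    by (simp add: nn_integral_completion)
  also have "\<dots> = (\<integral>\<^sup>+x. ennreal (jac (g' x) * indicator S x) \<partial>lborel)"
    by (rule nn_integral_of_vec) (use meas in measurable)
  also have "\<dots> = (\<integral>\<^sup>+x\<in>S. ennreal (jac (g' x)) \<partial>lborel)"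
    by (intro nn_integral_cong) (auto simp: indicator_def)
  finally have *: "integral\<^sup>N lebesgue (\<lambda>v. ennreal (?f v)) = (\<integral>\<^sup>+x\<in>S. ennreal (jac (g' x)) \<partial>lborel)" .
  have "(?f has_integral m) UNIV \<longleftrightarrow> ?f \<in> lebesgue \<rightarrow>\<^sub>M borel \<and> integral\<^sup>N lebesgue ?f = m \<and> 0 \<le> m"
    by (rule has_integral_iff_nn_integral_lebesgue) auto
  moreover have "?f \<in> lebesgue \<rightarrow>\<^sub>M borel"
    using mf by (simp add: measurable_completion)
  ultimately show ?thesis
    unfolding * unfolding f has_integral_restrict_UNIV by blast
qed

text \<open>Points hit several times are counted once on the left but repeatedly on the right, so
  without injectivity an inequality remains. \<open>fin\<close> turns the Jacobian into an
  integrable function, which also gives measurability of the image.\<close>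

lemma emeasure_differentiable_image_le:
  fixes g :: "'a::euclidean_space \<Rightarrow> 'a"
  assumes S: "S \<in> sets borel"
    and der: "\<And>x. x \<in> S \<Longrightarrow> (g has_derivative g' x) (at x within S)"
    and meas: "(\<lambda>x. jac (g' x) * indicator S x) \<in> borel_measurable borel"
    and fin: "(\<integral>\<^sup>+x\<in>S. ennreal (jac (g' x)) \<partial>lborel) < \<infinity>"
  shows "g ` S \<in> sets lebesgue"
    and "emeasure lebesgue (g ` S) \<le> (\<integral>\<^sup>+x\<in>S. ennreal (jac (g' x)) \<partial>lborel)"
proof -
  let ?g = "to_vec \<circ> g \<circ> of_vec" and ?g' = "\<lambda>v. to_vec \<circ> g' (of_vec v) \<circ> of_vec" and ?S = "to_vec ` S"
  have S': "?S \<in> sets lebesgue" using to_vec_image_borel[OF S] by (simp add: sets_completionI_sets)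
  have der': "(?g has_derivative ?g' v) (at v within ?S)" if "v \<in> ?S" for v
    using that has_derivative_to_vec_of_vec[OF der] by auto
  obtain m where m: "(\<integral>\<^sup>+x\<in>S. ennreal (jac (g' x)) \<partial>lborel) = ennreal m" "0 \<le> m"
    using fin by (cases "(\<integral>\<^sup>+x\<in>S. ennreal (jac (g' x)) \<partial>lborel)" rule: ennreal_cases) auto
  have hi: "((\<lambda>v. \<bar>det (matrix (?g' v))\<bar>) has_integral m) ?S"
    using jac_integral_vec[OF S meas] m by blast
  have im: "?g ` ?S = to_vec ` (g ` S)" by (auto simp: image_iff)
  have lm: "to_vec ` (g ` S) \<in> lmeasurable"
    using measurable_differentiable_image[OF S' der'] hi unfolding im by (auto simp: integrable_on_def)
  then show gS: "g ` S \<in> sets lebesgue"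
    by (auto intro: lebesgue_of_to_vec_image simp: fmeasurable_def)
  have "measure lebesgue (to_vec ` (g ` S)) \<le> m"
    using measure_differentiable_image[OF S' der'] hi unfolding im
    by (metis has_integral_integrable integral_unique)
  then show "emeasure lebesgue (g ` S) \<le> (\<integral>\<^sup>+x\<in>S. ennreal (jac (g' x)) \<partial>lborel)"
    unfolding m(1) to_vec_image_lebesgue(2)[OF gS, symmetric]
    using lm m(2) by (simp add: emeasure_eq_measure2 ennreal_leI)
qed

lemma emeasure_differentiable_image_eq:
  fixes g :: "'a::euclidean_space \<Rightarrow> 'a"
  assumes S: "S \<in> sets borel" and inj: "inj_on g S"
    and der: "\<And>x. x \<in> S \<Longrightarrow> (g has_derivative g' x) (at x within S)"
    and meas: "(\<lambda>x. jac (g' x) * indicator S x) \<in> borel_measurable borel"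
    and gS: "g ` S \<in> sets lebesgue"
  shows "emeasure lebesgue (g ` S) = (\<integral>\<^sup>+x\<in>S. ennreal (jac (g' x)) \<partial>lborel)"
proof -
  let ?g = "to_vec \<circ> g \<circ> of_vec" and ?g' = "\<lambda>v. to_vec \<circ> g' (of_vec v) \<circ> of_vec" and ?S = "to_vec ` S"
  have S': "?S \<in> sets lebesgue" using to_vec_image_borel[OF S] by (simp add: sets_completionI_sets)
  have der': "(?g has_derivative ?g' v) (at v within ?S)" if "v \<in> ?S" for v
    using that has_derivative_to_vec_of_vec[OF der] by auto
  have inj': "inj_on ?g ?S"
    using inj by (auto simp: inj_on_def) (metis of_vec_to_vec)
  have im: "?g ` ?S = to_vec ` (g ` S)" by (auto simp: image_iff)
  \<comment> \<open>Valid for every real m, so a finite value of either side determines the other;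
    if one side is infinite, so is the other.\<close>
  have key: "to_vec ` (g ` S) \<in> lmeasurable \<and> measure lebesgue (to_vec ` (g ` S)) = m
     \<longleftrightarrow> (\<integral>\<^sup>+x\<in>S. ennreal (jac (g' x)) \<partial>lborel) = ennreal m \<and> 0 \<le> m" for m
    using has_measure_differentiable_image[OF S' der' inj', of m] unfolding jac_integral_vec[OF S meas] im .
  have e: "emeasure lebesgue (to_vec ` (g ` S)) = emeasure lebesgue (g ` S)"
    by (rule to_vec_image_lebesgue(2)[OF gS])
  show ?thesis
  proof (cases "emeasure lebesgue (g ` S) = \<infinity>")
    case True
    show ?thesis
    proof (rule ccontr)
      assume "\<not> ?thesis"
      then obtain m where "(\<integral>\<^sup>+x\<in>S. ennreal (jac (g' x)) \<partial>lborel) = ennreal m" "0 \<le> m"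
        using True by (cases "(\<integral>\<^sup>+x\<in>S. ennreal (jac (g' x)) \<partial>lborel)" rule: ennreal_cases) auto
      then have "to_vec ` (g ` S) \<in> lmeasurable" using key by blast
      then show False using True e by (simp add: fmeasurable_def)
    qed
  next
    case False
    then have lm: "to_vec ` (g ` S) \<in> lmeasurable"
      using e to_vec_image_lebesgue(1)[OF gS] by (auto simp: fmeasurable_def less_top)
    then show ?thesis using key e by (metis emeasure_eq_measure2)
  qed
qed

text \<open>The image under g of Lebesgue measure with density \<open>jac\<close> on S is Lebesgue
  measure restricted to the image of S. The two measures agree on sets by the volume formula, and
  the claim integrates f against both.\<close>

lemma nn_integral_differentiable_image:
  fixes g :: "'a::euclidean_space \<Rightarrow> 'a"
  assumes S: "S \<in> sets borel" and inj: "inj_on g S"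
    and der: "\<And>x. x \<in> S \<Longrightarrow> (g has_derivative g' x) (at x within S)"
    and meas: "(\<lambda>x. jac (g' x) * indicator S x) \<in> borel_measurable borel"
    and gS: "g ` S \<in> sets borel" and f[measurable]: "f \<in> borel_measurable borel"
  shows "(\<integral>\<^sup>+y\<in>g ` S. f y \<partial>lborel) = (\<integral>\<^sup>+x\<in>S. ennreal (jac (g' x)) * f (g x) \<partial>lborel)"
proof -
  \<comment> \<open>A globally Borel substitute for g; off S the density vanishes.\<close>
  define g0 where "g0 x = indicator S x *\<^sub>R g x" for x
  have cont: "continuous_on S g"
    using der has_derivative_continuous_on by blast
  have [measurable]: "g0 \<in> borel_measurable borel"
    unfolding g0_def using S cont by (rule borel_measurable_continuous_on_indicator)
  let ?d = "\<lambda>x. ennreal (jac (g' x) * indicator S x)"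
  have [measurable]: "?d \<in> borel_measurable borel" using meas by measurable
  have [measurable]: "g ` S \<in> sets borel" "S \<in> sets borel" by fact+
  have "distr (density lborel ?d) borel g0 = density lborel (indicator (g ` S))"
  proof (rule measure_eqI)
    fix X assume "X \<in> sets (distr (density lborel ?d) borel g0)"
    then have [measurable]: "X \<in> sets borel" by simp
    define S1 where "S1 = S \<inter> g0 -` X"
    have [measurable]: "S1 \<in> sets borel" 
      unfolding S1_def using measurable_sets[of g0 borel borel X] by (auto intro!: sets.Int)
    have S1: "S1 \<subseteq> S" by (auto simp: S1_def)
    have im: "g ` S1 = g ` S \<inter> X"
      by (auto simp: S1_def g0_def)
    have "emeasure (distr (density lborel ?d) borel g0) X = (\<integral>\<^sup>+x\<in>g0 -` X. ?d x \<partial>lborel)"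
      using measurable_sets[of g0 borel borel X] 
      by (subst emeasure_distr) (use meas in \<open>auto intro!: emeasure_density\<close>)
    also have "\<dots> = (\<integral>\<^sup>+x\<in>S1. ennreal (jac (g' x)) \<partial>lborel)"
      by (intro nn_integral_cong) (auto simp: S1_def indicator_def)
    also have "\<dots> = emeasure lebesgue (g ` S1)"
    proof (rule emeasure_differentiable_image_eq[symmetric])
      show "inj_on g S1" using inj S1 inj_on_subset by blast
      show "(g has_derivative g' x) (at x within S1)" if "x \<in> S1" for x
        using der S1 that has_derivative_subset by blast
      have "(\<lambda>x. (jac (g' x) * indicator S x) * indicator S1 x) \<in> borel_measurable borel"
        using meas by measurable
      moreover have "(\<lambda>x. (jac (g' x) * indicator S x) * indicator S1 x) = (\<lambda>x. jac (g' x) * indicator S1 x)"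
        using S1 by (auto simp: indicator_def fun_eq_iff)
      ultimately show "(\<lambda>x. jac (g' x) * indicator S1 x) \<in> borel_measurable borel" by simp
      show "g ` S1 \<in> sets lebesgue" unfolding im by (simp add: sets_completionI_sets)
    qed simp
    also have "\<dots> = emeasure (density lborel (indicator (g ` S))) X"
      by (simp add: im emeasure_density nn_integral_indicator flip: indicator_inter_arith)
    finally show "emeasure (distr (density lborel ?d) borel g0) X = emeasure (density lborel (indicator (g ` S))) X" .
  qed simp
  then have "nn_integral (density lborel (indicator (g ` S))) f = nn_integral (distr (density lborel ?d) borel g0) f"
    by simp
  also have "\<dots> = (\<integral>\<^sup>+x. ?d x * f (g0 x) \<partial>lborel)"
    by (subst nn_integral_distr, simp, simp, subst nn_integral_density) (use meas in auto)
  also have "\<dots> = (\<integral>\<^sup>+x\<in>S. ennreal (jac (g' x)) * f (g x) \<partial>lborel)"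
    by (intro nn_integral_cong) (auto simp: indicator_def g0_def)
  finally show ?thesis
    by (simp add: nn_integral_density mult.commute)
qed

section \<open>The Gram Jacobian of a parametrised hypersurface\<close>

text \<open>Adding the unit normal u completes the n tangent columns to an endomorphism of the
  ambient space without changing the volume. After reflecting u to the last axis the map is M on the
  first factor, and the Gram matrix is the transpose of M times M.\<close>

lemma gram_jacobian_eq_jac:
  fixes \<phi> :: "real ^ 'n::finite \<Rightarrow> 'n ambient"
  assumes der: "(\<phi> has_derivative \<phi>') (at y)"
    and u: "norm u = 1" "\<And>w. \<phi>' w \<bullet> u = 0"
  shows "gram_jacobian \<phi> y = jac (\<lambda>(w, s). \<phi>' w + s *\<^sub>R u)"
proof -
  have l\<phi>: "linear \<phi>'" using der has_derivative_linear by blast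
  obtain Q :: "'n ambient \<Rightarrow> 'n ambient" where Q: "linear Q" "Q u = (0, 1)" "jac Q = 1" "\<And>x y. Q x \<bullet> Q y = x \<bullet> y"
    using exists_reflection[of u "(0 :: real ^ 'n, 1 :: real)"] u by (auto simp: norm_Pair)
  define M where "M w = fst (Q (\<phi>' w))" for w
  have lM: "linear M"
    unfolding M_def using linear_compose[OF linear_compose[OF l\<phi> Q(1)] linear_fst] by (simp add: o_def)
  have snd0: "snd (Q (\<phi>' w)) = 0" for w
  proof -
    have "Q (\<phi>' w) \<bullet> Q u = 0" using Q(4) u(2) by simp
    then show ?thesis by (simp add: Q(2) inner_prod_def)
  qed
  have Q\<phi>: "Q (\<phi>' w) = (M w, 0)" for w
    by (simp add: M_def snd0 prod_eq_iff)
  let ?R = "\<lambda>(w, s :: real). \<phi>' w + s *\<^sub>R u"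
  have lR: "linear ?R"
    using l\<phi> by (intro linearI) (auto simp: linear_add linear_scale algebra_simps)
  have "Q \<circ> ?R = (\<lambda>(w, s). (M w, 1 * s))"
    using Q by (auto simp: fun_eq_iff linear_add linear_scale Q\<phi>)
  then have "jac ?R = jac (\<lambda>(w, s :: real). (M w, 1 * s))"
    using jac_compose[OF Q(1) lR] Q(3) by simp
  also have "\<dots> = jac M" by (subst jac_prod[OF lM]) simp
  also have "\<dots> = \<bar>det (matrix M)\<bar>" by (rule jac_vec[OF lM])
  finally have R: "jac ?R = \<bar>det (matrix M)\<bar>" .
  have fd: "frechet_derivative \<phi> (at y) = \<phi>'" using der by (metis frechet_derivative_at)
  have "(\<chi> i j. \<phi>' (axis i 1) \<bullet> \<phi>' (axis j 1)) = transpose (matrix M) ** matrix M"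
  proof -
    have "\<phi>' a \<bullet> \<phi>' b = M a \<bullet> M b" for a b
      using Q(4)[of "\<phi>' a" "\<phi>' b"] by (simp add: Q\<phi> inner_prod_def)
    then show ?thesis
      by (simp add: vec_eq_iff transpose_def matrix_matrix_mult_def matrix_def inner_vec_def)
  qed
  then have "gram_jacobian \<phi> y = sqrt (det (transpose (matrix M) ** matrix M))"
    by (simp add: gram_jacobian_def fd)
  also have "\<dots> = \<bar>det (matrix M)\<bar>"
    by (simp add: det_mul det_transpose flip: power2_eq_square)
  finally show ?thesis using R by simp
qed

section \<open>Linear algebra\<close>

text \<open>A null vector u minimises the form; if the form did not vanish on (u, w), moving from w
  far enough along u would make it negative.\<close>

lemma psd_form_kernel:
  fixes \<gamma> :: "'a::real_vector \<Rightarrow> 'a \<Rightarrow> real"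
  assumes "bilinear \<gamma>" and V: "subspace V" and sym: "\<And>v w. v \<in> V \<Longrightarrow> w \<in> V \<Longrightarrow> \<gamma> v w = \<gamma> w v"
    and psd: "\<And>v. v \<in> V \<Longrightarrow> \<gamma> v v \<ge> 0" and u: "u \<in> V" "\<gamma> u u = 0" and w: "w \<in> V"
  shows "\<gamma> u w = 0"
proof (rule ccontr)
  assume nz: "\<gamma> u w \<noteq> 0"
  note bl = bilinear_ladd[OF assms(1)] bilinear_radd[OF assms(1)] bilinear_lmul[OF assms(1)] bilinear_rmul[OF assms(1)]
  \<comment> \<open>Chosen so that the form takes the value -1 at
    \<open>t *\<^sub>R u + w\<close>.\<close>
  define t where "t = - (\<gamma> w w + 1) / (2 * \<gamma> u w)"
  have "t *\<^sub>R u + w \<in> V" using u w V by (simp add: subspace_add subspace_scale)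
  then have "0 \<le> \<gamma> (t *\<^sub>R u + w) (t *\<^sub>R u + w)" by (rule psd)
  also have "\<dots> = 2 * t * \<gamma> u w + \<gamma> w w"
    using u sym[OF u(1) w] by (simp add: bl)
  also have "\<dots> = - 1" using nz by (simp add: t_def field_simps)
  finally show False by simp
qed

text \<open>A maximiser u of the Rayleigh quotient of D with respect to \<beta> works: with k the
  maximum, k \<beta>(v, w) - \<beta>(D v, w) is positive semidefinite and u is a null vector, hence
  in its kernel.\<close>

lemma selfadjoint_has_eigenvector:
  fixes D :: "'a::euclidean_space \<Rightarrow> 'a" and \<beta> :: "'a \<Rightarrow> 'a \<Rightarrow> real"
  assumes V: "subspace V" and D: "linear D" "\<And>v. v \<in> V \<Longrightarrow> D v \<in> V" and \<beta>: "bilinear \<beta>"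
    and sym: "\<And>v w. v \<in> V \<Longrightarrow> w \<in> V \<Longrightarrow> \<beta> v w = \<beta> w v"
    and pos: "\<And>v. v \<in> V \<Longrightarrow> v \<noteq> 0 \<Longrightarrow> \<beta> v v > 0"
    and adj: "\<And>v w. v \<in> V \<Longrightarrow> w \<in> V \<Longrightarrow> \<beta> (D v) w = \<beta> v (D w)"
    and ne: "V \<noteq> {0}"
  obtains u k where "u \<in> V" "u \<noteq> 0" "D u = k *\<^sub>R u"
proof -
  define K where "K = V \<inter> sphere 0 1"
  have K: "compact K" unfolding K_def
    using closed_Int_compact[OF closed_subspace[OF V]] by simp
  obtain v where v: "v \<in> V" "v \<noteq> 0" using ne subspace_0[OF V] by auto
  have "v /\<^sub>R norm v \<in> K" using v V by (simp add: K_def subspace_scale)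
  then have Kne: "K \<noteq> {}" by auto
  have bb: "bounded_bilinear \<beta>" using \<beta> by (simp add: bilinear_conv_bounded_bilinear)
  have bD: "bounded_linear D" using D(1) by (simp add: linear_conv_bounded_linear)
  have cD: "continuous_on K D" by (intro linear_continuous_on bD)
  define q where "q v = \<beta> (D v) v / \<beta> v v" for v
  have posK: "\<beta> v v > 0" if "v \<in> K" for v using that pos[of v] by (cases "v = 0") (auto simp: K_def)
  have "continuous_on K q"
    unfolding q_def using posK
    by (intro continuous_on_divide bounded_bilinear.continuous_on[OF bb] cD continuous_on_id) fastforce
  then obtain u where u: "u \<in> K" "\<And>v. v \<in> K \<Longrightarrow> q v \<le> q u"
    using continuous_attains_sup[OF K Kne] by blast
  define k where "k = q u"
  define \<gamma> where "\<gamma> v w = k * \<beta> v w - \<beta> (D v) w" for v w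
  note bl = bilinear_ladd[OF \<beta>] bilinear_radd[OF \<beta>] bilinear_lmul[OF \<beta>] bilinear_rmul[OF \<beta>] bilinear_lsub[OF \<beta>]
  have bg: "bilinear \<gamma>"
    unfolding bilinear_def \<gamma>_def using D(1)
    by (auto intro!: linearI simp: bl linear_add linear_scale algebra_simps)
  have uV: "u \<in> V" "u \<noteq> 0" using u(1) by (auto simp: K_def)
  have "\<gamma> v v \<ge> 0" if "v \<in> V" for v
  proof (cases "v = 0")
    case True then show ?thesis by (simp add: bilinear_lzero[OF bg])
  next
    case False
    have "v /\<^sub>R norm v \<in> K" using that False V by (simp add: K_def subspace_scale)
    then have "q (v /\<^sub>R norm v) \<le> k" using u k_def by simp
    moreover have "q (a *\<^sub>R v) = q v" if "a \<noteq> 0" for a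
      using that linear_scale[OF D(1)] by (simp add: q_def bl)
    then have "q (v /\<^sub>R norm v) = q v" using False by simp
    ultimately have "q v \<le> k" by simp
    then show ?thesis using pos[OF that False] by (simp add: q_def \<gamma>_def pos_divide_le_eq)
  qed
  moreover have "\<gamma> u u = 0" using pos[OF uV] by (simp add: \<gamma>_def k_def q_def)
  moreover have "\<gamma> v w = \<gamma> w v" if "v \<in> V" "w \<in> V" for v w
    using that D(2) sym adj by (simp add: \<gamma>_def)
  ultimately have *: "\<gamma> u w = 0" if "w \<in> V" for w
    using psd_form_kernel[OF bg V _ _ uV(1) _ that] by blast
  have inV: "k *\<^sub>R u - D u \<in> V" using uV D V by (simp add: subspace_diff subspace_scale)
  have "\<beta> (k *\<^sub>R u - D u) (k *\<^sub>R u - D u) = 0"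
    using *[OF inV] by (simp add: \<gamma>_def bl(3,5))
  then have "D u = k *\<^sub>R u" using pos[OF inV] by force
  then show ?thesis using that uV by blast
qed

text \<open>Induction on the dimension: the \<beta>-orthogonal complement of an eigenvector is
  invariant because D is self-adjoint for \<beta>.\<close>

theorem selfadjoint_eigenbasis:
  fixes D :: "'a::euclidean_space \<Rightarrow> 'a" and \<beta> :: "'a \<Rightarrow> 'a \<Rightarrow> real"
  assumes "subspace V" and D: "linear D" "\<And>v. v \<in> V \<Longrightarrow> D v \<in> V" and \<beta>: "bilinear \<beta>"
    and "\<And>v w. v \<in> V \<Longrightarrow> w \<in> V \<Longrightarrow> \<beta> v w = \<beta> w v"
    and "\<And>v. v \<in> V \<Longrightarrow> v \<noteq> 0 \<Longrightarrow> \<beta> v v > 0"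
    and "\<And>v w. v \<in> V \<Longrightarrow> w \<in> V \<Longrightarrow> \<beta> (D v) w = \<beta> v (D w)"
  shows "\<exists>B. B \<subseteq> V \<and> independent B \<and> span B = V \<and> (\<forall>b\<in>B. \<exists>k. D b = k *\<^sub>R b)"
  using assms
proof (induction "dim V" arbitrary: V rule: less_induct)
  case less
  note bl = bilinear_ladd[OF \<beta>] bilinear_radd[OF \<beta>] bilinear_lmul[OF \<beta>] bilinear_rmul[OF \<beta>]
     bilinear_lsub[OF \<beta>] bilinear_rsub[OF \<beta>]
  show ?case
  proof (cases "V = {0}")
    case True
    then show ?thesis by (intro exI[of _ "{}"]) (auto simp: independent_empty)
  next
    case False
    obtain u k where u: "u \<in> V" "u \<noteq> 0" "D u = k *\<^sub>R u"
      using selfadjoint_has_eigenvector[OF less.prems False] .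
    define W where "W = {w \<in> V. \<beta> u w = 0}"
    have W: "subspace W"
      using less.prems(1) bilinear_rzero[OF \<beta>] unfolding W_def subspace_def by (auto simp: bl)
    have uW: "u \<notin> W" using less.prems(6)[OF u(1,2)] by (auto simp: W_def)
    have "W \<subset> V" using uW u by (auto simp: W_def)
    then have dim: "dim W < dim V"
      using dim_psubset[of W V] W less.prems(1) by (simp add: span_eq_iff[THEN iffD2])
    have DW: "D w \<in> W" if "w \<in> W" for w
    proof -
      have "\<beta> u (D w) = \<beta> (D u) w" using that u less.prems(7)[of u w] by (simp add: W_def)
      then show ?thesis using that less.prems(3) by (simp add: W_def u bl)
    qed
    have "\<exists>B. B \<subseteq> W \<and> independent B \<and> span B = W \<and> (\<forall>b\<in>B. \<exists>k. D b = k *\<^sub>R b)"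
      by (rule less.hyps[OF dim W D(1) DW \<beta>]) (use less.prems in \<open>auto simp: W_def\<close>)
    then obtain B where B: "B \<subseteq> W" "independent B" "span B = W" "\<forall>b\<in>B. \<exists>k. D b = k *\<^sub>R b"
      by blast
    have "independent (insert u B)"
      using B uW by (intro independent_insertI) auto
    moreover have sub: "insert u B \<subseteq> V" using u B by (auto simp: W_def)
    moreover have "span (insert u B) = V"
    proof
      show "span (insert u B) \<subseteq> V" using sub less.prems(1) by (simp add: span_minimal)
      show "V \<subseteq> span (insert u B)"
      proof
        fix v assume v: "v \<in> V"
        define c where "c = \<beta> u v / \<beta> u u"
        have "v - c *\<^sub>R u \<in> W"
          using v u less.prems(1) less.prems(6)[OF u(1,2)]
          by (auto simp: W_def subspace_diff subspace_scale bl c_def)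
        then show "v \<in> span (insert u B)"
          unfolding span_insert using B(3) by auto
      qed
    qed
    ultimately show ?thesis using B(4) u(3) by (intro exI[of _ "insert u B"]) auto
  qed
qed

text \<open>A \<circ> S need not be symmetric for the Euclidean product, but S \<circ> A is
  symmetric for the form \<langle>A v, w\<rangle>, and A carries its eigenbasis to one of A \<circ>
  S. Here A will be the Hessian of F and S the Euclidean shape operator, so the anisotropic
  principal curvatures are real.\<close>

lemma product_eigenbasis:
  fixes A S :: "'a::euclidean_space \<Rightarrow> 'a"
  assumes V: "subspace V" and A: "linear A" "\<And>v. v \<in> V \<Longrightarrow> A v \<in> V"
    and S: "linear S" "\<And>v. v \<in> V \<Longrightarrow> S v \<in> V"
    and symA: "\<And>v w. v \<in> V \<Longrightarrow> w \<in> V \<Longrightarrow> A v \<bullet> w = v \<bullet> A w"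
    and posA: "\<And>v. v \<in> V \<Longrightarrow> v \<noteq> 0 \<Longrightarrow> A v \<bullet> v > 0"
    and symS: "\<And>v w. v \<in> V \<Longrightarrow> w \<in> V \<Longrightarrow> S v \<bullet> w = v \<bullet> S w"
  shows "\<exists>B. independent B \<and> span B = V \<and> (\<forall>b\<in>B. \<exists>k. A (S b) = k *\<^sub>R b)"
proof -
  let ?\<beta> = "\<lambda>v w. A v \<bullet> w"
  have "bilinear ?\<beta>"
    using A(1) by (auto simp: bilinear_def inner_add_left inner_add_right linear_add linear_scale intro!: linearI)
  moreover have "A v \<bullet> w = A w \<bullet> v" if "v \<in> V" "w \<in> V" for v w
    using symA[OF that] by (simp add: inner_commute)
  moreover have "A ((S \<circ> A) v) \<bullet> w = A v \<bullet> (S \<circ> A) w" if "v \<in> V" "w \<in> V" for v w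
    using that A(2) S(2) symA[of "S (A v)" w] symS[of "A v" "A w"] by simp
  ultimately have "\<exists>B. B \<subseteq> V \<and> independent B \<and> span B = V \<and> (\<forall>b\<in>B. \<exists>k. (S \<circ> A) b = k *\<^sub>R b)"
    using A(2) S(2) posA by (intro selfadjoint_eigenbasis[OF V linear_compose[OF A(1) S(1)], of ?\<beta>]) auto
  then obtain B where B: "B \<subseteq> V" "independent B" "span B = V" "\<forall>b\<in>B. \<exists>k. (S \<circ> A) b = k *\<^sub>R b"
    by blast
  have injA: "inj_on A V"
  proof (rule inj_onI)
    fix x y assume xy: "x \<in> V" "y \<in> V" "A x = A y"
    then have "A (x - y) \<bullet> (x - y) = 0" using A(1) by (simp add: linear_diff)
    then show "x = y" using posA[of "x - y"] xy V by (force simp: subspace_diff)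
  qed
  have "independent (A ` B)"
    using linear_independent_injective_image[OF A(1) B(2)] injA B(3) by simp
  moreover have "span (A ` B) = V"
  proof -
    have "span (A ` B) = A ` V" using linear_span_image[OF A(1)] B(3) by metis
    moreover have "dim (A ` V) = dim V"
      using dim_image_eq[OF A(1), of V] injA V by (simp add: span_eq_iff[THEN iffD2])
    moreover have "A ` V \<subseteq> V" using A(2) by auto
    ultimately show ?thesis
      using dim_eq_span[of "A ` V" V] V linear_subspace_image[OF A(1) V] by (simp add: span_eq_iff[THEN iffD2])
  qed
  moreover have "\<exists>k. A (S (A b)) = k *\<^sub>R A b" if "b \<in> B" for b
    using that B(4) linear_scale[OF A(1)] by force
  ultimately show ?thesis by (intro exI[of _ "A ` B"]) auto
qed

section \<open>Arithmetic and geometric means with the equality case\<close>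

lemma prod_le_mean_power:
  fixes x :: "'i::finite \<Rightarrow> real"
  assumes "\<And>i. x i \<ge> 0"
  shows "prod x UNIV \<le> (sum x UNIV / CARD('i)) ^ CARD('i)"
proof -
  have le: "prod x UNIV powr (1 / CARD('i)) \<le> sum x UNIV / CARD('i)"
    using arith_geom_mean[of "UNIV :: 'i set" x] assms by (simp add: sum_divide_distrib)
  have "p = (p powr (1 / CARD('i))) ^ CARD('i)" if "p \<ge> 0" for p :: real
    using that by (cases "p = 0") (simp_all add: powr_power)
  then have "prod x UNIV = (prod x UNIV powr (1 / CARD('i))) ^ CARD('i)"
    using prod_nonneg[of UNIV x] assms by blast
  also have "\<dots> \<le> (sum x UNIV / CARD('i)) ^ CARD('i)"
    by (intro power_mono le) simp
  finally show ?thesis .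
qed

text \<open>Averaging two distinct factors keeps the sum and increases the product.\<close>

lemma prod_eq_mean_power_imp:
  fixes x :: "'i::finite \<Rightarrow> real"
  assumes nn: "\<And>i. x i \<ge> 0" and eq: "prod x UNIV = (sum x UNIV / CARD('i)) ^ CARD('i)"
  shows "x i = sum x UNIV / CARD('i)"
proof -
  have const: "x i = x j" for i j
  proof (rule ccontr)
    assume ij: "x i \<noteq> x j"
    then have "i \<noteq> j" by auto
    have pos: "x k > 0" for k
    proof (rule ccontr)
      assume "\<not> x k > 0"
      then have "x k = 0" using nn[of k] by simp
      then have "prod x UNIV = 0" by (metis UNIV_I finite prod_zero)
      then have "sum x UNIV = 0" using eq by simp
      then have "\<forall>k. x k = 0" using nn by (simp add: sum_nonneg_eq_0_iff)
      then show False using ij by simp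
    qed
    define m where "m = (x i + x j) / 2"
    define y where "y = x(i := m, j := m)"
    have split: "sum f UNIV = f i + f j + sum f (UNIV - {i, j})" "prod f UNIV = f i * f j * prod f (UNIV - {i, j})"
      for f :: "'i \<Rightarrow> real"
      using \<open>i \<noteq> j\<close> by (simp_all add: sum.subset_diff[of "{i, j}" UNIV] prod.subset_diff[of "{i, j}" UNIV] algebra_simps)
    have rest: "sum y (UNIV - {i, j}) = sum x (UNIV - {i, j})" "prod y (UNIV - {i, j}) = prod x (UNIV - {i, j})"
      by (auto intro!: sum.cong prod.cong simp: y_def)
    have "sum y UNIV = sum x UNIV"
      using \<open>i \<noteq> j\<close> unfolding split(1)[of y] split(1)[of x] rest by (simp add: y_def m_def)
    moreover have "prod x UNIV < prod y UNIV"
    proof -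
      have "x i * x j < m * m"
      proof -
        have "0 < (x i - x j)\<^sup>2" using ij by simp
        then show ?thesis by (simp add: m_def power2_eq_square field_simps)
      qed
      moreover have "prod x (UNIV - {i, j}) > 0" using pos by (intro prod_pos) auto
      ultimately show ?thesis
        using \<open>i \<noteq> j\<close> unfolding split(2)[of y] split(2)[of x] rest by (simp add: y_def)
    qed
    moreover have "prod y UNIV \<le> (sum y UNIV / CARD('i)) ^ CARD('i)"
    proof (rule prod_le_mean_power)
      show "y k \<ge> 0" for k using nn by (simp add: y_def m_def)
    qed
    ultimately show False using eq by simp
  qed
  have "sum x UNIV = (\<Sum>j\<in>(UNIV :: 'i set). x i)" by (intro sum.cong refl const)
  then show ?thesis by simp
qed

section \<open>Trace and Jacobian from an eigenbasis of a hyperplane\<close>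

lemma hyperplane_coords:
  fixes b :: "'i::finite \<Rightarrow> 'a::euclidean_space"
  assumes b: "inj b" "independent (range b)" "span (range b) = {v. v \<bullet> \<nu> = 0}" and \<nu>: "norm \<nu> = 1"
  obtains c where "\<And>i. linear (c i :: 'a \<Rightarrow> real)" "\<And>x. x = (\<Sum>i\<in>UNIV. c i x *\<^sub>R b i) + (x \<bullet> \<nu>) *\<^sub>R \<nu>"
    "\<And>i j. c i (b j) = (if i = j then 1 else 0)" "\<And>i. c i \<nu> = 0"
proof -
  have \<nu>\<nu>: "\<nu> \<bullet> \<nu> = 1" using \<nu> by (simp add: dot_square_norm)
  then have "\<nu> \<notin> span (range b)" unfolding b(3) by simp
  then have "\<nu> \<notin> range b" using span_base[of \<nu> "range b"] by blast
  have ind: "independent (insert \<nu> (range b))"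
    using \<open>\<nu> \<notin> span (range b)\<close> b(2) by (rule independent_insertI)
  \<comment> \<open>Coordinate functionals of the basis formed by b and \<nu>. They replace inner
    products because an anisotropic eigenbasis is in general not orthogonal.\<close>
  have "\<exists>g. linear g \<and> (\<forall>x\<in>insert \<nu> (range b). g x = (if x = b i then 1 else (0::real)))" for i
    by (rule linear_independent_extend[OF ind])
  then obtain c where c: "\<And>i. linear (c i :: 'a \<Rightarrow> real)"
     "\<And>i x. x \<in> insert \<nu> (range b) \<Longrightarrow> c i x = (if x = b i then 1 else 0)"
    by metis
  have cb: "c i (b j) = (if i = j then 1 else 0)" for i j
    using c(2)[of "b j" i] b(1) by (auto simp: inj_eq)
  have c\<nu>: "c i \<nu> = 0" for i
    using c(2)[of \<nu> i] \<open>\<nu> \<notin> range b\<close> by auto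
  have rep: "y = (\<Sum>i\<in>UNIV. c i y *\<^sub>R b i)" if "y \<in> span (range b)" for y
    using that
  proof (induction rule: span_induct_alt)
    case base
    then show ?case using c(1) by (simp add: linear_0)
  next
    case (step a x y)
    then obtain j where "x = b j" by auto
    have "(\<Sum>i\<in>UNIV. c i (a *\<^sub>R x + y) *\<^sub>R b i) = a *\<^sub>R (\<Sum>i\<in>UNIV. (if i = j then 1 else 0) *\<^sub>R b i) + (\<Sum>i\<in>UNIV. c i y *\<^sub>R b i)"
      using c(1) by (simp add: linear_add linear_scale \<open>x = b j\<close> cb algebra_simps sum.distrib scaleR_sum_right)
    also have "(\<Sum>i\<in>UNIV. (if i = j then 1 else 0) *\<^sub>R b i) = (\<Sum>i\<in>UNIV. if i = j then b i else 0)"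
      by (intro sum.cong) auto
    finally show ?case using step(2) by (simp add: \<open>x = b j\<close>)
  qed
  have "x = (\<Sum>i\<in>UNIV. c i x *\<^sub>R b i) + (x \<bullet> \<nu>) *\<^sub>R \<nu>" for x
  proof -
    let ?y = "x - (x \<bullet> \<nu>) *\<^sub>R \<nu>"
    have "?y \<in> span (range b)" unfolding b(3) by (simp add: inner_diff_left \<nu>\<nu>)
    moreover have "c i ?y = c i x" for i using c(1) c\<nu> by (simp add: linear_diff linear_scale)
    ultimately have "?y = (\<Sum>i\<in>UNIV. c i x *\<^sub>R b i)" using rep[of ?y] by simp
    then show ?thesis by (simp add: algebra_simps)
  qed
  with that c(1) cb c\<nu> show ?thesis by blast
qed

text \<open>The trace is expanded over an orthonormal basis but evaluated in the coordinates of the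
  eigenbasis; the normal direction contributes \<langle>L \<nu>, \<nu>\<rangle>, which
  \<open>im\<close> makes zero. The left side does not mention b, so the sum of the eigenvalues is
  independent of the frame.\<close>

lemma trace_eigenbasis:
  fixes L :: "'a::euclidean_space \<Rightarrow> 'a" and b :: "'i::finite \<Rightarrow> 'a"
  assumes L: "linear L" and b: "inj b" "independent (range b)" "span (range b) = {v. v \<bullet> \<nu> = 0}"
    and \<nu>: "norm \<nu> = 1" and eig: "\<And>i. L (b i) = \<kappa> i *\<^sub>R b i" and im: "\<And>x. L x \<bullet> \<nu> = 0"
  shows "(\<Sum>e\<in>Basis. L e \<bullet> e) = sum \<kappa> UNIV"
proof -
  obtain c where c: "\<And>i. linear (c i :: 'a \<Rightarrow> real)" "\<And>x. x = (\<Sum>i\<in>UNIV. c i x *\<^sub>R b i) + (x \<bullet> \<nu>) *\<^sub>R \<nu>"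
    "\<And>i j. c i (b j) = (if i = j then 1 else 0)" "\<And>i. c i \<nu> = 0"
    using hyperplane_coords[OF b \<nu>] by blast
  have Le: "L e = (\<Sum>i\<in>UNIV. (c i e * \<kappa> i) *\<^sub>R b i) + (e \<bullet> \<nu>) *\<^sub>R L \<nu>" for e
    by (subst c(2)[of e]) (simp add: linear_add[OF L] linear_sum[OF L] linear_scale[OF L] eig)
  have ec: "(\<Sum>e\<in>Basis. c i e * (x \<bullet> e)) = c i x" for i x
    using linear_sum[OF c(1)[of i], of "\<lambda>e. (x \<bullet> e) *\<^sub>R e" Basis]
    by (simp add: euclidean_representation linear_scale[OF c(1)] mult.commute)
  have "(\<Sum>e\<in>Basis. L e \<bullet> e) = (\<Sum>e\<in>Basis. (\<Sum>i\<in>UNIV. \<kappa> i * (c i e * (b i \<bullet> e))) + (L \<nu> \<bullet> e) * (\<nu> \<bullet> e))"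
    by (intro sum.cong refl, subst Le) (simp add: inner_add_left inner_sum_left inner_commute[of \<nu>] mult_ac)
  also have "\<dots> = (\<Sum>i\<in>UNIV. \<kappa> i * (\<Sum>e\<in>Basis. c i e * (b i \<bullet> e))) + L \<nu> \<bullet> \<nu>"
    by (simp add: sum.distrib euclidean_inner[of "L \<nu>" \<nu>] sum.swap[of _ UNIV] sum_distrib_left)
  also have "\<dots> = sum \<kappa> UNIV" by (simp add: ec c(3) im)
  finally show ?thesis .
qed

text \<open>L \<nu> is left arbitrary because the normal will later be sent to an anisotropic
  normal; its tangential part only shears and drops out.\<close>

lemma jac_eigenbasis:
  fixes L :: "'n::finite ambient \<Rightarrow> 'n ambient" and b :: "'n \<Rightarrow> 'n ambient"
  assumes L: "linear L" and b: "inj b" "independent (range b)" "span (range b) = {v. v \<bullet> \<nu> = 0}"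
    and \<nu>: "norm \<nu> = 1" and eig: "\<And>i. L (b i) = \<kappa> i *\<^sub>R b i"
  shows "jac L = \<bar>L \<nu> \<bullet> \<nu>\<bar> * \<bar>prod \<kappa> UNIV\<bar>"
proof -
  obtain c where c: "\<And>i. linear (c i :: 'n ambient \<Rightarrow> real)" "\<And>x. x = (\<Sum>i\<in>UNIV. c i x *\<^sub>R b i) + (x \<bullet> \<nu>) *\<^sub>R \<nu>"
    "\<And>i j. c i (b j) = (if i = j then 1 else 0)" "\<And>i. c i \<nu> = 0"
    using hyperplane_coords[OF b \<nu>] by blast
  define P :: "'n ambient \<Rightarrow> 'n ambient" where "P = (\<lambda>(w, s). (\<Sum>i\<in>UNIV. (w $ i) *\<^sub>R b i) + s *\<^sub>R \<nu>)"
  define M :: "real ^ 'n \<Rightarrow> real ^ 'n" where "M w = (\<chi> i. \<kappa> i * w $ i)" for w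
  define \<Theta> where "\<Theta> = L \<nu> \<bullet> \<nu>"
  define d where "d = (\<chi> i. c i (L \<nu>))"
  define T1 where "T1 = (\<lambda>(w, s :: real). (M w, 1 * s))"
  define T2 where "T2 = (\<lambda>(w :: real ^ 'n, s :: real). (w + s *\<^sub>R d, s))"
  define T3 where "T3 = (\<lambda>(w :: real ^ 'n, s :: real). (id w, \<Theta> * s))"
  have lP: "linear P"
    by (intro linearI) (auto simp: P_def algebra_simps sum.distrib scaleR_sum_right)
  have lM: "linear M" by (intro linearI) (auto simp: M_def vec_eq_iff algebra_simps)
  have lT: "linear T1" "linear T2" "linear T3"
    using lM by (auto intro!: linearI simp: T1_def T2_def T3_def linear_add linear_scale algebra_simps)
  have injP: "inj P"
    unfolding linear_injective_0[OF lP]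
  proof (intro allI impI)
    fix x assume x: "P x = 0"
    obtain w s where ws: "x = (w, s)" by fastforce
    have \<nu>b: "b i \<bullet> \<nu> = 0" for i using b(3) span_base[of "b i" "range b"] by auto
    have "P x \<bullet> \<nu> = s" by (simp add: ws P_def inner_add_left inner_sum_left \<nu>b dot_square_norm \<nu>)
    then have "s = 0" using x by simp
    have "c j (P x) = w $ j" for j
      by (simp add: ws P_def linear_add[OF c(1)] linear_sum[OF c(1)] linear_scale[OF c(1)] c(3,4) if_distrib cong: if_cong)
    then have "w = 0" using x linear_0[OF c(1)] by (simp add: vec_eq_iff)
    then show "x = 0" using \<open>s = 0\<close> ws by (simp add: prod_eq_iff)
  qed
  have PT: "L (P x) = P ((T3 \<circ> (T1 \<circ> id)) x) + snd x *\<^sub>R (\<Sum>i\<in>UNIV. (d $ i) *\<^sub>R b i)" for x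
  proof -
    obtain w s where ws: "x = (w, s)" by fastforce
    have "L \<nu> = (\<Sum>i\<in>UNIV. (d $ i) *\<^sub>R b i) + \<Theta> *\<^sub>R \<nu>"
      by (subst c(2)[of "L \<nu>"]) (simp add: d_def \<Theta>_def)
    then show ?thesis
      by (simp add: ws P_def T3_def T1_def M_def linear_add[OF L] linear_sum[OF L] linear_scale[OF L] eig algebra_simps)
  qed
  text \<open>The matrix of \<open>L\<close> is block triangular; the shear has to act before the last coordinate is scaled
    since \<open>\<Theta>\<close> may vanish.\<close>
  have comm: "L \<circ> P = P \<circ> (T3 \<circ> (T2 \<circ> T1))"
    by (rule ext, subst o_apply, subst PT) (auto simp: P_def T3_def T2_def T1_def algebra_simps sum.distrib scaleR_sum_right)
  have "jac L * jac P = jac P * (jac T3 * (jac T2 * jac T1))"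
    using comm jac_compose[OF L lP] jac_compose[OF lP linear_compose[OF linear_compose[OF lT(1,2)] lT(3)]]
      jac_compose[OF lT(3) linear_compose[OF lT(1,2)]] jac_compose[OF lT(2,1)] by metis
  then have "jac L = jac T3 * (jac T2 * jac T1)" using jac_pos[OF lP injP]
    by (metis less_irrefl mult.commute mult_right_cancel)
  also have "jac T3 = \<bar>\<Theta>\<bar>" unfolding T3_def by (subst jac_prod) (auto simp: jac_id linear_id)
  also have "jac T2 = 1" unfolding T2_def by (rule jac_shear)
  also have "jac T1 = \<bar>prod \<kappa> UNIV\<bar>"
  proof -
    have "matrix M = (\<chi> i j. if i = j then \<kappa> i else 0)"
      by (simp add: matrix_def M_def vec_eq_iff axis_def)
    then have "det (matrix M) = prod \<kappa> UNIV" by (subst det_diagonal) auto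
    then show ?thesis unfolding T1_def by (subst jac_prod[OF lM]) (simp add: jac_vec[OF lM])
  qed
  finally show ?thesis by (simp add: \<Theta>_def)
qed

section \<open>Functions of class \<open>C\<^sup>2\<close>\<close>

lemma C_k_on_cong:
  assumes "open U" "\<And>x. x \<in> U \<Longrightarrow> f x = g x"
  shows "C_k_on k U f \<longleftrightarrow> C_k_on k U g"
  using assms(2)
proof (induction k arbitrary: f g)
  case 0
  then show ?case by (simp cong: continuous_on_cong)
next
  case (Suc k)
  have ev: "\<forall>\<^sub>F y in nhds x. f y = g y" if "x \<in> U" for x
    using eventually_nhds_in_open[OF assms(1) that] Suc.prems by (auto elim: eventually_mono)
  have der: "(f has_derivative D) (at x) \<longleftrightarrow> (g has_derivative D) (at x)" if "x \<in> U" for x D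
    using has_derivative_transform_within_open[OF _ assms(1) that] Suc.prems by metis
  have diff: "f differentiable (at x) \<longleftrightarrow> g differentiable (at x)" if "x \<in> U" for x
    using der[OF that] by (simp add: differentiable_def)
  have "frechet_derivative f (at x) v = frechet_derivative g (at x) v" if "x \<in> U" for x v
    using der[OF that] by (simp add: frechet_derivative_def)
  then have "C_k_on k U (\<lambda>x. frechet_derivative f (at x) v) \<longleftrightarrow> C_k_on k U (\<lambda>x. frechet_derivative g (at x) v)" for v
    by (intro Suc.IH) auto
  then show ?case using diff by auto
qed

lemma C_k_on_linear_compose:
  assumes "bounded_linear l" "open U" "C_k_on k U f"
  shows "C_k_on k U (\<lambda>x. l (f x))"
  using assms(3)
proof (induction k arbitrary: f)
  case 0
  then show ?case using bounded_linear.continuous_on[OF assms(1)] by simp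
next
  case (Suc k)
  have der: "((\<lambda>x. l (f x)) has_derivative (\<lambda>v. l (frechet_derivative f (at x) v))) (at x)" if "x \<in> U" for x
    using Suc.prems that frechet_derivative_works by (auto intro!: bounded_linear.has_derivative[OF assms(1)])
  have "C_k_on k U (\<lambda>x. frechet_derivative (\<lambda>x. l (f x)) (at x) v)" for v
  proof -
    have "C_k_on k U (\<lambda>x. l (frechet_derivative f (at x) v))"
      using Suc.prems by (intro Suc.IH) auto
    moreover have "frechet_derivative (\<lambda>x. l (f x)) (at x) v = l (frechet_derivative f (at x) v)" if "x \<in> U" for x
      using frechet_derivative_at[OF der[OF that]] by metis
    ultimately show ?thesis using C_k_on_cong[OF assms(2)] by (metis (no_types, lifting))
  qed
  moreover have "(\<lambda>x. l (f x)) differentiable (at x)" if "x \<in> U" for x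
    using der[OF that] differentiableI by blast
  ultimately show ?case by simp
qed

lemma C_k_on_subset:
  "C_k_on k U f \<Longrightarrow> U' \<subseteq> U \<Longrightarrow> C_k_on k U' f"
  by (induction k arbitrary: f) (auto intro: continuous_on_subset)

lemma C2_derivative:
  assumes "C_k_on 2 U f" "x \<in> U"
  shows "(f has_derivative frechet_derivative f (at x)) (at x)"
  using assms frechet_derivative_works by (auto simp: numeral_2_eq_2)

lemma C2_continuous_derivative:
  assumes "C_k_on 2 U f"
  shows "continuous_on U (\<lambda>x. frechet_derivative f (at x) v)"
proof -
  have "(\<lambda>x. frechet_derivative f (at x) v) differentiable (at x)" if "x \<in> U" for x
    using assms that by (auto simp: numeral_2_eq_2)
  then show ?thesis
    by (intro continuous_at_imp_continuous_on ballI differentiable_imp_continuous_within)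
qed

text \<open>Two mean value theorems, along v for the difference in w and along w for the gradient,
  express the second difference by one value of the Hessian near x.\<close>

lemma second_difference:
  fixes f :: "'a::real_inner \<Rightarrow> real"
  assumes f: "\<And>y. y \<in> ball x r \<Longrightarrow> (f has_derivative (\<lambda>v. G y \<bullet> v)) (at y)"
    and G: "\<And>y. y \<in> ball x r \<Longrightarrow> (G has_derivative H y) (at y)"
    and h: "h > 0" "h * (norm v + norm w) < r"
  shows "\<exists>p. dist x p < r \<and> dist x p \<le> h * (norm v + norm w) \<and>
    f (x + h *\<^sub>R v + h *\<^sub>R w) - f (x + h *\<^sub>R v) - (f (x + h *\<^sub>R w) - f x) = h * h * (H p w \<bullet> v)"
proof -
  have dist: "dist x (x + s *\<^sub>R v + t *\<^sub>R w) \<le> h * (norm v + norm w)" if "0 \<le> s" "s \<le> h" "0 \<le> t" "t \<le> h" for s t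
  proof -
    have "dist x (x + s *\<^sub>R v + t *\<^sub>R w) = norm (s *\<^sub>R v + t *\<^sub>R w)" by (metis add.assoc add_diff_cancel_left' dist_commute dist_norm)
    also have "\<dots> \<le> s * norm v + t * norm w" using norm_triangle_ineq[of "s *\<^sub>R v" "t *\<^sub>R w"] that by simp
    also have "\<dots> \<le> h * norm v + h * norm w" using that by (intro add_mono mult_right_mono) auto
    finally show ?thesis by (simp add: algebra_simps)
  qed
  have inb: "x + s *\<^sub>R v + t *\<^sub>R w \<in> ball x r" if "0 \<le> s" "s \<le> h" "0 \<le> t" "t \<le> h" for s t
    using dist[OF that] h by simp
  let ?\<phi> = "\<lambda>s. f (x + s *\<^sub>R v + h *\<^sub>R w) - f (x + s *\<^sub>R v + 0 *\<^sub>R w)"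
  have "DERIV ?\<phi> s :> (G (x + s *\<^sub>R v + h *\<^sub>R w) \<bullet> v - G (x + s *\<^sub>R v + 0 *\<^sub>R w) \<bullet> v)" if "0 \<le> s" "s \<le> h" for s
  proof -
    have "((\<lambda>s. f (x + s *\<^sub>R v + t *\<^sub>R w)) has_derivative (\<lambda>d. G (x + s *\<^sub>R v + t *\<^sub>R w) \<bullet> (d *\<^sub>R v))) (at s)"
      if "0 \<le> t" "t \<le> h" for t
      by (rule has_derivative_compose[of "\<lambda>s. x + s *\<^sub>R v + t *\<^sub>R w" "\<lambda>d. d *\<^sub>R v" s UNIV f
            "\<lambda>u. G (x + s *\<^sub>R v + t *\<^sub>R w) \<bullet> u", OF _ f[OF inb]])
         (use that \<open>0 \<le> s\<close> \<open>s \<le> h\<close> in \<open>auto intro!: derivative_eq_intros\<close>)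
    then have "((\<lambda>s. f (x + s *\<^sub>R v + t *\<^sub>R w)) has_field_derivative (G (x + s *\<^sub>R v + t *\<^sub>R w) \<bullet> v)) (at s)"
      if "0 \<le> t" "t \<le> h" for t
      using that by (simp add: has_field_derivative_def mult.commute[of _ "_ \<bullet> _"])
    from DERIV_diff[OF this[of h] this[of 0]] h show ?thesis by simp
  qed
  from MVT2[OF h(1) this]
  obtain s1 where s1: "0 < s1" "s1 < h"
    "?\<phi> h - ?\<phi> 0 = (h - 0) * (G (x + s1 *\<^sub>R v + h *\<^sub>R w) \<bullet> v - G (x + s1 *\<^sub>R v + 0 *\<^sub>R w) \<bullet> v)" by blast
  have "DERIV (\<lambda>t. G (x + s1 *\<^sub>R v + t *\<^sub>R w) \<bullet> v) t :> H (x + s1 *\<^sub>R v + t *\<^sub>R w) w \<bullet> v" if "0 \<le> t" "t \<le> h" for t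
  proof -
    have G': "(G has_derivative H (x + s1 *\<^sub>R v + t *\<^sub>R w)) (at (x + s1 *\<^sub>R v + t *\<^sub>R w))"
      using inb[of s1 t] s1 that by (intro G) auto
    have "((\<lambda>t. G (x + s1 *\<^sub>R v + t *\<^sub>R w)) has_derivative (\<lambda>d. H (x + s1 *\<^sub>R v + t *\<^sub>R w) (d *\<^sub>R w))) (at t)"
      by (rule has_derivative_compose[of "\<lambda>t. x + s1 *\<^sub>R v + t *\<^sub>R w" "\<lambda>d. d *\<^sub>R w" t UNIV G
            "H (x + s1 *\<^sub>R v + t *\<^sub>R w)", OF _ G']) (auto intro!: derivative_eq_intros)
    then have "((\<lambda>t. G (x + s1 *\<^sub>R v + t *\<^sub>R w) \<bullet> v) has_derivative (\<lambda>d. H (x + s1 *\<^sub>R v + t *\<^sub>R w) (d *\<^sub>R w) \<bullet> v)) (at t)"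
      by (auto intro!: derivative_eq_intros)
    then show ?thesis
      using linear_scale[OF has_derivative_linear[OF G']] by (simp add: has_field_derivative_def mult.commute[of _ "_ \<bullet> _"])
  qed
  from MVT2[OF h(1) this]
  obtain t1 where t1: "0 < t1" "t1 < h"
    "G (x + s1 *\<^sub>R v + h *\<^sub>R w) \<bullet> v - G (x + s1 *\<^sub>R v + 0 *\<^sub>R w) \<bullet> v = (h - 0) * (H (x + s1 *\<^sub>R v + t1 *\<^sub>R w) w \<bullet> v)"
    by blast
  show ?thesis
  proof (intro exI[of _ "x + s1 *\<^sub>R v + t1 *\<^sub>R w"] conjI)
    show "dist x (x + s1 *\<^sub>R v + t1 *\<^sub>R w) \<le> h * (norm v + norm w)" using dist[of s1 t1] s1 t1 by simp
    then show "dist x (x + s1 *\<^sub>R v + t1 *\<^sub>R w) < r" using h by simp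
    show "f (x + h *\<^sub>R v + h *\<^sub>R w) - f (x + h *\<^sub>R v) - (f (x + h *\<^sub>R w) - f x) = h * h * (H (x + s1 *\<^sub>R v + t1 *\<^sub>R w) w \<bullet> v)"
      using s1(3) t1(3) by simp
  qed
qed

text \<open>The second difference does not see the order of v and w, so two Hessian values near x
  coincide; continuity moves both to x.\<close>

lemma second_derivative_symmetric:
  fixes f :: "'a::real_inner \<Rightarrow> real"
  assumes U: "open U" "x \<in> U"
    and f: "\<And>y. y \<in> U \<Longrightarrow> (f has_derivative (\<lambda>v. G y \<bullet> v)) (at y)"
    and G: "\<And>y. y \<in> U \<Longrightarrow> (G has_derivative H y) (at y)"
    and H: "\<And>v. continuous_on U (\<lambda>y. H y v)"
  shows "H x v \<bullet> w = H x w \<bullet> v"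
proof (rule ccontr)
  assume ne: "H x v \<bullet> w \<noteq> H x w \<bullet> v"
  \<comment> \<open>Half the gap: two numbers within less than e of its two ends cannot
    coincide.\<close>
  define e where "e = \<bar>H x v \<bullet> w - H x w \<bullet> v\<bar> / 2"
  have e: "e > 0" using ne by (simp add: e_def)
  have c: "isCont (\<lambda>y. H y a \<bullet> b) x" for a b
    using H[of a] U by (intro continuous_intros) (simp add: continuous_on_eq_continuous_at)
  obtain r0 where r0: "r0 > 0" "ball x r0 \<subseteq> U" using U openE by blast
  obtain r1 where r1: "r1 > 0" "\<And>y. dist y x < r1 \<Longrightarrow> dist (H y v \<bullet> w) (H x v \<bullet> w) < e"
    using c[of v w] e unfolding continuous_at_eps_delta by blast
  obtain r2 where r2: "r2 > 0" "\<And>y. dist y x < r2 \<Longrightarrow> dist (H y w \<bullet> v) (H x w \<bullet> v) < e"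
    using c[of w v] e unfolding continuous_at_eps_delta by blast
  define r where "r = min r0 (min r1 r2)"
  have r: "r > 0" using r0 r1 r2 by (simp add: r_def)
  define h where "h = r / (2 * (norm v + norm w + 1))"
  have nn: "norm v + norm w + 1 > 0" by (smt (verit) norm_ge_zero)
  have h: "h > 0" "h * (norm v + norm w) < r" 
  proof -
    show "h > 0" using r nn by (simp add: h_def)
    have "h * (norm v + norm w) \<le> h * (norm v + norm w + 1)" using \<open>h > 0\<close> by (intro mult_left_mono) auto
    also have "\<dots> = r / 2" using nn by (simp add: h_def field_simps)
    finally show "h * (norm v + norm w) < r" using r by simp
  qed
  have sub: "ball x r \<subseteq> U" using r0 by (auto simp: r_def)
  obtain p where p: "dist x p < r" "f (x + h *\<^sub>R v + h *\<^sub>R w) - f (x + h *\<^sub>R v) - (f (x + h *\<^sub>R w) - f x) = h * h * (H p w \<bullet> v)"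
    using second_difference[of x r f G H h v w] f G sub h by blast
  obtain q where q: "dist x q < r" "f (x + h *\<^sub>R w + h *\<^sub>R v) - f (x + h *\<^sub>R w) - (f (x + h *\<^sub>R v) - f x) = h * h * (H q v \<bullet> w)"
    using second_difference[of x r f G H h w v] f G sub h(1) h(2)[unfolded add.commute[of "norm v"]] by blast
  have "h * h * (H p w \<bullet> v) = h * h * (H q v \<bullet> w)"
    unfolding p(2)[symmetric] q(2)[symmetric] by (simp add: algebra_simps)
  then have "H p w \<bullet> v = H q v \<bullet> w" using h by simp
  moreover have "dist (H p w \<bullet> v) (H x w \<bullet> v) < e" using p(1) by (intro r2) (auto simp: r_def dist_commute)
  moreover have "dist (H q v \<bullet> w) (H x v \<bullet> w) < e" using q(1) by (intro r1) (auto simp: r_def dist_commute)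
  ultimately show False by (simp add: dist_real_def e_def abs_if split: if_splits)
qed

text \<open>\<open>C_k_on\<close> descends to derivatives in one direction at a time; gradient and
  Hessian are assembled from the directions of a basis.\<close>

lemma C2_gradient:
  fixes f :: "'a::euclidean_space \<Rightarrow> real"
  assumes U: "open U" and f: "C_k_on 2 U f"
  obtains G H where "\<And>x. x \<in> U \<Longrightarrow> (f has_derivative (\<lambda>v. G x \<bullet> v)) (at x)"
    "\<And>x. x \<in> U \<Longrightarrow> (G has_derivative H x) (at x)"
    "\<And>v. continuous_on U (\<lambda>x. H x v)" "\<And>x v w. x \<in> U \<Longrightarrow> H x v \<bullet> w = H x w \<bullet> v"
proof -
  define G where "G x = (\<Sum>e\<in>Basis. frechet_derivative f (at x) e *\<^sub>R e)" for x
  define H where "H x v = (\<Sum>e\<in>Basis. frechet_derivative (\<lambda>x. frechet_derivative f (at x) e) (at x) v *\<^sub>R e)" for x v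
  have d: "f differentiable (at x)" "(\<lambda>x. frechet_derivative f (at x) e) differentiable (at x)" if "x \<in> U" for x e
    using f that by (auto simp: numeral_2_eq_2)
  have fG: "(f has_derivative (\<lambda>v. G x \<bullet> v)) (at x)" if "x \<in> U" for x
  proof -
    have hd: "(f has_derivative frechet_derivative f (at x)) (at x)"
      using d(1)[OF that] frechet_derivative_works by blast
    moreover have "frechet_derivative f (at x) v = G x \<bullet> v" for v
    proof -
      note lin = has_derivative_linear[OF hd]
      have "frechet_derivative f (at x) v = frechet_derivative f (at x) (\<Sum>e\<in>Basis. (v \<bullet> e) *\<^sub>R e)"
        by (simp add: euclidean_representation)
      also have "\<dots> = (\<Sum>e\<in>Basis. (v \<bullet> e) * frechet_derivative f (at x) e)"
        by (simp add: linear_sum[OF lin] linear_scale[OF lin])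
      finally show ?thesis
        by (simp add: G_def inner_sum_left inner_sum_right inner_commute[of v] mult.commute)
    qed
    ultimately show ?thesis by (simp add: has_derivative_eq_rhs[OF hd] fun_eq_iff)
  qed
  moreover have GH: "(G has_derivative H x) (at x)" if "x \<in> U" for x
    unfolding G_def[abs_def] H_def[abs_def] using d(2)[OF that] frechet_derivative_works
    by (intro has_derivative_sum has_derivative_scaleR_left) blast
  moreover have Hc: "continuous_on U (\<lambda>x. H x v)" for v
    unfolding H_def using f by (intro continuous_intros) (auto simp: numeral_2_eq_2)
  moreover have "H x v \<bullet> w = H x w \<bullet> v" if "x \<in> U" for x v w
    by (rule second_derivative_symmetric[OF U that fG GH Hc])
  ultimately show ?thesis using that by blast
qed

section \<open>Minkowski norms and Wulff shapes\<close>

locale minkowski =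
  fixes F :: "'a::euclidean_space \<Rightarrow> real"
  assumes minkowski_norm: "minkowski_norm F"
begin

abbreviation "\<Phi> \<equiv> Phi F"

definition dPhi :: "'a \<Rightarrow> 'a \<Rightarrow> 'a" where
  "dPhi x = frechet_derivative \<Phi> (at x)"

lemma F_homogeneous: "x \<noteq> 0 \<Longrightarrow> F x = norm x * F (x /\<^sub>R norm x)"
  using minkowski_norm unfolding minkowski_norm_def by blast

lemma F_0 [simp]: "F 0 = 0"
  using minkowski_norm unfolding minkowski_norm_def by blast

lemma F_pos: "x \<noteq> 0 \<Longrightarrow> F x > 0"
proof -
  assume x: "x \<noteq> 0"
  have "\<forall>z\<in>sphere 0 1. F z > 0"
    using minkowski_norm unfolding minkowski_norm_def by blast
  moreover have "x /\<^sub>R norm x \<in> sphere 0 1" using x by (simp add: dist_norm)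
  ultimately have "F (x /\<^sub>R norm x) > 0" by blast
  then show ?thesis using F_homogeneous[OF x] x by simp
qed

lemma F_nonneg [simp]: "F x \<ge> 0"
  using F_pos[of x] by (cases "x = 0") auto

lemma F_scale: "t \<ge> 0 \<Longrightarrow> F (t *\<^sub>R x) = t * F x"
proof -
  assume t: "t \<ge> 0"
  show ?thesis
  proof (cases "t = 0 \<or> x = 0")
    case False
    then have "t *\<^sub>R x /\<^sub>R norm (t *\<^sub>R x) = x /\<^sub>R norm x" using t by simp
    with False t show ?thesis
      by (metis F_homogeneous abs_of_nonneg mult.assoc norm_scaleR scaleR_eq_0_iff)
  qed auto
qed

lemma norm_has_derivative:
  fixes x :: "'a"
  assumes "x \<noteq> 0"
  shows "(norm has_derivative (\<lambda>v. (x /\<^sub>R norm x) \<bullet> v)) (at x)"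
  using has_derivative_norm[OF assms] by (simp add: sgn_div_norm inner_commute)

text \<open>F is the norm times its radial extension, which is smooth away from 0, so the product
  rule gives gradient and Hessian explicitly. On vectors tangent to the sphere all mixed terms carry
  a factor \<langle>z, X\<rangle> = 0, which leaves \<open>A_form\<close>.\<close>

lemma Phi_structure:
  "\<exists>D. (\<forall>x. x \<noteq> 0 \<longrightarrow> (F has_derivative (\<lambda>v. \<Phi> x \<bullet> v)) (at x) \<and> (\<Phi> has_derivative D x) (at x))
    \<and> (\<forall>v. continuous_on (- {0}) (\<lambda>x. D x v))
    \<and> (\<forall>z X. norm z = 1 \<longrightarrow> X \<bullet> z = 0 \<longrightarrow> D z X \<bullet> X = A_form F z X X)"
proof -
  let ?R = "radial_ext F"
  have C2: "C_k_on 2 (- {0}) ?R"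
    using minkowski_norm unfolding minkowski_norm_def smooth_on_sphere_def smooth_on_def by blast
  obtain G H where GH: "\<And>x. x \<in> - {0} \<Longrightarrow> (?R has_derivative (\<lambda>v. G x \<bullet> v)) (at x)"
    "\<And>x. x \<in> - {0} \<Longrightarrow> (G has_derivative H x) (at x)"
    "\<And>v. continuous_on (- {0}) (\<lambda>x. H x v)" "\<And>x v w. x \<in> - {0} \<Longrightarrow> H x v \<bullet> w = H x w \<bullet> v"
    using C2_gradient[OF _ C2] by auto
  have GDERIV_unique: "grad f x = D" if "(f has_derivative (\<lambda>v. D \<bullet> v)) (at x)" for f :: "'a \<Rightarrow> real" and x D
    unfolding grad_def
  proof (rule the_equality)
    show "GDERIV f x :> D" using that by (simp add: gderiv_def inner_commute)
    fix D' assume "GDERIV f x :> D'"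
    then have "(f has_derivative (\<lambda>v. D' \<bullet> v)) (at x)" by (simp add: gderiv_def inner_commute)
    then have "(\<lambda>v. D' \<bullet> v) = (\<lambda>v. D \<bullet> v)" using that has_derivative_unique by blast
    then show "D' = D" by (metis vector_eq_rdot)
  qed
  define P where "P x = (?R x / norm x) *\<^sub>R x + norm x *\<^sub>R G x" for x
  define D where "D x v = ((G x \<bullet> v) / norm x - ?R x * ((x /\<^sub>R norm x) \<bullet> v) / (norm x)\<^sup>2) *\<^sub>R x + (?R x / norm x) *\<^sub>R v
      + ((x /\<^sub>R norm x) \<bullet> v) *\<^sub>R G x + norm x *\<^sub>R H x v" for x v
  have open0: "open (- {0 :: 'a})" by auto
  have FP: "(F has_derivative (\<lambda>v. P x \<bullet> v)) (at x)" if x: "x \<noteq> 0" for x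
  proof -
    have "((\<lambda>x. norm x * ?R x) has_derivative (\<lambda>v. norm x * (G x \<bullet> v) + ((x /\<^sub>R norm x) \<bullet> v) * ?R x)) (at x)"
      using x by (intro has_derivative_mult norm_has_derivative GH(1)) auto
    then have "(F has_derivative (\<lambda>v. norm x * (G x \<bullet> v) + ((x /\<^sub>R norm x) \<bullet> v) * ?R x)) (at x)"
      by (rule has_derivative_transform_within_open[OF _ open0]) (use x F_homogeneous[symmetric] in \<open>auto simp: radial_ext_def\<close>)
    then show ?thesis
      by (rule has_derivative_eq_rhs) (auto simp: P_def fun_eq_iff inner_add_left field_simps)
  qed
  have PhiP: "\<Phi> x = P x" if "x \<noteq> 0" for x
    unfolding Phi_def by (rule GDERIV_unique[OF FP[OF that]])
  have PD: "(P has_derivative D x) (at x)" if x: "x \<noteq> 0" for x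
  proof -
    have "((\<lambda>x. ?R x / norm x) has_derivative (\<lambda>v. (- ?R x * (inverse (norm x) * ((x /\<^sub>R norm x) \<bullet> v) * inverse (norm x)) + (G x \<bullet> v) / norm x))) (at x)"
      using x by (intro has_derivative_divide norm_has_derivative GH(1)) auto
    from has_derivative_add[OF has_derivative_scaleR[OF this has_derivative_ident]
        has_derivative_scaleR[OF norm_has_derivative[OF x] GH(2)[of x]]] x
    have "(P has_derivative (\<lambda>v. ((?R x / norm x) *\<^sub>R v + (- ?R x * (inverse (norm x) * ((x /\<^sub>R norm x) \<bullet> v) * inverse (norm x)) + (G x \<bullet> v) / norm x) *\<^sub>R x)
       + (norm x *\<^sub>R H x v + ((x /\<^sub>R norm x) \<bullet> v) *\<^sub>R G x))) (at x)"
      by (simp add: P_def[abs_def])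
    then show ?thesis
      by (rule has_derivative_eq_rhs)
         (auto simp: D_def fun_eq_iff divide_inverse power2_eq_square algebra_simps)
  qed
  have PhiD: "(\<Phi> has_derivative D x) (at x)" if "x \<noteq> 0" for x
    by (rule has_derivative_transform_within_open[OF PD[OF that] open0]) (use that PhiP in auto)
  have cR: "continuous_on (- {0}) ?R" "continuous_on (- {0}) G"
    by (intro continuous_at_imp_continuous_on ballI has_derivative_continuous[OF GH(1)] has_derivative_continuous[OF GH(2)]; simp)+
  have "continuous_on (- {0}) (\<lambda>x. D x v)" for v
    unfolding D_def by (intro continuous_intros cR GH(3)) auto
  moreover have "D z X \<bullet> X = A_form F z X X" if "norm z = 1" "X \<bullet> z = 0" for z X
  proof -
    have z0: "z \<noteq> 0" using that by auto
    have "(grad ?R has_derivative H z) (at z)"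
      by (rule has_derivative_transform_within_open[OF GH(2) open0]) (use z0 GDERIV_unique[OF GH(1)] in auto)
    then have "frechet_derivative (grad ?R) (at z) = H z" by (metis frechet_derivative_at)
    then show ?thesis
      using that by (simp add: A_form_def sphere_hessian_def D_def inner_add_left inner_commute[of z X] radial_ext_def)
  qed
  ultimately show ?thesis using FP PhiP PhiD by (intro exI[of _ D]) auto
qed

lemma F_has_derivative: "x \<noteq> 0 \<Longrightarrow> (F has_derivative (\<lambda>v. \<Phi> x \<bullet> v)) (at x)"
  using Phi_structure by blast

lemma Phi_has_derivative: "x \<noteq> 0 \<Longrightarrow> (\<Phi> has_derivative dPhi x) (at x)"
  unfolding dPhi_def using Phi_structure by (metis frechet_derivative_at)

lemma continuous_on_dPhi: "continuous_on (- {0}) (\<lambda>x. dPhi x v)"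
proof -
  obtain D where D: "\<And>x. x \<noteq> 0 \<Longrightarrow> (\<Phi> has_derivative D x) (at x)" "continuous_on (- {0}) (\<lambda>x. D x v)"
    using Phi_structure by blast
  have "dPhi x = D x" if "x \<noteq> 0" for x
    using D(1)[OF that] unfolding dPhi_def by (metis frechet_derivative_at)
  then show ?thesis by (intro continuous_on_eq[OF D(2)]) auto
qed

lemma linear_dPhi: "x \<noteq> 0 \<Longrightarrow> linear (dPhi x)"
  using Phi_has_derivative has_derivative_linear by blast

lemma continuous_on_F: "continuous_on (- {0}) F"
  by (intro continuous_at_imp_continuous_on ballI has_derivative_continuous[OF F_has_derivative]) auto

lemma continuous_on_Phi: "continuous_on (- {0}) \<Phi>"
  by (intro continuous_at_imp_continuous_on ballI has_derivative_continuous[OF Phi_has_derivative]) auto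

lemma dPhi_symmetric: "x \<noteq> 0 \<Longrightarrow> dPhi x v \<bullet> w = dPhi x w \<bullet> v"
  by (rule second_derivative_symmetric[of "- {0}" x F \<Phi> dPhi])
     (auto intro: F_has_derivative Phi_has_derivative continuous_on_dPhi)

lemma Phi_Euler: "\<Phi> x \<bullet> x = F x" if "x \<noteq> 0"
proof -
  have "((\<lambda>t. t *\<^sub>R x) has_derivative (\<lambda>d. d *\<^sub>R x)) (at 1)" by (auto intro!: derivative_eq_intros)
  then have "((\<lambda>t. F (t *\<^sub>R x)) has_derivative (\<lambda>d. \<Phi> (1 *\<^sub>R x) \<bullet> (d *\<^sub>R x))) (at 1)"
    by (rule has_derivative_compose) (use F_has_derivative that in simp)
  moreover have "((\<lambda>t. F (t *\<^sub>R x)) has_derivative (\<lambda>d. d * F x)) (at 1)"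
  proof (rule has_derivative_transform_within_open[of _ _ _ _ "{0<..}"])
    show "((\<lambda>t. t * F x) has_derivative (\<lambda>d. d * F x)) (at 1)" by (auto intro!: derivative_eq_intros)
  qed (auto simp: F_scale)
  ultimately have "(\<lambda>d. \<Phi> (1 *\<^sub>R x) \<bullet> (d *\<^sub>R x)) = (\<lambda>d. d * F x)" by (rule has_derivative_unique)
  from fun_cong[OF this, of 1] show ?thesis by simp
qed

lemma Phi_scale: "\<Phi> (t *\<^sub>R x) = \<Phi> x" if "x \<noteq> 0" "t > 0"
proof -
  have "((\<lambda>x. t *\<^sub>R x) has_derivative (\<lambda>d. t *\<^sub>R d)) (at x)" by (auto intro!: derivative_eq_intros)
  then have "((\<lambda>x. F (t *\<^sub>R x)) has_derivative (\<lambda>d. \<Phi> (t *\<^sub>R x) \<bullet> (t *\<^sub>R d))) (at x)"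
    by (rule has_derivative_compose) (use F_has_derivative that in simp)
  moreover have "((\<lambda>x. F (t *\<^sub>R x)) has_derivative (\<lambda>d. t * (\<Phi> x \<bullet> d))) (at x)"
    using that has_derivative_mult_right[OF F_has_derivative[OF that(1)], of t] by (simp add: F_scale)
  ultimately have "(\<lambda>d. \<Phi> (t *\<^sub>R x) \<bullet> (t *\<^sub>R d)) = (\<lambda>d. t * (\<Phi> x \<bullet> d))" by (rule has_derivative_unique)
  then have "\<Phi> (t *\<^sub>R x) \<bullet> d = \<Phi> x \<bullet> d" for d using that by (auto dest!: fun_cong[of _ _ d])
  then show ?thesis by (metis vector_eq_rdot)
qed

lemma dPhi_self: "dPhi x x = 0" if "x \<noteq> 0"
proof -
  have "((\<lambda>t. t *\<^sub>R x) has_derivative (\<lambda>d. d *\<^sub>R x)) (at 1)" by (auto intro!: derivative_eq_intros)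
  then have "((\<lambda>t. \<Phi> (t *\<^sub>R x)) has_derivative (\<lambda>d. dPhi (1 *\<^sub>R x) (d *\<^sub>R x))) (at 1)"
    by (rule has_derivative_compose) (use Phi_has_derivative that in simp)
  moreover have "((\<lambda>t. \<Phi> (t *\<^sub>R x)) has_derivative (\<lambda>d. 0)) (at 1)"
    by (rule has_derivative_transform_within_open[of "\<lambda>_. \<Phi> x" _ _ _ "{0<..}"]) (use that in \<open>auto simp: Phi_scale\<close>)
  ultimately have "(\<lambda>d. dPhi (1 *\<^sub>R x) (d *\<^sub>R x)) = (\<lambda>d. 0)" by (rule has_derivative_unique)
  from fun_cong[OF this, of 1] show ?thesis by simp
qed

lemma dPhi_orthogonal: "dPhi x v \<bullet> x = 0" if "x \<noteq> 0"
  using dPhi_symmetric[OF that, of v x] dPhi_self[OF that] by simp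

lemma dPhi_pos: "dPhi z X \<bullet> X > 0" if "norm z = 1" "X \<bullet> z = 0" "X \<noteq> 0"
proof -
  obtain D where D: "\<And>x. x \<noteq> 0 \<Longrightarrow> (\<Phi> has_derivative D x) (at x)"
    "\<And>z X. norm z = 1 \<Longrightarrow> X \<bullet> z = 0 \<Longrightarrow> D z X \<bullet> X = A_form F z X X"
    using Phi_structure by blast
  have "z \<noteq> 0" using that by auto
  then have "dPhi z = D z" using D(1) unfolding dPhi_def by (metis frechet_derivative_at)
  moreover have "\<forall>z\<in>sphere 0 1. \<forall>X. X \<bullet> z = 0 \<longrightarrow> X \<noteq> 0 \<longrightarrow> A_form F z X X > 0"
    using minkowski_norm unfolding minkowski_norm_def by blast
  moreover have "z \<in> sphere 0 1" using that by simp
  ultimately show ?thesis using D(2)[OF that(1,2)] that by metis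
qed

lemma dPhi_scale: "dPhi x v = t *\<^sub>R dPhi (t *\<^sub>R x) v" if "x \<noteq> 0" "t > 0"
proof -
  have "((\<lambda>x. t *\<^sub>R x) has_derivative (\<lambda>d. t *\<^sub>R d)) (at x)" by (auto intro!: derivative_eq_intros)
  then have "((\<lambda>x. \<Phi> (t *\<^sub>R x)) has_derivative (\<lambda>d. dPhi (t *\<^sub>R x) (t *\<^sub>R d))) (at x)"
    by (rule has_derivative_compose) (use Phi_has_derivative that in simp)
  then have "(\<Phi> has_derivative (\<lambda>d. dPhi (t *\<^sub>R x) (t *\<^sub>R d))) (at x)"
    by (rule has_derivative_transform_within_open[of _ _ _ _ "- {0}"]) (use that in \<open>auto simp: Phi_scale\<close>)
  then have "dPhi x = (\<lambda>d. dPhi (t *\<^sub>R x) (t *\<^sub>R d))"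
    using Phi_has_derivative[OF that(1)] has_derivative_unique by blast
  then show ?thesis using that linear_scale[OF linear_dPhi[of "t *\<^sub>R x"]] by simp
qed

text \<open>The Hessian of a one-homogeneous function kills the radial direction and has no radial
  values, so only the tangential component of v counts.\<close>

lemma dPhi_pos_general: "dPhi x v \<bullet> v > 0" if x: "x \<noteq> 0" and v: "\<And>a. v \<noteq> a *\<^sub>R x"
proof -
  define z where "z = (1 / norm x) *\<^sub>R x"
  define X where "X = v - (v \<bullet> z) *\<^sub>R z"
  have z: "norm z = 1" "z \<noteq> 0" using x by (auto simp: z_def)
  then have zz: "z \<bullet> z = 1" by (simp add: dot_square_norm)
  have X: "X \<bullet> z = 0" "X \<noteq> 0"
    using v[of "(v \<bullet> z) / norm x"] by (auto simp: X_def inner_diff_left zz) (simp add: z_def)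
  have vX: "v = X + (v \<bullet> z) *\<^sub>R z" by (simp add: X_def)
  note lin = linear_dPhi[OF z(2)]
  have "dPhi z v = dPhi z X"
    by (subst vX) (simp add: linear_add[OF lin] linear_scale[OF lin] dPhi_self[OF z(2)])
  moreover have "dPhi z X \<bullet> v = dPhi z X \<bullet> X"
    by (subst vX) (simp add: inner_add_right dPhi_orthogonal[OF z(2)])
  ultimately have "dPhi z v \<bullet> v > 0" using dPhi_pos[OF z(1) X] by simp
  then show ?thesis using dPhi_scale[OF x, of "1 / norm x" v] x by (simp add: z_def)
qed

text \<open>By Euler's relation the tangent plane of F at x is the graph of the linear form
  \<langle>\<Phi> x, _\<rangle>, and strict convexity keeps it below F. If y is a negative multiple
  of x the form is negative. Otherwise the segment from x to y misses the origin and its direction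
  is never radial, so \<open>dPhi_pos_general\<close> makes F strictly convex along it.\<close>

theorem Phi_less: "\<Phi> x \<bullet> y < F y" if x: "x \<noteq> 0" and y: "\<And>s. s \<ge> 0 \<Longrightarrow> y \<noteq> s *\<^sub>R x"
proof (cases "\<exists>s. y = s *\<^sub>R x")
  case True
  then obtain s where s: "y = s *\<^sub>R x" "s < 0" using y by (metis not_le)
  then have "\<Phi> x \<bullet> y = s * F x" using Phi_Euler[OF x] by simp
  also have "\<dots> < 0" using s F_pos[OF x] by (simp add: mult_neg_pos)
  finally show ?thesis using F_nonneg[of y] by linarith
next
  case False
  define \<gamma> where "\<gamma> t = x + t *\<^sub>R (y - x)" for t :: real
  have ind: "a = 0" "b = 0" if "a *\<^sub>R x = b *\<^sub>R y" for a b
  proof -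
    show "b = 0"
    proof (rule ccontr)
      assume "b \<noteq> 0"
      then have "y = (1 / b) *\<^sub>R (b *\<^sub>R y)" by simp
      then have "y = (a / b) *\<^sub>R x" unfolding that[symmetric] by simp
      then show False using False by blast
    qed
    then show "a = 0" using that x by simp
  qed
  have \<gamma>0: "\<gamma> t \<noteq> 0" for t
  proof
    assume "\<gamma> t = 0"
    then have "(1 - t) *\<^sub>R x = (- t) *\<^sub>R y" by (simp add: \<gamma>_def algebra_simps)
    from ind[OF this] show False by simp
  qed
  have \<gamma>p: "y - x \<noteq> a *\<^sub>R \<gamma> t" for a t
  proof
    assume "y - x = a *\<^sub>R \<gamma> t"
    then have "(- 1 - a + a * t) *\<^sub>R x = (a * t - 1) *\<^sub>R y" by (simp add: \<gamma>_def algebra_simps)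
    from ind[OF this] show False by simp
  qed
  have d\<gamma>: "(\<gamma> has_derivative (\<lambda>d. d *\<^sub>R (y - x))) (at t)" for t
    unfolding \<gamma>_def by (auto intro!: derivative_eq_intros)
  have f': "DERIV (\<lambda>t. F (\<gamma> t)) t :> \<Phi> (\<gamma> t) \<bullet> (y - x)" for t
    using has_derivative_compose[OF d\<gamma> F_has_derivative[OF \<gamma>0]]
    by (simp add: has_field_derivative_def mult.commute[of _ "_ \<bullet> _"])
  have f'': "DERIV (\<lambda>t. \<Phi> (\<gamma> t) \<bullet> (y - x)) t :> dPhi (\<gamma> t) (y - x) \<bullet> (y - x)" for t
    using has_derivative_inner_left[OF has_derivative_compose[OF d\<gamma> Phi_has_derivative[OF \<gamma>0]], of "y - x" t]
    by (simp add: has_field_derivative_def mult.commute[of _ "_ \<bullet> _"] linear_scale[OF linear_dPhi[OF \<gamma>0]])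
  obtain t where t: "0 < t" "F (\<gamma> 1) - F (\<gamma> 0) = \<Phi> (\<gamma> t) \<bullet> (y - x)"
    using MVT2[of 0 1, OF _ f'] by auto
  obtain s where s: "\<Phi> (\<gamma> t) \<bullet> (y - x) - \<Phi> (\<gamma> 0) \<bullet> (y - x) = (t - 0) * (dPhi (\<gamma> s) (y - x) \<bullet> (y - x))"
    using MVT2[OF t(1) f''] by blast
  have "\<Phi> (\<gamma> t) \<bullet> (y - x) > \<Phi> (\<gamma> 0) \<bullet> (y - x)"
    using s t dPhi_pos_general[OF \<gamma>0 \<gamma>p] by (smt (verit) mult_pos_pos)
  then show ?thesis using t Phi_Euler[OF x] by (simp add: \<gamma>_def inner_diff_right)
qed

lemma Phi_le: "x \<noteq> 0 \<Longrightarrow> \<Phi> x \<bullet> y \<le> F y"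
proof (cases "\<exists>s\<ge>0. y = s *\<^sub>R x")
  case True
  moreover assume "x \<noteq> 0"
  ultimately show ?thesis using F_scale Phi_Euler by auto
next
  case False
  moreover assume "x \<noteq> 0"
  ultimately show ?thesis using Phi_less[of x y] by (meson less_imp_le)
qed

text \<open>\<Phi> is the gradient of a convex function: t times the increment is the sum of two
  defects in \<open>Phi_le\<close>, each nonnegative.\<close>

lemma Phi_mono:
  assumes "x \<noteq> 0" "x + t *\<^sub>R e \<noteq> 0" "t \<ge> 0"
  shows "\<Phi> x \<bullet> e \<le> \<Phi> (x + t *\<^sub>R e) \<bullet> e"
proof (cases "t = 0")
  case False
  let ?y = "x + t *\<^sub>R e"
  have "t * (\<Phi> ?y \<bullet> e - \<Phi> x \<bullet> e) = (\<Phi> ?y \<bullet> ?y - \<Phi> x \<bullet> ?y) + (\<Phi> x \<bullet> x - \<Phi> ?y \<bullet> x)"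
    by (simp add: inner_add_right algebra_simps)
  also have "\<dots> \<ge> 0"
    using Phi_le[OF assms(1), of ?y] Phi_le[OF assms(2), of x] Phi_Euler assms by simp
  finally show ?thesis using assms False by (simp add: zero_le_mult_iff)
qed auto

lemma Phi_strict_mono:
  assumes "x \<noteq> 0" "e \<noteq> 0" "\<And>a. x \<noteq> a *\<^sub>R e" "t > 0"
  shows "\<Phi> x \<bullet> e < \<Phi> (x + t *\<^sub>R e) \<bullet> e"
proof -
  let ?y = "x + t *\<^sub>R e"
  have y0: "?y \<noteq> 0" using assms(3)[of "- t"] by (auto simp: add_eq_0_iff)
  have "?y \<noteq> s *\<^sub>R x" for s
  proof
    assume "?y = s *\<^sub>R x"
    then have eq: "t *\<^sub>R e = (s - 1) *\<^sub>R x" by (simp add: algebra_simps)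
    then have "s - 1 \<noteq> 0" using assms(2,4) by auto
    then have "x = (1 / (s - 1)) *\<^sub>R ((s - 1) *\<^sub>R x)" by simp
    then have "x = (t / (s - 1)) *\<^sub>R e" unfolding eq[symmetric] by simp
    then show False using assms(3) by blast
  qed
  then have "\<Phi> x \<bullet> ?y < F ?y" using Phi_less[OF assms(1)] by blast
  have "t * (\<Phi> ?y \<bullet> e - \<Phi> x \<bullet> e) = (\<Phi> ?y \<bullet> ?y - \<Phi> x \<bullet> ?y) + (\<Phi> x \<bullet> x - \<Phi> ?y \<bullet> x)"
    by (simp add: inner_add_right algebra_simps)
  also have "\<dots> > 0"
    using \<open>\<Phi> x \<bullet> ?y < F ?y\<close> Phi_le[OF y0, of x] Phi_Euler assms y0 by simp
  finally show ?thesis using assms by (simp add: zero_less_mult_iff)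
qed

lemma Phi_inj:
  assumes "norm x = 1" "norm y = 1" "\<Phi> x = \<Phi> y"
  shows "x = y"
proof (rule ccontr)
  assume "x \<noteq> y"
  have x0: "x \<noteq> 0" "y \<noteq> 0" using assms by auto
  have "y \<noteq> s *\<^sub>R x" if "s \<ge> 0" for s
    using that assms \<open>x \<noteq> y\<close> by auto
  then have "\<Phi> x \<bullet> y < F y" using Phi_less[OF x0(1)] by blast
  then show False using Phi_Euler[OF x0(2)] assms(3) by simp
qed

section \<open>The dual norm and Wulff balls\<close>

lemma bdd_above_dual: "bdd_above ((\<lambda>z. (x \<bullet> z) / F z) ` sphere 0 1)"
  and dual_attained: "\<exists>z\<in>sphere 0 1. dual_norm F x = (x \<bullet> z) / F z"
proof -
  have "continuous_on (sphere 0 1) (\<lambda>z. (x \<bullet> z) / F z)"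
    by (intro continuous_intros continuous_on_subset[OF continuous_on_F] ballI less_imp_neq[OF F_pos, symmetric]) auto
  moreover have "sphere (0::'a) 1 \<noteq> {}" by simp
  ultimately obtain z where z: "z \<in> sphere 0 1" "\<forall>y\<in>sphere 0 1. (x \<bullet> y) / F y \<le> (x \<bullet> z) / F z"
    using continuous_attains_sup[of "sphere 0 1"] by (metis (no_types, lifting) compact_sphere)
  then show "bdd_above ((\<lambda>z. (x \<bullet> z) / F z) ` sphere 0 1)" by (auto intro!: bdd_aboveI2)
  have "dual_norm F x = (x \<bullet> z) / F z"
    unfolding dual_norm_def using z by (intro cSup_eq_maximum) auto
  then show "\<exists>z\<in>sphere 0 1. dual_norm F x = (x \<bullet> z) / F z" using z by blast
qed

lemma dual_norm_le_iff: "dual_norm F x \<le> r \<longleftrightarrow> (\<forall>z\<in>sphere 0 1. x \<bullet> z \<le> r * F z)"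
proof -
  have "(x \<bullet> z) / F z \<le> dual_norm F x" if "z \<in> sphere 0 1" for z
    unfolding dual_norm_def using that by (intro cSUP_upper bdd_above_dual)
  moreover have "F z > 0" if "z \<in> sphere 0 1" for z using that by (intro F_pos) auto
  ultimately show ?thesis using dual_attained[of x]
    by (smt (verit, best) pos_divide_le_eq)
qed

lemma dual_norm_less_iff: "dual_norm F x < r \<longleftrightarrow> (\<forall>z\<in>sphere 0 1. x \<bullet> z < r * F z)"
proof -
  have "(x \<bullet> z) / F z \<le> dual_norm F x" if "z \<in> sphere 0 1" for z
    unfolding dual_norm_def using that by (intro cSUP_upper bdd_above_dual)
  moreover have "F z > 0" if "z \<in> sphere 0 1" for z using that by (intro F_pos) auto
  ultimately show ?thesis using dual_attained[of x]
    by (smt (verit, best) pos_divide_less_eq)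
qed

lemma inner_le_dual_norm: "x \<bullet> y \<le> dual_norm F x * F y"
proof (cases "y = 0")
  case False
  then have "y /\<^sub>R norm y \<in> sphere 0 1" by (simp add: dist_norm)
  then have "x \<bullet> (y /\<^sub>R norm y) \<le> dual_norm F x * F (y /\<^sub>R norm y)"
    using dual_norm_le_iff[of x "dual_norm F x"] by blast
  then show ?thesis using False F_homogeneous[OF False] by (simp add: field_simps)
qed auto

lemma dual_norm_scale: "t > 0 \<Longrightarrow> dual_norm F (t *\<^sub>R x) = t * dual_norm F x"
proof -
  assume t: "t > 0"
  have le: "dual_norm F (t *\<^sub>R x) \<le> t * dual_norm F x" if "t > 0" for t x
    unfolding dual_norm_le_iff using inner_le_dual_norm that by (simp add: mult.assoc mult_left_mono)
  from le[OF t, of x] le[of "1 / t" "t *\<^sub>R x"] t show ?thesis by (simp add: field_simps)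
qed

lemma dual_norm_triangle: "dual_norm F (x + y) \<le> dual_norm F x + dual_norm F y"
  unfolding dual_norm_le_iff using inner_le_dual_norm by (simp add: inner_add_left algebra_simps add_mono)

lemma dual_norm_pos: "x \<noteq> 0 \<Longrightarrow> dual_norm F x > 0"
  using inner_le_dual_norm[of x x] F_pos[of x] by (smt (verit) inner_gt_zero_iff zero_less_mult_iff)

lemma dual_norm_0 [simp]: "dual_norm F 0 = 0"
  using dual_attained[of 0] by auto

lemma continuous_on_dual_norm: "continuous_on UNIV (dual_norm F)"
proof (rule convex_on_continuous)
  show "convex_on UNIV (dual_norm F)"
  proof (rule convex_onI)
    fix t :: real and x y assume t: "0 < t" "t < 1"
    have "dual_norm F ((1 - t) *\<^sub>R x + t *\<^sub>R y) \<le> dual_norm F ((1 - t) *\<^sub>R x) + dual_norm F (t *\<^sub>R y)"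
      by (rule dual_norm_triangle)
    then show "dual_norm F ((1 - t) *\<^sub>R x + t *\<^sub>R y) \<le> (1 - t) * dual_norm F x + t * dual_norm F y"
      using t by (simp add: dual_norm_scale)
  qed auto
qed auto

text \<open>If z attains the supremum, r F - \<langle>x, _\<rangle> has a minimum at z, so its
  gradient r \<Phi> z - x vanishes. This parametrises the Wulff shape by its normals.\<close>

lemma dual_norm_eq_iff:
  assumes "r > 0"
  shows "dual_norm F x = r \<longleftrightarrow> (\<exists>z\<in>sphere 0 1. x = r *\<^sub>R \<Phi> z)"
proof
  assume eq: "dual_norm F x = r"
  obtain z where z: "z \<in> sphere 0 1" "dual_norm F x = (x \<bullet> z) / F z" using dual_attained by blast
  have z0: "z \<noteq> 0" using z by auto
  have xz: "x \<bullet> z = r * F z" using z eq F_pos[OF z0] by (simp add: field_simps)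
  have d: "((\<lambda>y. r * F y - x \<bullet> y) has_derivative (\<lambda>v. r * (\<Phi> z \<bullet> v) - x \<bullet> v)) (at z)"
    by (intro has_derivative_diff has_derivative_mult_right F_has_derivative has_derivative_inner_right has_derivative_ident z0)
  have "(\<lambda>v. r * (\<Phi> z \<bullet> v) - x \<bullet> v) = (\<lambda>v. 0)"
    by (rule differential_zero_maxmin[OF _ _ d, of UNIV]) (use xz inner_le_dual_norm[of x] eq in auto)
  then have "(r *\<^sub>R \<Phi> z) \<bullet> v = x \<bullet> v" for v by (auto dest!: fun_cong[of _ _ v])
  then have "x = r *\<^sub>R \<Phi> z" by (metis vector_eq_rdot)
  then show "\<exists>z\<in>sphere 0 1. x = r *\<^sub>R \<Phi> z" using z by blast
next
  assume "\<exists>z\<in>sphere 0 1. x = r *\<^sub>R \<Phi> z"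
  then obtain z where z: "z \<in> sphere 0 1" "x = r *\<^sub>R \<Phi> z" by blast
  have z0: "z \<noteq> 0" using z by auto
  have "dual_norm F x \<le> r" unfolding dual_norm_le_iff z(2) using Phi_le[OF z0] assms by simp
  moreover have "r * F z \<le> dual_norm F x * F z"
    using inner_le_dual_norm[of x z] z Phi_Euler[OF z0] by simp
  ultimately show "dual_norm F x = r" using F_pos[OF z0] by simp
qed

lemma frontier_wulff_ball:
  assumes "r > 0"
  shows "frontier (wulff_ball F r c) = {x. dual_norm F (x - c) = r}"
proof -
  have cont: "continuous_on UNIV (\<lambda>x. dual_norm F (x - c))"
    by (rule continuous_on_compose2[OF continuous_on_dual_norm]) (auto intro!: continuous_intros)
  have op: "open (wulff_ball F r c)"
    unfolding wulff_ball_def by (intro open_Collect_less cont continuous_intros)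
  have cl: "closed {x. dual_norm F (x - c) \<le> r}"
    by (intro closed_Collect_le cont continuous_intros)
  have "closure (wulff_ball F r c) = {x. dual_norm F (x - c) \<le> r}"
  proof
    show "closure (wulff_ball F r c) \<subseteq> {x. dual_norm F (x - c) \<le> r}"
      by (rule closure_minimal[OF _ cl]) (auto simp: wulff_ball_def)
    show "{x. dual_norm F (x - c) \<le> r} \<subseteq> closure (wulff_ball F r c)"
    proof
      fix x assume x: "x \<in> {x. dual_norm F (x - c) \<le> r}"
      \<comment> \<open>Points pulled towards the centre. The offset 2 keeps the factor positive
        also at index 0, as \<open>dual_norm_scale\<close> requires.\<close>
      let ?s = "\<lambda>n. c + (1 - 1 / real (n + 2)) *\<^sub>R (x - c)"
      have "?s n \<in> wulff_ball F r c" for n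
      proof -
        have "dual_norm F ((1 - 1 / real (n + 2)) *\<^sub>R (x - c)) = (1 - 1 / real (n + 2)) * dual_norm F (x - c)"
          by (intro dual_norm_scale) (simp add: field_simps)
        also have "\<dots> < r"
        proof (cases "dual_norm F (x - c) > 0")
          case True
          then have "(1 - 1 / real (n + 2)) * dual_norm F (x - c) < 1 * dual_norm F (x - c)"
            by (intro mult_strict_right_mono) (auto simp: field_simps)
          then show ?thesis using x by simp
        next
          case False
          then have "x - c = 0" using dual_norm_pos by blast
          then show ?thesis using assms by simp
        qed
        finally show ?thesis by (simp add: wulff_ball_def)
      qed
      moreover have "?s \<longlonglongrightarrow> c + (1 - 0) *\<^sub>R (x - c)"
        by (intro tendsto_intros LIMSEQ_ignore_initial_segment lim_1_over_n)
      ultimately show "x \<in> closure (wulff_ball F r c)"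
        unfolding closure_sequential by (intro exI[of _ ?s]) auto
    qed
  qed
  then show ?thesis using op by (auto simp: frontier_def interior_open wulff_ball_def)
qed

lemma frontier_wulff_ball_Phi:
  assumes "r > 0"
  shows "frontier (wulff_ball F r c) = (\<lambda>z. c + r *\<^sub>R \<Phi> z) ` sphere 0 1"
proof -
  have "x \<in> frontier (wulff_ball F r c) \<longleftrightarrow> (\<exists>z\<in>sphere 0 1. x - c = r *\<^sub>R \<Phi> z)" for x
    using frontier_wulff_ball[OF assms, of c] dual_norm_eq_iff[OF assms, of "x - c"] by simp
  then show ?thesis by (auto simp: algebra_simps)
qed

lemma wulff_ball_iff: "x \<in> wulff_ball F r c \<longleftrightarrow> (\<forall>z\<in>sphere 0 1. (x - c) \<bullet> z < r * F z)"
  by (simp add: wulff_ball_def dual_norm_less_iff)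

end

section \<open>The truncated Wulff ball as a cone over normals\<close>

locale capillary = minkowski F for F :: "'n::finite ambient \<Rightarrow> real" +
  fixes \<omega>0 :: real
  assumes \<omega>0: "- F E_last < \<omega>0" "\<omega>0 < F (- E_last)"
begin

abbreviation "E \<equiv> (E_last :: 'n ambient)"

text \<open>Centre of the truncated Wulff ball. All three cases of \<open>E_F\<close> have height 1,
  and they keep the origin inside the ball.\<close>

definition shift :: "'n ambient" where "shift = \<omega>0 *\<^sub>R E_F F \<omega>0"

text \<open>The condition says that \<Phi> z + \<open>shift\<close> has positive height: these are
  the normals of the truncated Wulff shape strictly above the plane.\<close>

definition cap :: "'n ambient set" where "cap = {z. norm z = 1 \<and> \<Phi> z \<bullet> (- E) < \<omega>0}"

lemma norm_E [simp]: "norm E = 1" and E_E [simp]: "E \<bullet> E = 1" and E_nz [simp]: "E \<noteq> 0"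
  by (simp_all add: E_last_def norm_Pair zero_prod_def)

lemma shift_E: "shift \<bullet> E = \<omega>0"
proof -
  have "E_F F \<omega>0 \<bullet> E = 1"
    using Phi_Euler[of "- E"] Phi_Euler[of E] F_pos[of "- E"] F_pos[of E] by (auto simp: E_F_def field_simps)
  then show ?thesis by (simp add: shift_def)
qed

text \<open>Equivalent to the origin lying strictly inside the Wulff ball about
  \<open>shift\<close>. For \<omega>0 \<noteq> 0 the shift is -c \<Phi> y with y one of E, -E and c
  = \<bar>\<omega>0\<bar> / F y; the admissible range of \<omega>0 says c < 1.\<close>

lemma F_shift_pos: "F z + shift \<bullet> z > 0" if "z \<noteq> 0"
proof -
  note Fz = F_pos[OF that]
  have key: "F z - c * (\<Phi> y \<bullet> z) > 0" if "y \<noteq> 0" "0 \<le> c" "c < 1" for c y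
  proof -
    have "c * (\<Phi> y \<bullet> z) \<le> c * F z" using Phi_le[OF that(1)] that by (intro mult_left_mono) auto
    also have "\<dots> < F z" using that Fz by simp
    finally show ?thesis by simp
  qed
  consider "\<omega>0 > 0" | "\<omega>0 < 0" | "\<omega>0 = 0" by linarith
  then show ?thesis
  proof cases
    case 1
    then show ?thesis using key[of "- E" "\<omega>0 / F (- E)"] \<omega>0 F_pos[of "- E"]
      by (simp add: shift_def E_F_def field_simps)
  next
    case 2
    then show ?thesis using key[of "E" "- \<omega>0 / F E"] \<omega>0 F_pos[of "E"]
      by (simp add: shift_def E_F_def field_simps)
  next
    case 3
    have "shift = 0" unfolding shift_def using 3 by simp
    then show ?thesis using Fz by simp
  qed
qed

lemma cap_cone_in_truncated:
  assumes "z \<in> cap" "0 < t" "t < 1"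
  shows "t *\<^sub>R (\<Phi> z + shift) \<in> truncated_wulff_ball F \<omega>0"
proof -
  have z0: "z \<noteq> 0" using assms by (auto simp: cap_def)
  have "(t *\<^sub>R (\<Phi> z + shift) - shift) \<bullet> w < 1 * F w" if "w \<in> sphere 0 1" for w
  proof -
    have w0: "w \<noteq> 0" using that by auto
    have "0 < (1 - t) * (F w + shift \<bullet> w)" using F_shift_pos[OF w0] assms by simp
    moreover have "t * (\<Phi> z \<bullet> w) \<le> t * F w" using Phi_le[OF z0] assms by simp
    ultimately show ?thesis by (simp add: inner_diff_left inner_add_left algebra_simps)
  qed
  moreover have "t *\<^sub>R (\<Phi> z + shift) \<bullet> E > 0"
    using assms shift_E by (simp add: cap_def inner_add_left)
  ultimately show ?thesis
    by (simp add: truncated_wulff_ball_def wulff_ball_iff open_half_space_def flip: shift_def)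
qed

text \<open>Prolonging the ray from the origin through x until it leaves the ball gives \<Phi> z +
  \<open>shift\<close>; its height is a positive multiple of that of x, so z lies in
  \<open>cap\<close>.\<close>

lemma truncated_subset_cap_cone:
  assumes "x \<in> truncated_wulff_ball F \<omega>0"
  shows "\<exists>z\<in>cap. \<exists>t. 0 < t \<and> t < 1 \<and> x = t *\<^sub>R (\<Phi> z + shift)"
proof -
  have x: "dual_norm F (x - shift) < 1" "x \<bullet> E > 0"
    using assms by (auto simp: truncated_wulff_ball_def wulff_ball_def open_half_space_def shift_def)
  have x0: "x \<noteq> 0" using x by auto
  let ?h = "\<lambda>s :: real. dual_norm F (s *\<^sub>R x - shift)"
  have cont: "continuous_on UNIV ?h"
    by (rule continuous_on_compose2[OF continuous_on_dual_norm]) (auto intro!: continuous_intros)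
  \<comment> \<open>Far enough for the pairing of \<open>S *\<^sub>R x - shift\<close> with x to
    reach F x, so that the dual norm there is at least 1; the maximum with 1 orders the interval for
    the intermediate value theorem.\<close>
  define S where "S = max 1 ((F x + shift \<bullet> x) / (x \<bullet> x))"
  have "?h S \<ge> 1"
  proof (rule ccontr)
    assume "\<not> ?h S \<ge> 1"
    then have "(S *\<^sub>R x - shift) \<bullet> x < F x"
      using inner_le_dual_norm[of "S *\<^sub>R x - shift" x] F_pos[OF x0] by (smt (verit) mult_less_cancel_right2)
    moreover have "(F x + shift \<bullet> x) / (x \<bullet> x) * (x \<bullet> x) \<le> S * (x \<bullet> x)"
      by (intro mult_right_mono) (auto simp: S_def)
    ultimately show False using x0 by (simp add: inner_diff_left)
  qed
  then obtain s where s: "1 \<le> s" "?h s = 1"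
    using IVT'[of ?h 1 1 S] x(1) continuous_on_subset[OF cont] by (auto simp: S_def)
  then obtain z where z: "z \<in> sphere 0 1" "s *\<^sub>R x - shift = 1 *\<^sub>R \<Phi> z"
    using dual_norm_eq_iff[of 1] by auto
  have "s \<noteq> 1" using s x by auto
  have eq: "s *\<^sub>R x = \<Phi> z + shift" using z by (simp add: algebra_simps)
  have "\<Phi> z \<bullet> E + \<omega>0 = s * (x \<bullet> E)"
    using arg_cong[OF eq, of "\<lambda>v. v \<bullet> E"] by (simp add: inner_add_left shift_E)
  moreover have "s * (x \<bullet> E) > 0" using s x by simp
  ultimately have "z \<in> cap" using z by (simp add: cap_def)
  moreover have "x = (1 / s) *\<^sub>R (\<Phi> z + shift)" using s by (simp flip: eq)
  ultimately show ?thesis using s \<open>s \<noteq> 1\<close> by (intro bexI[of _ z] exI[of _ "1 / s"]) auto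
qed

text \<open>The point \<Phi> z + \<open>shift\<close> stays below the supporting plane with normal
  z', and this plane has positive distance from the origin by \<open>F_shift_pos\<close>; hence a
  smaller factor cannot reach the same point.\<close>

lemma cap_cone_inj:
  assumes "norm z = 1" "norm z' = 1" "0 < t" "0 < t'" and eq: "t *\<^sub>R (\<Phi> z + shift) = t' *\<^sub>R (\<Phi> z' + shift)"
  shows "t = t' \<and> z = z'"
proof -
  have *: "\<not> t < t'" if "norm z = 1" "norm z' = 1" "0 < t" "0 < t'" and eq: "t *\<^sub>R (\<Phi> z + shift) = t' *\<^sub>R (\<Phi> z' + shift)"
    for t t' z z'
  proof
    assume "t < t'"
    have z0: "z \<noteq> 0" "z' \<noteq> 0" using that by auto
    have "t * (\<Phi> z \<bullet> z' + shift \<bullet> z') = t' * (F z' + shift \<bullet> z')"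
      using arg_cong[OF eq, of "\<lambda>v. v \<bullet> z'"] by (simp add: inner_add_left Phi_Euler[OF z0(2)])
    moreover have "t * (\<Phi> z \<bullet> z' + shift \<bullet> z') \<le> t * (F z' + shift \<bullet> z')"
      using Phi_le[OF z0(1), of z'] that by simp
    ultimately show False using F_shift_pos[OF z0(2)] \<open>t < t'\<close> by simp
  qed
  have "t = t'" using *[of z z' t t'] *[of z' z t' t] assms by (metis linorder_cases)
  then have "\<Phi> z = \<Phi> z'" using eq assms by simp
  then show ?thesis using \<open>t = t'\<close> Phi_inj assms by blast
qed

end

section \<open>Adapted charts and tangent spaces\<close>

text \<open>At a boundary point of a hypersurface only one of v and -v need be the velocity of a
  curve in it, so membership is required for small positive t only. The curve is differentiable from
  both sides, as it comes from a chart of the ambient space.\<close>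

definition right_curve :: "'a::real_normed_vector set \<Rightarrow> 'a \<Rightarrow> 'a \<Rightarrow> bool" where
  "right_curve S p v \<longleftrightarrow>
     (\<exists>\<gamma>. \<gamma> 0 = p \<and> (\<gamma> has_vector_derivative v) (at 0) \<and> (\<forall>\<^sub>F t in at_right (0::real). \<gamma> t \<in> S))"

lemma right_curve_real_le:
  fixes f :: "'a::real_normed_vector \<Rightarrow> real"
  assumes "right_curve S p v" "(f has_derivative f') (at p)" "\<forall>\<^sub>F x in nhds p. x \<in> S \<longrightarrow> f x \<ge> f p"
  shows "f' v \<ge> 0"
proof (rule ccontr)
  assume "\<not> ?thesis"
  then have neg: "f' v < 0" by simp
  obtain \<gamma> where \<gamma>: "\<gamma> 0 = p" "(\<gamma> has_vector_derivative v) (at 0)" "\<forall>\<^sub>F t in at_right (0::real). \<gamma> t \<in> S"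
    using assms(1) unfolding right_curve_def by blast
  have "((f \<circ> \<gamma>) has_vector_derivative (f' v)) (at 0)"
    using vector_derivative_diff_chain_within[of \<gamma> v 0 UNIV f f'] \<gamma>(1,2) assms(2) has_derivative_at_withinI by blast
  then have "DERIV (f \<circ> \<gamma>) 0 :> f' v" by (simp add: has_real_derivative_iff_has_vector_derivative)
  then obtain d where d: "d > 0" "\<And>h. 0 < h \<Longrightarrow> h < d \<Longrightarrow> (f \<circ> \<gamma>) (0 + h) < (f \<circ> \<gamma>) 0"
    using DERIV_neg_dec_right[OF _ neg] by blast
  have "isCont \<gamma> 0" using \<gamma>(2) by (simp add: has_vector_derivative_continuous)
  then have "\<forall>\<^sub>F t in at_right 0. \<gamma> t \<in> S \<longrightarrow> f (\<gamma> t) \<ge> f p"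
  proof -
    have "filterlim \<gamma> (nhds p) (at_right 0)"
      using \<open>isCont \<gamma> 0\<close> \<gamma>(1) by (simp add: isCont_def filterlim_at_split)
    then show ?thesis using eventually_compose_filterlim[OF assms(3)] by blast
  qed
  moreover have "\<forall>\<^sub>F t in at_right 0. 0 < t \<and> t < d"
    unfolding eventually_at_right_field using d(1) by blast
  ultimately have "\<forall>\<^sub>F t in at_right (0::real). False"
    using \<gamma>(3) by eventually_elim (use d(2) \<gamma>(1) in force)
  then show False by simp
qed

lemma dim_hyperplane:
  "norm \<nu> = 1 \<Longrightarrow> dim {v. v \<bullet> \<nu> = 0} = CARD('n)" for \<nu> :: "'n::finite ambient"
proof -
  assume "norm \<nu> = 1"
  then have "\<nu> \<noteq> 0" by auto
  then have "dim {v. \<nu> \<bullet> v = 0} = DIM('n ambient) - 1" by (rule dim_hyperplane)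
  then show ?thesis by (simp add: inner_commute)
qed

lemma subspace_perp: "subspace {v. v \<bullet> \<nu> = 0}"
  by (auto simp: subspace_def inner_add_left)

lemma model_half_eq_iff [simp]: "model_half i = model_half j \<longleftrightarrow> i = j"
proof
  assume eq: "model_half i = model_half j"
  show "i = j"
  proof (rule ccontr)
    assume "i \<noteq> j"
    moreover have "- axis j 1 \<in> model_half i \<longleftrightarrow> - axis j (1::real) \<in> model_half j" using eq by simp
    ultimately show False by (simp add: model_half_def axis_def)
  qed
qed simp

lemma model_half_neq_UNIV [simp]: "model_half i \<noteq> UNIV"
proof
  assume "model_half i = UNIV"
  then have "- axis i (1::real) \<in> model_half i" by simp
  then show False by (simp add: model_half_def axis_def)
qed

locale chart =
  fixes S :: "'n::finite ambient set" and W U V \<psi> g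
  assumes chart: "adapted_chart S W U V \<psi> g"
begin

abbreviation "\<psi>' x \<equiv> frechet_derivative \<psi> (at x)"
abbreviation "g' y \<equiv> frechet_derivative g (at y)"

lemma W_cases: obtains "W = UNIV" | i where "W = model_half i"
  using chart by (auto simp: adapted_chart_def models_def)

lemma open_U: "open U" and open_V: "open V" and C2_\<psi>: "C_k_on 2 U \<psi>" and C2_g: "C_k_on 2 V g"
  and image: "\<psi> ` (S \<inter> U) = V \<inter> (W \<times> {0})" and homeo: "homeomorphism U V \<psi> g"
  using chart by (auto simp: adapted_chart_def)

lemma g_\<psi> [simp]: "x \<in> U \<Longrightarrow> g (\<psi> x) = x" and \<psi>_g [simp]: "y \<in> V \<Longrightarrow> \<psi> (g y) = y"
  and \<psi>_in: "x \<in> U \<Longrightarrow> \<psi> x \<in> V" and g_in: "y \<in> V \<Longrightarrow> g y \<in> U"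
  using homeo by (auto simp: homeomorphism_def)

lemma cont_\<psi>: "continuous_on U \<psi>"
  using homeo by (simp add: homeomorphism_def)

lemma in_S_iff: "x \<in> U \<Longrightarrow> x \<in> S \<longleftrightarrow> fst (\<psi> x) \<in> W \<and> snd (\<psi> x) = 0"
proof
  assume "x \<in> U" "x \<in> S"
  then have "\<psi> x \<in> \<psi> ` (S \<inter> U)" by blast
  then show "fst (\<psi> x) \<in> W \<and> snd (\<psi> x) = 0" unfolding image by (auto simp: mem_Times_iff)
next
  assume x: "x \<in> U" "fst (\<psi> x) \<in> W \<and> snd (\<psi> x) = 0"
  then have "\<psi> x \<in> \<psi> ` (S \<inter> U)" unfolding image using \<psi>_in by (auto simp: mem_Times_iff)
  then obtain y where "y \<in> S" "y \<in> U" "\<psi> x = \<psi> y" by blast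
  then show "x \<in> S" using x g_\<psi> by metis
qed

lemma g_in_S_iff: "(w, s) \<in> V \<Longrightarrow> g (w, s) \<in> S \<longleftrightarrow> w \<in> W \<and> s = 0"
  using in_S_iff[of "g (w, s)"] g_in by simp

lemma der_\<psi>: "x \<in> U \<Longrightarrow> (\<psi> has_derivative \<psi>' x) (at x)"
  using C2_derivative[OF C2_\<psi>] .

lemma der_g: "y \<in> V \<Longrightarrow> (g has_derivative g' y) (at y)"
  using C2_derivative[OF C2_g] .

lemma g'_\<psi>': "x \<in> U \<Longrightarrow> g' (\<psi> x) (\<psi>' x v) = v"
proof -
  assume x: "x \<in> U"
  have "((\<lambda>x. g (\<psi> x)) has_derivative (\<lambda>v. g' (\<psi> x) (\<psi>' x v))) (at x)"
    by (rule has_derivative_compose[OF der_\<psi>[OF x] der_g[OF \<psi>_in[OF x]]])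
  moreover have "((\<lambda>x. g (\<psi> x)) has_derivative (\<lambda>v. v)) (at x)"
    by (rule has_derivative_transform_within_open[OF _ open_U x]) (auto intro: has_derivative_ident)
  ultimately show ?thesis by (metis has_derivative_unique)
qed

lemma \<psi>'_g': "x \<in> U \<Longrightarrow> \<psi>' x (g' (\<psi> x) v) = v"
proof -
  assume x: "x \<in> U"
  have "((\<lambda>y. \<psi> (g y)) has_derivative (\<lambda>v. \<psi>' (g (\<psi> x)) (g' (\<psi> x) v))) (at (\<psi> x))"
    by (rule has_derivative_compose[OF der_g]) (use x \<psi>_in der_\<psi> in auto)
  moreover have "((\<lambda>y. \<psi> (g y)) has_derivative (\<lambda>v. v)) (at (\<psi> x))"
    by (rule has_derivative_transform_within_open[OF _ open_V \<psi>_in[OF x]]) (auto intro: has_derivative_ident)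
  ultimately show ?thesis using x by (metis g_\<psi> has_derivative_unique)
qed

lemma linear_\<psi>': "x \<in> U \<Longrightarrow> linear (\<psi>' x)" and linear_g': "y \<in> V \<Longrightarrow> linear (g' y)"
  using der_\<psi> der_g has_derivative_linear by blast+

definition "Tan x = {v. snd (\<psi>' x v) = 0}"

lemma Tan_iff: "x \<in> U \<Longrightarrow> v \<in> Tan x \<longleftrightarrow> (\<exists>w. v = g' (\<psi> x) (w, 0))"
proof
  assume x: "x \<in> U" "v \<in> Tan x"
  then have "\<psi>' x v = (fst (\<psi>' x v), 0)" by (simp add: Tan_def prod_eq_iff)
  then show "\<exists>w. v = g' (\<psi> x) (w, 0)" using g'_\<psi>'[OF x(1), of v] by metis
qed (auto simp: Tan_def \<psi>'_g')

lemma dim_Tan: "x \<in> U \<Longrightarrow> dim (Tan x) = CARD('n)"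
proof -
  assume x: "x \<in> U"
  have lin: "linear (\<lambda>w. g' (\<psi> x) (w, 0))"
  proof -
    have "linear (\<lambda>w :: real ^ 'n. (w, 0 :: real))" by (intro linearI) auto
    from linear_compose[OF this linear_g'[OF \<psi>_in[OF x]]] show ?thesis by (simp add: o_def)
  qed
  have "inj (\<lambda>w. g' (\<psi> x) (w, 0))" using \<psi>'_g'[OF x] by (metis (no_types, lifting) injI prod.inject)
  then have "dim (range (\<lambda>w. g' (\<psi> x) (w, 0))) = dim (UNIV :: (real ^ 'n) set)"
    using dim_image_eq[OF lin, of UNIV] by simp
  moreover have "Tan x = range (\<lambda>w. g' (\<psi> x) (w, 0))" using Tan_iff[OF x] by auto
  ultimately show ?thesis by simp
qed

lemma subspace_Tan: "x \<in> U \<Longrightarrow> subspace (Tan x)"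
  using linear_\<psi>'[of x] by (auto simp: subspace_def Tan_def linear_0 linear_add linear_scale)

lemma line_has_derivative:
  assumes "y + t *\<^sub>R (w, 0) \<in> V"
  shows "((\<lambda>t. g (y + t *\<^sub>R (w, 0))) has_vector_derivative g' (y + t *\<^sub>R (w, 0)) (w, 0)) (at t)"
proof -
  have "((\<lambda>t. y + t *\<^sub>R (w, 0)) has_derivative (\<lambda>d. d *\<^sub>R (w, 0))) (at t)" by (auto intro!: derivative_eq_intros)
  from has_derivative_compose[OF this der_g[OF assms]]
  show ?thesis by (simp add: has_vector_derivative_def linear_scale[OF linear_g'[OF assms]] del: scaleR_Pair)
qed

lemma eventually_line_in_V:
  assumes "y \<in> V" shows "\<exists>e>0. \<forall>t. \<bar>t\<bar> < e \<longrightarrow> y + t *\<^sub>R w \<in> V"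
proof -
  obtain r where r: "r > 0" "ball y r \<subseteq> V" using open_V assms openE by blast
  have "y + t *\<^sub>R w \<in> V" if t: "\<bar>t\<bar> < r / (norm w + 1)" for t
  proof -
    have "norm (t *\<^sub>R w) \<le> \<bar>t\<bar> * (norm w + 1)" by (simp add: mult_left_mono)
    also have "\<dots> < r" using t by (simp add: pos_less_divide_eq add_nonneg_pos)
    finally show ?thesis using r by (auto simp: dist_norm)
  qed
  moreover have "r / (norm w + 1) > 0" using r by (simp add: add_nonneg_pos)
  ultimately show ?thesis by blast
qed

definition "interior_param w \<longleftrightarrow> W = UNIV \<or> (\<exists>i. W = model_half i \<and> w $ i > 0)"

lemma right_curve_line:
  assumes p: "p \<in> S" "p \<in> U" and w: "interior_param (fst (\<psi> p)) \<or> (\<forall>i. W = model_half i \<longrightarrow> w $ i \<ge> 0)"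
  shows "right_curve S p (g' (\<psi> p) (w, 0))"
proof -
  let ?\<gamma> = "\<lambda>t. g (\<psi> p + t *\<^sub>R (w, 0))"
  have pV: "\<psi> p \<in> V" using p \<psi>_in by blast
  have p0: "fst (\<psi> p) \<in> W" "snd (\<psi> p) = 0" using in_S_iff p by auto
  obtain e where e: "e > 0" "\<And>t. \<bar>t\<bar> < e \<Longrightarrow> \<psi> p + t *\<^sub>R (w, 0) \<in> V"
    using eventually_line_in_V[OF pV, of "(w, 0)"] by blast
  have "\<exists>d>0. \<forall>t. 0 < t \<longrightarrow> t < d \<longrightarrow> fst (\<psi> p) + t *\<^sub>R w \<in> W"
  proof (cases rule: W_cases)
    case 1 then show ?thesis by (auto intro: exI[of _ 1])
  next
    case (2 i)
    show ?thesis
    proof (cases "w $ i \<ge> 0")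
      case True
      then show ?thesis using p0 2 by (auto simp: model_half_def intro!: exI[of _ 1])
    next
      case False
      then have pos: "fst (\<psi> p) $ i > 0"
        using w 2 unfolding interior_param_def by auto
      then show ?thesis using False 2
        by (intro exI[of _ "fst (\<psi> p) $ i / (- w $ i)"]) (auto simp: model_half_def field_simps zero_less_divide_iff)
    qed
  qed
  then obtain d where d: "d > 0" "\<And>t. 0 < t \<Longrightarrow> t < d \<Longrightarrow> fst (\<psi> p) + t *\<^sub>R w \<in> W" by blast
  have "?\<gamma> t \<in> S" if "0 < t" "t < min d e" for t
    using g_in_S_iff[of "fst (\<psi> p) + t *\<^sub>R w" 0] e(2)[of t] d(2)[of t] that p0 by (simp add: plus_prod_def)
  then have "\<forall>\<^sub>F t in at_right 0. ?\<gamma> t \<in> S"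
    unfolding eventually_at_right_field using d e by (intro exI[of _ "min d e"]) auto
  moreover have "(?\<gamma> has_vector_derivative g' (\<psi> p) (w, 0)) (at 0)"
    using line_has_derivative[of "\<psi> p" 0 w] pV by (simp del: scaleR_Pair)
  ultimately show ?thesis unfolding right_curve_def using p by (intro exI[of _ ?\<gamma>]) (auto simp: zero_prod_def[symmetric])
qed

text \<open>At least one of two opposite coordinate directions points into the model
  half-space.\<close>

lemma right_curve_or:
  assumes p: "p \<in> S" "p \<in> U" and v: "v \<in> Tan p"
  shows "right_curve S p v \<or> right_curve S p (- v)"
proof -
  obtain w where w: "v = g' (\<psi> p) (w, 0)" using Tan_iff p v by blast
  have mw: "- v = g' (\<psi> p) (- w, 0)"
    using linear_neg[OF linear_g'[OF \<psi>_in[OF p(2)]], of "(w, 0)"] by (simp add: w)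
  show ?thesis
  proof (cases rule: W_cases)
    case 1
    then have "interior_param (fst (\<psi> p))" unfolding interior_param_def by blast
    then show ?thesis using right_curve_line[OF p, of w] w by blast
  next
    case (2 i)
    show ?thesis
      using right_curve_line[OF p, of w] right_curve_line[OF p, of "- w"] w mw 2
      by (cases "w $ i \<ge> 0") auto
  qed
qed

text \<open>The last chart coordinate vanishes on S, so it is both minimal and maximal at p along
  the curve; at a boundary parameter the i-th coordinate is minimal.\<close>

lemma right_curve_Tan:
  assumes p: "p \<in> S" "p \<in> U" and v: "right_curve S p v"
  shows "v \<in> Tan p" and "W = model_half i \<Longrightarrow> fst (\<psi> p) $ i = 0 \<Longrightarrow> fst (\<psi>' p v) $ i \<ge> 0"
proof -
  have p0: "snd (\<psi> p) = 0" using in_S_iff p by auto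
  have evU: "\<forall>\<^sub>F x in nhds p. x \<in> U" using open_U p(2) by (simp add: eventually_nhds_in_open)
  note d = der_\<psi>[OF p(2)]
  have d1: "((\<lambda>x. snd (\<psi> x)) has_derivative (\<lambda>v. snd (\<psi>' p v))) (at p)"
    by (rule has_derivative_snd[OF d])
  have "snd (\<psi>' p v) \<ge> 0"
    by (rule right_curve_real_le[OF v d1], rule eventually_mono[OF evU]) (use in_S_iff p0 in auto)
  moreover have "- snd (\<psi>' p v) \<ge> 0"
    by (rule right_curve_real_le[OF v has_derivative_minus[OF d1]], rule eventually_mono[OF evU]) (use in_S_iff p0 in auto)
  ultimately show "v \<in> Tan p" by (simp add: Tan_def)
  assume W: "W = model_half i" "fst (\<psi> p) $ i = 0"
  have d2: "((\<lambda>x. fst (\<psi> x) $ i) has_derivative (\<lambda>v. fst (\<psi>' p v) $ i)) (at p)"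
    by (rule bounded_linear.has_derivative[OF bounded_linear_vec_nth has_derivative_fst[OF d]])
  show "fst (\<psi>' p v) $ i \<ge> 0"
    by (rule right_curve_real_le[OF v d2], rule eventually_mono[OF evU]) (use in_S_iff W in \<open>auto simp: model_half_def\<close>)
qed

text \<open>For the second-order test the velocity at 0 alone is not enough: the derivative is
  needed on an interval, and continuous at 0.\<close>

lemma interior_curve:
  assumes p: "p \<in> S" "p \<in> U" and i: "interior_param (fst (\<psi> p))" and v: "v \<in> Tan p"
  obtains \<gamma> \<gamma>' e where "e > 0" "\<And>t. \<bar>t\<bar> < e \<Longrightarrow> \<gamma> t \<in> S \<and> (\<gamma> has_vector_derivative \<gamma>' t) (at t)"
    "isCont \<gamma>' 0" "\<gamma> (0::real) = p" "\<gamma>' 0 = v"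
proof -
  obtain w where w: "v = g' (\<psi> p) (w, 0)" using Tan_iff p v by blast
  let ?l = "\<lambda>t. \<psi> p + t *\<^sub>R (w, 0)"
  let ?\<gamma> = "\<lambda>t. g (?l t)" and ?\<gamma>' = "\<lambda>t. g' (?l t) (w, 0)"
  have pV: "\<psi> p \<in> V" using p \<psi>_in by blast
  have p0: "fst (\<psi> p) \<in> W" "snd (\<psi> p) = 0" using in_S_iff p by auto
  obtain e where e: "e > 0" "\<And>t. \<bar>t\<bar> < e \<Longrightarrow> ?l t \<in> V"
    using eventually_line_in_V[OF pV, of "(w, 0)"] by blast
  obtain d where d: "d > 0" "\<And>t. \<bar>t\<bar> < d \<Longrightarrow> fst (\<psi> p) + t *\<^sub>R w \<in> W"
  proof (cases "W = UNIV")
    case True then show ?thesis using that[of 1] by auto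
  next
    case False
    then obtain i where i: "W = model_half i" "fst (\<psi> p) $ i > 0" using i by (auto simp: interior_param_def)
    have "fst (\<psi> p) + t *\<^sub>R w \<in> W" if t: "\<bar>t\<bar> < fst (\<psi> p) $ i / (\<bar>w $ i\<bar> + 1)" for t
    proof -
      have "\<bar>t * w $ i\<bar> \<le> \<bar>t\<bar> * (\<bar>w $ i\<bar> + 1)" by (simp add: abs_mult mult_left_mono)
      also have "\<dots> < fst (\<psi> p) $ i" using t by (simp add: pos_less_divide_eq add_nonneg_pos)
      finally show ?thesis by (simp add: i(1) model_half_def)
    qed
    then show ?thesis using that[of "fst (\<psi> p) $ i / (\<bar>w $ i\<bar> + 1)"] i by (simp add: add_nonneg_pos)
  qed
  have "?\<gamma> t \<in> S \<and> (?\<gamma> has_vector_derivative ?\<gamma>' t) (at t)" if "\<bar>t\<bar> < min d e" for t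
    using g_in_S_iff[of "fst (\<psi> p) + t *\<^sub>R w" 0] e(2)[of t] d(2)[of t] that p0 line_has_derivative[of "\<psi> p" t w]
    by (simp add: plus_prod_def)
  moreover have "isCont ?\<gamma>' 0"
  proof -
    have "isCont (\<lambda>y. g' y (w, 0)) (?l 0)"
      using C2_continuous_derivative[OF C2_g, of "(w, 0)"] open_V pV
      by (simp add: continuous_on_eq_continuous_at del: scaleR_Pair)
    moreover have "isCont ?l 0" by (intro continuous_intros)
    ultimately show ?thesis using isCont_o2[of 0 ?l] by blast
  qed
  ultimately show ?thesis
    using that[of "min d e" ?\<gamma> ?\<gamma>'] d e p w by (simp add: zero_prod_def[symmetric])
qed

lemma boundary_or_interior:
  assumes "p \<in> S" "p \<in> U" "p \<notin> hs_boundary S"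
  shows "interior_param (fst (\<psi> p))"
proof (cases rule: W_cases)
  case (2 i)
  have "fst (\<psi> p) \<in> model_half i" using in_S_iff assms 2 by blast
  moreover have "fst (\<psi> p) $ i \<noteq> 0" using assms chart 2 unfolding hs_boundary_def by blast
  ultimately have "fst (\<psi> p) $ i > 0" by (simp add: model_half_def)
  then show ?thesis using 2 unfolding interior_param_def by blast
next
  case 1
  then show ?thesis unfolding interior_param_def by blast
qed

end

text \<open>\<open>tangent_space\<close> is a union over all charts. A vector tangent in one chart
  is, up to sign, the velocity of a curve in S, and such velocities are tangent in every
  chart.\<close>

lemma tangent_space_eq_Tan:
  assumes c: "chart S W U V \<psi> g" and p: "p \<in> S" "p \<in> U"
  shows "tangent_space S p = chart.Tan \<psi> p"
proof -
  interpret chart S W U V \<psi> g by fact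
  have "v \<in> Tan p" if "adapted_chart S W' U' V' \<psi>2 g2" "p \<in> U'" "snd (frechet_derivative \<psi>2 (at p) v) = 0" for v W' U' V' \<psi>2 g2
  proof -
    interpret c2: chart S W' U' V' \<psi>2 g2 by unfold_locales fact
    have "right_curve S p v \<or> right_curve S p (- v)"
      using c2.right_curve_or[OF p(1) that(2)] that(3) unfolding c2.Tan_def by blast
    then have "v \<in> Tan p \<or> - v \<in> Tan p" using right_curve_Tan(1) p by blast
    then show ?thesis using subspace_neg[OF subspace_Tan[OF p(2)]] by (metis minus_minus)
  qed
  moreover have "v \<in> tangent_space S p" if "v \<in> Tan p" for v
    using that chart p unfolding tangent_space_def Tan_def by blast
  ultimately show ?thesis unfolding tangent_space_def by blast
qed

text \<open>In a boundary chart a curve in S cannot leave p through the face of the half-space, so a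
  full set of tangent directions excludes such charts. No chart at p is assumed, which permits the
  application to Wulff shapes given only through \<Phi>.\<close>

lemma not_boundary_if_full_tangent:
  fixes S :: "'n::finite ambient set"
  assumes p: "p \<in> S" and z: "norm z = 1" and full: "\<And>v. v \<bullet> z = 0 \<Longrightarrow> right_curve S p v"
  shows "p \<notin> hs_boundary S" and "tangent_space S p \<subseteq> {v. v \<bullet> z = 0}"
proof -
  have T: "chart.Tan \<psi> p = {v. v \<bullet> z = 0}" if "chart S W U V \<psi> g" "p \<in> U" for W U V \<psi> g
  proof -
    interpret chart S W U V \<psi> g by fact
    have "{v. v \<bullet> z = 0} \<subseteq> Tan p" using right_curve_Tan(1)[OF p that(2) full] by blast
    then have "{v. v \<bullet> z = 0} = Tan p"
      by (rule subspace_dim_equal[OF subspace_perp subspace_Tan[OF that(2)]])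
         (simp add: dim_Tan[OF that(2)] dim_hyperplane[OF z])
    then show ?thesis by simp
  qed
  show "tangent_space S p \<subseteq> {v. v \<bullet> z = 0}"
  proof
    fix v assume "v \<in> tangent_space S p"
    then obtain W U V \<psi> g where c: "adapted_chart S W U V \<psi> g" "p \<in> U" "snd (frechet_derivative \<psi> (at p) v) = 0"
      unfolding tangent_space_def by blast
    interpret chart S W U V \<psi> g by unfold_locales fact
    have "v \<in> Tan p" using c by (simp add: Tan_def)
    then show "v \<in> {v. v \<bullet> z = 0}" using T[OF chart_axioms c(2)] by simp
  qed
  show "p \<notin> hs_boundary S"
  proof
    assume "p \<in> hs_boundary S"
    then obtain i U V \<psi> g where c: "adapted_chart S (model_half i) U V \<psi> g" "p \<in> U" "fst (\<psi> p) $ i = 0"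
      unfolding hs_boundary_def by blast
    interpret chart S "model_half i" U V \<psi> g by unfold_locales fact
    let ?v = "g' (\<psi> p) (- axis i 1, 0)"
    have "?v \<in> Tan p" using Tan_iff c by blast
    then have "right_curve S p ?v" using full T[OF chart_axioms c(2)] by simp
    then have "fst (\<psi>' p ?v) $ i \<ge> 0" using right_curve_Tan(2) p c by blast
    then show False using c by (simp add: \<psi>'_g' axis_def)
  qed
qed

section \<open>Unit normals\<close>

text \<open>\<open>n\<close> extends the unit normal to an open set as the normalised gradient of a local defining
  function \<open>\<rho>\<close>.\<close>

definition normal_ext ::
  "'n::finite ambient set \<Rightarrow> ('n ambient \<Rightarrow> 'n ambient) \<Rightarrow> 'n ambient set \<Rightarrow> ('n ambient \<Rightarrow> 'n ambient) \<Rightarrow>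
   ('n ambient \<Rightarrow> 'n ambient \<Rightarrow> 'n ambient) \<Rightarrow> ('n ambient \<Rightarrow> real) \<Rightarrow> ('n ambient \<Rightarrow> real) \<Rightarrow> bool" where
  "normal_ext S \<nu> B n n' \<rho> a \<longleftrightarrow> open B \<and>
     (\<forall>x\<in>B. norm (n x) = 1 \<and> (n has_derivative n' x) (at x) \<and> a x > 0 \<and>
        (\<rho> has_derivative (\<lambda>v. a x * (n x \<bullet> v))) (at x)) \<and>
     (\<forall>v. continuous_on B (\<lambda>x. n' x v)) \<and>
     (\<forall>x\<in>S \<inter> B. n x = \<nu> x \<and> \<rho> x = 0 \<and> tangent_space S x = {v. v \<bullet> \<nu> x = 0} \<and>
        (\<forall>v w. v \<bullet> \<nu> x = 0 \<longrightarrow> w \<bullet> \<nu> x = 0 \<longrightarrow> n' x v \<bullet> w = n' x w \<bullet> v))"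

locale surface =
  fixes S :: "'n::finite ambient set" and \<nu> :: "'n ambient \<Rightarrow> 'n ambient"
  assumes C2: "C2_hypersurface S" and cont_\<nu>: "continuous_on S \<nu>"
    and norm_\<nu>: "\<And>p. p \<in> S \<Longrightarrow> norm (\<nu> p) = 1"
    and normal_\<nu>: "\<And>p v. p \<in> S \<Longrightarrow> v \<in> tangent_space S p \<Longrightarrow> \<nu> p \<bullet> v = 0"
begin

lemma exists_chart:
  assumes "p \<in> S" obtains W U V \<psi> g where "chart S W U V \<psi> g" "p \<in> U"
  using C2 assms unfolding C2_hypersurface_def chart_def by blast

text \<open>\<rho> is the last chart coordinate up to sign and n its normalised gradient. At each
  point of S near p the normal \<nu> is plus or minus that gradient direction, and continuity makes
  the sign constant. Symmetry of n' on the tangent space is symmetry of the Hessian of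
  \<rho>.\<close>

lemma exists_normal_ext:
  assumes c: "chart S W U V \<psi> g" and p: "p \<in> S" "p \<in> U"
  obtains B n n' \<rho> a where "normal_ext S \<nu> B n n' \<rho> a" "p \<in> B" "B \<subseteq> U"
proof -
  interpret chart S W U V \<psi> g by fact
  have "C_k_on 2 U (\<lambda>x. snd (\<psi> x))"
    by (rule C_k_on_linear_compose[OF bounded_linear_snd open_U C2_\<psi>])
  then obtain G H where GH: "\<And>x. x \<in> U \<Longrightarrow> ((\<lambda>x. snd (\<psi> x)) has_derivative (\<lambda>v. G x \<bullet> v)) (at x)"
    "\<And>x. x \<in> U \<Longrightarrow> (G has_derivative H x) (at x)"
    "\<And>v. continuous_on U (\<lambda>x. H x v)" "\<And>x v w. x \<in> U \<Longrightarrow> H x v \<bullet> w = H x w \<bullet> v"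
    using C2_gradient[OF open_U] by blast
  have Gv: "G x \<bullet> v = snd (\<psi>' x v)" if "x \<in> U" for x v
    using has_derivative_unique[OF GH(1)[OF that] has_derivative_snd[OF der_\<psi>[OF that]]] by metis
  have TanG: "Tan x = {v. G x \<bullet> v = 0}" if "x \<in> U" for x
    using Gv[OF that] by (auto simp: Tan_def)
  have G0: "G x \<noteq> 0" if "x \<in> U" for x
  proof
    assume "G x = 0"
    then have "snd (\<psi>' x (g' (\<psi> x) (0, 1))) = 0" using Gv[OF that] by (metis inner_zero_left)
    then show False using \<psi>'_g'[OF that] by simp
  qed
  define m where "m x = (1 / norm (G x)) *\<^sub>R G x" for x
  have norm_m: "norm (m x) = 1" if "x \<in> U" for x using G0[OF that] by (simp add: m_def)
  define s where "s x = \<nu> x \<bullet> m x" for x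
  have \<nu>m: "\<nu> x = s x *\<^sub>R m x \<and> \<bar>s x\<bar> = 1" if "x \<in> S" "x \<in> U" for x
  proof -
    have mm: "m x \<bullet> m x = 1" using norm_m[OF that(2)] by (simp add: dot_square_norm)
    let ?d = "\<nu> x - s x *\<^sub>R m x"
    have dm: "?d \<bullet> m x = 0" by (simp add: inner_diff_left mm s_def)
    then have "G x \<bullet> ?d = 0" using G0[OF that(2)] by (simp add: m_def inner_commute)
    then have "?d \<in> tangent_space S x"
      using tangent_space_eq_Tan[OF chart_axioms that] TanG[OF that(2)] by simp
    then have "\<nu> x \<bullet> ?d = 0" using normal_\<nu> that by blast
    then have "?d \<bullet> ?d = 0" using dm by (simp add: inner_diff_left inner_commute)
    then have eq: "\<nu> x = s x *\<^sub>R m x" by simp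
    have "\<bar>s x\<bar> = norm (s x *\<^sub>R m x)" using norm_m[OF that(2)] by simp
    also have "\<dots> = 1" using eq norm_\<nu>[OF that(1)] by metis
    finally show ?thesis using eq by blast
  qed
  have cont_G: "continuous_on U G"
    by (intro continuous_at_imp_continuous_on ballI has_derivative_continuous[OF GH(2)])
  have cont_m: "continuous_on U m"
    unfolding m_def using G0 by (intro continuous_intros cont_G) auto
  have "continuous_on (S \<inter> U) s"
    unfolding s_def by (intro continuous_intros continuous_on_subset[OF cont_\<nu>] continuous_on_subset[OF cont_m]) auto
  \<comment> \<open>The factor s has absolute value 1 on the surface, so a variation below 1
    excludes a change of sign.\<close>
  then obtain d where d: "d > 0" "\<And>x. x \<in> S \<inter> U \<Longrightarrow> dist x p < d \<Longrightarrow> dist (s x) (s p) < 1"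
    using p unfolding continuous_on_iff by (metis IntI zero_less_one)
  define B where "B = U \<inter> ball p d"
  define \<sigma> where "\<sigma> = s p"
  have \<sigma>: "\<bar>\<sigma>\<bar> = 1" using \<nu>m[OF p] by (simp add: \<sigma>_def)
  have s\<sigma>: "s x = \<sigma>" if "x \<in> S \<inter> B" for x
    using d(2)[of x] \<nu>m[of x] \<sigma> that by (auto simp: B_def \<sigma>_def dist_real_def dist_commute abs_if split: if_splits)
  define n where "n x = \<sigma> *\<^sub>R m x" for x
  define n' where "n' x v = \<sigma> *\<^sub>R ((1 / norm (G x)) *\<^sub>R H x v - ((m x \<bullet> H x v) / norm (G x)) *\<^sub>R m x)" for x v
  have "normal_ext S \<nu> B n n' (\<lambda>x. \<sigma> * snd (\<psi> x)) (\<lambda>x. norm (G x))"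
    unfolding normal_ext_def
  proof (intro conjI ballI allI impI)
    show "open B" using open_U by (auto simp: B_def)
    fix v
    show "continuous_on B (\<lambda>x. n' x v)"
      unfolding n'_def using G0
      by (intro continuous_intros continuous_on_subset[OF GH(3)] continuous_on_subset[OF cont_G] continuous_on_subset[OF cont_m])
        (auto simp: B_def)
  next
    fix x assume "x \<in> B"
    then have x: "x \<in> U" by (simp add: B_def)
    show "norm (n x) = 1" using \<sigma> norm_m[OF x] by (simp add: n_def)
    show "norm (G x) > 0" using G0[OF x] by simp
    have Gm: "G x = norm (G x) *\<^sub>R m x" using G0[OF x] by (simp add: m_def)
    have "((\<lambda>x. norm (G x)) has_derivative (\<lambda>v. m x \<bullet> H x v)) (at x)"
      using has_derivative_compose[OF GH(2)[OF x] has_derivative_norm[OF G0[OF x]]]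
      by (simp add: m_def sgn_div_norm divide_inverse_commute inner_commute)
    from has_derivative_scaleR[OF has_derivative_divide[OF has_derivative_const[of 1] this] GH(2)[OF x]]
    have "(m has_derivative (\<lambda>v. (1 / norm (G x)) *\<^sub>R H x v + (- 1 * (inverse (norm (G x)) * (m x \<bullet> H x v) * inverse (norm (G x))) + 0 / norm (G x)) *\<^sub>R G x)) (at x)"
      using G0[OF x] by (simp add: m_def[abs_def])
    then have "(n has_derivative (\<lambda>v. \<sigma> *\<^sub>R ((1 / norm (G x)) *\<^sub>R H x v + (- 1 * (inverse (norm (G x)) * (m x \<bullet> H x v) * inverse (norm (G x))) + 0 / norm (G x)) *\<^sub>R G x))) (at x)"
      unfolding n_def by (rule has_derivative_scaleR_right)
    then show "(n has_derivative n' x) (at x)"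
      by (rule has_derivative_eq_rhs) (auto simp: fun_eq_iff n'_def m_def divide_inverse algebra_simps)
    show "((\<lambda>x. \<sigma> * snd (\<psi> x)) has_derivative (\<lambda>v. norm (G x) * (n x \<bullet> v))) (at x)"
      by (rule has_derivative_eq_rhs[OF has_derivative_mult_right[OF GH(1)[OF x]]])
         (use G0[OF x] in \<open>auto simp: n_def m_def\<close>)
  next
    fix x assume xB: "x \<in> S \<inter> B"
    then have x: "x \<in> U" "x \<in> S" by (auto simp: B_def)
    show nx: "n x = \<nu> x" using \<nu>m[OF x(2,1)] s\<sigma>[OF xB] by (simp add: n_def)
    show "\<sigma> * snd (\<psi> x) = 0" using in_S_iff x by simp
    have "G x \<bullet> v = 0 \<longleftrightarrow> v \<bullet> \<nu> x = 0" for v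
      using G0[OF x(1)] \<sigma> by (auto simp: nx[symmetric] n_def m_def inner_commute)
    then show "tangent_space S x = {v. v \<bullet> \<nu> x = 0}"
      using tangent_space_eq_Tan[OF chart_axioms x(2,1)] TanG[OF x(1)] by simp
    fix v w assume vw: "v \<bullet> \<nu> x = 0" "w \<bullet> \<nu> x = 0"
    then have "v \<bullet> m x = 0" "w \<bullet> m x = 0" using \<sigma> by (auto simp: nx[symmetric] n_def)
    then show "n' x v \<bullet> w = n' x w \<bullet> v"
      using GH(4)[OF x(1), of v w] by (simp add: n'_def inner_diff_left inner_commute[of "m x"])
  qed
  moreover have "p \<in> B" "B \<subseteq> U" using p d by (auto simp: B_def)
  ultimately show ?thesis using that by blast
qed

lemma tangent_space_perp: "p \<in> S \<Longrightarrow> tangent_space S p = {v. v \<bullet> \<nu> p = 0}"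
proof -
  assume p: "p \<in> S"
  obtain W U V \<psi> g where c: "chart S W U V \<psi> g" "p \<in> U" using exists_chart p by blast
  obtain B n n' \<rho> a where "normal_ext S \<nu> B n n' \<rho> a" "p \<in> B" using exists_normal_ext[OF c(1) p c(2)] by metis
  then show ?thesis using p unfolding normal_ext_def by blast
qed

lemma right_curve_either: "p \<in> S \<Longrightarrow> v \<bullet> \<nu> p = 0 \<Longrightarrow> right_curve S p v \<or> right_curve S p (- v)"
proof -
  assume p: "p \<in> S" and v: "v \<bullet> \<nu> p = 0"
  obtain W U V \<psi> g where c: "chart S W U V \<psi> g" "p \<in> U" using exists_chart p by blast
  have "v \<in> chart.Tan \<psi> p" using tangent_space_eq_Tan[OF c(1) p c(2)] tangent_space_perp[OF p] v by blast
  then show ?thesis using chart.right_curve_or[OF c(1) p c(2)] by blast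
qed

lemma interior_curve:
  assumes p: "p \<in> S" "p \<notin> hs_boundary S" and v: "v \<bullet> \<nu> p = 0"
  shows "\<exists>\<gamma> \<gamma>' e. e > 0 \<and> (\<forall>t. \<bar>t\<bar> < e \<longrightarrow> \<gamma> t \<in> S \<and> (\<gamma> has_vector_derivative \<gamma>' t) (at t))
    \<and> isCont \<gamma>' 0 \<and> \<gamma> (0::real) = p \<and> \<gamma>' 0 = v"
proof -
  obtain W U V \<psi> g where c: "chart S W U V \<psi> g" "p \<in> U" using exists_chart p by blast
  interpret chart S W U V \<psi> g by fact
  have "v \<in> Tan p" using tangent_space_eq_Tan[OF chart_axioms p(1) c(2)] tangent_space_perp[OF p(1)] v by auto
  then show ?thesis
    by (rule interior_curve[OF p(1) c(2) boundary_or_interior[OF p(1) c(2) p(2)]]) blast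
qed

lemma right_curve_interior:
  assumes p: "p \<in> S" "p \<notin> hs_boundary S" and v: "v \<bullet> \<nu> p = 0"
  shows "right_curve S p v"
proof -
  obtain \<gamma> \<gamma>' e where \<gamma>: "e > 0" "\<And>t. \<bar>t\<bar> < e \<Longrightarrow> \<gamma> t \<in> S \<and> (\<gamma> has_vector_derivative \<gamma>' t) (at t)"
    "isCont \<gamma>' 0" "\<gamma> (0::real) = p" "\<gamma>' 0 = v" using interior_curve[OF p v] by blast
  then have "(\<gamma> has_vector_derivative v) (at 0)" by (metis abs_zero)
  moreover have "\<forall>\<^sub>F t in at_right 0. \<gamma> t \<in> S"
    unfolding eventually_at_right_field using \<gamma> by (intro exI[of _ e]) auto
  ultimately show ?thesis using \<gamma>(4) unfolding right_curve_def by blast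
qed

text \<open>The second-order condition at a constrained maximum of \<open>x \<bullet> u + \<mu> |x|\<^sup>2 / 2\<close>; the case
  \<open>\<mu> = 0\<close> is contact with a hyperplane, \<open>\<mu> = 1\<close> contact with a sphere.\<close>

lemma constrained_max:
  assumes ext: "normal_ext S \<nu> B n n' \<rho> a" and p: "p \<in> S" "p \<in> B" "p \<notin> hs_boundary S"
    and d: "d > 0" "\<And>x. x \<in> S \<Longrightarrow> dist x p < d \<Longrightarrow> x \<bullet> u + \<mu> / 2 * (x \<bullet> x) \<le> p \<bullet> u + \<mu> / 2 * (p \<bullet> p)"
  shows "\<exists>l. u + \<mu> *\<^sub>R p = l *\<^sub>R \<nu> p \<and> (\<forall>v. v \<bullet> \<nu> p = 0 \<longrightarrow> \<mu> * (v \<bullet> v) \<le> l * (n' p v \<bullet> v))"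
proof -
  let ?f = "\<lambda>x. x \<bullet> u + \<mu> / 2 * (x \<bullet> x)"
  have df: "(?f has_derivative (\<lambda>v. v \<bullet> (u + \<mu> *\<^sub>R x))) (at x)" for x
    by (rule derivative_eq_intros refl)+ (simp add: fun_eq_iff inner_add_right inner_commute[of x])
  have le: "v \<bullet> (u + \<mu> *\<^sub>R p) \<le> 0" if "v \<bullet> \<nu> p = 0" for v
  proof -
    have "- (v \<bullet> (u + \<mu> *\<^sub>R p)) \<ge> 0"
    proof (rule right_curve_real_le[OF right_curve_interior[OF p(1,3) that] has_derivative_minus[OF df]])
      show "\<forall>\<^sub>F x in nhds p. x \<in> S \<longrightarrow> - ?f p \<le> - ?f x"
      proof -
        have "- ?f p \<le> - ?f x" if "dist x p < d" "x \<in> S" for x using d(2)[OF that(2,1)] by (rule le_imp_neg_le)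
        then show ?thesis unfolding eventually_nhds_metric using d(1) by blast
      qed
    qed
    then show ?thesis by simp
  qed
  have perp: "v \<bullet> (u + \<mu> *\<^sub>R p) = 0" if "v \<bullet> \<nu> p = 0" for v
    using le[OF that] le[of "- v"] that by simp
  define l where "l = (u + \<mu> *\<^sub>R p) \<bullet> \<nu> p"
  have \<nu>\<nu>: "\<nu> p \<bullet> \<nu> p = 1" using norm_\<nu>[OF p(1)] by (simp add: dot_square_norm)
  have lam: "u + \<mu> *\<^sub>R p = l *\<^sub>R \<nu> p"
  proof -
    let ?v = "u + \<mu> *\<^sub>R p - l *\<^sub>R \<nu> p"
    have v0: "?v \<bullet> \<nu> p = 0" unfolding inner_diff_left l_def by (simp add: \<nu>\<nu>)
    have "?v \<bullet> ?v = 0" using perp[OF v0] v0 by (simp add: inner_diff_right)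
    then show ?thesis by simp
  qed
  have "\<mu> * (v \<bullet> v) \<le> l * (n' p v \<bullet> v)" if v: "v \<bullet> \<nu> p = 0" for v
  proof (rule ccontr)
    assume neg: "\<not> ?thesis"
    obtain \<gamma> \<gamma>' e where \<gamma>: "e > 0" "\<And>t. \<bar>t\<bar> < e \<Longrightarrow> \<gamma> t \<in> S \<and> (\<gamma> has_vector_derivative \<gamma>' t) (at t)"
      "isCont \<gamma>' 0" "\<gamma> (0::real) = p" "\<gamma>' 0 = v" using interior_curve[OF p(1,3) v] by blast
    \<comment> \<open>y vanishes at 0 by the first-order condition, and \<gamma>' is orthogonal to n
      along \<gamma>, so \<langle>\<gamma>', y\<rangle> is the derivative of \<open>?f\<close> along
      \<gamma>. Only continuity of \<gamma>' at 0 is known, hence the limit of \<langle>\<gamma>',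
      y\<rangle> / t takes the place of a second derivative.\<close>
    define y where "y t = u + \<mu> *\<^sub>R \<gamma> t - l *\<^sub>R n (\<gamma> t)" for t
    have \<gamma>d: "(\<gamma> has_derivative (\<lambda>d. d *\<^sub>R v)) (at 0)"
      using \<gamma>(2)[of 0] \<gamma>(1,5) by (simp add: has_vector_derivative_def)
    have nd: "(n has_derivative n' p) (at (\<gamma> 0))" using ext p \<gamma>(4) by (auto simp: normal_ext_def)
    have "((\<lambda>t. n (\<gamma> t)) has_derivative (\<lambda>d. n' p (d *\<^sub>R v))) (at 0)"
      by (rule has_derivative_compose[OF \<gamma>d nd])
    then have nd2: "((\<lambda>t. n (\<gamma> t)) has_derivative (\<lambda>d. d *\<^sub>R n' p v)) (at 0)"
      using linear_scale[OF has_derivative_linear[OF nd]] by simp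
    have yd: "(y has_derivative (\<lambda>d. d *\<^sub>R (\<mu> *\<^sub>R v - l *\<^sub>R n' p v))) (at 0)"
      unfolding y_def by (auto intro!: derivative_eq_intros \<gamma>d nd2 simp: algebra_simps)
    have y0: "y 0 = 0" using lam \<gamma>(4) ext p by (simp add: y_def normal_ext_def)
    have "((\<lambda>t. (y t \<bullet> b) / t) \<longlongrightarrow> (\<mu> *\<^sub>R v - l *\<^sub>R n' p v) \<bullet> b) (at 0)" for b
    proof -
      have "DERIV (\<lambda>t. y t \<bullet> b) 0 :> (\<mu> *\<^sub>R v - l *\<^sub>R n' p v) \<bullet> b"
        by (rule has_derivative_imp_has_field_derivative[OF has_derivative_inner_left[OF yd]])
           (simp only: inner_scaleR_left)
      then show ?thesis by (simp add: DERIV_def y0)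
    qed
    then have "((\<lambda>t. \<Sum>b\<in>Basis. (\<gamma>' t \<bullet> b) * ((y t \<bullet> b) / t)) \<longlongrightarrow> (\<Sum>b\<in>Basis. (v \<bullet> b) * ((\<mu> *\<^sub>R v - l *\<^sub>R n' p v) \<bullet> b))) (at 0)"
      using \<gamma>(3,5) unfolding isCont_def by (intro tendsto_intros) auto
    moreover have "(\<Sum>b\<in>Basis. (\<gamma>' t \<bullet> b) * ((y t \<bullet> b) / t)) = (\<gamma>' t \<bullet> y t) / t" for t
      by (subst euclidean_inner) (simp add: sum_divide_distrib)
    ultimately have "((\<lambda>t. (\<gamma>' t \<bullet> y t) / t) \<longlongrightarrow> v \<bullet> (\<mu> *\<^sub>R v - l *\<^sub>R n' p v)) (at 0)"
      by (simp flip: euclidean_inner)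
    moreover have "v \<bullet> (\<mu> *\<^sub>R v - l *\<^sub>R n' p v) > 0"
      using neg by (simp add: inner_diff_right inner_commute)
    ultimately have "\<forall>\<^sub>F t in at 0. (\<gamma>' t \<bullet> y t) / t > 0" by (rule order_tendstoD)
    then obtain e1 where e1: "e1 > 0" "\<And>t. t \<noteq> 0 \<Longrightarrow> \<bar>t\<bar> < e1 \<Longrightarrow> (\<gamma>' t \<bullet> y t) / t > 0"
      unfolding eventually_at by (auto simp: dist_real_def)
    have "isCont \<gamma> 0" using has_derivative_continuous[OF \<gamma>d] .
    moreover have "open B" using ext by (simp add: normal_ext_def)
    then obtain dB where "dB > 0" "ball p dB \<subseteq> B" using p openE by blast
    ultimately obtain e2 where e2: "e2 > 0" "\<And>t. \<bar>t\<bar> < e2 \<Longrightarrow> dist (\<gamma> t) p < min d dB"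
      using d(1) \<gamma>(4) unfolding continuous_at_eps_delta by (metis dist_real_def diff_zero min_less_iff_conj)
    define T where "T = min e (min e1 e2) / 2"
    have T: "T > 0" "T < e" "T < e1" "T < e2" using e1 e2 \<gamma> by (auto simp: T_def min_def)
    have phi: "DERIV (\<lambda>t. ?f (\<gamma> t)) t :> \<gamma>' t \<bullet> y t" if t: "0 \<le> t" "t \<le> T" for t
    proof -
      have te: "\<bar>t\<bar> < e" "\<bar>t\<bar> < e2" using t T by auto
      have gd: "(\<gamma> has_derivative (\<lambda>d. d *\<^sub>R \<gamma>' t)) (at t)" using \<gamma>(2)[OF te(1)] by (simp add: has_vector_derivative_def)
      have S: "\<gamma> t \<in> S" "\<gamma> t \<in> B" using \<gamma>(2)[OF te(1)] e2(2)[OF te(2)] \<open>ball p dB \<subseteq> B\<close> by (auto simp: dist_commute)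
      have shift: "((\<lambda>h. t + h) has_vector_derivative 1) (at 0)"
        unfolding has_vector_derivative_def by (auto intro!: derivative_eq_intros)
      have "((\<lambda>h. \<gamma> (t + h)) has_vector_derivative \<gamma>' t) (at 0)"
        using vector_diff_chain_at[OF shift, of \<gamma> "\<gamma>' t"] \<gamma>(2)[OF te(1)] by (simp add: o_def)
      moreover have "\<gamma> (t + h) \<in> S" if "0 < h" "h < e - t" for h
        using \<gamma>(2)[of "t + h"] that t by simp
      then have "\<forall>\<^sub>F h in at_right 0. \<gamma> (t + h) \<in> S"
        unfolding eventually_at_right_field using te(1) by (intro exI[of _ "e - t"]) simp
      ultimately have "right_curve S (\<gamma> t) (\<gamma>' t)"
        unfolding right_curve_def by (intro exI[of _ "\<lambda>h. \<gamma> (t + h)"]) simp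
      moreover obtain W U V \<psi> g where c: "chart S W U V \<psi> g" "\<gamma> t \<in> U" using exists_chart S by blast
      ultimately have "\<gamma>' t \<in> tangent_space S (\<gamma> t)"
        using chart.right_curve_Tan(1)[OF c(1) S(1) c(2)] tangent_space_eq_Tan[OF c(1) S(1) c(2)] by simp
      then have "\<nu> (\<gamma> t) \<bullet> \<gamma>' t = 0" using normal_\<nu>[OF S(1)] by blast
      then have "\<gamma>' t \<bullet> y t = \<gamma>' t \<bullet> (u + \<mu> *\<^sub>R \<gamma> t)"
        using ext S by (simp add: y_def normal_ext_def inner_diff_right inner_commute)
      then show ?thesis
        by (intro has_derivative_imp_has_field_derivative[OF has_derivative_compose[OF gd df]])
           (simp only: inner_scaleR_left)
    qed
    obtain t where t: "0 < t" "t < T" "?f (\<gamma> T) - ?f (\<gamma> 0) = (T - 0) * (\<gamma>' t \<bullet> y t)"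
      using MVT2[OF T(1) phi] by blast
    have "\<gamma>' t \<bullet> y t > 0" using e1(2)[of t] t T by (simp add: zero_less_divide_iff)
    then have "?f (\<gamma> T) > ?f p" using t T \<gamma>(4) by (simp add: algebra_simps)
    moreover have "?f (\<gamma> T) \<le> ?f p"
      using d(2)[of "\<gamma> T"] \<gamma>(2)[of T] e2(2)[of T] T by auto
    ultimately show False by simp
  qed
  then show ?thesis using lam by blast
qed

end

section \<open>Anisotropic curvature\<close>

lemma continuous_on_linear_family:
  fixes L :: "'b::topological_space \<Rightarrow> 'a::euclidean_space \<Rightarrow> 'c::real_normed_vector"
  assumes L: "\<And>v. continuous_on A (\<lambda>x. L x v)" and lin: "\<And>x. x \<in> A \<Longrightarrow> linear (L x)" and u: "continuous_on A u"
  shows "continuous_on A (\<lambda>x. L x (u x))"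
proof (rule continuous_on_eq)
  show "continuous_on A (\<lambda>x. \<Sum>e\<in>Basis. (u x \<bullet> e) *\<^sub>R L x e)"
    by (intro continuous_intros L u)
  fix x assume "x \<in> A"
  note l = lin[OF this]
  have "L x (u x) = L x (\<Sum>e\<in>Basis. (u x \<bullet> e) *\<^sub>R e)" by (simp add: euclidean_representation)
  also have "\<dots> = (\<Sum>e\<in>Basis. (u x \<bullet> e) *\<^sub>R L x e)" by (simp add: linear_sum[OF l] linear_scale[OF l])
  finally show "(\<Sum>e\<in>Basis. (u x \<bullet> e) *\<^sub>R L x e) = L x (u x)" by simp
qed

lemma continuous_on_jac:
  fixes L :: "'b::topological_space \<Rightarrow> 'a::euclidean_space \<Rightarrow> 'a"
  assumes L: "\<And>v. continuous_on A (\<lambda>x. L x v)"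
  shows "continuous_on A (\<lambda>x. jac (L x))"
proof -
  have "jac (L x) = \<bar>\<Sum>p\<in>{p. p permutes UNIV}. of_int (sign p) * (\<Prod>i\<in>UNIV. L x (of_vec (axis (p i) 1)) \<bullet> basis_enum i)\<bar>" for x
    by (simp add: jac_def det_def matrix_def to_vec_def)
  then show ?thesis by (simp, intro continuous_intros L)
qed

lemma continuous_on_local:
  fixes f :: "'a::metric_space \<Rightarrow> 'b::metric_space"
  assumes "\<And>p. p \<in> S \<Longrightarrow> \<exists>B h. open B \<and> p \<in> B \<and> continuous_on (S \<inter> B) h \<and> (\<forall>x\<in>S \<inter> B. f x = h x)"
  shows "continuous_on S f"
  unfolding continuous_on_eq_continuous_within
proof
  fix p assume p: "p \<in> S"
  then obtain B h where B: "open B" "p \<in> B" "continuous_on (S \<inter> B) h" "\<forall>x\<in>S \<inter> B. f x = h x"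
    using assms by blast
  have "continuous_on (S \<inter> B) f" using B(3) by (rule continuous_on_eq) (use B(4) in auto)
  then have "continuous (at p within S \<inter> B) f" using p B(2) by (simp add: continuous_on_eq_continuous_within)
  moreover have "at p within S \<inter> B = at p within S" using B(1,2) by (intro at_within_nhd[of p B]) auto
  ultimately show "continuous (at p within S) f" by simp
qed

text \<open>The absolute value is built in because K serves as the volume factor of the anisotropic
  Gauss map. Uniqueness of the value is contained in \<open>K_eq_frame\<close>.\<close>

definition gauss_kronecker ::
  "('n::finite ambient \<Rightarrow> real) \<Rightarrow> 'n ambient set \<Rightarrow> ('n ambient \<Rightarrow> 'n ambient) \<Rightarrow> 'n ambient \<Rightarrow> real" where
  "gauss_kronecker F S \<nu> p =
     (THE k. \<exists>\<kappa>. aniso_principal_curvatures F S \<nu> p \<kappa> \<and> k = \<bar>prod \<kappa> UNIV\<bar>)"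

locale aniso_surface = minkowski F + surface S \<nu>
  for F :: "'n::finite ambient \<Rightarrow> real" and S :: "'n ambient set" and \<nu> :: "'n ambient \<Rightarrow> 'n ambient"
begin

abbreviation "H \<equiv> aniso_mean_curvature F S \<nu>"
abbreviation "K \<equiv> gauss_kronecker F S \<nu>"

lemma \<nu>_nz: "p \<in> S \<Longrightarrow> \<nu> p \<noteq> 0" using norm_\<nu> by fastforce

context
  fixes B n n' \<rho> a
  assumes ext: "normal_ext S \<nu> B n n' \<rho> a"
begin

lemma ext_open: "open B" and ext_norm: "x \<in> B \<Longrightarrow> norm (n x) = 1"
  and ext_der: "x \<in> B \<Longrightarrow> (n has_derivative n' x) (at x)"
  and ext_cont': "continuous_on B (\<lambda>x. n' x v)"
  and ext_eq: "x \<in> S \<Longrightarrow> x \<in> B \<Longrightarrow> n x = \<nu> x"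
  and ext_sym: "x \<in> S \<Longrightarrow> x \<in> B \<Longrightarrow> v \<bullet> \<nu> x = 0 \<Longrightarrow> w \<bullet> \<nu> x = 0 \<Longrightarrow> n' x v \<bullet> w = n' x w \<bullet> v"
  using ext unfolding normal_ext_def by blast+

lemma ext_nz: "x \<in> B \<Longrightarrow> n x \<noteq> 0" using ext_norm by fastforce

lemma ext_linear: "x \<in> B \<Longrightarrow> linear (n' x)" using ext_der has_derivative_linear by blast

lemma ext_cont: "continuous_on B n"
  by (intro continuous_at_imp_continuous_on ballI has_derivative_continuous[OF ext_der])

text \<open>Derivative of the extended anisotropic Gauss map \<Phi> \<circ> n; on the tangent space
  it is the anisotropic shape operator.\<close>

definition "NF' x v = dPhi (n x) (n' x v)"

lemma NF_der: "x \<in> B \<Longrightarrow> ((\<lambda>x. \<Phi> (n x)) has_derivative NF' x) (at x)"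
  unfolding NF'_def by (rule has_derivative_compose[OF ext_der Phi_has_derivative]) (auto dest: ext_nz)

lemma NF_linear: "x \<in> B \<Longrightarrow> linear (NF' x)" using NF_der has_derivative_linear by blast

lemma NF_cont: "continuous_on B (\<lambda>x. NF' x v)"
  unfolding NF'_def
proof (rule continuous_on_linear_family[OF _ _ ext_cont'])
  show "continuous_on B (\<lambda>x. dPhi (n x) v)" for v
    by (rule continuous_on_compose2[OF continuous_on_dPhi ext_cont]) (auto dest: ext_nz)
  show "linear (dPhi (n x))" if "x \<in> B" for x using linear_dPhi ext_nz that by blast
qed

lemma ext_perp: "x \<in> B \<Longrightarrow> n' x v \<bullet> n x = 0"
proof -
  assume x: "x \<in> B"
  have "((\<lambda>x. n x \<bullet> n x) has_derivative (\<lambda>v. n x \<bullet> n' x v + n' x v \<bullet> n x)) (at x)"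
    by (rule has_derivative_inner[OF ext_der[OF x] ext_der[OF x]])
  moreover have "((\<lambda>x. n x \<bullet> n x) has_derivative (\<lambda>v. 0)) (at x)"
    by (rule has_derivative_transform_within_open[of "\<lambda>_. 1", OF _ ext_open x])
       (use ext_norm in \<open>auto simp: dot_square_norm\<close>)
  ultimately have "(\<lambda>v. n x \<bullet> n' x v + n' x v \<bullet> n x) = (\<lambda>v. 0)" by (rule has_derivative_unique)
  from fun_cong[OF this, of v] show ?thesis by (simp add: inner_commute)
qed

lemma NF_perp: "x \<in> B \<Longrightarrow> NF' x v \<bullet> n x = 0"
  unfolding NF'_def using dPhi_orthogonal ext_nz by blast

lemma NF_der_within: 
  assumes "p \<in> S" "p \<in> B" shows "((\<lambda>x. \<Phi> (\<nu> x)) has_derivative NF' p) (at p within S)"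
proof -
  have "((\<lambda>x. \<Phi> (n x)) has_derivative NF' p) (at p within S)"
    using NF_der[OF assms(2)] has_derivative_at_withinI by blast
  then show ?thesis
  proof (rule has_derivative_transform_eventually)
    show "\<forall>\<^sub>F x in at p within S. \<Phi> (n x) = \<Phi> (\<nu> x)"
      using eventually_at_topological ext_open assms(2) ext_eq by (metis (mono_tags, lifting))
  qed (use assms ext_eq in auto)
qed

text \<open>A derivative within S is tested along velocities of curves in S. At a boundary point
  only one of v and -v may occur, and linearity supplies the other.\<close>

lemma derivative_within_eq:
  assumes p: "p \<in> S" "p \<in> B" and D: "((\<lambda>x. \<Phi> (\<nu> x)) has_derivative D) (at p within S)" and v: "v \<bullet> \<nu> p = 0"
  shows "D v = NF' p v"
proof -
  have *: "D u = NF' p u" if rc: "right_curve S p u" for u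
  proof -
    obtain \<gamma> where \<gamma>: "\<gamma> 0 = p" "(\<gamma> has_vector_derivative u) (at 0)" "\<forall>\<^sub>F t in at_right (0::real). \<gamma> t \<in> S"
      using rc unfolding right_curve_def by blast
    obtain e where e: "e > 0" "\<And>t. 0 < t \<Longrightarrow> t < e \<Longrightarrow> \<gamma> t \<in> S"
      using \<gamma>(3) unfolding eventually_at_right_field by blast
    define I where "I = {0..e / 2}"
    have I: "\<gamma> ` I \<subseteq> S" using e \<gamma>(1) p by (force simp: I_def le_less)
    have "(\<gamma> has_vector_derivative u) (at 0 within I)" using \<gamma>(2) has_vector_derivative_at_within by blast
    moreover have "((\<lambda>x. \<Phi> (\<nu> x)) has_derivative D') (at (\<gamma> 0) within \<gamma> ` I)"
      if "((\<lambda>x. \<Phi> (\<nu> x)) has_derivative D') (at p within S)" for D'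
      using that has_derivative_subset[OF _ I] \<gamma>(1) by simp
    ultimately have "((\<lambda>x. \<Phi> (\<nu> x)) \<circ> \<gamma> has_vector_derivative D u) (at 0 within I)"
      "((\<lambda>x. \<Phi> (\<nu> x)) \<circ> \<gamma> has_vector_derivative NF' p u) (at 0 within I)"
      using vector_derivative_diff_chain_within D NF_der_within[OF p] by blast+
    moreover have "at 0 within I \<noteq> bot"
      unfolding I_def using e(1) by (simp add: at_within_Icc_at_right)
    ultimately show ?thesis using vector_derivative_unique_within by blast
  qed
  have lin: "linear D" "linear (NF' p)" using D NF_linear[OF p(2)] has_derivative_linear by blast+
  consider "right_curve S p v" | "right_curve S p (- v)" using right_curve_either[OF p(1) v] by blast
  then show ?thesis
  proof cases
    case 2
    from *[OF 2] show ?thesis using linear_neg[OF lin(1)] linear_neg[OF lin(2)] by simp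
  qed (use * in blast)
qed

definition eigen_frame :: "'n ambient \<Rightarrow> ('n \<Rightarrow> 'n ambient) \<Rightarrow> ('n \<Rightarrow> real) \<Rightarrow> bool" where
  "eigen_frame p b \<kappa> \<longleftrightarrow> inj b \<and> independent (range b) \<and> span (range b) = {v. v \<bullet> \<nu> p = 0} \<and>
   (\<forall>i. NF' p (b i) = \<kappa> i *\<^sub>R b i)"

lemma exists_eigen_frame:
  assumes p: "p \<in> S" "p \<in> B"
  shows "\<exists>b \<kappa>. eigen_frame p (b :: 'n \<Rightarrow> 'n ambient) \<kappa>"
proof -
  let ?T = "{v. v \<bullet> \<nu> p = 0}"
  have eq: "n p = \<nu> p" using ext_eq p by blast
  have "\<exists>C. independent C \<and> span C = ?T \<and> (\<forall>b\<in>C. \<exists>k. dPhi (\<nu> p) (n' p b) = k *\<^sub>R b)"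
  proof (rule product_eigenbasis[OF subspace_perp, where A = "dPhi (\<nu> p)" and S = "n' p"])
    show "linear (dPhi (\<nu> p))" using linear_dPhi \<nu>_nz p by blast
    show "linear (n' p)" using ext_linear p by blast
    show "dPhi (\<nu> p) v \<in> ?T" for v using dPhi_orthogonal \<nu>_nz p by blast
    show "n' p v \<in> ?T" for v using ext_perp[OF p(2)] eq by simp
    show "dPhi (\<nu> p) v \<bullet> w = v \<bullet> dPhi (\<nu> p) w" for v w
      using dPhi_symmetric[OF \<nu>_nz[OF p(1)], of v w] by (simp add: inner_commute)
    show "0 < dPhi (\<nu> p) v \<bullet> v" if "v \<in> ?T" "v \<noteq> 0" for v
      using that dPhi_pos norm_\<nu> p by blast
    show "n' p v \<bullet> w = v \<bullet> n' p w" if "v \<in> ?T" "w \<in> ?T" for v w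
      using ext_sym[OF p, of v w] that by (simp add: inner_commute)
  qed
  then obtain C where C: "independent C" "span C = ?T" "\<forall>b\<in>C. \<exists>k. dPhi (\<nu> p) (n' p b) = k *\<^sub>R b" by blast
  have "card C = CARD('n)"
    using dim_span_eq_card_independent[OF C(1)] C(2) dim_hyperplane[OF norm_\<nu>[OF p(1)]] by simp
  moreover have "finite C" using C(1) independent_imp_finite by blast
  ultimately obtain b where b: "bij_betw b (UNIV :: 'n set) C" by (metis finite_same_card_bij finite)
  then have r: "range b = C" "inj b" by (auto simp: bij_betw_def)
  have "\<forall>i. \<exists>k. NF' p (b i) = k *\<^sub>R b i" using C(3) r(1) by (auto simp: NF'_def eq)
  then obtain \<kappa> where "\<forall>i. NF' p (b i) = \<kappa> i *\<^sub>R b i" by metis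
  then show ?thesis using C r unfolding eigen_frame_def by (intro exI[of _ b] exI[of _ \<kappa>]) auto
qed

lemma principal_iff:
  assumes p: "p \<in> S" "p \<in> B"
  shows "aniso_principal_curvatures F S \<nu> p \<kappa> \<longleftrightarrow> (\<exists>b. eigen_frame p b \<kappa>)"
proof
  assume "aniso_principal_curvatures F S \<nu> p \<kappa>"
  then obtain D b where D: "((\<lambda>x. \<Phi> (\<nu> x)) has_derivative D) (at p within S)" "inj b" "independent (range b)"
    "span (range b) = tangent_space S p" "\<forall>i. D (b i) = \<kappa> i *\<^sub>R b i"
    unfolding aniso_principal_curvatures_def by blast
  have T: "span (range b) = {v. v \<bullet> \<nu> p = 0}" using D(4) tangent_space_perp[OF p(1)] by simp
  then have "b i \<bullet> \<nu> p = 0" for i using span_base[of "b i" "range b"] by blast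
  then have "NF' p (b i) = \<kappa> i *\<^sub>R b i" for i using derivative_within_eq[OF p D(1), of "b i"] D(5) by simp
  then show "\<exists>b. eigen_frame p b \<kappa>" using D T unfolding eigen_frame_def by blast
next
  assume "\<exists>b. eigen_frame p b \<kappa>"
  then show "aniso_principal_curvatures F S \<nu> p \<kappa>"
    unfolding aniso_principal_curvatures_def eigen_frame_def
    using NF_der_within[OF p] tangent_space_perp[OF p(1)] by metis
qed

lemma eigen_trace:
  assumes p: "p \<in> S" "p \<in> B" and b: "eigen_frame p b \<kappa>"
  shows "sum \<kappa> UNIV = (\<Sum>e\<in>Basis. NF' p e \<bullet> e)"
  using trace_eigenbasis[OF NF_linear[OF p(2)], of b "\<nu> p" \<kappa>] b norm_\<nu>[OF p(1)] NF_perp[OF p(2)] ext_eq[OF p]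
  by (simp add: eigen_frame_def)

text \<open>The shape operator is completed by an arbitrary image c of the normal. With c =
  \<open>\<nu> p\<close> this shows that the product of the curvatures does not depend on the frame;
  with c the shifted anisotropic normal it is the Jacobian of the cone.\<close>

lemma eigen_jac:
  assumes p: "p \<in> S" "p \<in> B" and b: "eigen_frame p b \<kappa>"
  shows "jac (\<lambda>x. NF' p (x - (x \<bullet> \<nu> p) *\<^sub>R \<nu> p) + (x \<bullet> \<nu> p) *\<^sub>R c) = \<bar>c \<bullet> \<nu> p\<bar> * \<bar>prod \<kappa> UNIV\<bar>"
proof -
  let ?L = "\<lambda>x. NF' p (x - (x \<bullet> \<nu> p) *\<^sub>R \<nu> p) + (x \<bullet> \<nu> p) *\<^sub>R c"
  note lin = NF_linear[OF p(2)]
  have lL: "linear ?L"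
    by (intro linearI)
       (simp_all add: linear_diff[OF lin] linear_add[OF lin] linear_scale[OF lin] inner_add_left algebra_simps)
  have n1: "\<nu> p \<bullet> \<nu> p = 1" using norm_\<nu>[OF p(1)] by (simp add: dot_square_norm)
  have bp: "b i \<bullet> \<nu> p = 0" for i using b span_base[of "b i" "range b"] unfolding eigen_frame_def by blast
  have "jac ?L = \<bar>?L (\<nu> p) \<bullet> \<nu> p\<bar> * \<bar>prod \<kappa> UNIV\<bar>"
    by (rule jac_eigenbasis[OF lL, of b]) (use b norm_\<nu>[OF p(1)] bp in \<open>auto simp: eigen_frame_def\<close>)
  then show ?thesis by (simp add: n1 linear_0[OF lin])
qed

text \<open>The trace does not depend on a choice of eigenvectors, which makes the
  \<open>THE\<close> of the definition unique, and it varies continuously with p.\<close>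

lemma H_eq: "H p = (\<Sum>e\<in>Basis. NF' p e \<bullet> e) / CARD('n)" if p: "p \<in> S" "p \<in> B"
  unfolding aniso_mean_curvature_def principal_iff[OF p]
proof (rule the_equality)
  show "\<exists>\<kappa>. (\<exists>b. eigen_frame p b \<kappa>) \<and> (\<Sum>e\<in>Basis. NF' p e \<bullet> e) / CARD('n) = sum \<kappa> UNIV / CARD('n)"
  proof -
    obtain b \<kappa> where b: "eigen_frame p b \<kappa>" using exists_eigen_frame[OF p] by blast
    then show ?thesis using eigen_trace[OF p b] by (intro exI[of _ \<kappa>]) auto
  qed
  fix h assume "\<exists>\<kappa>. (\<exists>b. eigen_frame p b \<kappa>) \<and> h = sum \<kappa> UNIV / CARD('n)"
  then show "h = (\<Sum>e\<in>Basis. NF' p e \<bullet> e) / CARD('n)" using eigen_trace[OF p] by auto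
qed

lemma K_eq_frame: "eigen_frame p b \<kappa> \<Longrightarrow> K p = \<bar>prod \<kappa> UNIV\<bar>" if p: "p \<in> S" "p \<in> B"
  unfolding gauss_kronecker_def principal_iff[OF p]
proof (intro the_equality exI conjI)
  assume b: "eigen_frame p b \<kappa>"
  fix k assume "\<exists>\<kappa>'. (\<exists>b'. eigen_frame p b' \<kappa>') \<and> k = \<bar>prod \<kappa>' UNIV\<bar>"
  then obtain \<kappa>' b' where b': "eigen_frame p b' \<kappa>'" "k = \<bar>prod \<kappa>' UNIV\<bar>" by blast
  show "k = \<bar>prod \<kappa> UNIV\<bar>"
    using eigen_jac[OF p b'(1), of "\<nu> p"] eigen_jac[OF p b, of "\<nu> p"] norm_\<nu>[OF p(1)] b'(2)
    by (simp add: dot_square_norm)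
qed auto

lemma jac_eq_K:
  assumes p: "p \<in> S" "p \<in> B"
  shows "jac (\<lambda>x. NF' p (x - (x \<bullet> \<nu> p) *\<^sub>R \<nu> p) + (x \<bullet> \<nu> p) *\<^sub>R c) = \<bar>c \<bullet> \<nu> p\<bar> * K p"
proof -
  obtain b \<kappa> where b: "eigen_frame p b \<kappa>" using exists_eigen_frame[OF p] by blast
  show ?thesis using eigen_jac[OF p b] K_eq_frame[OF p b] by simp
qed

lemma K_nonneg: "p \<in> S \<Longrightarrow> p \<in> B \<Longrightarrow> K p \<ge> 0"
proof -
  assume p: "p \<in> S" "p \<in> B"
  obtain b \<kappa> where b: "eigen_frame p b \<kappa>" using exists_eigen_frame[OF p] by blast
  show ?thesis using K_eq_frame[OF p b] by simp
qed

lemma K_H_umbilic: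
  assumes p: "p \<in> S" "p \<in> B" and umb: "\<And>v. v \<bullet> \<nu> p = 0 \<Longrightarrow> NF' p v = h *\<^sub>R v"
  shows "H p = h" "K p = \<bar>h\<bar> ^ CARD('n)"
proof -
  obtain b \<kappa> where b: "eigen_frame p (b :: 'n \<Rightarrow> _) \<kappa>" using exists_eigen_frame[OF p] by blast
  have "\<kappa> i = h" for i
  proof -
    have "b i \<bullet> \<nu> p = 0" using b span_base[of "b i" "range b"] unfolding eigen_frame_def by blast
    then have "\<kappa> i *\<^sub>R b i = h *\<^sub>R b i" using umb b unfolding eigen_frame_def by metis
    moreover have "b i \<noteq> 0" using b dependent_zero[of "range b"] unfolding eigen_frame_def by (metis rangeI)
    ultimately show ?thesis by simp
  qed
  then have \<kappa>: "\<kappa> = (\<lambda>_. h)" by auto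
  show "H p = h" unfolding H_eq[OF p] by (simp add: \<kappa> flip: eigen_trace[OF p b])
  show "K p = \<bar>h\<bar> ^ CARD('n)" using K_eq_frame[OF p b] by (simp add: \<kappa> power_abs)
qed

text \<open>\<open>A \<circ> d\<nu>\<close> has the signs of \<open>d\<nu>\<close>: from \<open>A w = \<kappa> b\<close> with \<open>w = d\<nu> b\<close> one gets
  \<open>\<kappa> \<langle>w, b\<rangle> = \<langle>A w, w\<rangle>\<close>.\<close>

lemma eigen_sign:
  assumes p: "p \<in> S" "p \<in> B" and b: "eigen_frame p b \<kappa>"
  shows "n' p (b i) \<bullet> b i \<ge> 0 \<Longrightarrow> \<kappa> i \<ge> 0" and "l * (n' p (b i) \<bullet> b i) > 0 \<Longrightarrow> l * \<kappa> i > 0"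
proof -
  let ?w = "n' p (b i)"
  have eq: "n p = \<nu> p" using ext_eq p by blast
  have w: "?w \<bullet> \<nu> p = 0" using ext_perp[OF p(2)] eq by simp
  have A: "dPhi (\<nu> p) ?w = \<kappa> i *\<^sub>R b i" using b by (simp add: eigen_frame_def NF'_def eq)
  then have q: "dPhi (\<nu> p) ?w \<bullet> ?w = \<kappa> i * (?w \<bullet> b i)" by (simp add: inner_commute)
  have b0: "b i \<noteq> 0" using b dependent_zero[of "range b"] unfolding eigen_frame_def by (metis rangeI)
  have pos: "\<kappa> i * (?w \<bullet> b i) > 0" if "?w \<noteq> 0" using dPhi_pos[OF norm_\<nu>[OF p(1)] w that] q by simp
  have z: "\<kappa> i = 0" if "?w = 0"
  proof -
    have "\<kappa> i *\<^sub>R b i = 0" using A that linear_0[OF linear_dPhi[OF \<nu>_nz[OF p(1)]]] by simp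
    then show ?thesis using b0 by simp
  qed
  show "\<kappa> i \<ge> 0" if "?w \<bullet> b i \<ge> 0"
  proof (cases "?w = 0")
    case True then show ?thesis using z by simp
  next
    case False then show ?thesis using pos that by (simp add: zero_less_mult_iff)
  qed
  show "l * \<kappa> i > 0" if l: "l * (?w \<bullet> b i) > 0"
  proof -
    have "?w \<noteq> 0" using l by auto
    from pos[OF this] l show ?thesis by (auto simp: zero_less_mult_iff)
  qed
qed

text \<open>Nonnegativity of d\<nu> passes to the anisotropic curvatures by
  \<open>eigen_sign\<close>. The comparison of K and H is then the inequality of arithmetic and
  geometric means, and its equality case makes all curvatures equal.\<close>

lemma contact_curvature:
  assumes p: "p \<in> S" "p \<in> B" and nn: "\<And>v. v \<bullet> \<nu> p = 0 \<Longrightarrow> n' p v \<bullet> v \<ge> 0"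
  shows "H p \<ge> 0" "K p \<le> H p ^ CARD('n)"
    "K p = H p ^ CARD('n) \<Longrightarrow> v \<bullet> \<nu> p = 0 \<Longrightarrow> NF' p v = H p *\<^sub>R v"
proof -
  obtain b \<kappa> where b: "eigen_frame p (b :: 'n \<Rightarrow> _) \<kappa>" using exists_eigen_frame[OF p] by blast
  have bp: "b i \<bullet> \<nu> p = 0" for i using b span_base[of "b i" "range b"] unfolding eigen_frame_def by blast
  have \<kappa>: "\<kappa> i \<ge> 0" for i using eigen_sign(1)[OF p b] nn bp by blast
  have H: "H p = sum \<kappa> UNIV / CARD('n)" using H_eq[OF p] eigen_trace[OF p b] by simp
  have K: "K p = prod \<kappa> UNIV" using K_eq_frame[OF p b] \<kappa> by (simp add: prod_nonneg)
  show "H p \<ge> 0" using \<kappa> by (simp add: H sum_nonneg)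
  show "K p \<le> H p ^ CARD('n)" unfolding H K by (rule prod_le_mean_power[OF \<kappa>])
  assume eq: "K p = H p ^ CARD('n)" and v: "v \<bullet> \<nu> p = 0"
  have \<kappa>H: "\<kappa> i = H p" for i using prod_eq_mean_power_imp[OF \<kappa>] eq unfolding H K by simp
  have "v \<in> span (range b)" using v b unfolding eigen_frame_def by blast
  then show "NF' p v = H p *\<^sub>R v"
  proof (induction rule: span_induct_alt)
    case base then show ?case using linear_0[OF NF_linear[OF p(2)]] by simp
  next
    case (step c x y)
    then obtain i where "x = b i" by blast
    then have "NF' p x = H p *\<^sub>R x" using b \<kappa>H unfolding eigen_frame_def by simp
    then show ?case using step(2) linear_add[OF NF_linear[OF p(2)]] linear_scale[OF NF_linear[OF p(2)]]
      by (simp add: algebra_simps)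
  qed
qed

text \<open>The sign of l is not known in advance; it is enough that l times every curvature is
  positive.\<close>

lemma H_nonzero:
  assumes p: "p \<in> S" "p \<in> B" and l: "\<And>v. v \<bullet> \<nu> p = 0 \<Longrightarrow> v \<noteq> 0 \<Longrightarrow> l * (n' p v \<bullet> v) > 0"
  shows "H p \<noteq> 0"
proof -
  obtain b \<kappa> where b: "eigen_frame p (b :: 'n \<Rightarrow> _) \<kappa>" using exists_eigen_frame[OF p] by blast
  have bp: "b i \<bullet> \<nu> p = 0" for i using b span_base[of "b i" "range b"] unfolding eigen_frame_def by blast
  have b0: "b i \<noteq> 0" for i using b dependent_zero[of "range b"] unfolding eigen_frame_def by (metis rangeI)
  have "l * \<kappa> i > 0" for i using eigen_sign(2)[OF p b] l bp b0 by blast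
  then have "(\<Sum>i\<in>UNIV. l * \<kappa> i) > 0" by (intro sum_pos) auto
  then have "l * sum \<kappa> UNIV > 0" by (simp add: sum_distrib_left)
  then have "sum \<kappa> UNIV \<noteq> 0" by auto
  moreover have "H p = sum \<kappa> UNIV / CARD('n)" using H_eq[OF p] eigen_trace[OF p b] by simp
  ultimately show ?thesis by simp
qed

lemma continuous_H_local: "continuous_on (S \<inter> B) H"
proof (rule continuous_on_eq)
  show "continuous_on (S \<inter> B) (\<lambda>p. (\<Sum>e\<in>Basis. NF' p e \<bullet> e) / CARD('n))"
    by (intro continuous_intros continuous_on_subset[OF NF_cont]) auto
qed (simp add: H_eq)

lemma continuous_K_local: "continuous_on (S \<inter> B) K"
proof (rule continuous_on_eq)
  have "continuous_on B (\<lambda>p. NF' p (v - (v \<bullet> n p) *\<^sub>R n p) + (v \<bullet> n p) *\<^sub>R n p)" for v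
    by (intro continuous_intros continuous_on_linear_family[OF NF_cont NF_linear] ext_cont)
  then show "continuous_on (S \<inter> B) (\<lambda>p. jac (\<lambda>v. NF' p (v - (v \<bullet> n p) *\<^sub>R n p) + (v \<bullet> n p) *\<^sub>R n p))"
    by (intro continuous_on_jac) (auto intro: continuous_on_subset)
  fix p assume "p \<in> S \<inter> B"
  then show "jac (\<lambda>v. NF' p (v - (v \<bullet> n p) *\<^sub>R n p) + (v \<bullet> n p) *\<^sub>R n p) = K p"
    using jac_eq_K[of p "\<nu> p"] norm_\<nu>[of p] by (simp add: ext_eq dot_square_norm)
qed

end

lemma exists_ext:
  assumes "p \<in> S"
  obtains B n n' \<rho> a where "normal_ext S \<nu> B n n' \<rho> a" "p \<in> B"
proof -
  obtain W U V \<psi> g where c: "chart S W U V \<psi> g" "p \<in> U" using exists_chart assms by blast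
  show ?thesis by (rule exists_normal_ext[OF c(1) assms c(2)]) (rule that)
qed

lemma continuous_on_H: "continuous_on S H"
proof (rule continuous_on_local)
  fix p assume "p \<in> S"
  then obtain B n n' \<rho> a where "normal_ext S \<nu> B n n' \<rho> a" "p \<in> B" using exists_ext by blast
  then show "\<exists>B h. open B \<and> p \<in> B \<and> continuous_on (S \<inter> B) h \<and> (\<forall>x\<in>S \<inter> B. H x = h x)"
    using ext_open continuous_H_local by (intro exI[of _ B] exI[of _ H]) auto
qed

lemma continuous_on_K: "continuous_on S K"
proof (rule continuous_on_local)
  fix p assume "p \<in> S"
  then obtain B n n' \<rho> a where "normal_ext S \<nu> B n n' \<rho> a" "p \<in> B" using exists_ext by blast
  then show "\<exists>B h. open B \<and> p \<in> B \<and> continuous_on (S \<inter> B) h \<and> (\<forall>x\<in>S \<inter> B. K x = h x)"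
    using ext_open continuous_K_local by (intro exI[of _ B] exI[of _ K]) auto
qed

end

section \<open>The area measure\<close>

lemma borel_preimage_of_continuous_on:
  fixes f :: "'a::topological_space \<Rightarrow> 'b::real_normed_vector"
  assumes A: "A \<in> sets borel" and f: "continuous_on A f" and X: "X \<in> sets borel"
  shows "{x \<in> A. f x \<in> X} \<in> sets borel"
proof -
  let ?f = "\<lambda>x. indicator A x *\<^sub>R f x"
  have "?f \<in> borel_measurable borel" using A f by (rule borel_measurable_continuous_on_indicator)
  then have "?f -` X \<in> sets borel" using X by (metis measurable_sets_borel)
  moreover have "{x \<in> A. f x \<in> X} = A \<inter> ?f -` X" by auto
  ultimately show ?thesis using A by simp
qed

lemma finite_sum_of_measures:
  fixes M :: "nat \<Rightarrow> 'a::topological_space measure"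
  assumes "\<And>k. sets (M k) = sets borel"
  shows "\<exists>\<mu>. sets \<mu> = sets borel \<and> (\<forall>X\<in>sets borel. emeasure \<mu> X = (\<Sum>k<N. emeasure (M k) X))"
proof -
  let ?f = "\<lambda>X. \<Sum>k<N. emeasure (M k) X"
  define \<mu> where "\<mu> = measure_of UNIV (sets borel) ?f"
  have sa: "sigma_algebra UNIV (sets (borel :: 'a measure))"
    using sets.sigma_algebra_axioms[of borel] by simp
  have sets: "sets \<mu> = sets borel"
    unfolding \<mu>_def using sigma_algebra.sets_measure_of_eq[OF sa] by simp
  have "countably_additive (sets borel) ?f"
  proof (rule countably_additiveI)
    fix A :: "nat \<Rightarrow> 'a set" assume A: "range A \<subseteq> sets borel" "disjoint_family A"
    have "(\<Sum>i. ?f (A i)) = (\<Sum>k<N. \<Sum>i. emeasure (M k) (A i))" by (rule suminf_sum) auto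
    also have "\<dots> = ?f (\<Union>i. A i)"
      using A assms by (intro sum.cong refl suminf_emeasure) auto
    finally show "(\<Sum>i. ?f (A i)) = ?f (\<Union>i. A i)" .
  qed
  then have "emeasure \<mu> X = ?f X" if "X \<in> sets borel" for X
    unfolding \<mu>_def using that
    by (intro emeasure_measure_of_sigma[OF sa]) (auto simp: positive_def)
  with sets show ?thesis by blast
qed

section \<open>Parametrisation by a chart and integration against area\<close>

context chart
begin

definition "par w = g (w, 0)"
definition "Dom = {w. w \<in> W \<and> (w, 0) \<in> V}"
abbreviation "gram \<equiv> gram_jacobian par"

lemma closed_W: "closed W"
proof (cases rule: W_cases)
  case (2 i)
  have "closed {y :: real ^ 'n. y $ i \<ge> 0}" by (intro closed_Collect_le continuous_intros)
  then show ?thesis unfolding 2 model_half_def .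
next
  case 1
  show ?thesis unfolding 1 by (rule closed_UNIV)
qed

lemma open_V0: "open {w. (w, 0) \<in> V}"
proof -
  have "{w. (w, 0) \<in> V} = (\<lambda>w. (w, 0)) -` V" by auto
  moreover have "open ((\<lambda>w. (w, 0)) -` V)"
    by (intro open_vimage open_V continuous_intros)
  ultimately show ?thesis by simp
qed

lemma Dom_borel: "Dom \<in> sets borel"
proof -
  have "Dom = W \<inter> {w. (w, 0) \<in> V}" by (auto simp: Dom_def)
  then show ?thesis using closed_W open_V0 by (simp add: borel_closed borel_open)
qed

lemma par_in: "w \<in> Dom \<Longrightarrow> par w \<in> S \<inter> U"
  using g_in g_in_S_iff by (auto simp: Dom_def par_def)

lemma \<psi>_par: "(w, 0) \<in> V \<Longrightarrow> \<psi> (par w) = (w, 0)"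
  by (simp add: par_def)

lemma par_fst_\<psi>: "p \<in> S \<Longrightarrow> p \<in> U \<Longrightarrow> fst (\<psi> p) \<in> Dom \<and> par (fst (\<psi> p)) = p"
proof -
  assume p: "p \<in> S" "p \<in> U"
  then have "\<psi> p = (fst (\<psi> p), 0)" using in_S_iff by (simp add: prod_eq_iff)
  then show ?thesis using p in_S_iff \<psi>_in[OF p(2)] g_\<psi>[OF p(2)] by (metis (mono_tags, lifting) Dom_def mem_Collect_eq par_def)
qed

lemma par_inj: "inj_on par Dom"
  by (rule inj_on_inverseI[where g = "\<lambda>x. fst (\<psi> x)"]) (simp add: Dom_def \<psi>_par)

lemma par_der: "(w, 0) \<in> V \<Longrightarrow> (par has_derivative (\<lambda>v. g' (w, 0) (v, 0))) (at w)"
proof -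
  assume w: "(w, 0) \<in> V"
  have "((\<lambda>w. (w, 0)) has_derivative (\<lambda>v. (v, 0))) (at w)" by (auto intro!: derivative_eq_intros)
  from has_derivative_compose[OF this der_g[OF w]] show ?thesis by (simp add: par_def[abs_def])
qed

lemma par_cont: "continuous_on {w. (w, 0) \<in> V} par"
  by (intro continuous_at_imp_continuous_on ballI has_derivative_continuous[OF par_der]) auto

lemma par_cont_Dom: "continuous_on Dom par"
  by (rule continuous_on_subset[OF par_cont]) (auto simp: Dom_def)

lemma par'_cont: "continuous_on {w. (w, 0) \<in> V} (\<lambda>w. g' (w, 0) v)"
  by (rule continuous_on_compose2[OF C2_continuous_derivative[OF C2_g], of _ "\<lambda>w. (w, 0)"])
     (auto intro!: continuous_intros)

lemma gram_cont: "continuous_on {w. (w, 0) \<in> V} gram"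
proof (rule continuous_on_eq)
  let ?f = "\<lambda>w. sqrt (det (\<chi> i j. g' (w, 0) (axis i 1, 0) \<bullet> g' (w, 0) (axis j 1, 0)))"
  show "continuous_on {w. (w, 0) \<in> V} ?f"
    unfolding det_def by (simp, intro continuous_intros par'_cont)
  fix w assume "w \<in> {w. (w, 0) \<in> V}"
  then have "frechet_derivative par (at w) = (\<lambda>v. g' (w, 0) (v, 0))"
    using frechet_derivative_at[OF par_der] by force
  then show "?f w = gram w" by (simp add: gram_jacobian_def)
qed

lemma gram_measurable: "B \<in> sets borel \<Longrightarrow> B \<subseteq> Dom \<Longrightarrow> (\<lambda>w. indicator B w * gram w) \<in> borel_measurable borel"
proof -
  assume B: "B \<in> sets borel" "B \<subseteq> Dom"
  have "B \<subseteq> {w. (w, 0) \<in> V}" using B(2) unfolding Dom_def by blast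
  from borel_measurable_continuous_on_indicator[OF B(1) continuous_on_subset[OF gram_cont this]]
  show ?thesis by simp
qed

text \<open>The image under the parametrisation is a preimage under the chart \<psi>.\<close>

lemma par_image_borel: "B \<in> sets borel \<Longrightarrow> B \<subseteq> Dom \<Longrightarrow> par ` B \<in> sets borel"
proof -
  assume B: "B \<in> sets borel" "B \<subseteq> Dom"
  have "par ` B = {x \<in> U. \<psi> x \<in> B \<times> {0}}"
  proof
    show "par ` B \<subseteq> {x \<in> U. \<psi> x \<in> B \<times> {0}}"
      using B(2) par_in \<psi>_par by (auto simp: Dom_def subset_iff)
    show "{x \<in> U. \<psi> x \<in> B \<times> {0}} \<subseteq> par ` B"
    proof
      fix x assume "x \<in> {x \<in> U. \<psi> x \<in> B \<times> {0}}"
      then obtain w where w: "x \<in> U" "\<psi> x = (w, 0)" "w \<in> B" by auto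
      then have "x = par w" using g_\<psi>[of x] by (simp add: par_def)
      then show "x \<in> par ` B" using w by blast
    qed
  qed
  also have "\<dots> \<in> sets borel"
    using open_U cont_\<psi> B(1) by (intro borel_preimage_of_continuous_on) (auto intro: borel_Times)
  finally show ?thesis .
qed

lemma par_preimage_borel: "A \<in> sets borel \<Longrightarrow> {w \<in> Dom. par w \<in> A} \<in> sets borel"
  by (rule borel_preimage_of_continuous_on[OF Dom_borel par_cont_Dom])

lemma par_image_preimage: "A \<subseteq> S \<inter> U \<Longrightarrow> par ` {w \<in> Dom. par w \<in> A} = A"
proof -
  assume A: "A \<subseteq> S \<inter> U"
  have "x \<in> par ` {w \<in> Dom. par w \<in> A}" if "x \<in> A" for x
  proof
    have "x \<in> S" "x \<in> U" using A that by auto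
    note f = par_fst_\<psi>[OF this]
    show "x = par (fst (\<psi> x))" using f by simp
    show "fst (\<psi> x) \<in> {w \<in> Dom. par w \<in> A}" using f that by simp
  qed
  then show ?thesis by blast
qed

lemma gram_eq_jac:
  assumes w: "(w, 0) \<in> V" and u: "norm u = 1" "\<And>v. v \<in> Tan (par w) \<Longrightarrow> v \<bullet> u = 0"
  shows "gram w = jac (\<lambda>(v, s). g' (w, 0) (v, 0) + s *\<^sub>R u)"
proof (rule gram_jacobian_eq_jac[OF par_der[OF w] u(1)])
  fix v
  have "par w \<in> U" using g_in[OF w] by (simp add: par_def)
  then have "g' (w, 0) (v, 0) \<in> Tan (par w)" using Tan_iff[of "par w"] \<psi>_par[OF w] by auto
  then show "g' (w, 0) (v, 0) \<bullet> u = 0" using u(2) by blast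
qed

lemma is_area_chart:
  assumes \<mu>: "is_area_measure S \<mu>" and B: "B \<in> sets borel" "B \<subseteq> Dom"
  shows "emeasure \<mu> (par ` B) = (\<integral>\<^sup>+w\<in>B. ennreal (gram w) \<partial>lborel)"
proof -
  have "B \<subseteq> W" "B \<times> {0} \<subseteq> V" using B by (auto simp: Dom_def)
  then have "emeasure \<mu> ((\<lambda>y. g (y, 0)) ` B) = (\<integral>\<^sup>+ y\<in>B. ennreal (gram_jacobian (\<lambda>y. g (y, 0)) y) \<partial>lborel)"
    using \<mu> chart B(1) unfolding is_area_measure_def by blast
  then show ?thesis by (simp add: par_def[abs_def])
qed

lemma nn_integral_area:
  assumes \<mu>: "is_area_measure S \<mu>" and B: "B \<in> sets borel" "B \<subseteq> Dom" and f[measurable]: "f \<in> borel_measurable borel"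
  shows "(\<integral>\<^sup>+x\<in>par ` B. f x \<partial>\<mu>) = (\<integral>\<^sup>+w\<in>B. ennreal (gram w) * f (par w) \<partial>lborel)"
proof -
  have sets[measurable_cong]: "sets \<mu> = sets borel" using \<mu> by (simp add: is_area_measure_def)
  define p0 where "p0 w = indicator B w *\<^sub>R par w" for w
  have [measurable]: "p0 \<in> borel_measurable borel"
    unfolding p0_def by (rule borel_measurable_continuous_on_indicator[OF B(1) continuous_on_subset[OF par_cont_Dom B(2)]])
  have [measurable]: "par ` B \<in> sets borel" "B \<in> sets borel" using par_image_borel B by auto
  let ?d = "\<lambda>w. ennreal (indicator B w * gram w)"
  have [measurable]: "?d \<in> borel_measurable borel" using gram_measurable[OF B] by measurable
  have "distr (density lborel ?d) borel p0 = density \<mu> (indicator (par ` B))"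
  proof (rule measure_eqI)
    fix X assume "X \<in> sets (distr (density lborel ?d) borel p0)"
    then have X[measurable]: "X \<in> sets borel" by simp
    define C where "C = B \<inter> p0 -` X"
    have C: "C \<in> sets borel" "C \<subseteq> Dom"
      using measurable_sets[of p0 borel borel X] B by (auto simp: C_def)
    have im: "par ` C = par ` B \<inter> X" by (auto simp: C_def p0_def)
    have "emeasure (distr (density lborel ?d) borel p0) X = (\<integral>\<^sup>+w\<in>p0 -` X. ?d w \<partial>lborel)"
      using measurable_sets[of p0 borel borel X]
      by (subst emeasure_distr) (use gram_measurable[OF B] in \<open>auto intro!: emeasure_density\<close>)
    also have "\<dots> = (\<integral>\<^sup>+w\<in>C. ennreal (gram w) \<partial>lborel)"
      by (intro nn_integral_cong) (auto simp: C_def indicator_def)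
    also have "\<dots> = emeasure \<mu> (par ` C)" using is_area_chart[OF \<mu> C] by simp
    also have "\<dots> = emeasure (density \<mu> (indicator (par ` B))) X"
      unfolding im by (subst emeasure_density) (auto simp: nn_integral_indicator sets simp flip: indicator_inter_arith)
    finally show "emeasure (distr (density lborel ?d) borel p0) X = emeasure (density \<mu> (indicator (par ` B))) X" .
  qed (simp add: sets)
  then have "nn_integral (density \<mu> (indicator (par ` B))) f = nn_integral (distr (density lborel ?d) borel p0) f" by simp
  also have "\<dots> = (\<integral>\<^sup>+w. ?d w * f (p0 w) \<partial>lborel)"
    by (subst nn_integral_distr, simp, simp, subst nn_integral_density) (use gram_measurable[OF B] in auto)
  also have "\<dots> = (\<integral>\<^sup>+w\<in>B. ennreal (gram w) * f (par w) \<partial>lborel)"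
    by (intro nn_integral_cong) (auto simp: indicator_def p0_def)
  finally show ?thesis by (subst (asm) nn_integral_density) (auto simp: mult.commute)
qed

end

text \<open>Charts of the ambient space make the transition map \<tau> differentiable also at
  boundary parameters. With a common unit normal adjoined, the first parametrisation factors through
  the second and the derivative of \<tau>, so the Gram densities differ by the Jacobian of
  \<tau>.\<close>

lemma gram_chart_change:
  assumes c1: "chart S W1 U1 V1 \<psi>1 g1" and c2: "chart S W2 U2 V2 \<psi>2 g2"
    and B1: "B1 \<in> sets borel" "B1 \<subseteq> chart.Dom W1 V1" and B2: "B2 \<in> sets borel" "B2 \<subseteq> chart.Dom W2 V2"
    and eq: "chart.par g1 ` B1 = chart.par g2 ` B2"
    and normal: "\<And>p. p \<in> S \<Longrightarrow> \<exists>u. norm u = 1 \<and> (\<forall>v\<in>tangent_space S p. v \<bullet> u = 0)"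
  shows "(\<integral>\<^sup>+w\<in>B1. ennreal (gram_jacobian (chart.par g1) w) \<partial>lborel) = (\<integral>\<^sup>+w\<in>B2. ennreal (gram_jacobian (chart.par g2) w) \<partial>lborel)"
proof -
  interpret a: chart S W1 U1 V1 \<psi>1 g1 by fact
  interpret b: chart S W2 U2 V2 \<psi>2 g2 by fact
  define \<tau> where "\<tau> w = fst (\<psi>2 (a.par w))" for w
  define \<tau>' where "\<tau>' w v = fst (b.\<psi>' (a.par w) (a.g' (w, 0) (v, 0)))" for w v
  have in2: "a.par w \<in> S" "a.par w \<in> U2" "(w, 0) \<in> V1" if "w \<in> B1" for w
  proof -
    have "a.par w \<in> b.par ` B2" using that eq by blast
    then show "a.par w \<in> S" "a.par w \<in> U2" using b.par_in B2(2) by auto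
    show "(w, 0) \<in> V1" using that B1(2) by (auto simp: a.Dom_def)
  qed
  have par\<tau>: "b.par (\<tau> w) = a.par w" if "w \<in> B1" for w
    using b.par_fst_\<psi> in2[OF that] by (simp add: \<tau>_def)
  have der: "(\<tau> has_derivative \<tau>' w) (at w)" if "w \<in> B1" for w
    unfolding \<tau>_def[abs_def] \<tau>'_def[abs_def]
    by (rule has_derivative_fst[OF has_derivative_compose[OF a.par_der b.der_\<psi>]]) (use in2[OF that] in auto)
  have linT: "linear (\<tau>' w)" if "w \<in> B1" for w using der[OF that] has_derivative_linear by blast
  have im: "\<tau> ` B1 = B2"
  proof
    show "\<tau> ` B1 \<subseteq> B2"
    proof
      fix z assume "z \<in> \<tau> ` B1"
      then obtain w where w: "w \<in> B1" "z = \<tau> w" by blast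
      then obtain w2 where "w2 \<in> B2" "a.par w = b.par w2" using eq by blast
      then show "z \<in> B2" using w b.\<psi>_par[of w2] B2(2) by (auto simp: \<tau>_def b.Dom_def)
    qed
    show "B2 \<subseteq> \<tau> ` B1"
    proof
      fix w2 assume w2: "w2 \<in> B2"
      then obtain w where w: "w \<in> B1" "a.par w = b.par w2" using eq by (metis imageE imageI)
      then have "\<tau> w = w2" using w2 b.\<psi>_par[of w2] B2(2) by (auto simp: \<tau>_def b.Dom_def)
      then show "w2 \<in> \<tau> ` B1" using w by blast
    qed
  qed
  have inj: "inj_on \<tau> B1"
    using par\<tau> a.par_inj B1(2) unfolding inj_on_def by (metis subsetD)
  have cont: "continuous_on B1 (\<lambda>w. \<tau>' w v)" for v
    unfolding \<tau>'_def
  proof (rule continuous_on_fst, rule continuous_on_linear_family[where L = "\<lambda>w. b.\<psi>' (a.par w)"])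
    show "continuous_on B1 (\<lambda>w. b.\<psi>' (a.par w) v)" for v
      by (rule continuous_on_compose2[OF C2_continuous_derivative[OF b.C2_\<psi>] continuous_on_subset[OF a.par_cont_Dom B1(2)]])
         (use in2 in auto)
    show "linear (b.\<psi>' (a.par w))" if "w \<in> B1" for w using in2[OF that] b.linear_\<psi>' by blast
    show "continuous_on B1 (\<lambda>w. a.g' (w, 0) (v, 0))"
      by (rule continuous_on_subset[OF a.par'_cont]) (use in2 in auto)
  qed
  have meas: "(\<lambda>w. jac (\<tau>' w) * indicator B1 w) \<in> borel_measurable borel"
    using borel_measurable_continuous_on_indicator[OF B1(1) continuous_on_jac[OF cont]] by (simp add: mult.commute)
  have gram: "a.gram w = jac (\<tau>' w) * b.gram (\<tau> w)" if w: "w \<in> B1" for w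
  proof -
    obtain u where u: "norm u = 1" "\<And>v. v \<in> tangent_space S (a.par w) \<Longrightarrow> v \<bullet> u = 0"
      using normal in2(1)[OF w] by blast
    have aU: "a.par w \<in> U1" using a.par_in B1(2) w by blast
    have T: "a.Tan (a.par w) = b.Tan (a.par w)" "b.Tan (a.par w) = tangent_space S (a.par w)"
      using tangent_space_eq_Tan[OF c1 in2(1)[OF w] aU] tangent_space_eq_Tan[OF c2 in2(1)[OF w] in2(2)[OF w]] by auto
    have \<psi>2: "\<psi>2 (a.par w) = (\<tau> w, 0)"
      using b.in_S_iff[OF in2(2)[OF w]] in2(1)[OF w] by (simp add: \<tau>_def prod_eq_iff)
    have \<tau>V: "(\<tau> w, 0) \<in> V2" using b.\<psi>_in[OF in2(2)[OF w]] by (simp add: \<psi>2)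
    have lin: "a.g' (w, 0) (v, 0) = b.g' (\<tau> w, 0) (\<tau>' w v, 0)" for v
    proof -
      have "a.g' (w, 0) (v, 0) \<in> b.Tan (a.par w)"
        unfolding T(1)[symmetric] a.Tan_iff[OF aU] using a.\<psi>_par[OF in2(3)[OF w]] by auto
      then have "b.\<psi>' (a.par w) (a.g' (w, 0) (v, 0)) = (\<tau>' w v, 0)" by (simp add: b.Tan_def \<tau>'_def prod_eq_iff)
      then show ?thesis using b.g'_\<psi>'[OF in2(2)[OF w], of "a.g' (w, 0) (v, 0)"] by (simp add: \<psi>2)
    qed
    let ?R1 = "\<lambda>(v, s). a.g' (w, 0) (v, 0) + s *\<^sub>R u" and ?R2 = "\<lambda>(v, s). b.g' (\<tau> w, 0) (v, 0) + s *\<^sub>R u"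
      and ?P = "\<lambda>(v, s :: real). (\<tau>' w v, 1 * s)"
    have lP: "linear ?P" by (intro linearI) (auto simp: linear_add[OF linT[OF w]] linear_scale[OF linT[OF w]])
    have lR: "linear ?R2"
    proof (intro linearI)
      note l = linear_add[OF b.linear_g'[OF \<tau>V]] linear_scale[OF b.linear_g'[OF \<tau>V]]
      show "?R2 (x + y) = ?R2 x + ?R2 y" for x y
        using l(1)[of "(fst x, 0)" "(fst y, 0)"] by (simp add: case_prod_beta algebra_simps)
      show "?R2 (c *\<^sub>R x) = c *\<^sub>R ?R2 x" for c x
        using l(2)[of c "(fst x, 0)"] by (simp add: case_prod_beta algebra_simps)
    qed
    have "?R1 = ?R2 \<circ> ?P" by (auto simp: fun_eq_iff lin)
    then have "jac ?R1 = jac ?R2 * jac ?P" using jac_compose[OF lR lP] by simp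
    also have "jac ?P = jac (\<tau>' w)" by (subst jac_prod[OF linT[OF w]]) simp
    moreover have "a.gram w = jac ?R1"
      by (rule a.gram_eq_jac[OF in2(3)[OF w] u(1)]) (use u(2) T in auto)
    moreover have "b.gram (\<tau> w) = jac ?R2"
      by (rule b.gram_eq_jac[OF \<tau>V u(1)]) (use u(2) T par\<tau>[OF w] in auto)
    ultimately show ?thesis by simp
  qed
  let ?f = "\<lambda>w. ennreal (indicator B2 w * b.gram w)"
  have "(\<integral>\<^sup>+w\<in>B2. ennreal (b.gram w) \<partial>lborel) = (\<integral>\<^sup>+w\<in>\<tau> ` B1. ?f w \<partial>lborel)"
    unfolding im by (intro nn_integral_cong) (auto simp: indicator_def)
  also have "\<dots> = (\<integral>\<^sup>+w\<in>B1. ennreal (jac (\<tau>' w)) * ?f (\<tau> w) \<partial>lborel)"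
  proof (rule nn_integral_differentiable_image[OF B1(1) inj _ meas])
    show "(\<tau> has_derivative \<tau>' w) (at w within B1)" if "w \<in> B1" for w using der[OF that] has_derivative_at_withinI by blast
    show "\<tau> ` B1 \<in> sets borel" using im B2 by simp
    show "?f \<in> borel_measurable borel" using b.gram_measurable[OF B2] by measurable
  qed
  also have "\<dots> = (\<integral>\<^sup>+w\<in>B1. ennreal (a.gram w) \<partial>lborel)"
    using im by (intro nn_integral_cong) (auto simp: indicator_def gram ennreal_mult')
  finally show ?thesis by simp
qed

section \<open>Existence, uniqueness and finiteness of the area of a compact surface\<close>

locale compact_surface = surface S \<nu> for S :: "'n::finite ambient set" and \<nu> +
  assumes compact_S: "compact S"
begin

lemma exists_unit_normal: "p \<in> S \<Longrightarrow> \<exists>u. norm u = 1 \<and> (\<forall>v\<in>tangent_space S p. v \<bullet> u = 0)"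
  using norm_\<nu> normal_\<nu> by (intro exI[of _ "\<nu> p"]) (auto simp: inner_commute)

lemma S_borel: "S \<in> sets borel" using compact_S by (simp add: borel_compact)

text \<open>Compactness gives finitely many neighbourhoods, each within one chart and carrying one
  extended normal; subtracting the earlier ones makes them disjoint. Integrals over S are computed
  on such pieces.\<close>

lemma exists_partition:
  obtains N :: nat and W U V \<psi> g B n n' \<rho> a A where
    "\<forall>k<N. chart S (W k) (U k) (V k) (\<psi> k) (g k)"
    "\<forall>k<N. normal_ext S \<nu> (B k) (n k) (n' k) (\<rho> k) (a k)"
    "\<forall>k<N. A k \<in> sets borel \<and> A k \<subseteq> S \<inter> U k \<inter> B k"
    "disjoint_family_on A {..<N}" "S = (\<Union>k<N. A k)"
proof -
  have "\<forall>p\<in>S. \<exists>W U V \<psi> g B n n' \<rho> a. chart S W U V \<psi> g \<and> normal_ext S \<nu> B n n' \<rho> a \<and> p \<in> B \<and> B \<subseteq> U"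
  proof
    fix p assume p: "p \<in> S"
    obtain W U V \<psi> g where c: "chart S W U V \<psi> g" "p \<in> U" using exists_chart p by blast
    obtain B n n' \<rho> a where "normal_ext S \<nu> B n n' \<rho> a" "p \<in> B" "B \<subseteq> U"
      by (rule exists_normal_ext[OF c(1) p c(2)])
    then show "\<exists>W U V \<psi> g B n n' \<rho> a. chart S W U V \<psi> g \<and> normal_ext S \<nu> B n n' \<rho> a \<and> p \<in> B \<and> B \<subseteq> U"
      using c by blast
  qed
  then obtain W U V \<psi> g B n n' \<rho> a where c: "\<And>p. p \<in> S \<Longrightarrow> chart S (W p) (U p) (V p) (\<psi> p) (g p)"
      "\<And>p. p \<in> S \<Longrightarrow> normal_ext S \<nu> (B p) (n p) (n' p) (\<rho> p) (a p)" "\<And>p. p \<in> S \<Longrightarrow> p \<in> B p \<and> B p \<subseteq> U p"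
    by metis
  have oB: "open (B p)" if "p \<in> S" for p using c(2)[OF that] by (simp add: normal_ext_def)
  obtain P where P: "P \<subseteq> S" "finite P" "S \<subseteq> (\<Union>p\<in>P. B p)"
    using compactE_image[OF compact_S, of S B] oB c(3) by blast
  obtain ps where ps: "set ps = P" using P(2) finite_list by blast
  define N where "N = length ps"
  define A where "A k = S \<inter> B (ps ! k) - (\<Union>j<k. B (ps ! j))" for k
  have inS: "ps ! k \<in> S" if "k < N" for k using that ps P(1) nth_mem by (fastforce simp: N_def)
  have "A k \<in> sets borel \<and> A k \<subseteq> S \<inter> U (ps ! k) \<inter> B (ps ! k)" if "k < N" for k
  proof
    have "B (ps ! j) \<in> sets borel" if "j \<le> k" for j using oB inS \<open>k < N\<close> that by (simp add: borel_open)
    then show "A k \<in> sets borel" unfolding A_def using S_borel by (intro sets.Diff sets.Int sets.finite_UN) auto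
    show "A k \<subseteq> S \<inter> U (ps ! k) \<inter> B (ps ! k)" using c(3)[OF inS[OF that]] by (auto simp: A_def)
  qed
  moreover have "disjoint_family_on A {..<N}"
    unfolding disjoint_family_on_def
  proof (intro ballI impI)
    fix i j :: nat assume "i \<noteq> j"
    then consider "i < j" | "j < i" by linarith
    then show "A i \<inter> A j = {}" by cases (auto simp: A_def)
  qed
  moreover have "S = (\<Union>k<N. A k)"
  proof
    show "S \<subseteq> (\<Union>k<N. A k)"
    proof
      fix x assume x: "x \<in> S"
      then obtain p where "p \<in> P" "x \<in> B p" using P(3) by blast
      then obtain k where k: "k < N" "x \<in> B (ps ! k)" using ps by (metis N_def in_set_conv_nth)
      define m where "m = (LEAST k. x \<in> B (ps ! k))"
      have "x \<in> B (ps ! m)" "m \<le> k" "\<And>j. j < m \<Longrightarrow> x \<notin> B (ps ! j)"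
        unfolding m_def using k(2) by (auto intro: LeastI Least_le dest: not_less_Least)
      then show "x \<in> (\<Union>k<N. A k)" using x k(1) by (auto simp: A_def intro!: bexI[of _ m])
    qed
  qed (auto simp: A_def)
  ultimately show ?thesis
    by (intro that[of N "\<lambda>k. W (ps ! k)" "\<lambda>k. U (ps ! k)" "\<lambda>k. V (ps ! k)" "\<lambda>k. \<psi> (ps ! k)" "\<lambda>k. g (ps ! k)"
      "\<lambda>k. B (ps ! k)" "\<lambda>k. n (ps ! k)" "\<lambda>k. n' (ps ! k)" "\<lambda>k. \<rho> (ps ! k)" "\<lambda>k. a (ps ! k)" A])
      (use c(1,2) inS in auto)
qed

text \<open>The measure is glued from the chart densities on a partition; that it has the right
  density in every other chart is \<open>gram_chart_change\<close>.\<close>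

lemma area_measure_exists: "\<exists>\<mu>. is_area_measure S \<mu>"
proof -
  obtain N :: nat and W U V \<psi> g B n n' \<rho> a A where part0:
    "\<forall>k<N. chart S (W k) (U k) (V k) (\<psi> k) (g k)"
    "\<forall>k<N. normal_ext S \<nu> (B k) (n k) (n' k) (\<rho> k) (a k)"
    "\<forall>k<N. A k \<in> sets borel \<and> A k \<subseteq> S \<inter> U k \<inter> B k"
    "disjoint_family_on A {..<N}" "S = (\<Union>k<N. A k)" by (rule exists_partition) (rule that)
  note part = part0(1)[rule_format] part0(2)[rule_format] part0(3)[rule_format] part0(4,5)
  define D where "D k = chart.Dom (W k) (V k)" for k
  define r where "r k = chart.par (g k)" for k
  define G where "G k = gram_jacobian (r k)" for k
  define P where "P k = {w \<in> D k. r k w \<in> A k}" for k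
  have Pb: "P k \<in> sets borel" if "k < N" for k
    unfolding P_def D_def r_def using chart.par_preimage_borel[OF part(1)[OF that]] part(3)[OF that] by blast
  have PD: "P k \<subseteq> D k" for k by (auto simp: P_def)
  define r0 where "r0 k w = indicator (P k) w *\<^sub>R r k w" for k w
  \<comment> \<open>Beyond N a placeholder with the Borel sigma-algebra, so that
    \<open>setsM\<close> holds for all k.\<close>
  define M where "M k = (if k < N then distr (density lborel (\<lambda>w. ennreal (indicator (P k) w * G k w))) borel (r0 k) else borel)" for k
  have setsM: "sets (M k) = sets borel" for k by (simp add: M_def)
  have gm: "(\<lambda>w. indicator (P k) w * G k w) \<in> borel_measurable borel" if "k < N" for k
    using chart.gram_measurable[OF part(1)[OF that] Pb[OF that]] PD unfolding G_def D_def r_def by blast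
  have r0m: "r0 k \<in> borel_measurable borel" if "k < N" for k
    unfolding r0_def using chart.par_cont_Dom[OF part(1)[OF that]] Pb[OF that] PD[of k]
    by (intro borel_measurable_continuous_on_indicator) (auto simp: D_def r_def intro: continuous_on_subset)
  have M: "emeasure (M k) X = (\<integral>\<^sup>+w\<in>{w \<in> P k. r k w \<in> X}. ennreal (G k w) \<partial>lborel)"
    if "k < N" "X \<in> sets borel" for k X
  proof -
    have "emeasure (M k) X = (\<integral>\<^sup>+w\<in>r0 k -` X. ennreal (indicator (P k) w * G k w) \<partial>lborel)"
      using that measurable_sets[OF r0m[OF that(1)] that(2)] r0m[OF that(1)] gm[OF that(1)]
      by (simp add: M_def emeasure_distr emeasure_density)
    also have "\<dots> = (\<integral>\<^sup>+w\<in>{w \<in> P k. r k w \<in> X}. ennreal (G k w) \<partial>lborel)"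
      by (intro nn_integral_cong) (auto simp: indicator_def r0_def)
    finally show ?thesis .
  qed
  obtain \<mu> where \<mu>0: "sets \<mu> = sets borel" "\<forall>X\<in>sets borel. emeasure \<mu> X = (\<Sum>k<N. emeasure (M k) X)"
    using finite_sum_of_measures[of M N] setsM by blast
  note \<mu> = \<mu>0(1) \<mu>0(2)[rule_format]
  have "is_area_measure S \<mu>"
    unfolding is_area_measure_def
  proof (intro conjI allI impI)
    show "sets \<mu> = sets borel" by fact
    have "emeasure (M k) (- S) = 0" if "k < N" for k
    proof -
      have "{w \<in> P k. r k w \<in> - S} = {}" using part(3)[OF that] by (auto simp: P_def)
      then show ?thesis using M[OF that, of "- S"] S_borel by simp
    qed
    then show "emeasure \<mu> (- S) = 0" using \<mu>(2)[of "- S"] S_borel by simp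
  next
    fix W' U' V' \<psi>2 g2 C
    assume c: "adapted_chart S W' U' V' \<psi>2 g2" and C: "C \<in> sets borel" "C \<subseteq> W'" "C \<times> {0} \<subseteq> V'"
    interpret c: chart S W' U' V' \<psi>2 g2 by unfold_locales fact
    have CD: "C \<subseteq> c.Dom" using C by (auto simp: c.Dom_def)
    define C' where "C' k = {w \<in> C. c.par w \<in> A k}" for k
    have C'b: "C' k \<in> sets borel" if "k < N" for k
    proof -
      have "{w \<in> c.Dom. c.par w \<in> A k} \<in> sets borel" using c.par_preimage_borel part(3)[OF that] by blast
      moreover have "C' k = C \<inter> {w \<in> c.Dom. c.par w \<in> A k}" using CD by (auto simp: C'_def)
      ultimately show ?thesis using C(1) by simp
    qed
    have C'D: "C' k \<subseteq> c.Dom" for k using CD by (auto simp: C'_def)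
    have imb: "c.par ` C \<in> sets borel" by (rule c.par_image_borel[OF C(1) CD])
    have piece: "emeasure (M k) (c.par ` C) = (\<integral>\<^sup>+w\<in>C' k. ennreal (c.gram w) \<partial>lborel)" if k: "k < N" for k
    proof -
      interpret d: chart S "W k" "U k" "V k" "\<psi> k" "g k" by (rule part(1)[OF k])
      let ?Q = "{w \<in> P k. r k w \<in> c.par ` C}"
      have "(\<integral>\<^sup>+w\<in>?Q. ennreal (d.gram w) \<partial>lborel) = (\<integral>\<^sup>+w\<in>C' k. ennreal (c.gram w) \<partial>lborel)"
      proof (rule gram_chart_change[OF d.chart_axioms c.chart_axioms _ _ C'b[OF k] C'D _ exists_unit_normal])
        have "?Q = P k \<inter> {w \<in> d.Dom. d.par w \<in> c.par ` C}" using PD[of k] by (auto simp: D_def r_def)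
        then show "?Q \<in> sets borel" using Pb[OF k] d.par_preimage_borel[OF imb] by simp
        show "?Q \<subseteq> d.Dom" using PD[of k] by (auto simp: D_def)
        have "d.par ` P k = A k"
          unfolding P_def D_def r_def using part(3)[OF k] by (intro d.par_image_preimage) auto
        moreover have "d.par ` ?Q = d.par ` P k \<inter> c.par ` C" unfolding r_def by blast
        moreover have "c.par ` C' k = A k \<inter> c.par ` C" unfolding C'_def by blast
        ultimately show "d.par ` ?Q = c.par ` C' k" by simp
      qed
      then show ?thesis using M[OF k imb] by (simp add: G_def r_def)
    qed
    have "(\<Sum>k<N. \<integral>\<^sup>+w\<in>C' k. ennreal (c.gram w) \<partial>lborel) = (\<integral>\<^sup>+w. (\<Sum>k<N. ennreal (indicator C w * c.gram w) * indicator (C' k) w) \<partial>lborel)"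
    proof (subst nn_integral_sum)
      fix k assume "k \<in> {..<N}"
      then have [measurable]: "C' k \<in> sets borel" using C'b[of k] by simp
      have [measurable]: "(\<lambda>w. indicator C w * c.gram w) \<in> borel_measurable borel"
        by (rule c.gram_measurable[OF C(1) CD])
      show "(\<lambda>w. ennreal (indicator C w * c.gram w) * indicator (C' k) w) \<in> borel_measurable lborel"
        by measurable
    next
      show "(\<Sum>k<N. \<integral>\<^sup>+w\<in>C' k. ennreal (c.gram w) \<partial>lborel) = (\<Sum>k<N. \<integral>\<^sup>+w\<in>C' k. ennreal (indicator C w * c.gram w) \<partial>lborel)"
        by (intro sum.cong refl nn_integral_cong) (auto simp: C'_def indicator_def)
    qed
    also have "\<dots> = (\<integral>\<^sup>+w\<in>C. ennreal (c.gram w) \<partial>lborel)"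
    proof (intro nn_integral_cong)
      fix w
      show "(\<Sum>k<N. ennreal (indicator C w * c.gram w) * indicator (C' k) w) = ennreal (c.gram w) * indicator C w"
      proof (cases "w \<in> C")
        case True
        then obtain k where k: "k < N" "c.par w \<in> A k" using c.par_in CD part(5) by blast
        have "indicator (C' j) w = (if j = k then 1 else (0 :: ennreal))" if "j < N" for j
          using that k part(4) True by (auto simp: C'_def indicator_def disjoint_family_on_def)
        then have "(\<Sum>j<N. ennreal (indicator C w * c.gram w) * indicator (C' j) w) =
            (\<Sum>j<N. ennreal (indicator C w * c.gram w) * (if j = k then 1 else 0))" by (intro sum.cong) auto
        then show ?thesis using k True by (simp add: if_distrib cong: if_cong)
      qed (auto simp: C'_def)
    qed
    finally show "emeasure \<mu> ((\<lambda>y. g2 (y, 0)) ` C) = (\<integral>\<^sup>+y\<in>C. ennreal (gram_jacobian (\<lambda>y. g2 (y, 0)) y) \<partial>lborel)"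
      using \<mu>(2)[OF imb] piece by (simp add: c.par_def[abs_def])
  qed
  then show ?thesis by blast
qed

text \<open>Concentration on S and the densities in the charts of one partition already determine
  the measure of every Borel set.\<close>

lemma area_measure_unique:
  assumes \<mu>1: "is_area_measure S \<mu>1" and \<mu>2: "is_area_measure S \<mu>2"
  shows "\<mu>1 = \<mu>2"
proof -
  obtain N :: nat and W U V \<psi> g B n n' \<rho> a A where part0:
    "\<forall>k<N. chart S (W k) (U k) (V k) (\<psi> k) (g k)"
    "\<forall>k<N. normal_ext S \<nu> (B k) (n k) (n' k) (\<rho> k) (a k)"
    "\<forall>k<N. A k \<in> sets borel \<and> A k \<subseteq> S \<inter> U k \<inter> B k"
    "disjoint_family_on A {..<N}" "S = (\<Union>k<N. A k)" by (rule exists_partition) (rule that)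
  note part = part0(1)[rule_format] part0(2)[rule_format] part0(3)[rule_format] part0(4,5)
  have eq: "emeasure \<mu> X = (\<Sum>k<N. \<integral>\<^sup>+w\<in>{w \<in> chart.Dom (W k) (V k). chart.par (g k) w \<in> X \<inter> A k}.
        ennreal (gram_jacobian (chart.par (g k)) w) \<partial>lborel)"
    if \<mu>: "is_area_measure S \<mu>" and X: "X \<in> sets borel" for \<mu> X
  proof -
    have sets: "sets \<mu> = sets borel" and null: "emeasure \<mu> (- S) = 0" using \<mu> by (auto simp: is_area_measure_def)
    have "emeasure \<mu> X = emeasure \<mu> (X \<inter> S)"
    proof -
      have "X = (X \<inter> S) \<union> (X - S)" by auto
      moreover have "emeasure \<mu> (X - S) = 0"
        using emeasure_mono[of "X - S" "- S" \<mu>] null sets S_borel by auto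
      then have "X - S \<in> null_sets \<mu>" using X S_borel sets by (auto simp: null_sets_def)
      ultimately show ?thesis using emeasure_Un_null_set[of "X \<inter> S" \<mu> "X - S"] X S_borel sets by auto
    qed
    also have "X \<inter> S = (\<Union>k<N. X \<inter> A k)" using part(5) by auto
    also have "emeasure \<mu> \<dots> = (\<Sum>k<N. emeasure \<mu> (X \<inter> A k))"
    proof (rule sum_emeasure[symmetric])
      show "(\<lambda>k. X \<inter> A k) ` {..<N} \<subseteq> sets \<mu>" using part(3) X sets by auto
      show "disjoint_family_on (\<lambda>k. X \<inter> A k) {..<N}" using part(4) by (auto simp: disjoint_family_on_def)
    qed simp
    also have "\<dots> = (\<Sum>k<N. \<integral>\<^sup>+w\<in>{w \<in> chart.Dom (W k) (V k). chart.par (g k) w \<in> X \<inter> A k}.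
        ennreal (gram_jacobian (chart.par (g k)) w) \<partial>lborel)"
    proof (intro sum.cong refl)
      fix k assume "k \<in> {..<N}"
      then have k: "k < N" by simp
      interpret c: chart S "W k" "U k" "V k" "\<psi> k" "g k" by (rule part(1)[OF k])
      have "c.par ` {w \<in> c.Dom. c.par w \<in> X \<inter> A k} = X \<inter> A k"
        using part(3)[OF k] by (intro c.par_image_preimage) auto
      moreover have "X \<inter> A k \<in> sets borel" using X part(3)[OF k] by auto
      ultimately show "emeasure \<mu> (X \<inter> A k) = (\<integral>\<^sup>+w\<in>{w \<in> c.Dom. c.par w \<in> X \<inter> A k}. ennreal (c.gram w) \<partial>lborel)"
        using c.is_area_chart[OF \<mu> c.par_preimage_borel[of "X \<inter> A k"]] by auto
    qed
    finally show ?thesis .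
  qed
  have sets: "sets \<mu>1 = sets borel" "sets \<mu>2 = sets borel" using assms by (auto simp: is_area_measure_def)
  show ?thesis
    by (rule measure_eqI) (use sets eq[OF \<mu>1] eq[OF \<mu>2] in auto)
qed

lemma is_area_measure: "is_area_measure S (area_measure S)"
  unfolding area_measure_def
  using area_measure_exists area_measure_unique by (metis theI)

abbreviation "\<mu> \<equiv> area_measure S"

lemma sets_\<mu> [simp, measurable_cong]: "sets \<mu> = sets borel"
  using is_area_measure by (simp add: is_area_measure_def)

lemma finite_area: "emeasure \<mu> S < \<infinity>"
proof -
  have "\<forall>p\<in>S. \<exists>O'. open O' \<and> p \<in> O' \<and> emeasure \<mu> (S \<inter> O') < \<infinity>"
  proof
    fix p assume p: "p \<in> S"
    obtain W U V \<psi> g where c: "chart S W U V \<psi> g" "p \<in> U" using exists_chart p by blast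
    interpret chart S W U V \<psi> g by fact
    let ?w = "fst (\<psi> p)"
    have w: "?w \<in> Dom" "par ?w = p" using par_fst_\<psi>[OF p c(2)] by auto
    obtain r where r: "r > 0" "cball ?w r \<subseteq> {w. (w, 0) \<in> V}"
      using open_V0 w(1) open_contains_cball by (metis (mono_tags, lifting) Dom_def mem_Collect_eq)
    let ?B = "cball ?w r \<inter> W"
    have B: "?B \<in> sets borel" "?B \<subseteq> Dom" using closed_W r by (auto simp: borel_closed Dom_def)
    have "compact (gram ` cball ?w r)"
      by (intro compact_continuous_image continuous_on_subset[OF gram_cont r(2)] compact_cball)
    then have "bounded (gram ` cball ?w r)" by (rule compact_imp_bounded)
    then obtain C where "\<forall>x\<in>gram ` cball ?w r. norm x \<le> C" unfolding bounded_iff by blast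
    then have C: "\<bar>gram x\<bar> \<le> C" if "x \<in> cball ?w r" for x using that by auto
    let ?O = "U \<inter> \<psi> -` (ball ?w r \<times> UNIV)"
    have "open ?O"
      using continuous_open_preimage[OF cont_\<psi> open_U, of "ball ?w r \<times> UNIV"] by (simp add: open_Times)
    moreover have "p \<in> ?O" using c(2) r(1) by (auto simp: mem_Times_iff)
    moreover have "emeasure \<mu> (S \<inter> ?O) < \<infinity>"
    proof -
      have "S \<inter> ?O \<subseteq> par ` ?B"
      proof
        fix x assume x: "x \<in> S \<inter> ?O"
        then have "fst (\<psi> x) \<in> ?B" "x = par (fst (\<psi> x))"
          using par_fst_\<psi>[of x] by (auto simp: Dom_def mem_Times_iff)
        then show "x \<in> par ` ?B" by blast
      qed
      then have "emeasure \<mu> (S \<inter> ?O) \<le> emeasure \<mu> (par ` ?B)"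
        using par_image_borel[OF B] by (intro emeasure_mono) auto
      also have "\<dots> = (\<integral>\<^sup>+w\<in>?B. ennreal (gram w) \<partial>lborel)" by (rule is_area_chart[OF is_area_measure B])
      also have "\<dots> \<le> (\<integral>\<^sup>+w. ennreal C * indicator (cball ?w r) w \<partial>lborel)"
        using C by (intro nn_integral_mono) (auto simp: indicator_def intro!: ennreal_leI dest: order_trans[OF abs_ge_self])
      also have "\<dots> < \<infinity>"
        using emeasure_lborel_cball_finite[of ?w r] by (simp add: nn_integral_cmult_indicator ennreal_mult_less_top)
      finally show ?thesis .
    qed
    ultimately show "\<exists>O'. open O' \<and> p \<in> O' \<and> emeasure \<mu> (S \<inter> O') < \<infinity>" by blast
  qed
  then obtain Q where Q: "\<And>p. p \<in> S \<Longrightarrow> open (Q p) \<and> p \<in> Q p \<and> emeasure \<mu> (S \<inter> Q p) < \<infinity>" by metis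
  obtain P where P: "P \<subseteq> S" "finite P" "S \<subseteq> (\<Union>p\<in>P. Q p)"
    using compactE_image[OF compact_S, of S Q] Q by blast
  have "emeasure \<mu> S \<le> emeasure \<mu> (\<Union>p\<in>P. S \<inter> Q p)"
    using P Q S_borel by (intro emeasure_mono sets.finite_UN) (auto simp: borel_open)
  also have "\<dots> \<le> (\<Sum>p\<in>P. emeasure \<mu> (S \<inter> Q p))"
    using P Q S_borel by (intro emeasure_subadditive_finite) (auto simp: borel_open)
  also have "\<dots> < \<infinity>" using P Q by (auto simp: less_top[symmetric])
  finally show ?thesis .
qed

text \<open>Serves to turn a strict inequality at one point into a strict inequality of integrals.
  The density is positive because the derivative of the parametrisation, with the normal adjoined,
  is injective.\<close>

lemma open_piece_positive:
  assumes p: "p \<in> S" "p \<in> Q" "open Q"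
  shows "emeasure \<mu> (S \<inter> Q) > 0"
proof (rule ccontr)
  assume "\<not> ?thesis"
  then have z: "emeasure \<mu> (S \<inter> Q) = 0" by simp
  obtain W U V \<psi> g where c: "chart S W U V \<psi> g" "p \<in> U" using exists_chart p by blast
  interpret chart S W U V \<psi> g by fact
  let ?w = "fst (\<psi> p)"
  have w: "?w \<in> Dom" "par ?w = p" using par_fst_\<psi>[OF p(1) c(2)] by auto
  have "open {w \<in> {w. (w, 0) \<in> V}. par w \<in> Q}"
    using continuous_open_preimage[OF par_cont open_V0 p(3)] by (simp add: vimage_def Int_def)
  then obtain r where r: "r > 0" "ball ?w r \<subseteq> {w \<in> {w. (w, 0) \<in> V}. par w \<in> Q}"
    using w p(2) openE by (metis (mono_tags, lifting) Dom_def mem_Collect_eq)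
  obtain O1 where O1: "open O1" "O1 \<noteq> {}" "O1 \<subseteq> ball ?w r" "O1 \<subseteq> W"
  proof (cases rule: W_cases)
    case 1 then show ?thesis using that[of "ball ?w r"] r by auto
  next
    case (2 i)
    \<comment> \<open>The ball is cut down to the open half-space; moving half a radius inwards
      shows that something remains even at a boundary parameter.\<close>
    let ?O = "ball ?w r \<inter> {y. y $ i > 0}"
    have "?w $ i \<ge> 0" using w(1) 2 unfolding Dom_def model_half_def by blast
    then have "?w + (r / 2) *\<^sub>R axis i 1 \<in> ?O" using r(1) by (auto simp: dist_norm)
    moreover have "open ?O" by (intro open_Int open_ball open_Collect_less continuous_intros)
    moreover have "?O \<subseteq> W" unfolding 2 model_half_def by auto
    ultimately show ?thesis using that[of ?O] by blast
  qed
  have O1D: "O1 \<subseteq> Dom" using O1 r by (auto simp: Dom_def)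
  have O1b: "O1 \<in> sets borel" using O1 by simp
  have gp: "gram x > 0" if "x \<in> O1" for x
  proof -
    have xV: "(x, 0) \<in> V" "par x \<in> S" "par x \<in> U" using that O1D par_in by (auto simp: Dom_def)
    obtain u where u: "norm u = 1" "\<forall>v\<in>tangent_space S (par x). v \<bullet> u = 0" using exists_unit_normal xV by blast
    have T: "tangent_space S (par x) = Tan (par x)" by (rule tangent_space_eq_Tan[OF chart_axioms xV(2,3)])
    let ?R = "\<lambda>(v, s). g' (x, 0) (v, 0) + s *\<^sub>R u"
    note l = linear_g'[OF xV(1)]
    have lR: "linear ?R"
    proof (intro linearI)
      show "?R (x + y) = ?R x + ?R y" for x y
        using linear_add[OF l, of "(fst x, 0)" "(fst y, 0)"] by (simp add: case_prod_beta algebra_simps)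
      show "?R (c *\<^sub>R x) = c *\<^sub>R ?R x" for c x
        using linear_scale[OF l, of c "(fst x, 0)"] by (simp add: case_prod_beta algebra_simps)
    qed
    have inT: "g' (x, 0) (v, 0) \<in> Tan (par x)" for v using Tan_iff[OF xV(3)] \<psi>_par[OF xV(1)] by auto
    have "inj ?R"
      unfolding linear_injective_0[OF lR]
    proof (intro allI impI)
      fix y assume y: "?R y = 0"
      obtain v s where vs: "y = (v, s)" by fastforce
      have "?R y \<bullet> u = s" using u inT[of v] T by (simp add: vs inner_add_left dot_square_norm)
      then have "s = 0" using y by simp
      then have "g' (x, 0) (v, 0) = 0" using y vs by simp
      then have "(v, 0 :: real) = 0" using \<psi>'_g'[OF xV(3), of "(v, 0)"] \<psi>_par[OF xV(1)] linear_0[OF linear_\<psi>'[OF xV(3)]] by simp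
      then show "y = 0" using vs \<open>s = 0\<close> by simp
    qed
    then show ?thesis using gram_eq_jac[OF xV(1) u(1)] u(2) T jac_pos[OF lR] by auto
  qed
  have "par ` O1 \<subseteq> S \<inter> Q" using O1D par_in O1 r by blast
  then have "emeasure \<mu> (par ` O1) \<le> emeasure \<mu> (S \<inter> Q)" using S_borel p(3) by (intro emeasure_mono) auto
  then have "(\<integral>\<^sup>+x\<in>O1. ennreal (gram x) \<partial>lborel) = 0"
    using z is_area_chart[OF is_area_measure O1b O1D] by simp
  then have "(\<integral>\<^sup>+x. ennreal (indicator O1 x * gram x) \<partial>lborel) = 0"
    by (metis (no_types, lifting) ennreal_indicator ennreal_mult'' indicator_pos_le mult.commute nn_integral_cong)
  then have "AE x in lborel. ennreal (indicator O1 x * gram x) = 0"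
    using gram_measurable[OF O1b O1D] by (subst (asm) nn_integral_0_iff_AE) auto
  then have "AE x in lborel. x \<notin> O1"
    by (rule AE_mp) (auto simp: indicator_def ennreal_eq_0_iff dest!: gp intro!: AE_I2)
  then have "O1 \<in> null_sets lborel" using O1b by (simp add: AE_iff_null_sets)
  then show False using O1(1,2) by (meson completion.complete null_sets_completionI negligible_iff_null_sets open_not_negligible)
qed

end

section \<open>Volume of cones over the anisotropic Gauss image\<close>

locale capillary_surface = capillary F \<omega>0 + aniso_surface F S \<nu> + compact_surface S \<nu>
  for F :: "'n::finite ambient \<Rightarrow> real" and \<omega>0 and S :: "'n ambient set" and \<nu> :: "'n ambient \<Rightarrow> 'n ambient"
begin

text \<open>Point with normal \<open>\<nu> p\<close> on the unit Wulff shape about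
  \<open>shift\<close>.\<close>

definition "Nrm p = \<Phi> (\<nu> p) + shift"
text \<open>Distance from the origin to the tangent plane of that Wulff shape at
  \<open>Nrm p\<close>; it is the weight in \<open>willmore_integral\<close>.\<close>

definition "\<Theta> p = F (\<nu> p) + shift \<bullet> \<nu> p"
definition "gcone A = {t *\<^sub>R Nrm p | t p. 0 < t \<and> t < 1 \<and> p \<in> A}"

lemma Nrm_\<nu>: "p \<in> S \<Longrightarrow> Nrm p \<bullet> \<nu> p = \<Theta> p"
  using Phi_Euler[OF \<nu>_nz] by (simp add: Nrm_def \<Theta>_def inner_add_left)

lemma \<Theta>_pos: "p \<in> S \<Longrightarrow> \<Theta> p > 0"
  unfolding \<Theta>_def using F_shift_pos \<nu>_nz by blast

lemma cont_\<Theta>: "continuous_on S \<Theta>"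
  unfolding \<Theta>_def
  by (intro continuous_intros cont_\<nu> continuous_on_compose2[OF continuous_on_F cont_\<nu>]) (use \<nu>_nz in auto)

lemma K_nonneg': "p \<in> S \<Longrightarrow> K p \<ge> 0"
proof -
  assume p: "p \<in> S"
  obtain B n n' \<rho> a where "normal_ext S \<nu> B n n' \<rho> a" "p \<in> B" using exists_ext[OF p] by blast
  then show ?thesis using K_nonneg p by blast
qed

lemma cont_\<Theta>K: "continuous_on S (\<lambda>p. \<Theta> p * K p)"
  by (intro continuous_intros cont_\<Theta> continuous_on_K)

lemma meas_on_S: "continuous_on S f \<Longrightarrow> (\<lambda>p. indicator S p * f p) \<in> borel_measurable borel" for f :: "'n ambient \<Rightarrow> real"
  using borel_measurable_continuous_on_indicator[OF S_borel, of f] by simp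

lemma finite_integral:
  assumes "continuous_on S f" "A \<subseteq> S"
  shows "(\<integral>\<^sup>+p\<in>A. ennreal (f p) \<partial>\<mu>) < \<infinity>"
proof -
  have "bounded (f ` S)" using compact_continuous_image[OF assms(1) compact_S] compact_imp_bounded by blast
  then obtain C where "\<forall>x\<in>f ` S. norm x \<le> C" unfolding bounded_iff by blast
  then have C: "f p \<le> C" if "p \<in> S" for p using that by fastforce
  have "(\<integral>\<^sup>+p\<in>A. ennreal (f p) \<partial>\<mu>) \<le> (\<integral>\<^sup>+p. ennreal C * indicator S p \<partial>\<mu>)"
    using C assms(2) by (intro nn_integral_mono) (auto simp: indicator_def intro!: ennreal_leI)
  also have "\<dots> = ennreal C * emeasure \<mu> S" using S_borel by (simp add: nn_integral_cmult_indicator)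
  also have "\<dots> < \<infinity>" using finite_area by (simp add: ennreal_mult_less_top)
  finally show ?thesis .
qed

text \<open>Source of the constant 1 / (n + 1): the radial part of the cone Jacobian is t ^
  n.\<close>

lemma integral_power_unit: "(\<integral>\<^sup>+t\<in>{0<..<1::real}. ennreal (t ^ k) \<partial>lborel) = ennreal (1 / (real k + 1))"
proof -
  have "(\<integral>\<^sup>+t\<in>{0<..<1::real}. ennreal (t ^ k) \<partial>lborel) = (\<integral>\<^sup>+t. ennreal (t ^ k) * indicator {0..1} t \<partial>lborel)"
    by (intro nn_integral_cong_AE, use AE_lborel_singleton[of 0] AE_lborel_singleton[of 1] in eventually_elim)
       (auto simp: indicator_def)
  also have "\<dots> = ennreal (1 ^ Suc k / (real k + 1) - 0 ^ Suc k / (real k + 1))"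
  proof (rule nn_integral_FTC_Icc)
    show "DERIV (\<lambda>t. t ^ Suc k / (real k + 1)) x :> x ^ k" for x :: real
    proof -
      have "real k + 1 \<noteq> 0" by auto
      then show ?thesis by (auto intro!: derivative_eq_intros simp del: power_Suc simp: add.commute[of 1])
    qed
  qed auto
  finally show ?thesis by simp
qed

text \<open>The cone is the image of (w, t) \<mapsto> t Nrm (par w), to which the change of
  variables formulas apply. Different surface points may have the same normal, so equality is
  claimed under injectivity only.\<close>

lemma cone_piece:
  assumes c: "chart S W U V \<psi> g" and ext: "normal_ext S \<nu> B n n' \<rho> a"
    and A: "A \<in> sets borel" "A \<subseteq> S \<inter> U \<inter> B"
  shows "gcone A \<in> sets lebesgue"
    and "emeasure lebesgue (gcone A) \<le> ennreal (1 / (real CARD('n) + 1)) * (\<integral>\<^sup>+p\<in>A. ennreal (\<Theta> p * K p) \<partial>\<mu>)"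
    and "inj_on (\<lambda>(p, t). t *\<^sub>R Nrm p) (A \<times> {0<..<1}) \<Longrightarrow>
      emeasure lebesgue (gcone A) = ennreal (1 / (real CARD('n) + 1)) * (\<integral>\<^sup>+p\<in>A. ennreal (\<Theta> p * K p) \<partial>\<mu>)"
proof -
  interpret chart S W U V \<psi> g by fact
  note eB = ext_eq[OF ext]
  define Q where "Q = {w \<in> Dom. par w \<in> A}"
  define P where "P = Q \<times> {0<..<1::real}"
  define f where "f w = \<Phi> (n (par w)) + shift" for w
  define N' where "N' x v = dPhi (n x) (n' x v)" for x v
  define G where "G x = snd x *\<^sub>R f (fst x)" for x :: "'n ambient"
  define G' where "G' x h = snd x *\<^sub>R N' (par (fst x)) (g' (fst x, 0) (fst h, 0)) + snd h *\<^sub>R f (fst x)" for x h :: "'n ambient"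
  have N'_eq: "N' = NF' n n'" by (auto simp: fun_eq_iff N'_def NF'_def[OF ext])
  have Qb: "Q \<in> sets borel" unfolding Q_def by (rule par_preimage_borel[OF A(1)])
  have QD: "Q \<subseteq> Dom" by (auto simp: Q_def)
  have parQ: "par ` Q = A" unfolding Q_def using A(2) by (intro par_image_preimage) auto
  have inA: "par w \<in> A" "par w \<in> S" "par w \<in> U" "par w \<in> B" "(w, 0) \<in> V" if "w \<in> Q" for w
    using that A(2) by (auto simp: Q_def Dom_def)
  have Pb: "P \<in> sets borel" unfolding P_def using Qb by (intro borel_Times) auto
  have fN: "f w = Nrm (par w)" if "w \<in> Q" for w
    using eB inA[OF that] by (simp add: f_def Nrm_def)
  have img: "G ` P = gcone A"
  proof
    show "G ` P \<subseteq> gcone A"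
    proof
      fix x assume "x \<in> G ` P"
      then obtain w t where wt: "w \<in> Q" "0 < t" "t < 1" "x = G (w, t)" unfolding P_def by auto
      then have "x = t *\<^sub>R Nrm (par w)" by (simp add: G_def fN)
      then show "x \<in> gcone A" using wt inA(1)[OF wt(1)] unfolding gcone_def by blast
    qed
    show "gcone A \<subseteq> G ` P"
    proof
      fix x assume "x \<in> gcone A"
      then obtain t p where tp: "0 < t" "t < 1" "p \<in> A" "x = t *\<^sub>R Nrm p" unfolding gcone_def by blast
      then obtain w where "w \<in> Q" "par w = p" using parQ by blast
      then show "x \<in> G ` P" using tp fN by (intro image_eqI[of _ _ "(w, t)"]) (auto simp: G_def P_def)
    qed
  qed
  have der: "(G has_derivative G' x) (at x within P)" if "x \<in> P" for x
  proof -
    have w: "fst x \<in> Q" using that by (auto simp: P_def)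
    have "((\<lambda>x. par (fst x)) has_derivative (\<lambda>h. g' (fst x, 0) (fst h, 0))) (at x)"
      by (rule has_derivative_compose[OF has_derivative_fst[OF has_derivative_ident] par_der[OF inA(5)[OF w]]])
    from has_derivative_compose[OF this NF_der[OF ext inA(4)[OF w]]]
    have "((\<lambda>x. f (fst x)) has_derivative (\<lambda>h. N' (par (fst x)) (g' (fst x, 0) (fst h, 0)))) (at x)"
      unfolding f_def N'_eq by (rule has_derivative_add_const)
    from has_derivative_scaleR[OF has_derivative_snd[OF has_derivative_ident] this]
    have "(G has_derivative G' x) (at x)" unfolding G_def G'_def[abs_def] .
    then show ?thesis by (rule has_derivative_at_withinI)
  qed
  have cpar: "continuous_on P (\<lambda>x. par (fst x))"
    by (rule continuous_on_compose2[OF par_cont_Dom]) (use QD in \<open>auto simp: P_def intro!: continuous_intros\<close>)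
  have nz: "n (par w) \<noteq> 0" "par w \<in> B" if "w \<in> Q" for w using inA(4)[OF that] ext_nz[OF ext] by blast+
  have cf: "continuous_on P (\<lambda>x. f (fst x))"
    unfolding f_def
    by (intro continuous_intros continuous_on_compose2[OF continuous_on_Phi] continuous_on_compose2[OF ext_cont[OF ext] cpar])
       (auto simp: P_def nz)
  have cg: "continuous_on P (\<lambda>x. g' (fst x, 0) v)" for v
    by (rule continuous_on_compose2[OF par'_cont]) (use inA in \<open>auto simp: P_def intro!: continuous_intros\<close>)
  have cN: "continuous_on P (\<lambda>x. N' (par (fst x)) (g' (fst x, 0) v))" for v
  proof (rule continuous_on_linear_family[where L = "\<lambda>x. N' (par (fst x))", OF _ _ cg])
    show "continuous_on P (\<lambda>x. N' (par (fst x)) v)" for v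
      unfolding N'_eq by (rule continuous_on_compose2[OF NF_cont[OF ext] cpar]) (use inA in \<open>auto simp: P_def\<close>)
    show "linear (N' (par (fst x)))" if "x \<in> P" for x
      unfolding N'_eq by (rule NF_linear[OF ext nz(2)]) (use that in \<open>auto simp: P_def\<close>)
  qed
  have cJ: "continuous_on P (\<lambda>x. jac (G' x))"
    by (rule continuous_on_jac) (unfold G'_def, intro continuous_intros cN cf)
  have meas: "(\<lambda>x. jac (G' x) * indicator P x) \<in> borel_measurable borel"
    using borel_measurable_continuous_on_indicator[OF Pb cJ] by (simp add: mult.commute)
  have J: "jac (G' (w, t)) = t ^ CARD('n) * (gram w * (\<Theta> (par w) * K (par w)))" if w: "w \<in> Q" and t: "0 < t" for w t
  proof -
    let ?p = "par w" and ?\<nu> = "\<nu> (par w)"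
    note i = inA[OF w]
    note lg = linear_g'[OF i(5)] and lN = NF_linear[OF ext i(4), folded N'_eq]
    define L where "L x = N' ?p (x - (x \<bullet> ?\<nu>) *\<^sub>R ?\<nu>) + (x \<bullet> ?\<nu>) *\<^sub>R Nrm ?p" for x
    define R where "R = (\<lambda>(v, s). g' (w, 0) (v, 0) + s *\<^sub>R ?\<nu>)"
    define D where "D = (\<lambda>(v :: real ^ 'n, s :: real). (t *\<^sub>R v, 1 * s))"
    have lL: "linear L"
      by (intro linearI) (simp_all add: L_def linear_diff[OF lN] linear_add[OF lN] linear_scale[OF lN] inner_add_left algebra_simps)
    have lR: "linear R"
    proof (intro linearI)
      show "R (x + y) = R x + R y" for x y
        using linear_add[OF lg, of "(fst x, 0)" "(fst y, 0)"] by (simp add: R_def case_prod_beta algebra_simps)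
      show "R (c *\<^sub>R x) = c *\<^sub>R R x" for c x
        using linear_scale[OF lg, of c "(fst x, 0)"] by (simp add: R_def case_prod_beta algebra_simps)
    qed
    have lt: "linear (\<lambda>v :: real ^ 'n. t *\<^sub>R v)" by (intro linearI) (auto simp: algebra_simps)
    have lD: "linear D" by (intro linearI) (auto simp: D_def algebra_simps)
    have T: "Tan ?p = {v. v \<bullet> ?\<nu> = 0}"
      using tangent_space_eq_Tan[OF chart_axioms i(2,3)] tangent_space_perp[OF i(2)] by simp
    have perp: "g' (w, 0) (v, 0) \<bullet> ?\<nu> = 0" for v
    proof -
      have "g' (w, 0) (v, 0) \<in> Tan ?p" using Tan_iff[OF i(3)] \<psi>_par[OF i(5)] by auto
      then show ?thesis using T by blast
    qed
    have \<nu>\<nu>: "?\<nu> \<bullet> ?\<nu> = 1" using norm_\<nu>[OF i(2)] by (simp add: dot_square_norm)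
    \<comment> \<open>D scales the tangential parameters by t, R maps them to the tangent space and
      the last axis to the normal, and L applies the anisotropic shape operator while sending the
      normal to \<open>Nrm\<close>. The three Jacobians are t ^ n, the Gram density and \<Theta>
      K.\<close>
    have "G' (w, t) = L \<circ> (R \<circ> D)"
    proof
      fix h :: "'n ambient"
      have sc: "g' (w, 0) (t *\<^sub>R fst h, 0) = t *\<^sub>R g' (w, 0) (fst h, 0)"
        using linear_scale[OF lg, of t "(fst h, 0)"] by simp
      have "(L \<circ> (R \<circ> D)) h = L (t *\<^sub>R g' (w, 0) (fst h, 0) + snd h *\<^sub>R ?\<nu>)"
        by (simp add: R_def D_def case_prod_beta sc)
      also have "\<dots> = t *\<^sub>R N' ?p (g' (w, 0) (fst h, 0)) + snd h *\<^sub>R Nrm ?p"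
        by (simp add: L_def inner_add_left perp \<nu>\<nu> linear_scale[OF lN])
      finally show "G' (w, t) h = (L \<circ> (R \<circ> D)) h" by (simp add: G'_def fN[OF w])
    qed
    then have "jac (G' (w, t)) = jac L * (jac R * jac D)"
      using jac_compose[OF lL linear_compose[OF lD lR]] jac_compose[OF lR lD] by simp
    also have "jac D = t ^ CARD('n)"
      unfolding D_def by (subst jac_prod[OF lt]) (use t in \<open>simp add: jac_vec[OF lt] power_abs\<close>)
    also have "jac R = gram w"
      unfolding R_def by (rule gram_eq_jac[OF i(5) norm_\<nu>[OF i(2)], symmetric]) (use T in blast)
    also have "jac L = \<Theta> ?p * K ?p"
      unfolding L_def N'_eq using jac_eq_K[OF ext i(2,4), of "Nrm ?p"] Nrm_\<nu>[OF i(2)] \<Theta>_pos[OF i(2)] by simp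
    finally show ?thesis by simp
  qed
  have cQ: "continuous_on Q (\<lambda>w. gram w * (\<Theta> (par w) * K (par w)))"
  proof (intro continuous_on_mult)
    show "continuous_on Q gram" by (rule continuous_on_subset[OF gram_cont]) (use inA in auto)
    have "continuous_on Q par" by (rule continuous_on_subset[OF par_cont_Dom QD])
    then show "continuous_on Q (\<lambda>w. \<Theta> (par w))" "continuous_on Q (\<lambda>w. K (par w))"
      by (auto intro!: continuous_on_compose2[OF cont_\<Theta>] continuous_on_compose2[OF continuous_on_K] dest: inA(2))
  qed
  have mQ[measurable]: "(\<lambda>w. indicator Q w * (gram w * (\<Theta> (par w) * K (par w)))) \<in> borel_measurable borel"
    using borel_measurable_continuous_on_indicator[OF Qb cQ] by simp
  have gn: "0 \<le> gram w" if "w \<in> Q" for w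
  proof -
    note i = inA[OF that]
    have "Tan (par w) = {v. v \<bullet> \<nu> (par w) = 0}"
      using tangent_space_eq_Tan[OF chart_axioms i(2,3)] tangent_space_perp[OF i(2)] by simp
    then have "gram w = jac (\<lambda>(v, s). g' (w, 0) (v, 0) + s *\<^sub>R \<nu> (par w))"
      by (intro gram_eq_jac[OF i(5) norm_\<nu>[OF i(2)]]) blast
    then show ?thesis by simp
  qed
  have TK: "0 \<le> \<Theta> p * K p" if "p \<in> S" for p using \<Theta>_pos K_nonneg' that by (simp add: less_imp_le)
  have int: "(\<integral>\<^sup>+x\<in>P. ennreal (jac (G' x)) \<partial>lborel) = ennreal (1 / (real CARD('n) + 1)) * (\<integral>\<^sup>+p\<in>A. ennreal (\<Theta> p * K p) \<partial>\<mu>)"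
  proof -
    let ?h = "\<lambda>w. ennreal (indicator Q w * (gram w * (\<Theta> (par w) * K (par w))))"
      and ?k = "\<lambda>t :: real. ennreal (t ^ CARD('n)) * indicator {0<..<1} t"
    have "(\<integral>\<^sup>+x\<in>P. ennreal (jac (G' x)) \<partial>lborel) = (\<integral>\<^sup>+x. ?h (fst x) * ?k (snd x) \<partial>lborel)"
    proof (intro nn_integral_cong)
      fix x :: "'n ambient"
      obtain w t where x: "x = (w, t)" by fastforce
      show "ennreal (jac (G' x)) * indicator P x = ?h (fst x) * ?k (snd x)"
      proof (cases "x \<in> P")
        case True
        then have wt: "w \<in> Q" "0 < t" "t < 1" by (auto simp: x P_def)
        then show ?thesis using True J[OF wt(1,2)] gn[OF wt(1)] TK[OF inA(2)[OF wt(1)]]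
          by (simp add: x ennreal_mult mult.commute)
      qed (auto simp: x P_def indicator_def)
    qed
    also have "\<dots> = (\<integral>\<^sup>+x. ?h (fst x) * ?k (snd x) \<partial>(lborel \<Otimes>\<^sub>M lborel))" by (simp add: lborel_prod)
    also have "\<dots> = (\<integral>\<^sup>+w. \<integral>\<^sup>+t. ?h w * ?k t \<partial>lborel \<partial>lborel)"
      by (subst lborel.nn_integral_fst[symmetric]) auto
    also have "\<dots> = (\<integral>\<^sup>+w. ?h w * ennreal (1 / (real CARD('n) + 1)) \<partial>lborel)"
      by (simp add: nn_integral_cmult integral_power_unit)
    also have "\<dots> = ennreal (1 / (real CARD('n) + 1)) * (\<integral>\<^sup>+w. ?h w \<partial>lborel)"
      by (rule trans[OF nn_integral_multc mult.commute]) (use mQ in measurable)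
    also have "(\<integral>\<^sup>+w. ?h w \<partial>lborel) = (\<integral>\<^sup>+w\<in>Q. ennreal (gram w) * ennreal (indicator S (par w) * (\<Theta> (par w) * K (par w))) \<partial>lborel)"
      using inA(2) gn by (intro nn_integral_cong) (auto simp: indicator_def ennreal_mult')
    also have "\<dots> = (\<integral>\<^sup>+p\<in>par ` Q. ennreal (indicator S p * (\<Theta> p * K p)) \<partial>\<mu>)"
      by (rule nn_integral_area[OF is_area_measure Qb QD, symmetric]) (use meas_on_S[OF cont_\<Theta>K] in measurable)
    also have "\<dots> = (\<integral>\<^sup>+p\<in>A. ennreal (\<Theta> p * K p) \<partial>\<mu>)"
      unfolding parQ using A(2) by (intro nn_integral_cong) (auto simp: indicator_def)
    finally show ?thesis .
  qed
  have fin: "(\<integral>\<^sup>+x\<in>P. ennreal (jac (G' x)) \<partial>lborel) < \<infinity>"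
    unfolding int using finite_integral[OF cont_\<Theta>K, of A] A(2) by (auto simp: ennreal_mult_less_top)
  show leb: "gcone A \<in> sets lebesgue"
    using emeasure_differentiable_image_le(1)[OF Pb der meas fin] unfolding img .
  show "emeasure lebesgue (gcone A) \<le> ennreal (1 / (real CARD('n) + 1)) * (\<integral>\<^sup>+p\<in>A. ennreal (\<Theta> p * K p) \<partial>\<mu>)"
    using emeasure_differentiable_image_le(2)[OF Pb der meas fin] unfolding img int .
  assume inj: "inj_on (\<lambda>(p, t). t *\<^sub>R Nrm p) (A \<times> {0<..<1})"
  have "inj_on G P"
  proof (rule inj_onI)
    fix x y assume xy: "x \<in> P" "y \<in> P" "G x = G y"
    then have "fst x \<in> Q" "fst y \<in> Q" by (auto simp: P_def)
    moreover from this have "(par (fst x), snd x) = (par (fst y), snd y)"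
      using xy fN inA(1) by (intro inj_onD[OF inj]) (auto simp: G_def P_def)
    ultimately show "x = y" using inj_onD[OF par_inj, of "fst x" "fst y"] QD by (auto simp: prod_eq_iff)
  qed
  then show "emeasure lebesgue (gcone A) = ennreal (1 / (real CARD('n) + 1)) * (\<integral>\<^sup>+p\<in>A. ennreal (\<Theta> p * K p) \<partial>\<mu>)"
    using emeasure_differentiable_image_eq[OF Pb _ der meas] leb unfolding img int by blast
qed

text \<open>Cones over different pieces of the partition may overlap, which subadditivity tolerates;
  when the cone map is injective they are disjoint and the volumes add up.\<close>

theorem cone_volume:
  assumes A: "A \<in> sets borel" "A \<subseteq> S"
  shows "gcone A \<in> sets lebesgue"
    and "emeasure lebesgue (gcone A) \<le> ennreal (1 / (real CARD('n) + 1)) * (\<integral>\<^sup>+p\<in>A. ennreal (\<Theta> p * K p) \<partial>\<mu>)"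
    and "inj_on (\<lambda>(p, t). t *\<^sub>R Nrm p) (A \<times> {0<..<1}) \<Longrightarrow>
      emeasure lebesgue (gcone A) = ennreal (1 / (real CARD('n) + 1)) * (\<integral>\<^sup>+p\<in>A. ennreal (\<Theta> p * K p) \<partial>\<mu>)"
proof -
  obtain N :: nat and W U V \<psi> g B n n' \<rho> a X where part0:
    "\<forall>k<N. chart S (W k) (U k) (V k) (\<psi> k) (g k)"
    "\<forall>k<N. normal_ext S \<nu> (B k) (n k) (n' k) (\<rho> k) (a k)"
    "\<forall>k<N. X k \<in> sets borel \<and> X k \<subseteq> S \<inter> U k \<inter> B k"
    "disjoint_family_on X {..<N}" "S = (\<Union>k<N. X k)" by (rule exists_partition) (rule that)
  note part = part0(1)[rule_format] part0(2)[rule_format] part0(3)[rule_format] part0(4,5)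
  define Y where "Y k = A \<inter> X k" for k
  have Y: "Y k \<in> sets borel" "Y k \<subseteq> S \<inter> U k \<inter> B k" if "k < N" for k
    using part(3)[OF that] A by (auto simp: Y_def)
  have AY: "A = (\<Union>k<N. Y k)" using A(2) part(5) by (auto simp: Y_def)
  have disj: "disjoint_family_on Y {..<N}" using part(4) by (auto simp: Y_def disjoint_family_on_def)
  note piece = cone_piece[OF part(1) part(2) Y]
  let ?c = "ennreal (1 / (real CARD('n) + 1))"
  have cone_UN: "gcone A = (\<Union>k<N. gcone (Y k))" unfolding gcone_def by (subst AY) blast
  have leb: "gcone (Y k) \<in> sets lebesgue" if "k < N" for k using piece(1) that by blast
  show "gcone A \<in> sets lebesgue" unfolding cone_UN using leb by (intro sets.finite_UN) auto
  have int: "?c * (\<integral>\<^sup>+p\<in>A. ennreal (\<Theta> p * K p) \<partial>\<mu>) = (\<Sum>k<N. ?c * (\<integral>\<^sup>+p\<in>Y k. ennreal (\<Theta> p * K p) \<partial>\<mu>))"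
  proof -
    let ?f = "\<lambda>p. ennreal (indicator S p * (\<Theta> p * K p))"
    have [measurable]: "?f \<in> borel_measurable borel" using meas_on_S[OF cont_\<Theta>K] by measurable
    have eq: "(\<integral>\<^sup>+p\<in>Z. ennreal (\<Theta> p * K p) \<partial>\<mu>) = (\<integral>\<^sup>+p. ?f p * indicator Z p \<partial>\<mu>)" if "Z \<subseteq> S" for Z
      using that by (intro nn_integral_cong) (auto simp: indicator_def)
    have "(\<integral>\<^sup>+p\<in>A. ennreal (\<Theta> p * K p) \<partial>\<mu>) = (\<integral>\<^sup>+p. (\<Sum>k<N. ?f p * indicator (Y k) p) \<partial>\<mu>)"
      unfolding eq[OF A(2)] 
      by (subst AY) (simp add: indicator_UN_disjoint[OF _ disj] sum_distrib_left)
    also have "\<dots> = (\<Sum>k<N. \<integral>\<^sup>+p. ?f p * indicator (Y k) p \<partial>\<mu>)"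
      using Y by (intro nn_integral_sum) (auto intro!: borel_measurable_times_ennreal)
    also have "\<dots> = (\<Sum>k<N. \<integral>\<^sup>+p\<in>Y k. ennreal (\<Theta> p * K p) \<partial>\<mu>)"
      using Y by (intro sum.cong refl eq[symmetric]) auto
    finally show ?thesis by (simp add: sum_distrib_left)
  qed
  have "emeasure lebesgue (gcone A) \<le> (\<Sum>k<N. emeasure lebesgue (gcone (Y k)))"
    unfolding cone_UN using leb by (intro emeasure_subadditive_finite) auto
  also have "\<dots> \<le> (\<Sum>k<N. ?c * (\<integral>\<^sup>+p\<in>Y k. ennreal (\<Theta> p * K p) \<partial>\<mu>))"
    using piece(2) by (intro sum_mono) auto
  finally show "emeasure lebesgue (gcone A) \<le> ?c * (\<integral>\<^sup>+p\<in>A. ennreal (\<Theta> p * K p) \<partial>\<mu>)" unfolding int .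
  assume inj: "inj_on (\<lambda>(p, t). t *\<^sub>R Nrm p) (A \<times> {0<..<1})"
  have "disjoint_family_on (\<lambda>k. gcone (Y k)) {..<N}"
    unfolding disjoint_family_on_def
  proof (intro ballI impI)
    fix i j assume ij: "i \<in> {..<N}" "j \<in> {..<N}" "i \<noteq> j"
    show "gcone (Y i) \<inter> gcone (Y j) = {}"
    proof (rule ccontr)
      assume "gcone (Y i) \<inter> gcone (Y j) \<noteq> {}"
      then obtain t p t' p' where tp: "0 < t" "t < 1" "p \<in> Y i" "0 < t'" "t' < 1" "p' \<in> Y j" "t *\<^sub>R Nrm p = t' *\<^sub>R Nrm p'"
        unfolding gcone_def by auto metis
      then have "(p, t) = (p', t')" by (intro inj_onD[OF inj]) (auto simp: Y_def)
      then show False using tp ij disj by (auto simp: disjoint_family_on_def)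
    qed
  qed
  then have "emeasure lebesgue (gcone A) = (\<Sum>k<N. emeasure lebesgue (gcone (Y k)))"
    unfolding cone_UN using leb by (intro sum_emeasure[symmetric]) auto
  also have "\<dots> = (\<Sum>k<N. ?c * (\<integral>\<^sup>+p\<in>Y k. ennreal (\<Theta> p * K p) \<partial>\<mu>))"
  proof (intro sum.cong refl)
    fix k assume k: "k \<in> {..<N}"
    have "inj_on (\<lambda>(p, t). t *\<^sub>R Nrm p) (Y k \<times> {0<..<1})"
      by (rule inj_on_subset[OF inj]) (auto simp: Y_def)
    then show "emeasure lebesgue (gcone (Y k)) = ?c * (\<integral>\<^sup>+p\<in>Y k. ennreal (\<Theta> p * K p) \<partial>\<mu>)"
      using piece(3) k by auto
  qed
  finally show "emeasure lebesgue (gcone A) = ?c * (\<integral>\<^sup>+p\<in>A. ennreal (\<Theta> p * K p) \<partial>\<mu>)" unfolding int .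
qed

lemma willmore_eq_nn_integral:
  "ennreal (willmore_integral F \<omega>0 S \<nu>) = (\<integral>\<^sup>+p\<in>S. ennreal (\<Theta> p * \<bar>H p\<bar> ^ CARD('n)) \<partial>\<mu>)"
  and willmore_nonneg: "willmore_integral F \<omega>0 S \<nu> \<ge> 0"
proof -
  let ?f = "\<lambda>p. \<Theta> p * \<bar>H p\<bar> ^ CARD('n)"
  have cf: "continuous_on S ?f" by (intro continuous_intros cont_\<Theta> continuous_on_H)
  have nn: "0 \<le> indicator S p * ?f p" for p using \<Theta>_pos[of p] by (auto simp: indicator_def less_imp_le)
  have fin: "(\<integral>\<^sup>+p. ennreal (indicator S p * ?f p) \<partial>\<mu>) < \<infinity>"
  proof -
    have "(\<integral>\<^sup>+p. ennreal (indicator S p * ?f p) \<partial>\<mu>) = (\<integral>\<^sup>+p\<in>S. ennreal (?f p) \<partial>\<mu>)"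
      by (intro nn_integral_cong) (auto simp: indicator_def)
    then show ?thesis using finite_integral[OF cf] by simp
  qed
  have "willmore_integral F \<omega>0 S \<nu> = (LINT p|\<mu>. indicator S p * ?f p)"
    unfolding willmore_integral_def set_lebesgue_integral_def \<Theta>_def shift_def
    by (simp add: inner_commute algebra_simps)
  moreover have int: "integrable \<mu> (\<lambda>p. indicator S p * ?f p)"
    using meas_on_S[OF cf] fin nn by (intro integrableI_nonneg) auto
  ultimately show "ennreal (willmore_integral F \<omega>0 S \<nu>) = (\<integral>\<^sup>+p\<in>S. ennreal (\<Theta> p * \<bar>H p\<bar> ^ CARD('n)) \<partial>\<mu>)"
    using nn_integral_eq_integral[OF int] nn
    by (simp, subst nn_integral_cong[of \<mu> _ "\<lambda>p. ennreal (indicator S p * ?f p)"]) (auto simp: indicator_def)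
  show "willmore_integral F \<omega>0 S \<nu> \<ge> 0"
    using \<open>willmore_integral F \<omega>0 S \<nu> = _\<close> nn by (simp add: integral_nonneg_AE)
qed

end

section \<open>Contact points\<close>

text \<open>The polar of an open half-space is a ray: a nonzero component u of z orthogonal to n
  would be detected by directions with a large multiple of u.\<close>

lemma inner_le_halfspace_imp:
  fixes z n :: "'a::real_inner"
  assumes n: "norm n = 1" and z: "\<And>v. v \<bullet> n < 0 \<Longrightarrow> v \<bullet> z \<le> 0"
  obtains a where "a \<ge> 0" "z = a *\<^sub>R n"
proof -
  have nn: "n \<bullet> n = 1" using n by (simp add: dot_square_norm)
  define a where "a = z \<bullet> n"
  define u where "u = z - a *\<^sub>R n"
  have un: "u \<bullet> n = 0" by (simp add: u_def inner_diff_left a_def nn)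
  have "(- n) \<bullet> z \<le> 0" by (rule z) (simp add: nn)
  then have a: "a \<ge> 0" by (simp add: a_def inner_commute)
  have uz: "u \<bullet> z = u \<bullet> u" using un by (simp add: u_def inner_diff_right)
  have "u = 0"
  proof (rule ccontr)
    assume "u \<noteq> 0"
    then have pos: "u \<bullet> u > 0" by simp
    \<comment> \<open>Makes \<open>k *\<^sub>R u - n\<close> pair with z to the value 1.\<close>
    define k where "k = (a + 1) / (u \<bullet> u)"
    have "(k *\<^sub>R u - n) \<bullet> z \<le> 0" by (rule z) (simp add: inner_diff_left un nn)
    moreover have "(k *\<^sub>R u - n) \<bullet> z = k * (u \<bullet> u) - a"
      by (simp add: inner_diff_left uz a_def inner_commute[of n])
    moreover have "k * (u \<bullet> u) = a + 1" using pos by (simp add: k_def)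
    ultimately show False by simp
  qed
  then show ?thesis using that[of a] a by (simp add: u_def)
qed

text \<open>The polar of a wedge is the cone spanned by its two outer normals n and -e.\<close>

lemma inner_le_wedge_imp:
  fixes z n e :: "'a::real_inner"
  assumes n: "norm n = 1" and e: "norm e = 1" and ne: "\<bar>n \<bullet> e\<bar> < 1"
    and z: "\<And>v. v \<bullet> n < 0 \<Longrightarrow> v \<bullet> e > 0 \<Longrightarrow> v \<bullet> z \<le> 0"
  obtains a b where "a \<ge> 0" "b \<ge> 0" "z = a *\<^sub>R n - b *\<^sub>R e"
proof -
  define c where "c = n \<bullet> e"
  have nn: "n \<bullet> n = 1" "e \<bullet> e = 1" "n \<bullet> e = c" "e \<bullet> n = c"
    using n e by (simp_all add: dot_square_norm c_def inner_commute)
  have D: "1 - c\<^sup>2 > 0" using ne by (simp add: c_def abs_square_less_1)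
  define k where "k = 1 / (1 - c\<^sup>2)"
  have k: "k * (1 - c\<^sup>2) = 1" using D by (simp add: k_def)
  \<comment> \<open>Basis of the plane of n and e that is dual to -n and e; k is the reciprocal of
    the Gram determinant.\<close>
  define v1 v2 where "v1 = k *\<^sub>R (c *\<^sub>R e - n)" and "v2 = k *\<^sub>R (e - c *\<^sub>R n)"
  have "v1 \<bullet> n = - (k * (1 - c\<^sup>2))" "v2 \<bullet> e = k * (1 - c\<^sup>2)"
    by (simp_all add: v1_def v2_def inner_diff_left nn power2_eq_square algebra_simps)
  then have v1: "v1 \<bullet> n = - 1" "v1 \<bullet> e = 0" and v2: "v2 \<bullet> n = 0" "v2 \<bullet> e = 1"
    unfolding k by (simp_all add: v1_def v2_def inner_diff_left nn)
  define a b where "a = - (v1 \<bullet> z)" and "b = - (v2 \<bullet> z)"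
  \<comment> \<open>Extension to the closed wedge: a vector of it, scaled by s and moved by v1 + v2,
    lies in the open wedge, and s is so large that the displacement cannot restore the sign.\<close>
  have le: "v \<bullet> z \<le> 0" if v: "v \<bullet> n \<le> 0" "v \<bullet> e \<ge> 0" for v
  proof (rule ccontr)
    assume "\<not> v \<bullet> z \<le> 0"
    then have pos: "v \<bullet> z > 0" by simp
    define s where "s = (\<bar>(v1 + v2) \<bullet> z\<bar> + 1) / (v \<bullet> z)"
    have s: "s > 0" using pos by (simp add: s_def add_nonneg_pos)
    have "(s *\<^sub>R v + (v1 + v2)) \<bullet> z \<le> 0"
    proof (rule z)
      have "s * (v \<bullet> n) \<le> 0" "s * (v \<bullet> e) \<ge> 0" using v s by (simp_all add: mult_nonneg_nonpos)
      then show "(s *\<^sub>R v + (v1 + v2)) \<bullet> n < 0" "(s *\<^sub>R v + (v1 + v2)) \<bullet> e > 0"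
        using v1 v2 by (simp_all add: inner_add_left)
    qed
    moreover have "s * (v \<bullet> z) = \<bar>(v1 + v2) \<bullet> z\<bar> + 1" using pos by (simp add: s_def)
    ultimately show False by (simp add: inner_add_left)
  qed
  have "a \<ge> 0" "b \<ge> 0" using le[of v1] le[of v2] v1 v2 by (auto simp: a_def b_def)
  moreover have "z = a *\<^sub>R n - b *\<^sub>R e"
  proof -
    have "z \<bullet> w = (a *\<^sub>R n - b *\<^sub>R e) \<bullet> w" for w
    proof -
      \<comment> \<open>The part of w orthogonal to n and e; u and -u both lie in the closed wedge,
        so z does not see it.\<close>
      define u where "u = w + (w \<bullet> n) *\<^sub>R v1 - (w \<bullet> e) *\<^sub>R v2"
      have un: "u \<bullet> n = 0" "u \<bullet> e = 0" by (simp_all add: u_def inner_diff_left inner_add_left v1 v2)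
      have "u \<bullet> z \<le> 0" by (rule le) (simp_all add: un)
      moreover have "(- u) \<bullet> z \<le> 0" by (rule le) (simp_all add: un)
      ultimately have "u \<bullet> z = 0" by simp
      then have "w \<bullet> z = (w \<bullet> e) * (v2 \<bullet> z) - (w \<bullet> n) * (v1 \<bullet> z)"
        by (simp add: u_def inner_diff_left inner_add_left)
      then show ?thesis
        by (simp add: a_def b_def inner_diff_left inner_commute[of z w] inner_commute[of n w] inner_commute[of e w])
    qed
    then show ?thesis by (metis vector_eq_rdot)
  qed
  ultimately show ?thesis using that by blast
qed

section \<open>The enclosed domain near the surface, and first contact\<close>

locale willmore_problem = capillary_surface F \<omega>0 S \<nu>
  for F :: "'n::finite ambient \<Rightarrow> real" and \<omega>0 and S :: "'n ambient set" and \<nu> :: "'n ambient \<Rightarrow> 'n ambient" +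
  fixes \<Omega> :: "'n ambient set"
  assumes half: "S \<subseteq> closed_half_space" and bdry: "hs_boundary S \<subseteq> bounding_plane"
    and transv: "intersects_plane_transversally S" and encl: "enclosed_domain S \<Omega>"
    and outward: "outward_unit_normal S \<Omega> \<nu>"
    and contact_angle: "\<And>p. p \<in> hs_boundary S \<Longrightarrow> \<Phi> (\<nu> p) \<bullet> (- E) \<ge> \<omega>0"
begin

lemma height_nonneg: "p \<in> S \<Longrightarrow> p \<bullet> E \<ge> 0"
  using half by (auto simp: closed_half_space_def)

lemma open_\<Omega>: "open \<Omega>" and \<Omega>_half: "x \<in> \<Omega> \<Longrightarrow> x \<bullet> E > 0" and bounded_\<Omega>: "bounded \<Omega>" and \<Omega>_ne: "\<Omega> \<noteq> {}"
  using encl by (auto simp: enclosed_domain_def open_half_space_def)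

lemma frontier_iff: "x \<bullet> E > 0 \<Longrightarrow> x \<in> frontier \<Omega> \<longleftrightarrow> x \<in> S"
  using encl by (auto simp: enclosed_domain_def open_half_space_def)

lemma has_derivative_height: "((\<lambda>x. x \<bullet> E) has_derivative (\<lambda>v. v \<bullet> E)) F'"
  by (auto intro!: derivative_eq_intros)

lemma transversal: "p \<in> S \<Longrightarrow> p \<bullet> E = 0 \<Longrightarrow> \<exists>v. v \<bullet> \<nu> p = 0 \<and> v \<bullet> E \<noteq> 0"
proof -
  assume p: "p \<in> S" "p \<bullet> E = 0"
  then have "E \<in> {u + w | u w. u \<in> tangent_space S p \<and> w \<in> bounding_plane}"
    using transv unfolding intersects_plane_transversally_def bounding_plane_def by blast
  then obtain u w where "E = u + w" "u \<in> tangent_space S p" "w \<bullet> E = 0" by (auto simp: bounding_plane_def)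
  moreover from this have "u \<bullet> E = 1" by (metis E_E add.right_neutral inner_add_left)
  ultimately show ?thesis using tangent_space_perp[OF p(1)] by (intro exI[of _ u]) auto
qed

lemma right_curve_height: "p \<in> S \<Longrightarrow> p \<bullet> E = 0 \<Longrightarrow> right_curve S p v \<Longrightarrow> v \<bullet> E \<ge> 0"
  by (rule right_curve_real_le[OF _ has_derivative_height], assumption, rule always_eventually)
     (use height_nonneg in auto)

text \<open>At a point on the plane outside the boundary both v and -v would be velocities of curves
  in S, while the height is minimal there; the tangent plane would be horizontal, against
  transversality.\<close>

lemma boundary_iff: "p \<in> S \<Longrightarrow> p \<in> hs_boundary S \<longleftrightarrow> p \<bullet> E = 0"
proof
  assume "p \<in> hs_boundary S" then show "p \<bullet> E = 0" using bdry by (auto simp: bounding_plane_def)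
next
  assume p: "p \<in> S" "p \<bullet> E = 0"
  obtain v where v: "v \<bullet> \<nu> p = 0" "v \<bullet> E \<noteq> 0" using transversal[OF p] by blast
  show "p \<in> hs_boundary S"
  proof (rule ccontr)
    assume nb: "p \<notin> hs_boundary S"
    have "right_curve S p v" "right_curve S p (- v)" using v(1) by (intro right_curve_interior[OF p(1) nb]; simp)+
    then have "v \<bullet> E \<ge> 0" "(- v) \<bullet> E \<ge> 0" using right_curve_height[OF p] by blast+
    then show False using v(2) by simp
  qed
qed

text \<open>At a point on the plane transversality gives a nonhorizontal tangent vector; one of its
  two signs is realised by a curve in S, and that curve must rise. Statements above the plane thus
  extend to all of S by continuity.\<close>

lemma approach_interior:
  assumes p: "p \<in> S" and \<delta>: "\<delta> > 0"
  shows "\<exists>q\<in>S. dist q p < \<delta> \<and> q \<bullet> E > 0"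
proof (cases "p \<bullet> E = 0")
  case False
  then show ?thesis using p \<delta> height_nonneg[OF p] by (intro bexI[of _ p]) auto
next
  case True
  obtain v where v: "v \<bullet> \<nu> p = 0" "v \<bullet> E \<noteq> 0" using transversal[OF p True] by blast
  have "(- v) \<bullet> E \<noteq> 0" using v(2) by simp
  then obtain u where u: "right_curve S p u" "u \<bullet> E \<noteq> 0" using right_curve_either[OF p v(1)] v(2) by blast
  then have pos: "u \<bullet> E > 0" using right_curve_height[OF p True u(1)] by simp
  obtain \<gamma> where \<gamma>: "\<gamma> 0 = p" "(\<gamma> has_vector_derivative u) (at 0)" "\<forall>\<^sub>F t in at_right (0::real). \<gamma> t \<in> S"
    using u(1) unfolding right_curve_def by blast
  have "((\<lambda>t. \<gamma> t \<bullet> E) has_derivative (\<lambda>d. (d *\<^sub>R u) \<bullet> E)) (at 0)"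
    using \<gamma>(2) unfolding has_vector_derivative_def by (rule has_derivative_inner_left)
  then have "DERIV (\<lambda>t. \<gamma> t \<bullet> E) 0 :> u \<bullet> E" by (rule has_derivative_imp_has_field_derivative) simp
  from DERIV_pos_inc_right[OF this pos] obtain d where d: "d > 0" "\<And>h. 0 < h \<Longrightarrow> h < d \<Longrightarrow> \<gamma> h \<bullet> E > 0"
    using \<gamma>(1) True by auto
  obtain b where b: "b > 0" "\<And>t. 0 < t \<Longrightarrow> t < b \<Longrightarrow> \<gamma> t \<in> S"
    using \<gamma>(3) unfolding eventually_at_right_field by blast
  have "isCont \<gamma> 0" using \<gamma>(2) by (simp add: has_vector_derivative_continuous)
  then obtain c where c: "c > 0" "\<And>t. dist t 0 < c \<Longrightarrow> dist (\<gamma> t) p < \<delta>"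
    using \<delta> \<gamma>(1) unfolding continuous_at_eps_delta by metis
  define t where "t = min b (min c d) / 2"
  have "0 < t" "t < b" "t < c" "t < d" using b c d by (auto simp: t_def min_def)
  then show ?thesis using b(2) c(2) d(2) by (intro bexI[of _ "\<gamma> t"]) auto
qed

text \<open>The frontier of \<Omega> is prescribed above the plane only, so points of S on the plane
  are reached as limits.\<close>

lemma S_subset_closure: "S \<subseteq> closure \<Omega>"
proof
  fix p assume p: "p \<in> S"
  have *: "q \<in> closure \<Omega>" if "q \<in> S" "q \<bullet> E > 0" for q
    using frontier_iff[OF that(2)] that(1) by (simp add: frontier_def)
  have "p \<in> closure (closure \<Omega>)"
    unfolding closure_approachable using approach_interior[OF p] * by (metis)
  then show "p \<in> closure \<Omega>" by simp
qed

lemma inward_point: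
  assumes p: "p \<in> S" "p \<bullet> E > 0"
  shows "\<forall>\<^sub>F t in at_right 0. p - t *\<^sub>R \<nu> p \<in> \<Omega>"
proof -
  have "p \<in> S - hs_boundary S" using boundary_iff[OF p(1)] p by auto
  then show ?thesis using outward unfolding outward_unit_normal_def by (auto elim: eventually_mono)
qed

text \<open>Above the plane \<Omega> can only be left through S.\<close>

lemma connected_in_\<Omega>:
  assumes "connected T" "T \<inter> \<Omega> \<noteq> {}" "T \<inter> S = {}" "\<And>x. x \<in> T \<Longrightarrow> x \<bullet> E > 0"
  shows "T \<subseteq> \<Omega>"
proof (rule ccontr)
  assume "\<not> T \<subseteq> \<Omega>"
  then have "T \<inter> frontier \<Omega> \<noteq> {}" using connected_Int_frontier[OF assms(1,2)] by blast
  then show False using frontier_iff assms(3,4) by blast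
qed

text \<open>Directions pointing into the wedge between the surface and the plane enter the domain: a short
  segment in such a direction, based slightly inside the domain near \<open>p\<close>, does not meet the surface
  again.\<close>

lemma wedge_direction_enters:
  assumes p: "p \<in> S" and v: "v \<bullet> \<nu> p < 0" and h: "p \<bullet> E > 0 \<or> v \<bullet> E > 0"
  shows "\<exists>e>0. \<forall>t. 0 < t \<longrightarrow> t < e \<longrightarrow> p + t *\<^sub>R v \<in> \<Omega>"
proof -
  obtain B n n' \<rho> a where ext: "normal_ext S \<nu> B n n' \<rho> a" and pB: "p \<in> B" using exists_ext[OF p] .
  have \<rho>d: "(\<rho> has_derivative (\<lambda>v. a x * (n x \<bullet> v))) (at x)" "a x > 0" if "x \<in> B" for x
    using ext that by (auto simp: normal_ext_def)
  have \<rho>0: "\<rho> x = 0" if "x \<in> S" "x \<in> B" for x using ext that by (auto simp: normal_ext_def)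
  note ne = ext_eq[OF ext] and oB = ext_open[OF ext]
  have "continuous_on B (\<lambda>x. n x \<bullet> v)" by (intro continuous_intros ext_cont[OF ext])
  then have "open {x \<in> B. n x \<bullet> v < 0}"
    using continuous_open_preimage[OF _ oB, of "\<lambda>x. n x \<bullet> v" "{..<0}"] by (simp add: vimage_def Int_def)
  moreover have "open {x. p \<bullet> E > 0 \<longrightarrow> x \<bullet> E > 0}"
    by (cases "p \<bullet> E > 0") (auto intro!: open_Collect_less continuous_intros)
  ultimately have "open ({x \<in> B. n x \<bullet> v < 0} \<inter> {x. p \<bullet> E > 0 \<longrightarrow> x \<bullet> E > 0})" by (rule open_Int)
  moreover have "p \<in> {x \<in> B. n x \<bullet> v < 0} \<inter> {x. p \<bullet> E > 0 \<longrightarrow> x \<bullet> E > 0}"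
    using p pB v ne[OF p pB] by (simp add: inner_commute)
  ultimately obtain r where r: "r > 0" "ball p r \<subseteq> {x \<in> B. n x \<bullet> v < 0} \<inter> {x. p \<bullet> E > 0 \<longrightarrow> x \<bullet> E > 0}"
    using openE by blast
  then have rB: "x \<in> B" "n x \<bullet> v < 0" "p \<bullet> E > 0 \<Longrightarrow> x \<bullet> E > 0" if "x \<in> ball p r" for x using that by auto
  define e where "e = r / (2 * (norm v + 1))"
  have nv: "norm v + 1 > 0" by (simp add: add_nonneg_pos)
  have e: "e > 0" using r nv by (simp add: e_def)
  have small: "norm (s *\<^sub>R v) < r / 2" if "0 \<le> s" "s < e" for s
  proof -
    have "norm (s *\<^sub>R v) \<le> s * (norm v + 1)" using that by (simp add: mult_left_mono)
    also have "\<dots> < r / 2" using that nv by (simp add: e_def field_simps)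
    finally show ?thesis .
  qed
  have in_ball: "x + s *\<^sub>R v \<in> ball p r" if "dist x p < r / 2" "0 \<le> s" "s < e" for x s
  proof -
    have "dist p (x + s *\<^sub>R v) \<le> dist p x + dist x (x + s *\<^sub>R v)" by (rule dist_triangle)
    also have "dist x (x + s *\<^sub>R v) = norm (s *\<^sub>R v)" by (simp add: dist_norm)
    finally show ?thesis using small[OF that(2,3)] that(1) unfolding mem_ball dist_commute[of p x] by linarith
  qed
  have dec: "\<rho> (x + s *\<^sub>R v) < \<rho> x" if x: "dist x p < r / 2" and s: "0 < s" "s < e" for x s
  proof -
    have "\<exists>y. DERIV (\<lambda>t. \<rho> (x + t *\<^sub>R v)) t :> y \<and> y < 0" if t: "0 \<le> t" "t \<le> s" for t
    proof (intro exI conjI)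
      have b: "x + t *\<^sub>R v \<in> ball p r" using in_ball x t s by simp
      have "((\<lambda>t. x + t *\<^sub>R v) has_derivative (\<lambda>d. d *\<^sub>R v)) (at t)" by (auto intro!: derivative_eq_intros)
      from has_derivative_compose[OF this \<rho>d(1)[OF rB(1)[OF b]]]
      show "DERIV (\<lambda>t. \<rho> (x + t *\<^sub>R v)) t :> a (x + t *\<^sub>R v) * (n (x + t *\<^sub>R v) \<bullet> v)"
        by (rule has_derivative_imp_has_field_derivative) simp
      show "a (x + t *\<^sub>R v) * (n (x + t *\<^sub>R v) \<bullet> v) < 0"
        using \<rho>d(2)[OF rB(1)[OF b]] rB(2)[OF b] by (rule mult_pos_neg)
    qed
    then have "\<rho> (x + s *\<^sub>R v) < \<rho> (x + 0 *\<^sub>R v)" using DERIV_neg_imp_decreasing[OF s(1), of "\<lambda>t. \<rho> (x + t *\<^sub>R v)"] by blast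
    then show ?thesis by simp
  qed
  \<comment> \<open>The side \<rho> < 0 above the plane: disjoint from S, and stable under motion
    along v as long as the ball is not left.\<close>
  define Q where "Q = {x \<in> ball p r. \<rho> x < 0} \<inter> {x. x \<bullet> E > 0}"
  have "continuous_on (ball p r) \<rho>"
    by (intro continuous_at_imp_continuous_on ballI has_derivative_continuous[OF \<rho>d(1)] rB(1))
  then have "open {x \<in> ball p r. \<rho> x < 0}"
    using continuous_open_preimage[OF _ open_ball, of p r \<rho> "{..<0}"] by (simp add: vimage_def Int_def)
  moreover have "open {x. x \<bullet> E > 0}" by (intro open_Collect_less continuous_intros)
  ultimately have oQ: "open Q" unfolding Q_def by (rule open_Int)
  have QS: "Q \<inter> S = {}" using \<rho>0 rB(1) by (fastforce simp: Q_def)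
  show ?thesis
  proof (intro exI[of _ e] conjI allI impI e)
    fix t assume t: "0 < t" "t < e"
    let ?y = "p + t *\<^sub>R v"
    have "?y \<bullet> E > 0"
    proof (cases "p \<bullet> E > 0")
      case True then show ?thesis using rB(3)[OF in_ball[of p t]] r(1) t by simp
    next
      case False
      then show ?thesis using h height_nonneg[OF p] t by (simp add: inner_add_left)
    qed
    moreover have "\<rho> ?y < 0" using dec[of p t] \<rho>0[OF p pB] t r(1) by simp
    ultimately have "?y \<in> Q" using in_ball[of p t] t r(1) by (simp add: Q_def)
    then obtain \<epsilon> where \<epsilon>: "\<epsilon> > 0" "ball ?y \<epsilon> \<subseteq> Q" using oQ openE by blast
    obtain q where q: "q \<in> S" "dist q p < min (\<epsilon> / 2) (r / 4)" "q \<bullet> E > 0"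
      using approach_interior[OF p, of "min (\<epsilon> / 2) (r / 4)"] \<epsilon>(1) r(1) by auto
    have qB: "q \<in> B" using rB(1)[of q] q(2) r(1) by (simp add: dist_commute)
    obtain s0 where s0: "s0 > 0" "\<And>s. 0 < s \<Longrightarrow> s < s0 \<Longrightarrow> q - s *\<^sub>R \<nu> q \<in> \<Omega>"
      using inward_point[OF q(1,3)] unfolding eventually_at_right_field by blast
    have "((\<lambda>s. q - s *\<^sub>R \<nu> q) has_derivative (\<lambda>d. - (d *\<^sub>R \<nu> q))) (at 0)" by (auto intro!: derivative_eq_intros)
    moreover have "(\<rho> has_derivative (\<lambda>v. a q * (n q \<bullet> v))) (at (q - 0 *\<^sub>R \<nu> q))" using \<rho>d(1)[OF qB] by simp
    ultimately have "((\<lambda>s. \<rho> (q - s *\<^sub>R \<nu> q)) has_derivative (\<lambda>d. a q * (n q \<bullet> - (d *\<^sub>R \<nu> q)))) (at 0)"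
      by (rule has_derivative_compose)
    then have "DERIV (\<lambda>s. \<rho> (q - s *\<^sub>R \<nu> q)) 0 :> - a q"
      by (rule has_derivative_imp_has_field_derivative)
         (use norm_\<nu>[OF q(1)] ne[OF q(1) qB] in \<open>simp add: dot_square_norm\<close>)
    from DERIV_neg_dec_right[OF this] \<rho>d(2)[OF qB] obtain s1 where
      s1: "s1 > 0" "\<And>s. 0 < s \<Longrightarrow> s < s1 \<Longrightarrow> \<rho> (q - s *\<^sub>R \<nu> q) < 0"
      using \<rho>0[OF q(1) qB] by auto
    \<comment> \<open>Below s0 the point \<open>?x\<close> is in \<Omega>, below s1 it has \<rho> <
      0, below q \<bullet> E it stays above the plane, and the remaining bounds keep it close to
      p.\<close>
    define s where "s = min (min s0 s1) (min (q \<bullet> E) (min (\<epsilon> / 2) (r / 4))) / 2"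
    have s: "0 < s" "s < s0" "s < s1" "s < q \<bullet> E" "s < \<epsilon> / 2" "s < r / 4"
      using s0 s1 q(3) \<epsilon>(1) r(1) by (auto simp: s_def min_def)
    let ?x = "q - s *\<^sub>R \<nu> q"
    have xq: "norm (?x - p) < min \<epsilon> (r / 2)"
    proof -
      have "norm (?x - p) \<le> norm (q - p) + norm (s *\<^sub>R \<nu> q)"
        using norm_triangle_ineq4[of "q - p" "s *\<^sub>R \<nu> q"] by (simp add: algebra_simps)
      then show ?thesis using q(2) s norm_\<nu>[OF q(1)] by (auto simp: dist_norm)
    qed
    have x: "?x \<in> \<Omega>" "\<rho> ?x < 0" "dist ?x p < r / 2" using s0(2) s1(2) s xq by (auto simp: dist_norm)
    have xE: "?x \<bullet> E > 0"
    proof -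
      have "\<nu> q \<bullet> E \<le> 1" using norm_cauchy_schwarz[of "\<nu> q" E] norm_\<nu>[OF q(1)] by simp
      then have "s * (\<nu> q \<bullet> E) \<le> s" using s(1) by (simp add: mult_left_le)
      then show ?thesis using s(4) by (simp add: inner_diff_left)
    qed
    have seg: "?x + u *\<^sub>R v \<in> Q" if u: "0 \<le> u" "u \<le> t" for u
    proof -
      have b: "?x + u *\<^sub>R v \<in> ball p r" using in_ball[OF x(3)] u t by simp
      have "\<rho> (?x + u *\<^sub>R v) < 0" using dec[OF x(3), of u] x(2) u t by (cases "u = 0") auto
      moreover have "(?x + u *\<^sub>R v) \<bullet> E > 0"
      proof (cases "p \<bullet> E > 0")
        case True then show ?thesis using rB(3)[OF b] by blast
      next
        case False
        then have "u * (v \<bullet> E) \<ge> 0" using h u by simp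
        then show ?thesis using xE by (simp add: inner_add_left)
      qed
      ultimately show ?thesis using b by (simp add: Q_def)
    qed
    \<comment> \<open>The segment runs parallel to the one from p to \<open>?y\<close> and ends in
      the ball around \<open>?y\<close>. The union is connected, lies in Q and contains a point of
      \<Omega>, so it stays in \<Omega>.\<close>
    let ?T = "closed_segment ?x (?x + t *\<^sub>R v) \<union> ball ?y \<epsilon>"
    have "dist ?y (?x + t *\<^sub>R v) < \<epsilon>"
    proof -
      have "dist ?y (?x + t *\<^sub>R v) = norm (?x - p)"
        unfolding dist_norm norm_minus_commute[of ?y] by (simp add: algebra_simps)
      then show ?thesis using xq by simp
    qed
    then have "closed_segment ?x (?x + t *\<^sub>R v) \<inter> ball ?y \<epsilon> \<noteq> {}" by (metis IntI emptyE ends_in_segment(2) mem_ball)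
    then have "connected ?T" by (intro connected_Un) auto
    moreover have TQ: "?T \<subseteq> Q"
    proof -
      have "w \<in> Q" if "w \<in> closed_segment ?x (?x + t *\<^sub>R v)" for w
      proof -
        obtain l where l: "0 \<le> l" "l \<le> 1" "w = (1 - l) *\<^sub>R ?x + l *\<^sub>R (?x + t *\<^sub>R v)"
          using \<open>w \<in> _\<close> unfolding in_segment by blast
        then have "w = ?x + (l * t) *\<^sub>R v" by (simp add: algebra_simps)
        then show ?thesis using seg[of "l * t"] l t by (simp add: mult_left_le_one_le)
      qed
      then show ?thesis using \<epsilon>(2) by blast
    qed
    moreover have "?x \<in> ?T \<inter> \<Omega>" using x(1) by simp
    ultimately have "?T \<subseteq> \<Omega>"
      using QS by (intro connected_in_\<Omega>) (auto simp: Q_def)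
    then show "?y \<in> \<Omega>" using \<epsilon>(1) by auto
  qed
qed

lemma max_direction:
  assumes "\<And>x. x \<in> closure \<Omega> \<Longrightarrow> x \<bullet> z \<le> p \<bullet> z" and "\<exists>e>0. \<forall>t. 0 < t \<longrightarrow> t < e \<longrightarrow> p + t *\<^sub>R v \<in> \<Omega>"
  shows "v \<bullet> z \<le> 0"
proof -
  obtain e where e: "e > 0" "\<And>t. 0 < t \<Longrightarrow> t < e \<Longrightarrow> p + t *\<^sub>R v \<in> \<Omega>" using assms(2) by blast
  have "p + (e / 2) *\<^sub>R v \<in> \<Omega>" using e(1) by (intro e(2)) auto
  then have "(p + (e / 2) *\<^sub>R v) \<bullet> z \<le> p \<bullet> z" using closure_subset[of \<Omega>] by (intro assms(1)) blast
  then show ?thesis using e(1) by (simp add: inner_add_left mult_le_0_iff)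
qed

text \<open>The hyperplane comes to rest at a maximiser p of \<langle>_, z\<rangle> on the closure.
  Besides S above the plane, p could lie on the edge or on the flat part of the frontier; the
  directions entering the domain there force z into a polar cone that the contact angle or the range
  of \<omega>0 excludes.\<close>

theorem contact_point_exists:
  assumes z: "z \<in> cap"
  shows "\<exists>p\<in>S. p \<bullet> E > 0 \<and> \<nu> p = z \<and> (\<forall>x\<in>closure \<Omega>. x \<bullet> z \<le> p \<bullet> z)"
proof -
  have z1: "norm z = 1" "\<Phi> z \<bullet> (- E) < \<omega>0" using z by (auto simp: cap_def)
  have z0: "z \<noteq> 0" using z1 by auto
  have "compact (closure \<Omega>)" using bounded_\<Omega> by (simp add: compact_closure)
  moreover have "closure \<Omega> \<noteq> {}" using \<Omega>_ne by simp
  moreover have "continuous_on (closure \<Omega>) (\<lambda>x. x \<bullet> z)" by (intro continuous_intros)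
  ultimately obtain p where p: "p \<in> closure \<Omega>" "\<And>x. x \<in> closure \<Omega> \<Longrightarrow> x \<bullet> z \<le> p \<bullet> z"
    using continuous_attains_sup by metis
  have md: "v \<bullet> z \<le> 0" if "\<exists>e>0. \<forall>t. 0 < t \<longrightarrow> t < e \<longrightarrow> p + t *\<^sub>R v \<in> \<Omega>" for v
    by (rule max_direction[of z p, OF p(2) that])
  have "p \<notin> \<Omega>"
  proof
    assume "p \<in> \<Omega>"
    then obtain r where r: "r > 0" "ball p r \<subseteq> \<Omega>" using open_\<Omega> openE by blast
    have "p + t *\<^sub>R z \<in> \<Omega>" if "0 < t" "t < r" for t using r(2) that z1(1) by (auto simp: dist_norm)
    then have "z \<bullet> z \<le> 0" using md r(1) by blast
    then show False using z1(1) by (simp only: dot_square_norm) simp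
  qed
  then have pf: "p \<in> frontier \<Omega>" using p(1) open_\<Omega> by (simp add: frontier_def interior_open)
  have "closure \<Omega> \<subseteq> {x. x \<bullet> E \<ge> 0}"
    by (rule closure_minimal) (auto intro!: closed_Collect_le continuous_intros dest: \<Omega>_half)
  then have pE: "p \<bullet> E \<ge> 0" using p(1) by blast
  \<comment> \<open>A normal obtained from an edge normal y by moving towards -E has at least the
    angle of y, hence at least \<omega>0, and is not in \<open>cap\<close>.\<close>
  have bad: False if "z = a *\<^sub>R y - b *\<^sub>R E" "a > 0" "b \<ge> 0" "norm y = 1" "\<Phi> y \<bullet> (- E) \<ge> \<omega>0" for a b y
  proof -
    have y0: "y \<noteq> 0" using that by auto
    have eq: "a *\<^sub>R y + b *\<^sub>R (- E) = z" using that(1) by simp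
    have "\<Phi> (a *\<^sub>R y) \<bullet> (- E) \<le> \<Phi> z \<bullet> (- E)"
      using Phi_mono[of "a *\<^sub>R y" b "- E"] that y0 z0 unfolding eq by simp
    then show False using that Phi_scale[OF y0, of a] z1 by simp
  qed
  \<comment> \<open>The normal -E has the extreme angle F (-E), which exceeds \<omega>0.\<close>
  have bad2: False if "z = - b *\<^sub>R E" "b \<ge> 0" for b
  proof -
    have "b = 1" using that z1(1) by simp
    then have "z = - E" using that by simp
    then show False using z1(2) Phi_Euler[of "- E"] \<omega>0(2) by simp
  qed
  show ?thesis
  proof (cases "p \<in> S")
    case True
    have n1: "norm (\<nu> p) = 1" using norm_\<nu> True by blast
    show ?thesis
    proof (cases "p \<bullet> E > 0")
      case pos: True
      have "v \<bullet> z \<le> 0" if "v \<bullet> \<nu> p < 0" for v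
        by (rule md[OF wedge_direction_enters[OF True that]]) (use pos in simp)
      then obtain a where a: "a \<ge> 0" "z = a *\<^sub>R \<nu> p" using inner_le_halfspace_imp[OF n1] by blast
      then have "a = 1" using z1(1) n1 by simp
      then have "\<nu> p = z" using a by simp
      then show ?thesis using True pos p(2) by blast
    next
      case False
      then have p0: "p \<bullet> E = 0" using pE by simp
      obtain u where u: "u \<bullet> \<nu> p = 0" "u \<bullet> E \<noteq> 0" using transversal[OF True p0] by blast
      have "\<bar>\<nu> p \<bullet> E\<bar> \<noteq> norm (\<nu> p) * norm E"
      proof
        assume "\<bar>\<nu> p \<bullet> E\<bar> = norm (\<nu> p) * norm E"
        then have "collinear {0, \<nu> p, E}" by (rule norm_cauchy_schwarz_equal[THEN iffD1])
        then obtain c where "E = c *\<^sub>R \<nu> p" using \<nu>_nz[OF True] by (auto simp: collinear_lemma)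
        then have "u \<bullet> E = c * (u \<bullet> \<nu> p)" by (metis inner_scaleR_right)
        then show False using u by simp
      qed
      then have ab: "\<bar>\<nu> p \<bullet> E\<bar> < 1" using Cauchy_Schwarz_ineq2[of "\<nu> p" E] n1 by simp
      have "v \<bullet> z \<le> 0" if "v \<bullet> \<nu> p < 0" "v \<bullet> E > 0" for v
        by (rule md[OF wedge_direction_enters[OF True that(1)]]) (use that in simp)
      then obtain a b where ab: "a \<ge> 0" "b \<ge> 0" "z = a *\<^sub>R \<nu> p - b *\<^sub>R E"
        using inner_le_wedge_imp[OF n1 norm_E ab] by blast
      have "p \<in> hs_boundary S" using boundary_iff[OF True] p0 by simp
      then have "\<Phi> (\<nu> p) \<bullet> (- E) \<ge> \<omega>0" by (rule contact_angle)
      then have False using bad[OF ab(3) _ ab(2) n1] bad2[of b] ab by (cases "a = 0") auto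
      then show ?thesis ..
    qed
  next
    case False
    then have p0: "p \<bullet> E = 0" using frontier_iff[of p] pf pE by fastforce
    have "closed S" using compact_S by (simp add: compact_imp_closed)
    then obtain r where r: "r > 0" "ball p r \<inter> S = {}" using False
      by (metis Compl_iff disjoint_eq_subset_Compl open_Compl openE)
    \<comment> \<open>Away from S the domain fills a whole half ball at p, so every upward direction
      enters it and -E is the only possible normal.\<close>
    have half_ball: "ball p r \<inter> {x. x \<bullet> E > 0} \<subseteq> \<Omega>"
    proof (rule connected_in_\<Omega>)
      have "convex {x. x \<bullet> E > 0}" using convex_halfspace_gt[of 0 E] by (simp add: inner_commute)
      then show "connected (ball p r \<inter> {x. x \<bullet> E > 0})" by (intro convex_connected convex_Int convex_ball)
      obtain x where "x \<in> \<Omega>" "dist x p < r" using p(1) r(1) unfolding closure_approachable by blast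
      then have "x \<in> ball p r \<inter> {x. x \<bullet> E > 0} \<inter> \<Omega>" using \<Omega>_half[of x] by (simp add: dist_commute)
      then show "ball p r \<inter> {x. x \<bullet> E > 0} \<inter> \<Omega> \<noteq> {}" by blast
      show "ball p r \<inter> {x. x \<bullet> E > 0} \<inter> S = {}" using r(2) by blast
    qed auto
    have "v \<bullet> z \<le> 0" if v: "v \<bullet> (- E) < 0" for v
    proof (rule md, intro exI[of _ "r / (norm v + 1)"] conjI allI impI)
      have nv: "norm v + 1 > 0" by (simp add: add_nonneg_pos)
      then show "r / (norm v + 1) > 0" using r(1) by simp
      fix t assume t: "0 < t" "t < r / (norm v + 1)"
      then have "norm (t *\<^sub>R v) < r" using nv by (simp add: field_simps)
      then have "p + t *\<^sub>R v \<in> ball p r" by (simp add: dist_norm)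
      moreover have "(p + t *\<^sub>R v) \<bullet> E > 0" using v t p0 by (simp add: inner_add_left)
      ultimately show "p + t *\<^sub>R v \<in> \<Omega>" using half_ball by blast
    qed
    moreover have "norm (- E) = 1" by simp
    ultimately obtain a where "a \<ge> 0" "z = a *\<^sub>R (- E)" using inner_le_halfspace_imp by blast
    then have False using bad2[of a] by simp
    then show ?thesis ..
  qed
qed

section \<open>The inequality\<close>

definition "contact p \<longleftrightarrow> (\<forall>x\<in>closure \<Omega>. x \<bullet> \<nu> p \<le> p \<bullet> \<nu> p)"
definition "\<Sigma>_plus = {p \<in> S. p \<bullet> E > 0 \<and> contact p \<and> \<nu> p \<in> cap}"

text \<open>The case u = \<nu> p, \<mu> = 0 of \<open>constrained_max\<close>; the multiplier is
  then 1.\<close>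

lemma contact_second_order:
  assumes p: "p \<in> S" "p \<bullet> E > 0" "contact p" and ext: "normal_ext S \<nu> B n n' \<rho> a" "p \<in> B" and v: "v \<bullet> \<nu> p = 0"
  shows "n' p v \<bullet> v \<ge> 0"
proof -
  have nb: "p \<notin> hs_boundary S" using boundary_iff[OF p(1)] p(2) by simp
  have "x \<bullet> \<nu> p + 0 / 2 * (x \<bullet> x) \<le> p \<bullet> \<nu> p + 0 / 2 * (p \<bullet> p)" if "x \<in> S" "dist x p < 1" for x
    using p(3) S_subset_closure that unfolding contact_def by auto
  from constrained_max[OF ext(1) p(1) ext(2) nb zero_less_one this]
  obtain l where l: "\<nu> p + 0 *\<^sub>R p = l *\<^sub>R \<nu> p" "\<And>v. v \<bullet> \<nu> p = 0 \<Longrightarrow> 0 * (v \<bullet> v) \<le> l * (n' p v \<bullet> v)" by blast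
  have "\<nu> p = l *\<^sub>R \<nu> p" using l(1) by simp
  then have "\<nu> p \<bullet> \<nu> p = l * (\<nu> p \<bullet> \<nu> p)" by (metis inner_scaleR_left)
  then have "l = 1" using norm_\<nu>[OF p(1)] by (simp add: dot_square_norm)
  then show ?thesis using l(2)[OF v] by simp
qed

lemma contact_H_K:
  assumes p: "p \<in> S" "p \<bullet> E > 0" "contact p"
  shows "H p \<ge> 0" "K p \<le> H p ^ CARD('n)"
    and "K p = H p ^ CARD('n) \<Longrightarrow> normal_ext S \<nu> B n n' \<rho> a \<Longrightarrow> p \<in> B \<Longrightarrow> v \<bullet> \<nu> p = 0 \<Longrightarrow> NF' n n' p v = H p *\<^sub>R v"
proof -
  obtain B n n' \<rho> a where ext: "normal_ext S \<nu> B n n' \<rho> a" "p \<in> B" using exists_ext[OF p(1)] .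
  note so = contact_second_order[OF p ext]
  show "H p \<ge> 0" by (rule contact_curvature(1)[OF ext(1) p(1) ext(2) so])
  show "K p \<le> H p ^ CARD('n)" by (rule contact_curvature(2)[OF ext(1) p(1) ext(2) so])
next
  assume eq: "K p = H p ^ CARD('n)" and ext: "normal_ext S \<nu> B n n' \<rho> a" "p \<in> B" and v: "v \<bullet> \<nu> p = 0"
  show "NF' n n' p v = H p *\<^sub>R v"
    by (rule contact_curvature(3)[OF ext(1) p(1) ext(2) contact_second_order[OF p ext] eq v])
qed

lemma closed_contact: "closed {p \<in> S. contact p}"
proof -
  have eq: "{p \<in> S. contact p} = S \<inter> (\<Inter>x\<in>closure \<Omega>. S \<inter> (\<lambda>p. (x - p) \<bullet> \<nu> p) -` {..0})"
  proof (rule set_eqI)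
    fix p
    have "(x - p) \<bullet> \<nu> p \<in> {..0} \<longleftrightarrow> x \<bullet> \<nu> p \<le> p \<bullet> \<nu> p" for x by (simp add: inner_diff_left)
    then show "p \<in> {p \<in> S. contact p} \<longleftrightarrow> p \<in> S \<inter> (\<Inter>x\<in>closure \<Omega>. S \<inter> (\<lambda>p. (x - p) \<bullet> \<nu> p) -` {..0})"
      unfolding contact_def mem_Collect_eq Int_iff INT_iff vimage_eq by blast
  qed
  have cl: "closed S" using compact_S by (rule compact_imp_closed)
  have "closed (S \<inter> (\<lambda>p. (x - p) \<bullet> \<nu> p) -` {..0})" for x
    by (intro continuous_closed_preimage continuous_intros cont_\<nu> cl closed_atMost)
  then show ?thesis unfolding eq by (intro closed_Int closed_INT cl) blast
qed

lemma cont_angle: "continuous_on S (\<lambda>p. \<Phi> (\<nu> p) \<bullet> (- E))"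
  by (intro continuous_intros continuous_on_compose2[OF continuous_on_Phi cont_\<nu>]) (use \<nu>_nz in auto)

lemma \<Sigma>_plus_borel: "\<Sigma>_plus \<in> sets borel" and \<Sigma>_plus_subset: "\<Sigma>_plus \<subseteq> S"
proof -
  have "\<Sigma>_plus = {p \<in> S. contact p} \<inter> {p. p \<bullet> E > 0} \<inter> {p \<in> S. \<Phi> (\<nu> p) \<bullet> (- E) \<in> {..<\<omega>0}}"
    using norm_\<nu> by (auto simp: \<Sigma>_plus_def cap_def)
  moreover have "open {p. p \<bullet> E > 0}" by (intro open_Collect_less continuous_intros)
  moreover have "{p \<in> S. \<Phi> (\<nu> p) \<bullet> (- E) \<in> {..<\<omega>0}} \<in> sets borel"
    by (rule borel_preimage_of_continuous_on[OF S_borel cont_angle]) simp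
  ultimately show "\<Sigma>_plus \<in> sets borel" using closed_contact by (simp add: borel_closed borel_open sets.Int)
  show "\<Sigma>_plus \<subseteq> S" by (auto simp: \<Sigma>_plus_def)
qed

lemma truncated_subset_cone: "truncated_wulff_ball F \<omega>0 \<subseteq> gcone \<Sigma>_plus"
proof
  fix x assume "x \<in> truncated_wulff_ball F \<omega>0"
  then obtain z t where z: "z \<in> cap" "0 < t" "t < 1" "x = t *\<^sub>R (\<Phi> z + shift)" using truncated_subset_cap_cone by blast
  obtain p where "p \<in> S" "p \<bullet> E > 0" "\<nu> p = z" "\<forall>x\<in>closure \<Omega>. x \<bullet> z \<le> p \<bullet> z"
    using contact_point_exists[OF z(1)] by blast
  then have "p \<in> \<Sigma>_plus" "x = t *\<^sub>R Nrm p" using z by (auto simp: \<Sigma>_plus_def contact_def Nrm_def)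
  then show "x \<in> gcone \<Sigma>_plus" using z unfolding gcone_def by blast
qed

lemma truncated_borel: "truncated_wulff_ball F \<omega>0 \<in> sets borel"
proof -
  have "open (wulff_ball F 1 x)" for x :: "'n ambient"
    unfolding wulff_ball_def
    by (intro open_Collect_less continuous_on_compose2[OF continuous_on_dual_norm] continuous_intros) auto
  moreover have "open (open_half_space :: 'n ambient set)"
    unfolding open_half_space_def by (intro open_Collect_less continuous_intros)
  ultimately show ?thesis unfolding truncated_wulff_ball_def by (intro borel_open open_Int)
qed

text \<open>Stated for any Borel set between \<open>\<Sigma>_plus\<close> and S: the smallest choice
  gives the inequality, a slightly larger one is used in the equality case.\<close>

lemma emeasure_truncated_le:
  assumes "A \<in> sets borel" "\<Sigma>_plus \<subseteq> A" "A \<subseteq> S"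
  shows "emeasure lborel (truncated_wulff_ball F \<omega>0) \<le> ennreal (1 / (real CARD('n) + 1)) * (\<integral>\<^sup>+p\<in>A. ennreal (\<Theta> p * K p) \<partial>\<mu>)"
proof -
  have "emeasure lborel (truncated_wulff_ball F \<omega>0) = emeasure lebesgue (truncated_wulff_ball F \<omega>0)"
    using truncated_borel by simp
  also have "\<dots> \<le> emeasure lebesgue (gcone A)"
  proof (rule emeasure_mono[OF _ cone_volume(1)[OF assms(1,3)]])
    have "gcone \<Sigma>_plus \<subseteq> gcone A" using assms(2) unfolding gcone_def by blast
    then show "truncated_wulff_ball F \<omega>0 \<subseteq> gcone A" using truncated_subset_cone by blast
  qed
  also have "\<dots> \<le> ennreal (1 / (real CARD('n) + 1)) * (\<integral>\<^sup>+p\<in>A. ennreal (\<Theta> p * K p) \<partial>\<mu>)"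
    by (rule cone_volume(2)[OF assms(1,3)])
  finally show ?thesis .
qed

theorem willmore_inequality:
  "ennreal (measure lborel (truncated_wulff_ball F \<omega>0)) = emeasure lborel (truncated_wulff_ball F \<omega>0)"
  "emeasure lborel (truncated_wulff_ball F \<omega>0) \<le> ennreal (1 / (real CARD('n) + 1) * willmore_integral F \<omega>0 S \<nu>)"
  "measure lborel (truncated_wulff_ball F \<omega>0) \<le> 1 / (real CARD('n) + 1) * willmore_integral F \<omega>0 S \<nu>"
proof -
  let ?c = "ennreal (1 / (real CARD('n) + 1))"
  have "emeasure lborel (truncated_wulff_ball F \<omega>0) \<le> ?c * (\<integral>\<^sup>+p\<in>\<Sigma>_plus. ennreal (\<Theta> p * K p) \<partial>\<mu>)"
    by (rule emeasure_truncated_le[OF \<Sigma>_plus_borel order_refl \<Sigma>_plus_subset])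
  also have "\<dots> \<le> ?c * (\<integral>\<^sup>+p\<in>S. ennreal (\<Theta> p * \<bar>H p\<bar> ^ CARD('n)) \<partial>\<mu>)"
  proof (intro mult_left_mono nn_integral_mono)
    fix p
    show "ennreal (\<Theta> p * K p) * indicator \<Sigma>_plus p \<le> ennreal (\<Theta> p * \<bar>H p\<bar> ^ CARD('n)) * indicator S p"
    proof (cases "p \<in> \<Sigma>_plus")
      case True
      then have p: "p \<in> S" "p \<bullet> E > 0" "contact p" by (auto simp: \<Sigma>_plus_def)
      have "\<Theta> p * K p \<le> \<Theta> p * \<bar>H p\<bar> ^ CARD('n)"
        using contact_H_K(1,2)[OF p] \<Theta>_pos[OF p(1)] by (intro mult_left_mono) auto
      then show ?thesis using True p by (simp add: ennreal_leI)
    qed simp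
  qed simp
  also have "\<dots> = ennreal (1 / (real CARD('n) + 1) * willmore_integral F \<omega>0 S \<nu>)"
    unfolding willmore_eq_nn_integral[symmetric] using willmore_nonneg by (intro ennreal_mult[symmetric]) auto
  finally show le: "emeasure lborel (truncated_wulff_ball F \<omega>0) \<le> ennreal (1 / (real CARD('n) + 1) * willmore_integral F \<omega>0 S \<nu>)" .
  \<comment> \<open>Finiteness of the volume comes from the bound itself; it is needed because
    \<open>measure\<close> of a set of infinite volume is 0.\<close>
  then have "emeasure lborel (truncated_wulff_ball F \<omega>0) < \<infinity>" using le_less_trans ennreal_less_top by fastforce
  then show eq: "ennreal (measure lborel (truncated_wulff_ball F \<omega>0)) = emeasure lborel (truncated_wulff_ball F \<omega>0)"
    by (simp add: emeasure_eq_ennreal_measure)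
  show "measure lborel (truncated_wulff_ball F \<omega>0) \<le> 1 / (real CARD('n) + 1) * willmore_integral F \<omega>0 S \<nu>"
    using le willmore_nonneg unfolding eq[symmetric] by (simp add: ennreal_le_iff)
qed

end

section \<open>Umbilic pieces of the surface\<close>

text \<open>The inverse function theorem with derivatives continuous in each direction; in finite
  dimension this is continuity in operator norm.\<close>

lemma local_inverse:
  fixes f :: "'a::euclidean_space \<Rightarrow> 'a"
  assumes U: "open U" "x0 \<in> U" and f: "\<And>x. x \<in> U \<Longrightarrow> (f has_derivative f' x) (at x)"
    and cont: "\<And>v. continuous_on U (\<lambda>x. f' x v)" and inj: "\<And>v. f' x0 v = 0 \<Longrightarrow> v = 0"
  shows "\<exists>U' V g g'. open U' \<and> U' \<subseteq> U \<and> x0 \<in> U' \<and> open V \<and> homeomorphism U' V f g \<and>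
    (\<forall>y\<in>V. (g has_derivative g' y) (at y) \<and> (\<forall>v. f' (g y) (g' y v) = v))"
proof -
  define D where "D x = Blinfun (f' x)" for x
  have D: "blinfun_apply (D x) = f' x" if "x \<in> U" for x
    using f[OF that] by (simp add: D_def bounded_linear_Blinfun_apply has_derivative_bounded_linear)
  have contD: "continuous_on U D"
  proof (rule continuous_on_blinfun_componentwise)
    fix i :: 'a
    show "continuous_on U (\<lambda>x. blinfun_apply (D x) i)"
      by (rule continuous_on_eq[OF cont[of i]]) (simp add: D)
  qed
  have lin: "linear (f' x0)" using f[OF U(2)] has_derivative_linear by blast
  have "inj (f' x0)" using inj by (simp add: linear_injective_0[OF lin])
  then obtain k where k: "linear k" "\<And>x. k (f' x0 x) = x" using linear_injective_isomorphism[OF lin] by blast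
  have "blinfun_apply (Blinfun k) = k" using k(1) by (simp add: bounded_linear_Blinfun_apply linear_conv_bounded_linear)
  then have inv: "Blinfun k o\<^sub>L D x0 = id_blinfun"
    by (intro blinfun_eqI) (simp add: D[OF U(2)] k(2))
  show ?thesis
  proof (rule inverse_function_theorem[OF U(1) _ contD U(2) inv])
    show "(f has_derivative blinfun_apply (D x)) (at x)" if "x \<in> U" for x using f[OF that] by (simp add: D that)
  next
    fix U' V g g'
    assume *: "open U'" "U' \<subseteq> U" "x0 \<in> U'" "open V" "f x0 \<in> V" "homeomorphism U' V f g"
      "\<And>y. y \<in> V \<Longrightarrow> (g has_derivative (g' y)) (at y)"
      "\<And>y. y \<in> V \<Longrightarrow> g' y = inv (blinfun_apply (D (g y)))" "\<And>y. y \<in> V \<Longrightarrow> bij (blinfun_apply (D (g y)))"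
    have "f' (g y) (g' y v) = v" if "y \<in> V" for y v
    proof -
      have "g y \<in> U" using *(2,6) that unfolding homeomorphism_def by blast
      then have "bij (f' (g y))" "g' y = inv (f' (g y))" using *(8,9)[OF that] by (simp_all add: D)
      then show ?thesis by (simp add: bij_is_surj surj_f_inv_f)
    qed
    then have "\<forall>y\<in>V. (g has_derivative g' y) (at y) \<and> (\<forall>v. f' (g y) (g' y v) = v)" using *(7) by simp
    with *(1-4,6) show ?thesis by (intro exI[of _ U'] exI[of _ V] exI[of _ g] exI[of _ g']) simp
  qed
qed

lemma constant_on_segment:
  fixes f :: "'a::real_normed_vector \<Rightarrow> 'b::real_normed_vector"
  assumes "convex D" "x \<in> D" "y \<in> D" and f: "\<And>z. z \<in> D \<Longrightarrow> (f has_derivative f' z) (at z)"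
    and zero: "\<And>z. z \<in> D \<Longrightarrow> f' z (y - x) = 0"
  shows "f x = f y"
proof -
  have mem: "x + t *\<^sub>R (y - x) \<in> D" if "t \<in> {0..1}" for t
  proof -
    have "(1 - t) *\<^sub>R x + t *\<^sub>R y \<in> D" using that by (intro convexD_alt assms) auto
    then show ?thesis by (simp add: algebra_simps)
  qed
  have "((\<lambda>t. f (x + t *\<^sub>R (y - x))) has_derivative (\<lambda>h. 0)) (at t within {0..1})" if t: "t \<in> {0..1}" for t
  proof -
    have 1: "((\<lambda>t. x + t *\<^sub>R (y - x)) has_derivative (\<lambda>h. h *\<^sub>R (y - x))) (at t within {0..1})"
      by (auto intro!: derivative_eq_intros)
    have lin: "linear (f' (x + t *\<^sub>R (y - x)))" using f[OF mem[OF t]] has_derivative_linear by blast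
    have "((\<lambda>t. f (x + t *\<^sub>R (y - x))) has_derivative (\<lambda>h. f' (x + t *\<^sub>R (y - x)) (h *\<^sub>R (y - x)))) (at t within {0..1})"
      by (rule has_derivative_compose[OF 1 f[OF mem[OF t]]])
    then show ?thesis by (simp add: linear_cmul[OF lin] zero[OF mem[OF t]])
  qed
  then obtain c where "\<And>t. t \<in> {0..1} \<Longrightarrow> f (x + t *\<^sub>R (y - x)) = c"
    using has_derivative_zero_constant[of "{0..1::real}"] by (metis convex_closed_interval)
  from this[of 0] this[of 1] show ?thesis by simp
qed

text \<open>Here the dimension of the surface enters: for n \<ge> 2 there is a tangent direction
  orthogonal to a given tangent vector.\<close>

lemma exists_orthogonal_unit:
  fixes a b :: "'a::euclidean_space"
  assumes "DIM('a) \<ge> 3"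
  shows "\<exists>e. norm e = 1 \<and> e \<bullet> a = 0 \<and> e \<bullet> b = 0"
proof -
  have "dim {a, b} \<le> card {a, b}" by (rule dim_le_card') simp
  also have "\<dots> \<le> 2" by (simp add: card_insert_if)
  finally have "dim {a, b} < DIM('a)" using assms by simp
  then obtain x where x: "x \<noteq> 0" "\<And>y. y \<in> span {a, b} \<Longrightarrow> orthogonal x y" using orthogonal_to_subspace_exists by blast
  have "x \<bullet> a = 0" "x \<bullet> b = 0" using x(2)[of a] x(2)[of b] by (simp_all add: span_base orthogonal_def)
  then show ?thesis using x(1) by (intro exI[of _ "x /\<^sub>R norm x"]) simp
qed

context surface
begin

text \<open>In contrast to \<open>normal_ext\<close>, S is here the entire zero set of s in B. This
  is available at interior points; at a boundary point the chart coordinate also vanishes beyond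
  S.\<close>

definition regular_level :: "'n ambient set \<Rightarrow> ('n ambient \<Rightarrow> real) \<Rightarrow> ('n ambient \<Rightarrow> 'n ambient \<Rightarrow> real) \<Rightarrow> bool" where
  "regular_level B s s' \<longleftrightarrow> open B \<and> (\<forall>x\<in>B. (s has_derivative s' x) (at x)) \<and> (\<forall>v. continuous_on B (\<lambda>x. s' x v)) \<and>
    (\<forall>x\<in>B. x \<in> S \<longleftrightarrow> s x = 0) \<and> (\<forall>x\<in>S \<inter> B. \<forall>v. s' x v = 0 \<longleftrightarrow> v \<bullet> \<nu> x = 0)"

lemma exists_regular_level:
  assumes p: "p \<in> S" "p \<notin> hs_boundary S"
  obtains B s s' where "regular_level B s s'" "p \<in> B"
proof -
  obtain W U V \<psi> g where c: "chart S W U V \<psi> g" and pU: "p \<in> U" using exists_chart[OF p(1)] .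
  interpret chart S W U V \<psi> g by (rule c)
  have int: "interior_param (fst (\<psi> p))" by (rule boundary_or_interior[OF p(1) pU p(2)])
  have "\<exists>G. open G \<and> fst (\<psi> p) \<in> G \<and> G \<subseteq> W"
  proof (cases "W = UNIV")
    case False
    then obtain i where i: "W = model_half i" "fst (\<psi> p) $ i > 0" using int unfolding interior_param_def by blast
    have "open {y. y $ i > (0::real)}" by (intro open_Collect_less continuous_intros)
    then show ?thesis using i by (intro exI[of _ "{y. y $ i > 0}"]) (auto simp: model_half_def)
  qed auto
  then obtain G where G: "open G" "fst (\<psi> p) \<in> G" "G \<subseteq> W" by blast
  define B where "B = U \<inter> (\<lambda>x. fst (\<psi> x)) -` G"
  have oB: "open B" unfolding B_def
    by (intro continuous_open_preimage continuous_on_fst cont_\<psi> open_U G(1))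
  have dd: "((\<lambda>x. snd (\<psi> x)) has_derivative (\<lambda>v. snd (\<psi>' x v))) (at x)" if "x \<in> U" for x
    by (rule has_derivative_snd[OF der_\<psi>[OF that]])
  have cc: "continuous_on B (\<lambda>x. snd (\<psi>' x v))" for v
    by (rule continuous_on_snd, rule continuous_on_subset[OF C2_continuous_derivative[OF C2_\<psi>]]) (auto simp: B_def)
  have t: "snd (\<psi>' x v) = 0 \<longleftrightarrow> v \<bullet> \<nu> x = 0" if x: "x \<in> S" "x \<in> U" for x v
  proof -
    have "{v. v \<bullet> \<nu> x = 0} = Tan x" using tangent_space_eq_Tan[OF c x] tangent_space_perp[OF x(1)] by simp
    then show ?thesis unfolding Tan_def by blast
  qed
  show ?thesis
  proof
    show "p \<in> B" using pU G(2) by (simp add: B_def)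
    have BU: "x \<in> U" and BW: "fst (\<psi> x) \<in> W" if "x \<in> B" for x using that G(3) unfolding B_def by blast+
    show "regular_level B (\<lambda>x. snd (\<psi> x)) (\<lambda>x v. snd (\<psi>' x v))"
      unfolding regular_level_def
    proof (intro conjI ballI allI oB cc)
      show "((\<lambda>x. snd (\<psi> x)) has_derivative (\<lambda>v. snd (\<psi>' x v))) (at x)" if "x \<in> B" for x
        by (rule dd[OF BU[OF that]])
      show "x \<in> S \<longleftrightarrow> snd (\<psi> x) = 0" if "x \<in> B" for x using in_S_iff[OF BU[OF that]] BW[OF that] by simp
      show "snd (\<psi>' x v) = 0 \<longleftrightarrow> v \<bullet> \<nu> x = 0" if "x \<in> S \<inter> B" for x v using t BU that by blast
    qed
  qed
qed

end

context aniso_surface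
begin

text \<open>In graph coordinates \<open>y\<close> over the tangent plane at \<open>p\<close> the \<open>e\<close>-component of the anisotropic normal
  of an umbilic piece depends only on \<open>y \<bullet> e\<close>, hence so does its derivative, the curvature.  In
  dimension at least three this makes the curvature locally constant.\<close>

lemma umbilic_locally_constant:
  assumes n: "CARD('n) \<ge> 2" and p: "p \<in> S" "p \<notin> hs_boundary S" and Q: "open Q" "p \<in> Q"
    and nz: "H p \<noteq> 0"
    and umb: "\<And>B n n' \<rho> a q v. normal_ext S \<nu> B n n' \<rho> a \<Longrightarrow> q \<in> S \<Longrightarrow> q \<in> B \<Longrightarrow> q \<in> Q \<Longrightarrow> v \<bullet> \<nu> q = 0 \<Longrightarrow> NF' n n' q v = H q *\<^sub>R v"
  shows "\<exists>\<delta>>0. \<forall>q\<in>S. dist q p < \<delta> \<longrightarrow> H q = H p \<and> q - \<Phi> (\<nu> q) /\<^sub>R H p = p - \<Phi> (\<nu> p) /\<^sub>R H p"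
proof -
  obtain B n n' \<rho> a where ext: "normal_ext S \<nu> B n n' \<rho> a" and pB: "p \<in> B" using exists_ext[OF p(1)] .
  obtain L s s' where lev: "regular_level L s s'" and pL: "p \<in> L" using exists_regular_level[OF p] .
  have L: "open L" "p \<in> L" and s: "\<And>x. x \<in> L \<Longrightarrow> (s has_derivative s' x) (at x)"
    and s': "\<And>v. continuous_on L (\<lambda>x. s' x v)" and LS: "\<And>x. x \<in> L \<Longrightarrow> x \<in> S \<longleftrightarrow> s x = 0"
    and ker: "\<And>x v. x \<in> S \<Longrightarrow> x \<in> L \<Longrightarrow> s' x v = 0 \<longleftrightarrow> v \<bullet> \<nu> x = 0"
    using lev pL unfolding regular_level_def by blast+
  define z where "z = \<nu> p"
  have zz: "z \<bullet> z = 1" using norm_\<nu>[OF p(1)] by (simp add: z_def dot_square_norm)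
  \<comment> \<open>Graph coordinates: the component along z, measured from p, is replaced by s and
    the others are kept, so S becomes the hyperplane through p orthogonal to z.\<close>
  define \<Psi> where "\<Psi> x = x + (s x - (x - p) \<bullet> z) *\<^sub>R z" for x
  define \<Psi>' where "\<Psi>' x v = v + (s' x v - v \<bullet> z) *\<^sub>R z" for x v
  have \<Psi>p: "\<Psi> p = p" using LS[OF L(2)] p(1) by (simp add: \<Psi>_def)
  let ?U = "L \<inter> B \<inter> Q"
  have "\<exists>U' V X X'. open U' \<and> U' \<subseteq> ?U \<and> p \<in> U' \<and> open V \<and> homeomorphism U' V \<Psi> X \<and>
    (\<forall>y\<in>V. (X has_derivative X' y) (at y) \<and> (\<forall>v. \<Psi>' (X y) (X' y v) = v))"
  proof (rule local_inverse)
    show "open ?U" using L(1) ext_open[OF ext] Q(1) by blast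
    show "p \<in> ?U" using L(2) pB Q(2) by blast
    show "(\<Psi> has_derivative \<Psi>' x) (at x)" if "x \<in> ?U" for x
    proof -
      have "x \<in> L" using that by blast
      note [derivative_intros] = s[OF this]
      show ?thesis unfolding \<Psi>_def \<Psi>'_def by (auto intro!: derivative_eq_intros)
    qed
    show "continuous_on ?U (\<lambda>x. \<Psi>' x v)" for v
      unfolding \<Psi>'_def by (intro continuous_intros continuous_on_subset[OF s']) blast
    fix v assume v: "\<Psi>' p v = 0"
    have "\<Psi>' p v \<bullet> z = s' p v" by (simp add: \<Psi>'_def inner_add_left zz)
    then have "s' p v = 0" using v by simp
    moreover from this have "v \<bullet> z = 0" using ker[OF p(1) L(2)] by (simp add: z_def)
    ultimately show "v = 0" using v by (simp add: \<Psi>'_def)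
  qed
  then obtain U' V X X' where UV: "open U'" "U' \<subseteq> ?U" "p \<in> U'" "open V" "homeomorphism U' V \<Psi> X"
    and X: "\<And>y. y \<in> V \<Longrightarrow> (X has_derivative X' y) (at y)" "\<And>y v. y \<in> V \<Longrightarrow> \<Psi>' (X y) (X' y v) = v" by blast
  have X\<Psi>: "X (\<Psi> x) = x" "\<Psi> x \<in> V" if "x \<in> U'" for x using UV(5) that unfolding homeomorphism_def by blast+
  have \<Psi>X: "\<Psi> (X y) = y" "X y \<in> U'" if "y \<in> V" for y using UV(5) that unfolding homeomorphism_def by blast+
  have "p \<in> V" using X\<Psi>(2)[OF UV(3)] \<Psi>p by simp
  then obtain r where r: "r > 0" "ball p r \<subseteq> V" using UV(4) openE by blast
  define D where "D = ball p r \<inter> {y. (y - p) \<bullet> z = 0}"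
  have convD: "convex D"
  proof -
    have "{y. (y - p) \<bullet> z = 0} = {y. z \<bullet> y = z \<bullet> p}" by (simp add: inner_diff_left inner_commute[of z])
    then show ?thesis unfolding D_def by (simp add: convex_Int convex_hyperplane)
  qed
  have DV: "y \<in> V" if "y \<in> D" for y using that r(2) by (auto simp: D_def)
  have pD: "p \<in> D" using r(1) by (simp add: D_def)
  have XS: "X y \<in> S" "X y \<in> B" "X y \<in> Q" "X y \<in> L" if y: "y \<in> D" for y
  proof -
    show *: "X y \<in> B" "X y \<in> Q" "X y \<in> L" using \<Psi>X(2)[OF DV[OF y]] UV(2) by auto
    have "y \<bullet> z = \<Psi> (X y) \<bullet> z" by (simp add: \<Psi>X(1)[OF DV[OF y]])
    also have "\<dots> = s (X y) + p \<bullet> z" by (simp add: \<Psi>_def inner_add_left inner_diff_left zz)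
    finally have "s (X y) = 0" using y by (simp add: D_def inner_diff_left)
    then show "X y \<in> S" using LS[OF *(3)] by simp
  qed
  have tan: "X' y v \<bullet> \<nu> (X y) = 0" and comp: "e \<bullet> z = 0 \<Longrightarrow> X' y v \<bullet> e = v \<bullet> e" if y: "y \<in> D" and v: "v \<bullet> z = 0" for y v e
  proof -
    have "v \<bullet> z = \<Psi>' (X y) (X' y v) \<bullet> z" by (simp add: X(2)[OF DV[OF y]])
    also have "\<dots> = s' (X y) (X' y v)" by (simp add: \<Psi>'_def inner_add_left zz)
    finally show "X' y v \<bullet> \<nu> (X y) = 0" using v ker[OF XS(1,4)[OF y]] by simp
    assume e: "e \<bullet> z = 0"
    have "v \<bullet> e = \<Psi>' (X y) (X' y v) \<bullet> e" by (simp add: X(2)[OF DV[OF y]])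
    also have "\<dots> = X' y v \<bullet> e" using e by (simp add: \<Psi>'_def inner_add_left inner_commute[of z e])
    finally show "X' y v \<bullet> e = v \<bullet> e" by simp
  qed
  define \<phi> where "\<phi> y = \<Phi> (n (X y))" for y
  define \<phi>' where "\<phi>' y v = NF' n n' (X y) (X' y v)" for y v
  have \<phi>: "(\<phi> has_derivative \<phi>' y) (at y)" if "y \<in> D" for y
    unfolding \<phi>_def \<phi>'_def by (rule has_derivative_compose[OF X(1)[OF DV[OF that]] NF_der[OF ext XS(2)[OF that]]])
  have \<phi>': "\<phi>' y v = H (X y) *\<^sub>R X' y v" if y: "y \<in> D" and v: "v \<bullet> z = 0" for y v
    unfolding \<phi>'_def by (rule umb[OF ext XS(1-3)[OF y] tan[OF y v]])
  \<comment> \<open>By \<open>\<phi>'\<close> and \<open>comp\<close> the derivative of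
    \<langle>\<phi>, e\<rangle> along v is H \<langle>v, e\<rangle>, which is zero for v orthogonal
    to e.\<close>
  have const: "\<phi> y \<bullet> e = \<phi> y' \<bullet> e" if y: "y \<in> D" "y' \<in> D" and e: "e \<bullet> z = 0" "(y' - y) \<bullet> e = 0" for y y' e
  proof (rule constant_on_segment[OF convD y])
    fix x assume x: "x \<in> D"
    show "((\<lambda>x. \<phi> x \<bullet> e) has_derivative (\<lambda>v. \<phi>' x v \<bullet> e)) (at x)"
      by (rule has_derivative_inner_left[OF \<phi>[OF x]])
    have v: "(y' - y) \<bullet> z = 0" using y by (simp add: D_def inner_diff_left)
    show "\<phi>' x (y' - y) \<bullet> e = 0" using \<phi>'[OF x v] comp[OF x v e(1)] e(2) by simp
  qed
  have H_const: "H (X y) = H p" if y: "y \<in> D" for y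
  proof -
    have "DIM('n ambient) \<ge> 3" using n by simp
    \<comment> \<open>Orthogonal to y - p, so the functions \<langle>\<phi>, e\<rangle> along the
      parallel lines p + t e and y + t e agree; their derivatives at 0 are the curvatures at p and
      at X y.\<close>
    then obtain e where e: "norm e = 1" "e \<bullet> z = 0" "e \<bullet> (y - p) = 0" using exists_orthogonal_unit by blast
    have der: "((\<lambda>t. \<phi> (x + t *\<^sub>R e) \<bullet> e) has_real_derivative H (X x)) (at 0)" if x: "x \<in> D" for x
    proof -
      have 1: "((\<lambda>t. x + t *\<^sub>R e) has_derivative (\<lambda>h. h *\<^sub>R e)) (at (0::real))"
        by (auto intro!: derivative_eq_intros)
      have 2: "(\<phi> has_derivative \<phi>' x) (at (x + 0 *\<^sub>R e))" using \<phi>[OF x] by simp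
      have "((\<lambda>t. \<phi> (x + t *\<^sub>R e) \<bullet> e) has_derivative (\<lambda>h. \<phi>' x (h *\<^sub>R e) \<bullet> e)) (at 0)"
        by (rule has_derivative_inner_left[OF has_derivative_compose[OF 1 2]])
      moreover have "\<phi>' x (h *\<^sub>R e) \<bullet> e = H (X x) * h" for h
        using \<phi>'[OF x, of "h *\<^sub>R e"] comp[OF x, of "h *\<^sub>R e" e] e by (simp add: dot_square_norm)
      ultimately show ?thesis by (simp add: has_field_derivative_def)
    qed
    have near: "\<forall>\<^sub>F t in nhds 0. x + t *\<^sub>R e \<in> D" if x: "x \<in> D" for x
    proof -
      have "((\<lambda>t. x + t *\<^sub>R e) \<longlongrightarrow> x + 0 *\<^sub>R e) (nhds (0::real))" by (intro tendsto_intros filterlim_ident)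
      then have "\<forall>\<^sub>F t in nhds (0::real). x + t *\<^sub>R e \<in> ball p r"
        using x by (intro topological_tendstoD) (auto simp: D_def)
      then show ?thesis by (rule eventually_mono) (use x e in \<open>simp add: D_def inner_diff_left inner_add_left\<close>)
    qed
    have "\<forall>\<^sub>F t in nhds 0. \<phi> (p + t *\<^sub>R e) \<bullet> e = \<phi> (y + t *\<^sub>R e) \<bullet> e"
      using near[OF pD] near[OF y]
    proof eventually_elim
      case (elim t)
      show ?case by (rule const[OF elim e(2)]) (use e(3) in \<open>simp add: inner_commute\<close>)
    qed
    then have "((\<lambda>t. \<phi> (p + t *\<^sub>R e) \<bullet> e) has_real_derivative H (X y)) (at 0)"
      using der[OF y] DERIV_cong_ev[OF refl _ refl] by fastforce
    moreover have "X p = p" using X\<Psi>(1)[OF UV(3)] \<Psi>p by simp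
    ultimately show ?thesis using der[OF pD] DERIV_unique by fastforce
  qed
  \<comment> \<open>With H constant on the piece, X and \<phi> / H have the same derivative along
    the hyperplane.\<close>
  have center: "X y - \<phi> y /\<^sub>R H p = p - \<phi> p /\<^sub>R H p" if y: "y \<in> D" for y
  proof -
    have "X y - \<phi> y /\<^sub>R H p = X p - \<phi> p /\<^sub>R H p"
    proof (rule constant_on_segment[OF convD y pD])
      fix x assume x: "x \<in> D"
      show "((\<lambda>x. X x - \<phi> x /\<^sub>R H p) has_derivative (\<lambda>v. X' x v - \<phi>' x v /\<^sub>R H p)) (at x)"
        by (intro has_derivative_diff has_derivative_scaleR_right \<phi>[OF x] X(1)[OF DV[OF x]])
      have v: "(p - y) \<bullet> z = 0" using y by (simp add: D_def inner_diff_left)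
      show "X' x (p - y) - \<phi>' x (p - y) /\<^sub>R H p = 0" unfolding \<phi>'[OF x v] H_const[OF x] using nz by simp
    qed
    then show ?thesis using X\<Psi>(1)[OF UV(3)] \<Psi>p by simp
  qed
  have cont: "isCont \<Psi> p"
  proof -
    have "isCont s p" using s[OF L(2)] has_derivative_continuous by blast
    then show ?thesis unfolding \<Psi>_def by (intro continuous_intros)
  qed
  then obtain \<delta>1 where \<delta>1: "\<delta>1 > 0" "\<And>x. dist x p < \<delta>1 \<Longrightarrow> dist (\<Psi> x) p < r"
    using r(1) \<Psi>p unfolding continuous_at_eps_delta by metis
  obtain \<delta>2 where \<delta>2: "\<delta>2 > 0" "ball p \<delta>2 \<subseteq> U'" using UV(1,3) openE by blast
  show ?thesis
  proof (intro exI[of _ "min \<delta>1 \<delta>2"] conjI ballI impI)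
    show "min \<delta>1 \<delta>2 > 0" using \<delta>1 \<delta>2 by simp
    fix q assume q: "q \<in> S" "dist q p < min \<delta>1 \<delta>2"
    have qU: "q \<in> U'" using \<delta>2(2) q(2) by (auto simp: dist_commute)
    then have qB: "q \<in> L" "q \<in> B" using UV(2) by auto
    have "(\<Psi> q - p) \<bullet> z = s q" by (simp add: \<Psi>_def inner_add_left inner_diff_left zz)
    also have "\<dots> = 0" using LS[OF qB(1)] q(1) by simp
    finally have qD: "\<Psi> q \<in> D" using \<delta>1(2)[of q] q(2) by (simp add: D_def dist_commute)
    show "H q = H p" using H_const[OF qD] X\<Psi>(1)[OF qU] by simp
    have "\<phi> (\<Psi> q) = \<Phi> (\<nu> q)" "\<phi> p = \<Phi> (\<nu> p)"
      using ext_eq[OF ext q(1) qB(2)] ext_eq[OF ext p(1) pB] X\<Psi>(1)[OF qU] X\<Psi>(1)[OF UV(3)] \<Psi>p by (simp_all add: \<phi>_def)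
    then show "q - \<Phi> (\<nu> q) /\<^sub>R H p = p - \<Phi> (\<nu> p) /\<^sub>R H p" using center[OF qD] X\<Psi>(1)[OF qU] by simp
  qed
qed

text \<open>A shape operator with trivial kernel makes the Gauss map open at p. The sphere is
  thickened by the factor 1 + s, so that an open mapping theorem for the ambient space
  applies.\<close>

lemma gauss_map_open:
  assumes p: "p \<in> S" "p \<notin> hs_boundary S"
    and inj: "\<And>B n n' \<rho> a v. normal_ext S \<nu> B n n' \<rho> a \<Longrightarrow> p \<in> B \<Longrightarrow> v \<bullet> \<nu> p = 0 \<Longrightarrow> n' p v = 0 \<Longrightarrow> v = 0"
    and \<epsilon>: "\<epsilon> > 0"
  shows "\<exists>\<delta>>0. \<forall>z. norm z = 1 \<longrightarrow> dist z (\<nu> p) < \<delta> \<longrightarrow> (\<exists>q\<in>S. dist q p < \<epsilon> \<and> \<nu> q = z)"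
proof -
  obtain B n n' \<rho> a where ext: "normal_ext S \<nu> B n n' \<rho> a" and pB: "p \<in> B" using exists_ext[OF p(1)] .
  obtain L s s' where lev: "regular_level L s s'" and pL: "p \<in> L" using exists_regular_level[OF p] .
  have L: "open L" "p \<in> L" and s: "\<And>x. x \<in> L \<Longrightarrow> (s has_derivative s' x) (at x)"
    and s': "\<And>v. continuous_on L (\<lambda>x. s' x v)" and LS: "\<And>x. x \<in> L \<Longrightarrow> x \<in> S \<longleftrightarrow> s x = 0"
    and ker: "\<And>x v. x \<in> S \<Longrightarrow> x \<in> L \<Longrightarrow> s' x v = 0 \<longleftrightarrow> v \<bullet> \<nu> x = 0"
    using lev pL unfolding regular_level_def by blast+
  have sp: "s p = 0" using LS[OF L(2)] p(1) by simp
  have np: "n p = \<nu> p" "norm (n p) = 1" using ext_eq[OF ext p(1) pB] ext_norm[OF ext pB] by auto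
  have cs: "continuous_on L s" by (intro continuous_at_imp_continuous_on ballI has_derivative_continuous[OF s])
  define T where "T = (L \<inter> s -` {-1<..<1}) \<inter> B \<inter> ball p \<epsilon>"
  have oT: "open T" unfolding T_def
    by (intro open_Int continuous_open_preimage cs L(1) ext_open[OF ext] open_ball open_greaterThanLessThan)
  have pT: "p \<in> T" using L(2) pB \<epsilon> sp by (simp add: T_def)
  define G where "G x = (1 + s x) *\<^sub>R n x" for x
  define G' where "G' v = s' p v *\<^sub>R n p + n' p v" for v
  have der: "(G has_derivative G') (at p)"
  proof -
    have "(G has_derivative (\<lambda>v. (1 + s p) *\<^sub>R n' p v + (0 + s' p v) *\<^sub>R n p)) (at p)"
      unfolding G_def by (intro has_derivative_scaleR has_derivative_add has_derivative_const s[OF L(2)] ext_der[OF ext pB])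
    moreover have "G' = (\<lambda>v. (1 + s p) *\<^sub>R n' p v + (0 + s' p v) *\<^sub>R n p)"
      by (simp only: fun_eq_iff G'_def sp) simp
    ultimately show ?thesis by simp
  qed
  have lin: "linear G'" using der has_derivative_linear by blast
  have "v = 0" if v: "G' v = 0" for v
  proof -
    have "G' v \<bullet> n p = s' p v" using ext_perp[OF ext pB, of v] np(2) by (simp add: G'_def inner_add_left dot_square_norm)
    then have s0: "s' p v = 0" using v by simp
    then have "n' p v = 0" using v by (simp add: G'_def)
    then show ?thesis using inj[OF ext pB] ker[OF p(1) L(2)] s0 by blast
  qed
  then have "inj G'" by (simp add: linear_injective_0[OF lin])
  then obtain k where k: "linear k" "\<And>x. G' (k x) = x" using linear_injective_isomorphism[OF lin] by blast
  have Gk: "G' \<circ> k = id" using k(2) by (auto simp: fun_eq_iff)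
  have cG: "continuous_on T G"
    unfolding G_def by (intro continuous_intros continuous_on_subset[OF cs] continuous_on_subset[OF ext_cont[OF ext]]) (auto simp: T_def)
  have bk: "bounded_linear k" using k(1) by (simp add: linear_conv_bounded_linear)
  have "p \<in> interior T" using pT oT by (simp add: interior_open)
  then have "G p \<in> interior (G ` T)" by (rule sussmann_open_mapping[OF oT cG pT der bk Gk order_refl])
  moreover have "G p = \<nu> p" by (simp add: G_def sp np(1))
  ultimately obtain \<delta> where \<delta>: "\<delta> > 0" "ball (\<nu> p) \<delta> \<subseteq> G ` T" unfolding mem_interior by auto
  show ?thesis
  proof (intro exI[of _ \<delta>] conjI allI impI)
    show "\<delta> > 0" by (rule \<delta>(1))
    fix z assume z: "norm z = 1" "dist z (\<nu> p) < \<delta>"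
    have "z \<in> ball (\<nu> p) \<delta>" using z(2) by (simp add: dist_commute)
    then obtain q where q: "q \<in> T" "z = G q" using \<delta>(2) by blast
    then have qT: "q \<in> L" "q \<in> B" "\<bar>s q\<bar> < 1" "dist q p < \<epsilon>" by (auto simp: T_def dist_commute)
    \<comment> \<open>Unit length together with \<bar>s q\<bar> < 1 forces s q = 0, which brings q
      back to S; this is why T bounds s.\<close>
    have "\<bar>1 + s q\<bar> = 1" using z(1) q(2) ext_norm[OF ext qT(2)] by (simp add: G_def)
    then have s0: "s q = 0" using qT(3) by linarith
    then have qS: "q \<in> S" using LS[OF qT(1)] by simp
    have "\<nu> q = z" using q(2) s0 ext_eq[OF ext qS qT(2)] by (simp add: G_def)
    then show "\<exists>q\<in>S. dist q p < \<epsilon> \<and> \<nu> q = z" using qS qT(4) by blast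
  qed
qed

end

section \<open>Wulff shapes\<close>

context minkowski
begin

lemma Phi_normalize: "x \<noteq> 0 \<Longrightarrow> \<Phi> (x /\<^sub>R norm x) = \<Phi> x"
  by (rule Phi_scale) auto

text \<open>On the tangent space the Hessian is positive definite, hence injective, hence onto;
  adding the normal part makes it an endomorphism of the whole space.\<close>

lemma dPhi_onto:
  assumes z: "norm z = 1" and v: "v \<bullet> z = 0"
  obtains u where "u \<bullet> z = 0" "dPhi z u = v"
proof -
  have z0: "z \<noteq> 0" and zz: "z \<bullet> z = 1" using z by (auto simp: dot_square_norm)
  define L where "L w = dPhi z w + (w \<bullet> z) *\<^sub>R z" for w
  have Lz: "L w \<bullet> z = w \<bullet> z" for w by (simp add: L_def inner_add_left dPhi_orthogonal[OF z0] zz)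
  have lin: "linear L" unfolding L_def
    by (intro linear_compose_add linear_dPhi z0 linearI) (simp_all add: inner_add_left scaleR_add_left)
  have "w = 0" if "L w = 0" for w
  proof -
    have wz: "w \<bullet> z = 0" using Lz[of w] that by simp
    then have "dPhi z w = 0" using that by (simp add: L_def)
    then show ?thesis using dPhi_pos[OF z wz] by (metis inner_zero_left less_irrefl)
  qed
  then have "inj L" by (simp add: linear_injective_0[OF lin])
  then have "surj L" by (rule linear_inj_imp_surj[OF lin])
  then obtain u where u: "v = L u" by auto
  then have "u \<bullet> z = 0" using v Lz by simp
  then show ?thesis using that[of u] u by (simp add: L_def)
qed

lemma frontier_wulff_mem: "r > 0 \<Longrightarrow> y \<noteq> 0 \<Longrightarrow> c + r *\<^sub>R \<Phi> y \<in> frontier (wulff_ball F r c)"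
  using Phi_normalize[of y] unfolding frontier_wulff_ball_Phi
  by (intro image_eqI[of _ _ "y /\<^sub>R norm y"]) auto

lemma frontier_wulff_support:
  assumes "r > 0" "x \<in> frontier (wulff_ball F r c)"
  shows "(x - c) \<bullet> y \<le> r * F y"
  using inner_le_dual_norm[of "x - c" y] assms by (simp add: frontier_wulff_ball)

text \<open>The curve is t \<mapsto> c + r \<Phi> (z + t u) with u a preimage of v / r under the
  Hessian; by homogeneity z + t u does not have to be normalised.\<close>

lemma frontier_wulff_curve:
  assumes r: "r > 0" and z: "norm z = 1" and v: "v \<bullet> z = 0"
  obtains \<gamma> where "\<gamma> 0 = c + r *\<^sub>R \<Phi> z" "(\<gamma> has_vector_derivative v) (at 0)"
    "\<And>t::real. \<gamma> t \<in> frontier (wulff_ball F r c)"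
proof -
  have z0: "z \<noteq> 0" using z by auto
  obtain u where u: "u \<bullet> z = 0" "dPhi z u = v /\<^sub>R r" using dPhi_onto[OF z, of "v /\<^sub>R r"] v by auto
  have nz: "z + t *\<^sub>R u \<noteq> 0" for t
  proof
    assume "z + t *\<^sub>R u = 0"
    then have "(z + t *\<^sub>R u) \<bullet> z = 0" by simp
    then show False using u(1) z by (simp add: inner_add_left dot_square_norm)
  qed
  have 1: "((\<lambda>t. z + t *\<^sub>R u) has_derivative (\<lambda>t. t *\<^sub>R u)) (at 0)" by (auto intro!: derivative_eq_intros)
  have 2: "(\<Phi> has_derivative dPhi z) (at (z + 0 *\<^sub>R u))" using Phi_has_derivative[OF z0] by simp
  have "((\<lambda>t. c + r *\<^sub>R \<Phi> (z + t *\<^sub>R u)) has_derivative (\<lambda>t. 0 + r *\<^sub>R dPhi z (t *\<^sub>R u))) (at 0)"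
    by (intro has_derivative_add has_derivative_const has_derivative_scaleR_right has_derivative_compose[OF 1 2])
  moreover have "r *\<^sub>R dPhi z (t *\<^sub>R u) = t *\<^sub>R v" for t
    using linear_cmul[OF linear_dPhi[OF z0]] u(2) r by simp
  ultimately have "((\<lambda>t. c + r *\<^sub>R \<Phi> (z + t *\<^sub>R u)) has_vector_derivative v) (at 0)"
    by (simp add: has_vector_derivative_def)
  then show ?thesis by (intro that[of "\<lambda>t. c + r *\<^sub>R \<Phi> (z + t *\<^sub>R u)"] frontier_wulff_mem[OF r nz]) simp_all
qed

text \<open>Moving inwards improves the support inequality for directions y with \<langle>z,
  y\<rangle> > 0. The other directions form a compact set on which it already holds with a uniform
  margin m, which limits t to r m.\<close>

lemma wulff_normal_sides:
  assumes r: "r > 0" and z: "norm z = 1"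
  shows "\<forall>\<^sub>F t in at_right 0. c + r *\<^sub>R \<Phi> z - t *\<^sub>R z \<in> wulff_ball F r c"
    and "t \<ge> 0 \<Longrightarrow> c + r *\<^sub>R \<Phi> z + t *\<^sub>R z \<notin> wulff_ball F r c"
proof -
  have z0: "z \<noteq> 0" using z by auto
  define B where "B = sphere 0 1 \<inter> {y. z \<bullet> y \<le> 0}"
  have cB: "compact B" unfolding B_def by (intro compact_Int_closed compact_sphere closed_Collect_le continuous_intros)
  have B0: "y \<noteq> 0" if "y \<in> B" for y using that by (auto simp: B_def)
  have pos: "F y - \<Phi> z \<bullet> y > 0" if "y \<in> B" for y
  proof -
    have "y \<noteq> s *\<^sub>R z" if s: "s \<ge> 0" for s
    proof
      assume y: "y = s *\<^sub>R z"
      then have "s \<le> 0" using \<open>y \<in> B\<close> z by (simp add: B_def dot_square_norm)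
      then show False using s y B0[OF \<open>y \<in> B\<close>] by simp
    qed
    then show ?thesis using Phi_less[OF z0, of y] by simp
  qed
  have cont: "continuous_on B (\<lambda>y. F y - \<Phi> z \<bullet> y)"
    by (intro continuous_intros continuous_on_subset[OF continuous_on_F]) (use B0 in auto)
  have "\<exists>m>0. \<forall>y\<in>B. m \<le> F y - \<Phi> z \<bullet> y"
  proof (cases "B = {}")
    case True then show ?thesis by (intro exI[of _ 1]) auto
  next
    case False
    then obtain y where "y \<in> B" "\<forall>x\<in>B. F y - \<Phi> z \<bullet> y \<le> F x - \<Phi> z \<bullet> x"
      using continuous_attains_inf[OF cB _ cont] by blast
    then show ?thesis using pos by blast
  qed
  then obtain m where m: "m > 0" "\<And>y. y \<in> B \<Longrightarrow> m \<le> F y - \<Phi> z \<bullet> y" by blast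
  have "c + r *\<^sub>R \<Phi> z - t *\<^sub>R z \<in> wulff_ball F r c" if t: "0 < t" "t < r * m" for t
    unfolding wulff_ball_iff
  proof
    fix y :: 'a assume y: "y \<in> sphere 0 1"
    have eq: "(c + r *\<^sub>R \<Phi> z - t *\<^sub>R z - c) \<bullet> y = r * (\<Phi> z \<bullet> y) - t * (z \<bullet> y)" by (simp add: inner_diff_left)
    show "(c + r *\<^sub>R \<Phi> z - t *\<^sub>R z - c) \<bullet> y < r * F y"
    proof (cases "z \<bullet> y \<le> 0")
      case True
      then have "r * m \<le> r * (F y - \<Phi> z \<bullet> y)" using m(2)[of y] y r by (simp add: B_def)
      moreover have "- (z \<bullet> y) \<le> 1" using Cauchy_Schwarz_ineq2[of z y] y z by simp
      then have "t * (- (z \<bullet> y)) \<le> t * 1" using t(1) by (intro mult_left_mono) auto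
      ultimately show ?thesis unfolding eq using t(2) by (simp add: right_diff_distrib)
    next
      case False
      then have "t * (z \<bullet> y) > 0" using t(1) by simp
      moreover have "r * (\<Phi> z \<bullet> y) \<le> r * F y" using Phi_le[OF z0, of y] r by simp
      ultimately show ?thesis unfolding eq by simp
    qed
  qed
  then show "\<forall>\<^sub>F t in at_right 0. c + r *\<^sub>R \<Phi> z - t *\<^sub>R z \<in> wulff_ball F r c"
    using m(1) r unfolding eventually_at_right_field by (intro exI[of _ "r * m"]) simp
  assume t: "t \<ge> 0"
  have "(c + r *\<^sub>R \<Phi> z + t *\<^sub>R z - c) \<bullet> z = r * F z + t"
    using z Phi_Euler[OF z0] by (simp add: inner_add_left dot_square_norm)
  then have "\<not> (c + r *\<^sub>R \<Phi> z + t *\<^sub>R z - c) \<bullet> z < r * F z" using t by simp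
  then show "c + r *\<^sub>R \<Phi> z + t *\<^sub>R z \<notin> wulff_ball F r c" using z unfolding wulff_ball_iff by auto
qed

definition "wulff_normal r c x = (THE z. norm z = 1 \<and> x = c + r *\<^sub>R \<Phi> z)"

lemma wulff_normal:
  assumes "r > 0" "norm z = 1" shows "wulff_normal r c (c + r *\<^sub>R \<Phi> z) = z"
  unfolding wulff_normal_def
proof (rule the_equality)
  show "norm z = 1 \<and> c + r *\<^sub>R \<Phi> z = c + r *\<^sub>R \<Phi> z" using assms by simp
next
  fix y assume "norm y = 1 \<and> c + r *\<^sub>R \<Phi> z = c + r *\<^sub>R \<Phi> y"
  then show "y = z" using Phi_inj[of y z] assms by simp
qed

lemma continuous_on_wulff_normal:
  assumes "r > 0" shows "continuous_on (frontier (wulff_ball F r c)) (wulff_normal r c)"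
  unfolding frontier_wulff_ball_Phi[OF assms]
proof (rule continuous_on_inv[OF _ compact_sphere])
  show "continuous_on (sphere 0 1) (\<lambda>z. c + r *\<^sub>R \<Phi> z)"
    by (intro continuous_intros continuous_on_subset[OF continuous_on_Phi]) auto
qed (use assms wulff_normal in auto)

end

section \<open>Normals of the part of a Wulff shape above a plane\<close>

context capillary
begin

lemma right_curve_frontier_wulff:
  fixes v :: "'n ambient"
  assumes "r > 0" "norm z = 1" "v \<bullet> z = 0"
  shows "right_curve (frontier (wulff_ball F r c)) (c + r *\<^sub>R \<Phi> z) v"
proof -
  obtain \<gamma> where "\<gamma> 0 = c + r *\<^sub>R \<Phi> z" "(\<gamma> has_vector_derivative v) (at 0)"
    "\<And>t::real. \<gamma> t \<in> frontier (wulff_ball F r c)" using frontier_wulff_curve[OF assms, of c] by blast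
  then show ?thesis unfolding right_curve_def by (intro exI[of _ \<gamma>] conjI always_eventually) auto
qed

text \<open>Tangency is tested on the curves of \<open>frontier_wulff_curve\<close> rather than in
  charts of the Wulff shape.\<close>

lemma outward_wulff_normal:
  assumes r: "r > 0"
  shows "outward_unit_normal (frontier (wulff_ball F r c)) (wulff_ball F r c) (wulff_normal r c)"
  unfolding outward_unit_normal_def
proof (intro conjI ballI continuous_on_wulff_normal r)
  fix p assume "p \<in> frontier (wulff_ball F r c)"
  then obtain z where z: "norm z = 1" "p = c + r *\<^sub>R \<Phi> z" by (auto simp: frontier_wulff_ball_Phi[OF r])
  then have n: "wulff_normal r c p = z" by (simp add: wulff_normal[OF r])
  show "norm (wulff_normal r c p) = 1" by (simp only: n z(1))
  fix v assume "v \<in> tangent_space (frontier (wulff_ball F r c)) p"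
  moreover have "z \<noteq> 0" using z(1) by auto
  ultimately have "v \<bullet> z = 0"
    using not_boundary_if_full_tangent(2)[OF frontier_wulff_mem[OF r \<open>z \<noteq> 0\<close>] z(1) right_curve_frontier_wulff[OF r z(1)], of c]
    unfolding z(2) by blast
  then show "wulff_normal r c p \<bullet> v = 0" by (simp add: n inner_commute)
next
  fix p assume "p \<in> frontier (wulff_ball F r c) - hs_boundary (frontier (wulff_ball F r c))"
  then obtain z where z: "norm z = 1" "p = c + r *\<^sub>R \<Phi> z" by (auto simp: frontier_wulff_ball_Phi[OF r])
  then have n: "wulff_normal r c p = z" by (simp add: wulff_normal[OF r])
  have "\<forall>\<^sub>F t in at_right (0::real). t > 0" by (simp add: eventually_at_right_less)
  with wulff_normal_sides(1)[OF r z(1), of c]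
  show "\<forall>\<^sub>F t in at_right 0. p - t *\<^sub>R wulff_normal r c p \<in> wulff_ball F r c \<and> p + t *\<^sub>R wulff_normal r c p \<notin> wulff_ball F r c"
    unfolding n unfolding z(2)
  proof eventually_elim
    case (elim t)
    then show ?case using wulff_normal_sides(2)[OF r z(1), of t c] by simp
  qed
qed

text \<open>Pushing a normal towards \<open>E\<close> along a great circle increases the height of \<open>\<Phi>\<close>.\<close>

lemma connected_upper_normals: "connected {z. norm z = 1 \<and> z \<noteq> - E \<and> \<Phi> z \<bullet> (- E) < a}" (is "connected ?Z")
proof -
  define y where "y z s = (1 - s) *\<^sub>R z + s *\<^sub>R E" for z :: "'n ambient" and s
  define arc where "arc z = (\<lambda>s. y z s /\<^sub>R norm (y z s)) ` {0..1::real}" for z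
  \<comment> \<open>The chord from z to E misses the ray through -E, so it can be normalised and the
    resulting arc avoids -E.\<close>
  have y0: "\<nexists>k. k \<ge> 0 \<and> y z s = k *\<^sub>R (- E)" if z: "z \<in> ?Z" and s: "s \<in> {0..1}" for z s
  proof
    assume "\<exists>k\<ge>0. y z s = k *\<^sub>R (- E)"
    then obtain k where k: "k \<ge> 0" "(1 - s) *\<^sub>R z = - (k + s) *\<^sub>R E" by (auto simp: y_def algebra_simps)
    have "norm ((1 - s) *\<^sub>R z) = norm (- (k + s) *\<^sub>R E)" unfolding k(2) ..
    then have "1 - s = k + s" using s k(1) z by simp
    then have "- (k + s) *\<^sub>R E = (1 - s) *\<^sub>R (- E)" by (metis scaleR_minus_left scaleR_minus_right)
    with k(2) have "(1 - s) *\<^sub>R z = (1 - s) *\<^sub>R (- E)" by (rule trans)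
    moreover have "1 - s \<noteq> 0" using \<open>1 - s = k + s\<close> k(1) s by auto
    ultimately have "z = - E" by (simp only: scaleR_cancel_left) simp
    then show False using z by simp
  qed
  have ynz: "y z s \<noteq> 0" if "z \<in> ?Z" "s \<in> {0..1}" for z s using y0[OF that] by (metis order_refl scaleR_zero_left)
  have arc_in: "arc z \<subseteq> ?Z" if z: "z \<in> ?Z" for z
  proof
    fix w assume "w \<in> arc z"
    then obtain s where s: "s \<in> {0..1}" and w: "w = y z s /\<^sub>R norm (y z s)" unfolding arc_def by blast
    note nz = ynz[OF z s]
    have z0: "z \<noteq> 0" using z by auto
    have "norm w = 1" using nz by (simp add: w)
    moreover have "w \<noteq> - E"
    proof
      assume "w = - E"
      then have "y z s = norm (y z s) *\<^sub>R (- E)" using nz by (metis divideR_right norm_eq_zero w)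
      then show False using y0[OF z s] norm_ge_zero by blast
    qed
    moreover have "\<Phi> w \<bullet> (- E) < a"
    proof (cases "s = 1")
      case True
      then have "\<Phi> w = \<Phi> E" by (simp add: w y_def)
      moreover have "\<Phi> z \<bullet> E \<le> \<Phi> E \<bullet> E" using Phi_le[OF z0, of E] Phi_Euler[of E] by simp
      ultimately show ?thesis using z by simp
    next
      case False
      \<comment> \<open>Up to a positive factor a point of the chord is z + t E, to which
        \<open>Phi_mono\<close> applies.\<close>
      define t where "t = s / (1 - s)"
      have t: "t \<ge> 0" "1 - s > 0" using s False by (auto simp: t_def)
      have yt: "y z s = (1 - s) *\<^sub>R (z + t *\<^sub>R E)" using t(2) by (simp add: y_def t_def scaleR_add_right)
      then have nt: "z + t *\<^sub>R E \<noteq> 0" using nz by auto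
      have "\<Phi> w = \<Phi> (z + t *\<^sub>R E)" unfolding w Phi_normalize[OF nz] unfolding yt by (rule Phi_scale[OF nt t(2)])
      then show ?thesis using Phi_mono[OF z0 nt t(1)] z by simp
    qed
    ultimately show "w \<in> ?Z" by blast
  qed
  have conn: "connected (arc z)" if z: "z \<in> ?Z" for z
    unfolding arc_def
    by (rule connected_continuous_image) (use ynz[OF z] in \<open>auto simp: y_def intro!: continuous_intros\<close>)
  have mem: "z \<in> arc z" "E \<in> arc z" if z: "z \<in> ?Z" for z
    unfolding arc_def using z by (auto simp: y_def image_iff intro: bexI[of _ 0] bexI[of _ 1])
  have "connected (\<Union>(arc ` ?Z))"
  proof (rule connected_Union)
    show "connected A" if "A \<in> arc ` ?Z" for A using that conn by blast
    have "E \<in> \<Inter>(arc ` ?Z)" using mem(2) by blast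
    then show "\<Inter>(arc ` ?Z) \<noteq> {}" by blast
  qed
  moreover have "\<Union>(arc ` ?Z) = ?Z" using arc_in mem(1) by blast
  ultimately show ?thesis by simp
qed

text \<open>Provides nearby normals whose points on a Wulff shape lie strictly higher, so that its
  points on the plane become limits of points above the plane.\<close>

lemma push_up:
  assumes z: "norm z = 1" "z \<noteq> E" "z \<noteq> - E"
  shows "\<exists>\<zeta>. (\<zeta> \<longlongrightarrow> z) (at_right (0::real)) \<and> (\<forall>t>0. norm (\<zeta> t) = 1 \<and> \<zeta> t \<noteq> - E \<and> \<Phi> z \<bullet> E < \<Phi> (\<zeta> t) \<bullet> E)"
proof -
  have z0: "z \<noteq> 0" using z by auto
  have np: "z \<noteq> a *\<^sub>R E" for a
  proof
    assume a: "z = a *\<^sub>R E"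
    then have "\<bar>a\<bar> = 1" using z(1) by simp
    then have "a = 1 \<or> a = - 1" by linarith
    then show False using a z(2,3) by auto
  qed
  have nz: "z + t *\<^sub>R E \<noteq> 0" for t
  proof
    assume "z + t *\<^sub>R E = 0"
    then have "z = (- t) *\<^sub>R E" by (simp add: eq_neg_iff_add_eq_0)
    then show False using np by blast
  qed
  define \<zeta> where "\<zeta> t = (z + t *\<^sub>R E) /\<^sub>R norm (z + t *\<^sub>R E)" for t
  have "(\<zeta> \<longlongrightarrow> (z + 0 *\<^sub>R E) /\<^sub>R norm (z + 0 *\<^sub>R E)) (at_right 0)"
    unfolding \<zeta>_def by (intro tendsto_intros) (use nz[of 0] in auto)
  moreover have "norm (\<zeta> t) = 1 \<and> \<zeta> t \<noteq> - E \<and> \<Phi> z \<bullet> E < \<Phi> (\<zeta> t) \<bullet> E" if t: "t > 0" for t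
  proof -
    have lt: "\<Phi> z \<bullet> E < \<Phi> (\<zeta> t) \<bullet> E"
      unfolding \<zeta>_def Phi_normalize[OF nz] by (rule Phi_strict_mono[OF z0 E_nz np t])
    have "\<Phi> z \<bullet> (- E) \<le> F (- E)" by (rule Phi_le[OF z0])
    then have "\<zeta> t \<noteq> - E" using lt Phi_Euler[of "- E"] by auto
    then show ?thesis using lt nz[of t] by (simp add: \<zeta>_def)
  qed
  ultimately show ?thesis using z(1) by (intro exI[of _ \<zeta>]) simp
qed

text \<open>Normals tilted slightly away from -E: their angles tend to the extreme value F (-E)
  without attaining it. They detect a Wulff shape lying wholly above the plane.\<close>

lemma lowest_normal_limit:
  "\<exists>\<zeta>. ((\<lambda>t. \<Phi> (\<zeta> t) \<bullet> (- E)) \<longlongrightarrow> F (- E)) (at_right (0::real)) \<and>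
    (\<forall>t>0. norm (\<zeta> t) = 1 \<and> \<zeta> t \<noteq> - E \<and> \<Phi> (\<zeta> t) \<bullet> (- E) < F (- E))"
proof -
  obtain e0 :: "'n ambient" where e0: "e0 \<bullet> E = 0" "e0 \<noteq> 0"
  proof
    show "(1, 0) \<bullet> E = (0::real)" "((1::real ^ 'n), 0::real) \<noteq> 0" by (auto simp: E_last_def zero_prod_def)
  qed
  define y where "y t = - E + t *\<^sub>R e0" for t :: real
  have nz: "y t \<noteq> 0" for t
  proof
    assume "y t = 0"
    then have "y t \<bullet> E = 0" by simp
    then show False using e0 by (simp add: y_def inner_add_left inner_diff_left)
  qed
  define \<zeta> where "\<zeta> t = y t /\<^sub>R norm (y t)" for t
  have \<Phi>\<zeta>: "\<Phi> (\<zeta> t) = \<Phi> (y t)" for t unfolding \<zeta>_def by (rule Phi_normalize[OF nz])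
  have "((\<lambda>t. \<Phi> (y t)) \<longlongrightarrow> \<Phi> (- E)) (at_right 0)"
  proof (rule continuous_on_tendsto_compose[OF continuous_on_Phi])
    have "(y \<longlongrightarrow> - E + 0 *\<^sub>R e0) (at_right 0)" unfolding y_def by (intro tendsto_intros)
    then show "(y \<longlongrightarrow> - E) (at_right 0)" by simp
  qed (use nz in \<open>auto intro: always_eventually\<close>)
  then have "((\<lambda>t. \<Phi> (\<zeta> t) \<bullet> (- E)) \<longlongrightarrow> \<Phi> (- E) \<bullet> (- E)) (at_right 0)" unfolding \<Phi>\<zeta> by (intro tendsto_intros)
  moreover have "norm (\<zeta> t) = 1 \<and> \<zeta> t \<noteq> - E \<and> \<Phi> (\<zeta> t) \<bullet> (- E) < F (- E)" if t: "t > 0" for t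
  proof -
    have "- E \<noteq> s *\<^sub>R y t" if "s \<ge> 0" for s
    proof
      assume s: "- E = s *\<^sub>R y t"
      have "(- E) \<bullet> e0 = s * (t * (e0 \<bullet> e0))"
        unfolding s using e0(1) by (simp add: y_def inner_add_left inner_diff_left inner_commute[of E e0])
      then have "s = 0" using e0 t by (simp add: inner_commute)
      then show False using s by simp
    qed
    then have lt: "\<Phi> (\<zeta> t) \<bullet> (- E) < F (- E)" unfolding \<Phi>\<zeta> by (rule Phi_less[OF nz])
    then have "\<zeta> t \<noteq> - E" using Phi_Euler[of "- E"] by auto
    then show ?thesis using lt nz[of t] by (simp add: \<zeta>_def)
  qed
  ultimately show ?thesis using Phi_Euler[of "- E"] by (intro exI[of _ \<zeta>]) simp
qed

end

section \<open>Rigidity\<close>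

lemma continuous_on_positive_nhd:
  fixes f :: "'a::topological_space \<Rightarrow> real"
  assumes "continuous_on S f" "p \<in> S" "f p > 0"
  shows "\<exists>Q. open Q \<and> p \<in> Q \<and> (\<forall>q\<in>S \<inter> Q. f q > 0)"
proof -
  obtain Q where "open Q" "Q \<inter> S = f -` {0<..} \<inter> S"
    using assms(1) unfolding continuous_on_open_invariant by (metis open_greaterThan)
  then show ?thesis using assms(2,3) by (intro exI[of _ Q]) auto
qed

locale willmore_equality = willmore_problem F \<omega>0 S \<nu> \<Omega>
  for F :: "'n::finite ambient \<Rightarrow> real" and \<omega>0 and S :: "'n ambient set" and \<nu> \<Omega> +
  assumes two_le: "CARD('n) \<ge> 2"
    and equality: "1 / (real CARD('n) + 1) * willmore_integral F \<omega>0 S \<nu> = measure lborel (truncated_wulff_ball F \<omega>0)"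
begin

text \<open>Differs from \<open>\<Sigma>_plus\<close> by allowing the angle \<omega>0. Violating the
  angle condition then means exceeding \<omega>0, which is an open condition on S.\<close>

definition "\<Sigma>_contact = {p \<in> S. p \<bullet> E > 0 \<and> contact p \<and> \<Phi> (\<nu> p) \<bullet> (- E) \<le> \<omega>0}"

lemma \<Sigma>_contact_borel: "\<Sigma>_contact \<in> sets borel"
proof -
  have "\<Sigma>_contact = {p \<in> S. contact p} \<inter> {p. p \<bullet> E > 0} \<inter> {p \<in> S. \<Phi> (\<nu> p) \<bullet> (- E) \<in> {..\<omega>0}}"
    unfolding \<Sigma>_contact_def by blast
  moreover have "open {p. p \<bullet> E > 0}" by (intro open_Collect_less continuous_intros)
  moreover have "{p \<in> S. \<Phi> (\<nu> p) \<bullet> (- E) \<in> {..\<omega>0}} \<in> sets borel"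
    by (rule borel_preimage_of_continuous_on[OF S_borel cont_angle]) simp
  ultimately show ?thesis using closed_contact by (simp add: borel_closed borel_open sets.Int)
qed

text \<open>Equality forces equality almost everywhere in the chain
  \<open>\<Theta> K 1\<^bsub>\<Sigma>_contact\<^esub> \<le> \<Theta> \<bar>H\<bar>\<^sup>n\<close>; a strict inequality at one interior point with \<open>H \<noteq> 0\<close> would
  persist on a piece of positive area.\<close>

lemma curved_point_contact:
  assumes p: "p \<in> S" "p \<bullet> E > 0" "H p \<noteq> 0"
  shows "contact p \<and> \<Phi> (\<nu> p) \<bullet> (- E) \<le> \<omega>0 \<and> K p = \<bar>H p\<bar> ^ CARD('n)"
proof (rule ccontr)
  assume bad: "\<not> ?thesis"
  let ?f = "\<lambda>q. ennreal (\<Theta> q * K q) * indicator \<Sigma>_contact q"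
  let ?g = "\<lambda>q. ennreal (\<Theta> q * \<bar>H q\<bar> ^ CARD('n)) * indicator S q"
  let ?c = "ennreal (1 / (real CARD('n) + 1))"
  have Kle: "K q \<le> \<bar>H q\<bar> ^ CARD('n)" if "q \<in> \<Sigma>_contact" for q
    using that contact_H_K(1,2)[of q] unfolding \<Sigma>_contact_def by auto
  have cH: "continuous_on S (\<lambda>q. \<bar>H q\<bar>)" by (intro continuous_intros continuous_on_H)
  have "\<exists>Q. open Q \<and> p \<in> Q \<and> (\<forall>q\<in>S \<inter> Q. \<bar>H q\<bar> > 0 \<and> (q \<in> \<Sigma>_contact \<longrightarrow> K q < \<bar>H q\<bar> ^ CARD('n)))"
  proof -
    obtain Q1 where Q1: "open Q1" "p \<in> Q1" "\<forall>q\<in>S \<inter> Q1. \<bar>H q\<bar> > 0"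
      using continuous_on_positive_nhd[OF cH p(1)] p(3) by auto
    have "\<exists>Q2. open Q2 \<and> p \<in> Q2 \<and> (\<forall>q\<in>S \<inter> Q2. q \<in> \<Sigma>_contact \<longrightarrow> K q < \<bar>H q\<bar> ^ CARD('n))"
    proof -
      \<comment> \<open>Each way of failing persists nearby: the contact set is closed, and the
        angle, H and K are continuous on S.\<close>
      consider "\<not> contact p" | "\<Phi> (\<nu> p) \<bullet> (- E) - \<omega>0 > 0" | "p \<in> \<Sigma>_contact" "\<bar>H p\<bar> ^ CARD('n) - K p > 0"
      proof (cases "contact p \<and> \<Phi> (\<nu> p) \<bullet> (- E) \<le> \<omega>0")
        case True
        then have "p \<in> \<Sigma>_contact" using p by (simp add: \<Sigma>_contact_def)
        moreover from this have "\<bar>H p\<bar> ^ CARD('n) - K p > 0" using Kle[of p] bad True by simp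
        ultimately show ?thesis using that(3) by blast
      next
        case False then show ?thesis using that(1,2) by fastforce
      qed
      then show ?thesis
      proof cases
        case 1
        then show ?thesis using closed_contact p(1)
          by (intro exI[of _ "- {p \<in> S. contact p}"]) (auto simp: \<Sigma>_contact_def)
      next
        case 2
        have "continuous_on S (\<lambda>q. \<Phi> (\<nu> q) \<bullet> (- E) - \<omega>0)" by (intro continuous_on_diff cont_angle continuous_on_const)
        from continuous_on_positive_nhd[OF this p(1) 2] obtain Q2 where
          Q2: "open Q2" "p \<in> Q2" "\<forall>q\<in>S \<inter> Q2. \<Phi> (\<nu> q) \<bullet> (- E) - \<omega>0 > 0" by blast
        have "q \<notin> \<Sigma>_contact" if "q \<in> S \<inter> Q2" for q
        proof -
          have "\<Phi> (\<nu> q) \<bullet> (- E) - \<omega>0 > 0" using Q2(3) that by blast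
          then show ?thesis by (simp add: \<Sigma>_contact_def)
        qed
        then show ?thesis using Q2(1,2) by blast
      next
        case 3
        have "continuous_on S (\<lambda>q. \<bar>H q\<bar> ^ CARD('n) - K q)" by (intro continuous_intros continuous_on_H continuous_on_K)
        from continuous_on_positive_nhd[OF this p(1) 3(2)] show ?thesis by fastforce
      qed
    qed
    then obtain Q2 where "open Q2" "p \<in> Q2" "\<forall>q\<in>S \<inter> Q2. q \<in> \<Sigma>_contact \<longrightarrow> K q < \<bar>H q\<bar> ^ CARD('n)" by blast
    then show ?thesis using Q1 by (intro exI[of _ "Q1 \<inter> Q2"]) (simp add: open_Int)
  qed
  then obtain Q where Q: "open Q" "p \<in> Q"
    "\<And>q. q \<in> S \<Longrightarrow> q \<in> Q \<Longrightarrow> \<bar>H q\<bar> > 0 \<and> (q \<in> \<Sigma>_contact \<longrightarrow> K q < \<bar>H q\<bar> ^ CARD('n))" by blast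
  have less: "?f q < ?g q" if q: "q \<in> S \<inter> Q" for q
  proof -
    have pos: "\<Theta> q > 0" "\<bar>H q\<bar> ^ CARD('n) > 0" using q Q(3)[of q] \<Theta>_pos by auto
    show ?thesis
    proof (cases "q \<in> \<Sigma>_contact")
      case True
      then have "\<Theta> q * K q < \<Theta> q * \<bar>H q\<bar> ^ CARD('n)" using q Q(3)[of q] pos by (simp add: mult_strict_left_mono)
      moreover have "\<Theta> q * K q \<ge> 0" using pos K_nonneg'[of q] q by simp
      ultimately show ?thesis using True q by (simp add: ennreal_lessI)
    next
      case False
      then show ?thesis using q pos by simp
    qed
  qed
  have le: "?f q \<le> ?g q" for q
  proof (cases "q \<in> \<Sigma>_contact")
    case True
    then have "q \<in> S" by (simp add: \<Sigma>_contact_def)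
    then show ?thesis using True Kle[OF True] \<Theta>_pos[of q] by (simp add: ennreal_leI mult_left_mono)
  qed simp
  have sub: "\<Sigma>_contact \<subseteq> S" by (auto simp: \<Sigma>_contact_def)
  have mf: "?f \<in> borel_measurable \<mu>"
  proof -
    have "(\<lambda>q. ennreal (indicator S q * (\<Theta> q * K q)) * indicator \<Sigma>_contact q) \<in> borel_measurable borel"
      using meas_on_S[OF cont_\<Theta>K] \<Sigma>_contact_borel by measurable
    moreover have "(\<lambda>q. ennreal (indicator S q * (\<Theta> q * K q)) * indicator \<Sigma>_contact q) = ?f"
      using sub by (auto simp: fun_eq_iff indicator_def)
    ultimately have "?f \<in> borel_measurable borel" by simp
    then show ?thesis by (simp cong: measurable_cong_sets)
  qed
  have cg: "continuous_on S (\<lambda>q. \<Theta> q * \<bar>H q\<bar> ^ CARD('n))"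
    by (intro continuous_intros cont_\<Theta> continuous_on_H)
  have mg: "?g \<in> borel_measurable \<mu>"
  proof -
    have "(\<lambda>q. ennreal (indicator S q * (\<Theta> q * \<bar>H q\<bar> ^ CARD('n)))) \<in> borel_measurable borel"
      using meas_on_S[OF cg] by measurable
    moreover have "(\<lambda>q. ennreal (indicator S q * (\<Theta> q * \<bar>H q\<bar> ^ CARD('n)))) = ?g"
      by (auto simp: fun_eq_iff indicator_def)
    ultimately have "?g \<in> borel_measurable borel" by simp
    then show ?thesis by (simp cong: measurable_cong_sets)
  qed
  have "\<Sigma>_plus \<subseteq> \<Sigma>_contact" by (auto simp: \<Sigma>_plus_def \<Sigma>_contact_def cap_def)
  then have "emeasure lborel (truncated_wulff_ball F \<omega>0) \<le> ?c * (\<integral>\<^sup>+q. ?f q \<partial>\<mu>)"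
    by (rule emeasure_truncated_le[OF \<Sigma>_contact_borel _ sub])
  moreover have "emeasure lborel (truncated_wulff_ball F \<omega>0) = ?c * (\<integral>\<^sup>+q. ?g q \<partial>\<mu>)"
    unfolding willmore_inequality(1)[symmetric] equality[symmetric] willmore_eq_nn_integral[symmetric]
    using willmore_nonneg by (intro ennreal_mult) auto
  ultimately have "?c * (\<integral>\<^sup>+q. ?g q \<partial>\<mu>) \<le> ?c * (\<integral>\<^sup>+q. ?f q \<partial>\<mu>)" by simp
  then have gf: "(\<integral>\<^sup>+q. ?g q \<partial>\<mu>) \<le> (\<integral>\<^sup>+q. ?f q \<partial>\<mu>)"
    by (subst (asm) ennreal_mult_le_mult_iff) auto
  have "(\<integral>\<^sup>+q. ?f q \<partial>\<mu>) < (\<integral>\<^sup>+q. ?g q \<partial>\<mu>)"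
  proof (rule nn_integral_less[OF mf mg])
    have "(\<integral>\<^sup>+q. ?f q \<partial>\<mu>) < \<infinity>" by (rule finite_integral[OF cont_\<Theta>K sub])
    then show "(\<integral>\<^sup>+q. ?f q \<partial>\<mu>) \<noteq> \<infinity>" by simp
    show "AE q in \<mu>. ?f q \<le> ?g q" using le by simp
    show "\<not> (AE q in \<mu>. ?g q \<le> ?f q)"
    proof
      assume "AE q in \<mu>. ?g q \<le> ?f q"
      then have "AE q in \<mu>. q \<notin> S \<inter> Q" by eventually_elim (use less in \<open>meson leD\<close>)
      moreover have "S \<inter> Q \<in> sets \<mu>" using S_borel Q(1) by (simp add: borel_open sets.Int)
      ultimately have "emeasure \<mu> (S \<inter> Q) = 0" by (subst (asm) AE_iff_null_sets[symmetric]) auto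
      then show False using open_piece_positive[OF p(1) Q(2,1)] by simp
    qed
  qed
  then show False using gf by simp
qed

lemma curved_point:
  assumes p: "p \<in> S" "p \<bullet> E > 0" "H p \<noteq> 0"
  shows "contact p" "\<Phi> (\<nu> p) \<bullet> (- E) \<le> \<omega>0" "H p > 0"
    and "normal_ext S \<nu> B n n' \<rho> a \<Longrightarrow> p \<in> B \<Longrightarrow> v \<bullet> \<nu> p = 0 \<Longrightarrow> NF' n n' p v = H p *\<^sub>R v"
proof -
  note * = curved_point_contact[OF p]
  show c: "contact p" and "\<Phi> (\<nu> p) \<bullet> (- E) \<le> \<omega>0" using * by blast+
  have "H p \<ge> 0" by (rule contact_H_K(1)[OF p(1,2) c])
  then show "H p > 0" using p(3) by simp
  then have "K p = H p ^ CARD('n)" using * by simp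
  then show "normal_ext S \<nu> B n n' \<rho> a \<Longrightarrow> p \<in> B \<Longrightarrow> v \<bullet> \<nu> p = 0 \<Longrightarrow> NF' n n' p v = H p *\<^sub>R v"
    by (rule contact_H_K(3)[OF p(1,2) c])
qed

lemma interior_not_boundary: "p \<in> S \<Longrightarrow> p \<bullet> E > 0 \<Longrightarrow> p \<notin> hs_boundary S"
  using boundary_iff by fastforce

text \<open>Points where S agrees with the Wulff shape of centre c and radius r in position, normal
  and curvature. The set is compact, and above the plane it is open in S by
  \<open>core_open\<close>.\<close>

definition "core c r = {p \<in> S. p = c + r *\<^sub>R \<Phi> (\<nu> p) \<and> H p = 1 / r}"

lemma cont_Phi_\<nu>: "continuous_on S (\<lambda>p. \<Phi> (\<nu> p))"
  by (intro continuous_on_compose2[OF continuous_on_Phi cont_\<nu>]) (use \<nu>_nz in auto)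

lemma compact_core: "compact (core c r)"
proof -
  have "continuous_on S (\<lambda>p. (p - c - r *\<^sub>R \<Phi> (\<nu> p), H p))"
    by (intro continuous_intros cont_Phi_\<nu> continuous_on_H)
  then have "closed (S \<inter> (\<lambda>p. (p - c - r *\<^sub>R \<Phi> (\<nu> p), H p)) -` {(0, 1 / r)})"
    by (intro continuous_closed_preimage compact_imp_closed compact_S) auto
  moreover have "p - c - r *\<^sub>R \<Phi> (\<nu> p) = 0 \<longleftrightarrow> p = c + r *\<^sub>R \<Phi> (\<nu> p)" for p
    by (simp add: diff_diff_eq)
  then have "S \<inter> (\<lambda>p. (p - c - r *\<^sub>R \<Phi> (\<nu> p), H p)) -` {(0, 1 / r)} = core c r"
    by (simp add: core_def set_eq_iff)
  ultimately have "compact (S \<inter> core c r)" using compact_S by (intro compact_Int_closed) simp_all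
  then show ?thesis by (simp add: core_def Int_absorb1)
qed

lemma core_open:
  assumes r: "r > 0" and p: "p \<in> core c r" "p \<bullet> E > 0"
  shows "\<exists>\<delta>>0. \<forall>q\<in>S. dist q p < \<delta> \<longrightarrow> q \<in> core c r"
proof -
  have pS: "p \<in> S" "p = c + r *\<^sub>R \<Phi> (\<nu> p)" "H p = 1 / r" using p(1) unfolding core_def by blast+
  then have nz: "H p \<noteq> 0" using r by simp
  have "continuous_on S (\<lambda>q. \<bar>H q\<bar>)" by (intro continuous_intros continuous_on_H)
  from continuous_on_positive_nhd[OF this pS(1)] nz obtain Q where
    Q: "open Q" "p \<in> Q" "\<And>q. q \<in> S \<Longrightarrow> q \<in> Q \<Longrightarrow> \<bar>H q\<bar> > 0" by auto
  have "open (Q \<inter> {x. x \<bullet> E > 0})" by (intro open_Int Q(1) open_Collect_less continuous_intros)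
  moreover have "p \<in> Q \<inter> {x. x \<bullet> E > 0}" using Q(2) p(2) by simp
  ultimately have "\<exists>\<delta>>0. \<forall>q\<in>S. dist q p < \<delta> \<longrightarrow> H q = H p \<and> q - \<Phi> (\<nu> q) /\<^sub>R H p = p - \<Phi> (\<nu> p) /\<^sub>R H p"
  proof (rule umbilic_locally_constant[OF two_le pS(1) interior_not_boundary[OF pS(1) p(2)] _ _ nz])
    fix B n n' \<rho> a q v
    assume ext: "normal_ext S \<nu> B n n' \<rho> a" and q: "q \<in> S" "q \<in> B" "q \<in> Q \<inter> {x. x \<bullet> E > 0}" and v: "v \<bullet> \<nu> q = 0"
    then have "q \<bullet> E > 0" "H q \<noteq> 0" using Q(3)[of q] by auto
    then show "NF' n n' q v = H q *\<^sub>R v" by (rule curved_point(4)[OF q(1) _ _ ext q(2) v])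
  qed
  then obtain \<delta> where \<delta>: "\<delta> > 0"
    "\<And>q. q \<in> S \<Longrightarrow> dist q p < \<delta> \<Longrightarrow> H q = H p \<and> q - \<Phi> (\<nu> q) /\<^sub>R H p = p - \<Phi> (\<nu> p) /\<^sub>R H p" by blast
  have "q \<in> core c r" if q: "q \<in> S" "dist q p < \<delta>" for q
  proof -
    have "q - r *\<^sub>R \<Phi> (\<nu> q) = p - r *\<^sub>R \<Phi> (\<nu> p)" "H q = 1 / r" using \<delta>(2)[OF q] pS(3) by simp_all
    moreover have "p - r *\<^sub>R \<Phi> (\<nu> p) = c" by (subst pS(2)) simp
    ultimately have "q = c + r *\<^sub>R \<Phi> (\<nu> q)" by (metis diff_add_cancel)
    then show ?thesis using q(1) \<open>H q = 1 / r\<close> unfolding core_def by blast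
  qed
  then show ?thesis using \<delta>(1) by blast
qed

text \<open>The normals realised on the core form a compact set, hence a relatively closed part of
  the connected set of admissible normals; it is open there by \<open>core_open\<close> and
  \<open>gauss_map_open\<close>. The Gauss map is open because the umbilic equation with H \<noteq>
  0 excludes a kernel of d\<nu>.\<close>

lemma core_normals:
  assumes r: "r > 0" and p: "p \<in> core c r" "p \<bullet> E > 0"
    and z: "norm z = 1" "z \<noteq> - E" "(c + r *\<^sub>R \<Phi> z) \<bullet> E > 0"
  shows "c + r *\<^sub>R \<Phi> z \<in> core c r" "\<nu> (c + r *\<^sub>R \<Phi> z) = z"
proof -
  let ?Z = "{z. norm z = 1 \<and> z \<noteq> - E \<and> \<Phi> z \<bullet> (- E) < c \<bullet> E / r}"
  have height: "\<Phi> y \<bullet> (- E) < c \<bullet> E / r \<longleftrightarrow> (c + r *\<^sub>R \<Phi> y) \<bullet> E > 0" for y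
    using r by (auto simp: inner_add_left field_simps)
  have core_eq: "q = c + r *\<^sub>R \<Phi> (\<nu> q)" "q \<in> S" "H q = 1 / r" if "q \<in> core c r" for q
    using that unfolding core_def by blast+
  let ?T = "?Z \<inter> \<nu> ` core c r"
  have "compact (\<nu> ` core c r)"
    by (rule compact_continuous_image[OF continuous_on_subset[OF cont_\<nu>] compact_core]) (auto simp: core_def)
  then have cl: "closedin (top_of_set ?Z) ?T" by (intro closedin_closed_Int compact_imp_closed)
  have op: "openin (top_of_set ?Z) ?T"
    unfolding openin_euclidean_subtopology_iff
  proof (intro conjI ballI)
    fix y assume y: "y \<in> ?T"
    then obtain q where q: "q \<in> core c r" "y = \<nu> q" by blast
    have "q \<bullet> E > 0" using y height[of y] core_eq(1)[OF q(1)] q(2) by simp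
    then obtain \<epsilon> where \<epsilon>: "\<epsilon> > 0" "\<And>x. x \<in> S \<Longrightarrow> dist x q < \<epsilon> \<Longrightarrow> x \<in> core c r"
      using core_open[OF r q(1)] by blast
    have qS: "q \<in> S" and Hq: "H q \<noteq> 0" using core_eq[OF q(1)] r by auto
    have "\<exists>\<delta>>0. \<forall>z. norm z = 1 \<longrightarrow> dist z (\<nu> q) < \<delta> \<longrightarrow> (\<exists>x\<in>S. dist x q < \<epsilon> \<and> \<nu> x = z)"
    proof (rule gauss_map_open[OF qS interior_not_boundary[OF qS \<open>q \<bullet> E > 0\<close>] _ \<epsilon>(1)])
      fix B n n' \<rho> a v
      assume ext: "normal_ext S \<nu> B n n' \<rho> a" "q \<in> B" and v: "v \<bullet> \<nu> q = 0" and "n' q v = 0"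
      then have "NF' n n' q v = 0"
        using linear_0[OF linear_dPhi[OF ext_nz[OF ext]]] unfolding NF'_def[OF ext(1)] by simp
      then show "v = 0" using curved_point(4)[OF qS \<open>q \<bullet> E > 0\<close> Hq ext v] Hq by simp
    qed
    then obtain \<delta> where \<delta>: "\<delta> > 0" "\<And>z. norm z = 1 \<Longrightarrow> dist z (\<nu> q) < \<delta> \<Longrightarrow> \<exists>x\<in>S. dist x q < \<epsilon> \<and> \<nu> x = z" by blast
    show "\<exists>e>0. \<forall>x'\<in>?Z. dist x' y < e \<longrightarrow> x' \<in> ?T"
    proof (intro exI[of _ \<delta>] conjI ballI impI \<delta>(1))
      fix x' assume x': "x' \<in> ?Z" "dist x' y < \<delta>"
      then obtain x where "x \<in> S" "dist x q < \<epsilon>" "\<nu> x = x'" using \<delta>(2)[of x'] q(2) by blast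
      then show "x' \<in> ?T" using x'(1) \<epsilon>(2) by blast
    qed
  qed auto
  have "?T \<noteq> {}"
  proof -
    have pS: "p \<in> S" "H p \<noteq> 0" using core_eq[OF p(1)] r by auto
    have le: "\<Phi> (\<nu> p) \<bullet> (- E) \<le> \<omega>0" by (rule curved_point(2)[OF pS(1) p(2) pS(2)])
    have "\<nu> p \<noteq> - E" using le Phi_Euler[of "- E"] \<omega>0(2) by auto
    moreover have "\<Phi> (\<nu> p) \<bullet> (- E) < c \<bullet> E / r" using height[of "\<nu> p"] core_eq(1)[OF p(1)] p(2) by simp
    ultimately have "\<nu> p \<in> ?T" using norm_\<nu>[OF pS(1)] p(1) by blast
    then show ?thesis by blast
  qed
  then have "?T = ?Z" using connected_upper_normals[of "c \<bullet> E / r"] cl op unfolding connected_clopen by blast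
  moreover have "z \<in> ?Z" using z height by simp
  ultimately obtain q where q: "q \<in> core c r" "z = \<nu> q" by blast
  then have "q = c + r *\<^sub>R \<Phi> z" using core_eq(1) by simp
  then show "c + r *\<^sub>R \<Phi> z \<in> core c r" "\<nu> (c + r *\<^sub>R \<Phi> z) = z" using q by simp_all
qed

text \<open>Otherwise the Wulff shape would lie above the plane near its lowest normal, and S would
  contain interior curved points with angles near F (-E) > \<omega>0, against
  \<open>curved_point\<close>.\<close>

lemma core_not_low:
  assumes r: "r > 0" and p: "p \<in> core c r" "p \<bullet> E > 0"
  shows "c \<bullet> E < r * F (- E)"
proof (rule ccontr)
  assume "\<not> c \<bullet> E < r * F (- E)"
  then have ce: "c \<bullet> E \<ge> r * F (- E)" by simp
  obtain \<zeta> where \<zeta>: "((\<lambda>t. \<Phi> (\<zeta> t) \<bullet> (- E)) \<longlongrightarrow> F (- E)) (at_right (0::real))"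
    "\<And>t. t > 0 \<Longrightarrow> norm (\<zeta> t) = 1 \<and> \<zeta> t \<noteq> - E \<and> \<Phi> (\<zeta> t) \<bullet> (- E) < F (- E)"
    using lowest_normal_limit by blast
  have "\<Phi> (\<zeta> t) \<bullet> (- E) \<le> \<omega>0" if t: "t > 0" for t
  proof -
    note z = \<zeta>(2)[OF t]
    have "r * (\<Phi> (\<zeta> t) \<bullet> (- E)) < r * F (- E)" using z r by (intro mult_strict_left_mono) blast+
    then have pos: "(c + r *\<^sub>R \<Phi> (\<zeta> t)) \<bullet> E > 0" using ce by (simp add: inner_add_left)
    have "c + r *\<^sub>R \<Phi> (\<zeta> t) \<in> core c r" "\<nu> (c + r *\<^sub>R \<Phi> (\<zeta> t)) = \<zeta> t"
      using core_normals[OF r p _ _ pos] z by blast+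
    moreover from this have "c + r *\<^sub>R \<Phi> (\<zeta> t) \<in> S" "H (c + r *\<^sub>R \<Phi> (\<zeta> t)) \<noteq> 0" using r by (auto simp: core_def)
    ultimately show ?thesis using curved_point(2)[OF _ pos] by metis
  qed
  then have "\<forall>\<^sub>F t in at_right (0::real). \<Phi> (\<zeta> t) \<bullet> (- E) \<le> \<omega>0"
    using eventually_at_right_less by (rule eventually_mono[rotated])
  then have "F (- E) \<le> \<omega>0" by (rule tendsto_upperbound[OF \<zeta>(1)]) simp
  then show False using \<omega>0(2) by simp
qed

text \<open>A point of maximal distance from a far away point below the plane is a point of nonzero curvature.\<close>

lemma exists_curved_point:
  assumes C: "closed C" and Cop: "\<And>p. p \<in> C \<Longrightarrow> p \<in> S \<Longrightarrow> p \<bullet> E > 0 \<Longrightarrow> \<exists>\<delta>>0. \<forall>q\<in>S. dist q p < \<delta> \<longrightarrow> q \<in> C"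
    and y0: "y0 \<in> S" "y0 \<bullet> E > 0" "y0 \<notin> C"
  shows "\<exists>y\<in>S. y \<bullet> E > 0 \<and> y \<notin> C \<and> H y \<noteq> 0"
proof -
  define Y where "Y = {p \<in> S. p \<bullet> E > 0} - C"
  obtain M where M: "\<And>x. x \<in> S \<Longrightarrow> norm x \<le> M" using compact_imp_bounded[OF compact_S] unfolding bounded_iff by blast
  \<comment> \<open>-R E is the centre of the touching sphere, f being half the squared distance to
    it up to a constant. R is large enough for f y0 to exceed f at every point of S on the
    plane.\<close>
  define R where "R = (M\<^sup>2 + 1) / (y0 \<bullet> E)"
  have RE: "R * (y0 \<bullet> E) = M\<^sup>2 + 1" using y0 by (simp add: R_def)
  have R: "R > 0" using y0 by (simp add: R_def add_nonneg_pos)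
  define f where "f x = x \<bullet> (R *\<^sub>R E) + 1 / 2 * (x \<bullet> x)" for x :: "'n ambient"
  have YS: "closure Y \<subseteq> S" by (intro closure_minimal compact_imp_closed compact_S) (auto simp: Y_def)
  have "bounded Y" by (rule bounded_subset[OF compact_imp_bounded[OF compact_S]]) (auto simp: Y_def)
  then have "compact (closure Y)" by (simp add: compact_closure)
  moreover have "y0 \<in> closure Y" using y0 closure_subset[of Y] by (auto simp: Y_def)
  moreover have "continuous_on (closure Y) f" unfolding f_def by (intro continuous_intros)
  ultimately have "\<exists>y\<in>closure Y. \<forall>x\<in>closure Y. f x \<le> f y"
    by (metis continuous_attains_sup empty_iff)
  then obtain y where y: "y \<in> closure Y" "\<And>x. x \<in> closure Y \<Longrightarrow> f x \<le> f y" by blast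
  have yS: "y \<in> S" using y(1) YS by blast
  have yE: "y \<bullet> E > 0"
  proof (rule ccontr)
    assume "\<not> y \<bullet> E > 0"
    then have "f y = 1 / 2 * (norm y)\<^sup>2" using height_nonneg[OF yS] by (simp add: f_def dot_square_norm)
    also have "\<dots> \<le> (norm y)\<^sup>2" by simp
    also have "\<dots> \<le> M\<^sup>2" using M[OF yS] by (intro power_mono) auto
    also have "\<dots> < R * (y0 \<bullet> E)" unfolding RE by simp
    also have "\<dots> \<le> f y0" by (simp add: f_def)
    also have "\<dots> \<le> f y" by (rule y(2)) fact
    finally show False by simp
  qed
  \<comment> \<open>Passing to the closure of Y cannot add points of C above the plane, because C is
    open in S there.\<close>
  have yC: "y \<notin> C"
  proof
    assume "y \<in> C"
    then obtain \<delta> where "\<delta> > 0" "\<forall>q\<in>S. dist q y < \<delta> \<longrightarrow> q \<in> C" using Cop yS yE by blast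
    then show False using y(1) unfolding closure_approachable by (auto simp: Y_def)
  qed
  have "open ({x. x \<bullet> E > 0} - C)" using C by (intro open_Diff open_Collect_less continuous_intros)
  then obtain d where d: "d > 0" "ball y d \<subseteq> {x. x \<bullet> E > 0} - C" using yE yC openE by blast
  have loc: "x \<bullet> (R *\<^sub>R E) + 1 / 2 * (x \<bullet> x) \<le> y \<bullet> (R *\<^sub>R E) + 1 / 2 * (y \<bullet> y)" if x: "x \<in> S" "dist x y < d" for x
  proof -
    have "x \<in> ball y d" using x(2) by (simp add: dist_commute)
    then have "x \<in> Y" using x(1) d(2) by (auto simp: Y_def)
    then show ?thesis using y(2)[of x] closure_subset[of Y] by (auto simp: f_def)
  qed
  obtain B n n' \<rho> a where ext: "normal_ext S \<nu> B n n' \<rho> a" "y \<in> B" using exists_ext[OF yS] .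
  obtain l where l: "\<And>v. v \<bullet> \<nu> y = 0 \<Longrightarrow> 1 * (v \<bullet> v) \<le> l * (n' y v \<bullet> v)"
    using constrained_max[OF ext(1) yS ext(2) interior_not_boundary[OF yS yE] d(1) loc] by blast
  have "H y \<noteq> 0"
  proof (rule H_nonzero[OF ext(1) yS ext(2)])
    fix v assume v: "v \<bullet> \<nu> y = 0" "v \<noteq> 0"
    then have "v \<bullet> v > 0" by simp
    then show "l * (n' y v \<bullet> v) > 0" using l[OF v(1)] by linarith
  qed
  then show ?thesis using yS yE yC by blast
qed

lemma curved_point_core:
  assumes p: "p \<in> S" "p \<bullet> E > 0" "H p \<noteq> 0"
  shows "p \<in> core (p - (1 / H p) *\<^sub>R \<Phi> (\<nu> p)) (1 / H p)"
  using p by (simp add: core_def)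

lemma core_top:
  assumes r: "r > 0" and p: "p \<in> core c r" "p \<bullet> E > 0"
  shows "(c + r *\<^sub>R \<Phi> E) \<bullet> E > 0"
proof -
  have pS: "p \<in> S" "p = c + r *\<^sub>R \<Phi> (\<nu> p)" using p(1) unfolding core_def by blast+
  have "\<Phi> (\<nu> p) \<bullet> E \<le> \<Phi> E \<bullet> E" using Phi_le[OF \<nu>_nz[OF pS(1)], of E] Phi_Euler[of E] by simp
  then have "r * (\<Phi> (\<nu> p) \<bullet> E) \<le> r * (\<Phi> E \<bullet> E)" using r by simp
  moreover have "p \<bullet> E = c \<bullet> E + r * (\<Phi> (\<nu> p) \<bullet> E)" by (subst pS(2)) (simp add: inner_add_left)
  ultimately show ?thesis using p(2) by (simp add: inner_add_left)
qed

text \<open>Two solved pieces have the same support function near \<open>E\<close>, hence the same top point.\<close>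

lemma core_unique:
  assumes r: "r > 0" "r' > 0" and p: "p \<in> core c r" "p \<bullet> E > 0" and p': "p' \<in> core c' r'" "p' \<bullet> E > 0"
  shows "c = c' \<and> r = r'"
proof -
  define N where "N = {z. z \<noteq> 0 \<and> z \<bullet> E > 0} \<inter> {z \<in> - {0}. (c + r *\<^sub>R \<Phi> z) \<bullet> E > 0} \<inter> {z \<in> - {0}. (c' + r' *\<^sub>R \<Phi> z) \<bullet> E > 0}"
  have op: "open {z \<in> - {0}. (b + s *\<^sub>R \<Phi> z) \<bullet> E > 0}" for b s
  proof -
    have "continuous_on (- {0}) (\<lambda>z. (b + s *\<^sub>R \<Phi> z) \<bullet> E)" by (intro continuous_intros continuous_on_Phi)
    from continuous_open_preimage[OF this, of "{0<..}"] show ?thesis by (simp add: vimage_def Int_def open_Compl)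
  qed
  have "open {z :: 'n ambient. z \<noteq> 0 \<and> z \<bullet> E > 0}"
  proof -
    have "{z :: 'n ambient. z \<noteq> 0 \<and> z \<bullet> E > 0} = {z. z \<bullet> E > 0}" by auto
    then show ?thesis by (simp add: open_Collect_less continuous_intros)
  qed
  then have oN: "open N" unfolding N_def by (intro open_Int op)
  have EN: "E \<in> N" using core_top[OF r(1) p] core_top[OF r(2) p'] by (simp add: N_def)
  \<comment> \<open>Contact at both points with the same normal y makes their supporting planes
    coincide; scaling back to z gives equality of the two support functions on a neighbourhood of
    E.\<close>
  have h: "(c - c') \<bullet> z + (r - r') * F z = 0" if z: "z \<in> N" for z
  proof -
    have z0: "z \<noteq> 0" "z \<bullet> E > 0" and hz: "(c + r *\<^sub>R \<Phi> z) \<bullet> E > 0" "(c' + r' *\<^sub>R \<Phi> z) \<bullet> E > 0"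
      using z unfolding N_def by blast+
    define y where "y = z /\<^sub>R norm z"
    have \<Phi>y: "\<Phi> y = \<Phi> z" unfolding y_def by (rule Phi_normalize[OF z0(1)])
    have y1: "norm y = 1" using z0(1) by (simp add: y_def)
    have "y \<bullet> E > 0" using z0 by (simp add: y_def)
    then have yE: "y \<noteq> - E" by auto
    let ?q = "c + r *\<^sub>R \<Phi> y" and ?q' = "c' + r' *\<^sub>R \<Phi> y"
    have q: "?q \<in> core c r" "\<nu> ?q = y" using core_normals[OF r(1) p y1 yE] hz(1) \<Phi>y by simp_all
    have q': "?q' \<in> core c' r'" "\<nu> ?q' = y" using core_normals[OF r(2) p' y1 yE] hz(2) \<Phi>y by simp_all
    have qS: "?q \<in> S" "?q' \<in> S" "H ?q \<noteq> 0" "H ?q' \<noteq> 0" using q(1) q'(1) r unfolding core_def by auto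
    have "contact ?q" "contact ?q'" using curved_point(1) qS hz \<Phi>y by simp_all
    then have "?q' \<bullet> y \<le> ?q \<bullet> y" "?q \<bullet> y \<le> ?q' \<bullet> y"
      unfolding contact_def q(2) q'(2) using qS S_subset_closure by blast+
    then have eq: "?q \<bullet> y = ?q' \<bullet> y" by simp
    have z_eq: "z = norm z *\<^sub>R y" using z0 by (simp add: y_def)
    have "?q \<bullet> z = ?q' \<bullet> z" by (subst (1 2) z_eq) (simp only: inner_scaleR_right eq)
    then show ?thesis unfolding \<Phi>y using Phi_Euler[OF z0(1)] by (simp add: inner_add_left inner_diff_left left_diff_distrib)
  qed
  have d1: "((\<lambda>z. (c - c') \<bullet> z + (r - r') * F z) has_derivative (\<lambda>v. (c - c') \<bullet> v + (r - r') * (\<Phi> E \<bullet> v))) (at E)"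
    by (intro has_derivative_add has_derivative_mult_right F_has_derivative E_nz has_derivative_inner_right has_derivative_ident)
  have "((\<lambda>z. (c - c') \<bullet> z + (r - r') * F z) has_derivative (\<lambda>v. 0)) (at E)"
    by (rule has_derivative_transform_within_open[OF has_derivative_const oN EN]) (simp add: h)
  from has_derivative_unique[OF d1 this] have d0: "(c - c') \<bullet> v + (r - r') * (\<Phi> E \<bullet> v) = 0" for v by (rule fun_cong)
  have "((c + r *\<^sub>R \<Phi> E) - (c' + r' *\<^sub>R \<Phi> E)) \<bullet> v = 0" for v
    using d0[of v] by (simp add: inner_add_left inner_diff_left algebra_simps)
  then have eq: "c + r *\<^sub>R \<Phi> E = c' + r' *\<^sub>R \<Phi> E" by (metis eq_iff_diff_eq_0 inner_eq_zero_iff)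
  have "norm E = 1" "E \<noteq> - E" by (auto simp: E_last_def)
  then have "c + r *\<^sub>R \<Phi> E \<in> core c r" "c' + r' *\<^sub>R \<Phi> E \<in> core c' r'"
    using core_normals(1)[OF r(1) p _ _ core_top[OF r(1) p]] core_normals(1)[OF r(2) p' _ _ core_top[OF r(2) p']] by blast+
  \<comment> \<open>The common top point lies in both cores, and its curvature determines the
    radius.\<close>
  then have "1 / r = 1 / r'" using eq unfolding core_def by auto
  then have "r = r'" by simp
  then show ?thesis using eq by simp
qed

text \<open>\<open>exists_curved_point\<close> is used twice: with the empty set to find a curved
  point, and with the core of that point to produce, from a point outside, a curved point whose core
  must be the same by \<open>core_unique\<close>.\<close>

lemma interior_core: "\<exists>c r. r > 0 \<and> (\<exists>p\<in>core c r. p \<bullet> E > 0) \<and> (\<forall>p\<in>S. p \<bullet> E > 0 \<longrightarrow> p \<in> core c r)"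
proof -
  obtain s0 where "s0 \<in> S" using transv unfolding intersects_plane_transversally_def by blast
  then obtain q0 where "q0 \<in> S" "q0 \<bullet> E > 0" using approach_interior[of s0 1] by auto
  then have "\<exists>y\<in>S. y \<bullet> E > 0 \<and> y \<notin> {} \<and> H y \<noteq> 0" by (intro exists_curved_point) auto
  then obtain p where p: "p \<in> S" "p \<bullet> E > 0" "H p \<noteq> 0" by blast
  define r c where "r = 1 / H p" and "c = p - r *\<^sub>R \<Phi> (\<nu> p)"
  have r: "r > 0" using curved_point(3)[OF p] by (simp add: r_def)
  have pc: "p \<in> core c r" using curved_point_core[OF p] by (simp add: c_def r_def)
  have "q \<in> core c r" if q: "q \<in> S" "q \<bullet> E > 0" for q
  proof (rule ccontr)
    assume "q \<notin> core c r"
    then have "\<exists>y\<in>S. y \<bullet> E > 0 \<and> y \<notin> core c r \<and> H y \<noteq> 0"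
      using q core_open[OF r] compact_imp_closed[OF compact_core] by (intro exists_curved_point) blast+
    then obtain y where y: "y \<in> S" "y \<bullet> E > 0" "y \<notin> core c r" "H y \<noteq> 0" by blast
    have "c = y - (1 / H y) *\<^sub>R \<Phi> (\<nu> y) \<and> r = 1 / H y"
      using curved_point(3)[OF y(1,2,4)] by (intro core_unique[OF r _ pc p(2) curved_point_core[OF y(1,2,4)] y(2)]) simp
    then show False using curved_point_core[OF y(1,2,4)] y(3) by simp
  qed
  then show ?thesis using r pc p(2) by blast
qed

theorem rigidity: "capillary_wulff_shape F \<omega>0 S"
proof -
  obtain c r p where r: "r > 0" and p: "p \<in> core c r" "p \<bullet> E > 0" and all: "\<And>q. q \<in> S \<Longrightarrow> q \<bullet> E > 0 \<Longrightarrow> q \<in> core c r"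
    using interior_core by blast
  let ?W = "wulff_ball F r c"
  have low: "\<Phi> (- E) \<bullet> E = - F (- E)" using Phi_Euler[of "- E"] by simp
  have inS: "c + r *\<^sub>R \<Phi> z \<in> S" "\<nu> (c + r *\<^sub>R \<Phi> z) = z" "\<Phi> z \<bullet> (- E) \<le> \<omega>0"
    if z: "norm z = 1" "z \<noteq> - E" "(c + r *\<^sub>R \<Phi> z) \<bullet> E > 0" for z
  proof -
    have *: "c + r *\<^sub>R \<Phi> z \<in> core c r" "\<nu> (c + r *\<^sub>R \<Phi> z) = z" using core_normals[OF r p z] by blast+
    then show "c + r *\<^sub>R \<Phi> z \<in> S" "\<nu> (c + r *\<^sub>R \<Phi> z) = z" by (auto simp: core_def)
    moreover have "H (c + r *\<^sub>R \<Phi> z) \<noteq> 0" using * r by (auto simp: core_def)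
    ultimately show "\<Phi> z \<bullet> (- E) \<le> \<omega>0" using curved_point(2)[OF _ z(3)] by metis
  qed
  text \<open>Points of the Wulff shape on the plane are limits of points above the plane.\<close>
  have flat: "c + r *\<^sub>R \<Phi> z \<in> S \<and> \<nu> (c + r *\<^sub>R \<Phi> z) = z \<and> \<Phi> z \<bullet> (- E) \<le> \<omega>0"
    if z: "norm z = 1" "(c + r *\<^sub>R \<Phi> z) \<bullet> E = 0" for z
  proof -
    have z0: "z \<noteq> 0" using z by auto
    have "z \<noteq> E" using core_top[OF r p] z by auto
    moreover have "z \<noteq> - E"
      using core_not_low[OF r p] z(2) low by (auto simp: inner_add_left)
    ultimately obtain \<zeta> where \<zeta>: "(\<zeta> \<longlongrightarrow> z) (at_right (0::real))"
      "\<And>t. t > 0 \<Longrightarrow> norm (\<zeta> t) = 1 \<and> \<zeta> t \<noteq> - E \<and> \<Phi> z \<bullet> E < \<Phi> (\<zeta> t) \<bullet> E"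
      using push_up[OF z(1)] by blast
    have ev0: "\<forall>\<^sub>F t in at_right (0::real). t > 0" by (rule eventually_at_right_less)
    have ev: "c + r *\<^sub>R \<Phi> (\<zeta> t) \<in> S \<and> \<nu> (c + r *\<^sub>R \<Phi> (\<zeta> t)) = \<zeta> t \<and> \<Phi> (\<zeta> t) \<bullet> (- E) \<le> \<omega>0" if t: "t > 0" for t
    proof -
      have "r * (\<Phi> z \<bullet> E) < r * (\<Phi> (\<zeta> t) \<bullet> E)" using \<zeta>(2)[OF t] r by simp
      then have "(c + r *\<^sub>R \<Phi> (\<zeta> t)) \<bullet> E > 0" using z(2) by (simp add: inner_add_left)
      then show ?thesis using inS[of "\<zeta> t"] \<zeta>(2)[OF t] by blast
    qed
    have \<Phi>lim: "((\<lambda>t. \<Phi> (\<zeta> t)) \<longlongrightarrow> \<Phi> z) (at_right 0)"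
    proof (rule continuous_on_tendsto_compose[OF continuous_on_Phi \<zeta>(1)])
      show "\<forall>\<^sub>F t in at_right 0. \<zeta> t \<in> - {0}" using ev0 by eventually_elim (use \<zeta>(2) in force)
    qed (use z0 in simp)
    then have lim: "((\<lambda>t. c + r *\<^sub>R \<Phi> (\<zeta> t)) \<longlongrightarrow> c + r *\<^sub>R \<Phi> z) (at_right 0)" by (intro tendsto_intros)
    have evS: "\<forall>\<^sub>F t in at_right 0. c + r *\<^sub>R \<Phi> (\<zeta> t) \<in> S" using ev0 by eventually_elim (use ev in blast)
    have S: "c + r *\<^sub>R \<Phi> z \<in> S"
      by (rule Lim_in_closed_set[OF compact_imp_closed[OF compact_S] evS _ lim]) simp
    have "((\<lambda>t. \<nu> (c + r *\<^sub>R \<Phi> (\<zeta> t))) \<longlongrightarrow> \<nu> (c + r *\<^sub>R \<Phi> z)) (at_right 0)"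
      by (rule continuous_on_tendsto_compose[OF cont_\<nu> lim S evS])
    moreover have "((\<lambda>t. \<nu> (c + r *\<^sub>R \<Phi> (\<zeta> t))) \<longlongrightarrow> z) (at_right 0)"
      by (rule Lim_transform_eventually[OF \<zeta>(1)]) (use ev0 in \<open>eventually_elim, use ev in force\<close>)
    ultimately have n: "\<nu> (c + r *\<^sub>R \<Phi> z) = z" using tendsto_unique trivial_limit_at_right_real by blast
    have "((\<lambda>t. \<Phi> (\<zeta> t) \<bullet> (- E)) \<longlongrightarrow> \<Phi> z \<bullet> (- E)) (at_right 0)" by (intro tendsto_intros \<Phi>lim)
    then have "\<Phi> z \<bullet> (- E) \<le> \<omega>0"
      by (rule tendsto_upperbound) (use ev0 in \<open>eventually_elim, use ev in blast\<close>, simp)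
    then show ?thesis using S n by blast
  qed
  \<comment> \<open>One inclusion uses density of the points above the plane, the other the realised
    normals; \<open>core_not_low\<close> excludes the normal -E.\<close>
  have S_eq: "S = frontier ?W \<inter> closed_half_space"
  proof (intro equalityI subsetI)
    fix q assume q: "q \<in> S"
    have "q \<in> closure (frontier ?W)"
      unfolding closure_approachable
    proof (intro allI impI)
      fix e :: real assume "e > 0"
      then obtain x where x: "x \<in> S" "dist x q < e" "x \<bullet> E > 0" using approach_interior[OF q] by blast
      then have "x = c + r *\<^sub>R \<Phi> (\<nu> x)" using all unfolding core_def by blast
      then have "x \<in> frontier ?W" using frontier_wulff_mem[OF r \<nu>_nz[OF x(1)], of c] by simp
      then show "\<exists>y\<in>frontier ?W. dist y q < e" using x(2) by blast
    qed
    then show "q \<in> frontier ?W \<inter> closed_half_space" using half q by auto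
  next
    fix q assume q: "q \<in> frontier ?W \<inter> closed_half_space"
    then obtain z where z: "norm z = 1" "q = c + r *\<^sub>R \<Phi> z" by (auto simp: frontier_wulff_ball_Phi[OF r])
    have "q \<bullet> E \<ge> 0" using q by (simp add: closed_half_space_def)
    show "q \<in> S"
    proof (cases "q \<bullet> E = 0")
      case True then show ?thesis using flat[of z] z by blast
    next
      case False
      then have pos: "(c + r *\<^sub>R \<Phi> z) \<bullet> E > 0" using \<open>q \<bullet> E \<ge> 0\<close> z(2) by simp
      moreover have "z \<noteq> - E" using core_not_low[OF r p] pos low by (auto simp: inner_add_left)
      ultimately show ?thesis using inS[of z] z by blast
    qed
  qed
  have "aniso_capillary F \<omega>0 S (wulff_normal r c)"
    unfolding aniso_capillary_def
  proof (intro conjI ballI C2 half bdry transv)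
    fix q assume q: "q \<in> hs_boundary S"
    then have qS: "q \<in> S" by (simp add: hs_boundary_def)
    then have q0: "q \<bullet> E = 0" using q boundary_iff by blast
    obtain z where z: "norm z = 1" "q = c + r *\<^sub>R \<Phi> z" using qS S_eq by (auto simp: frontier_wulff_ball_Phi[OF r])
    \<comment> \<open>The limit of interior angles bounds the angle from above, the hypothesis on
      the boundary bounds it from below.\<close>
    have "\<Phi> z \<bullet> (- E) \<le> \<omega>0" "\<nu> q = z" using flat[of z] q0 z by blast+
    moreover from this have "\<Phi> z \<bullet> (- E) \<ge> \<omega>0" using contact_angle[OF q] by simp
    moreover have "wulff_normal r c q = z" unfolding z(2) by (rule wulff_normal[OF r z(1)])
    ultimately show "\<Phi> (wulff_normal r c q) \<bullet> (- E) = \<omega>0" by simp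
  qed
  then show ?thesis unfolding capillary_wulff_shape_def
    using r S_eq outward_wulff_normal[OF r, of c] by blast
qed

end

section \<open>Capillary Wulff shapes attain equality\<close>

lemma unit_normal_unique:
  fixes a b :: "'a::real_inner"
  assumes "norm a = 1" "norm b = 1" "\<And>v. v \<bullet> a = 0 \<Longrightarrow> v \<bullet> b = 0"
  shows "b = a \<or> b = - a"
proof -
  define v where "v = b - (b \<bullet> a) *\<^sub>R a"
  have va: "v \<bullet> a = 0" using assms(1) by (simp add: v_def inner_diff_left dot_square_norm)
  then have "v \<bullet> v = v \<bullet> b" by (simp add: v_def inner_diff_right)
  then have "v = 0" using assms(3)[OF va] by simp
  then have b: "b = (b \<bullet> a) *\<^sub>R a" by (simp add: v_def)
  have "\<bar>b \<bullet> a\<bar> = norm b" by (subst (2) b) (simp add: assms(1))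
  then have "b \<bullet> a = 1 \<or> b \<bullet> a = - 1" using assms(2) by linarith
  then show ?thesis using b by (metis scaleR_minus1_left scaleR_one)
qed

lemma adapted_chart_restrict:
  assumes c: "adapted_chart S W U V \<psi> g" and G: "open G" "T \<inter> G = S \<inter> G"
  shows "adapted_chart T W (U \<inter> G) (V \<inter> g -` G) \<psi> g"
proof -
  have hom: "homeomorphism U V \<psi> g" and o: "open U" "open V" and C2: "C_k_on 2 U \<psi>" "C_k_on 2 V g"
    and im: "\<psi> ` (S \<inter> U) = V \<inter> (W \<times> {0})" and W: "W \<in> models"
    using c unfolding adapted_chart_def by blast+
  have g\<psi>: "g (\<psi> x) = x" "\<psi> x \<in> V" if "x \<in> U" for x using hom that unfolding homeomorphism_def by blast+
  have \<psi>g: "\<psi> (g y) = y" "g y \<in> U" if "y \<in> V" for y using hom that unfolding homeomorphism_def by blast+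
  have oU: "open (U \<inter> G)" using o(1) G(1) by blast
  have "continuous_on V g" using hom unfolding homeomorphism_def by blast
  then have oV: "open (V \<inter> g -` G)" using o(2) G(1) by (rule continuous_open_preimage)
  have "\<psi> ` (U \<inter> G) = V \<inter> g -` G"
  proof (intro equalityI subsetI)
    fix y assume "y \<in> \<psi> ` (U \<inter> G)" then show "y \<in> V \<inter> g -` G" using g\<psi> by auto
  next
    fix y assume y: "y \<in> V \<inter> g -` G"
    then have "y = \<psi> (g y)" "g y \<in> U \<inter> G" using \<psi>g by auto
    then show "y \<in> \<psi> ` (U \<inter> G)" by blast
  qed
  then have hom': "homeomorphism (U \<inter> G) (V \<inter> g -` G) \<psi> g"
    by (intro homeomorphism_of_subsets[OF hom]) auto
  have "\<psi> ` (T \<inter> (U \<inter> G)) = (V \<inter> g -` G) \<inter> (W \<times> {0})"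
  proof (intro equalityI subsetI)
    fix y assume "y \<in> \<psi> ` (T \<inter> (U \<inter> G))"
    then obtain x where x: "x \<in> S \<inter> U" "x \<in> G" "y = \<psi> x" using G(2) by blast
    then have "y \<in> V \<inter> (W \<times> {0})" using im by blast
    then show "y \<in> (V \<inter> g -` G) \<inter> (W \<times> {0})" using x g\<psi> by auto
  next
    fix y assume y: "y \<in> (V \<inter> g -` G) \<inter> (W \<times> {0})"
    then have "y \<in> \<psi> ` (S \<inter> U)" using im by blast
    then obtain x where x: "x \<in> S" "x \<in> U" "y = \<psi> x" by blast
    then have "x \<in> G" using y g\<psi> by auto
    then show "y \<in> \<psi> ` (T \<inter> (U \<inter> G))" using x G(2) by blast
  qed
  with W oU oV hom' show ?thesis unfolding adapted_chart_def
    by (intro conjI C_k_on_subset[OF C2(1)] C_k_on_subset[OF C2(2)]) auto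
qed

text \<open>To be applied to S and the full Wulff shape, which coincide above the plane.\<close>

lemma tangent_space_local:
  assumes "open G" "T \<inter> G = S \<inter> G" "p \<in> G" shows "tangent_space S p \<subseteq> tangent_space T p"
proof
  fix v assume "v \<in> tangent_space S p"
  then obtain W U V \<psi> g where c: "adapted_chart S W U V \<psi> g" "p \<in> U" "snd (frechet_derivative \<psi> (at p) v) = 0"
    unfolding tangent_space_def by blast
  have "p \<in> U \<inter> G" using c(2) assms(3) by blast
  then show "v \<in> tangent_space T p"
    unfolding tangent_space_def using adapted_chart_restrict[OF c(1) assms(1,2)] c(3) by blast
qed

context willmore_problem
begin

lemma zero_if_zero_above:
  fixes f :: "'n ambient \<Rightarrow> 'b::real_normed_vector"
  assumes f: "continuous_on S f" and zero: "\<And>p. p \<in> S \<Longrightarrow> p \<bullet> E > 0 \<Longrightarrow> f p = 0" and p: "p \<in> S"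
  shows "f p = 0"
proof (rule ccontr)
  assume "f p \<noteq> 0"
  then obtain d where d: "d > 0" "\<And>q. q \<in> S \<Longrightarrow> dist q p < d \<Longrightarrow> dist (f q) (f p) < norm (f p)"
    using f p unfolding continuous_on_iff by (metis zero_less_norm_iff)
  obtain q where q: "q \<in> S" "dist q p < d" "q \<bullet> E > 0" using approach_interior[OF p d(1)] by blast
  then show False using d(2)[OF q(1,2)] zero[OF q(1,3)] by simp
qed

section \<open>Normals and curvature of a capillary Wulff shape\<close>

context
  fixes r c \<nu>'
  assumes r: "r > 0" and S_eq: "S = frontier (wulff_ball F r c) \<inter> closed_half_space"
    and out: "outward_unit_normal (frontier (wulff_ball F r c)) (wulff_ball F r c) \<nu>'"
    and cap': "aniso_capillary F \<omega>0 S \<nu>'"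
begin

abbreviation "N \<equiv> wulff_normal r c"

lemma N: assumes "p \<in> S" shows "norm (N p) = 1" "p = c + r *\<^sub>R \<Phi> (N p)"
proof -
  obtain z where z: "norm z = 1" "p = c + r *\<^sub>R \<Phi> z" using assms S_eq by (auto simp: frontier_wulff_ball_Phi[OF r])
  have "N p = z" unfolding z(2) by (rule wulff_normal[OF r z(1)])
  then show "norm (N p) = 1" "p = c + r *\<^sub>R \<Phi> (N p)" using z by simp_all
qed

lemma cont_N: "continuous_on S N"
  by (rule continuous_on_subset[OF continuous_on_wulff_normal[OF r]]) (use S_eq in blast)

lemma support_le: "x \<in> S \<Longrightarrow> p \<in> S \<Longrightarrow> x \<bullet> N p \<le> p \<bullet> N p"
proof -
  assume x: "x \<in> S" and p: "p \<in> S"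
  have "N p \<noteq> 0" using N(1)[OF p] by auto
  have "(x - c) \<bullet> N p \<le> r * F (N p)" by (rule frontier_wulff_support[OF r]) (use x S_eq in blast)
  also have "\<dots> = (p - c) \<bullet> N p" by (subst N(2)[OF p]) (simp add: Phi_Euler[OF \<open>N p \<noteq> 0\<close>])
  finally show ?thesis by (simp add: inner_diff_left)
qed

text \<open>p maximises \<langle>_, N p\<rangle> on S, so every tangent direction at the interior
  point p is orthogonal to N p.\<close>

lemma N_parallel:
  assumes p: "p \<in> S" "p \<bullet> E > 0" shows "N p = \<nu> p \<or> N p = - \<nu> p"
proof (rule unit_normal_unique[OF norm_\<nu>[OF p(1)] N(1)[OF p(1)]])
  fix v assume v: "v \<bullet> \<nu> p = 0"
  have nb: "p \<notin> hs_boundary S" using boundary_iff[OF p(1)] p(2) by simp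
  have "w \<bullet> N p \<le> 0" if w: "w \<bullet> \<nu> p = 0" for w
  proof -
    have "((\<lambda>x. - (x \<bullet> N p)) has_derivative (\<lambda>v. - (v \<bullet> N p))) (at p)" by (auto intro!: derivative_eq_intros)
    then have "- (w \<bullet> N p) \<ge> 0"
      by (rule right_curve_real_le[OF right_curve_interior[OF p(1) nb w]])
         (intro always_eventually allI impI, use support_le[OF _ p(1)] in simp)
    then show ?thesis by simp
  qed
  from this[OF v] this[of "- v"] v show "v \<bullet> N p = 0" by simp
qed

text \<open>The normal in the definition of a capillary Wulff shape is an arbitrary outward one.
  Tangency fixes it up to sign above the plane, and the opposite sign would place points beyond the
  supporting plane inside the ball; continuity does the rest.\<close>

lemma \<nu>'_eq:
  assumes p: "p \<in> S" shows "\<nu>' p = N p"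
proof -
  let ?A = "frontier (wulff_ball F r c)"
  have above: "\<nu>' q - N q = 0" if q: "q \<in> S" "q \<bullet> E > 0" for q
  proof -
    let ?G = "{x. x \<bullet> E > 0}"
    have qA: "q \<in> ?A" using q(1) S_eq by blast
    have "open ?G" by (intro open_Collect_less continuous_intros)
    moreover have "?A \<inter> ?G = S \<inter> ?G" unfolding S_eq by (auto simp: closed_half_space_def)
    ultimately have "tangent_space S q \<subseteq> tangent_space ?A q" by (rule tangent_space_local) (use q in simp)
    then have perp: "\<nu>' q \<bullet> v = 0" if "v \<bullet> \<nu> q = 0" for v
      using that out qA tangent_space_perp[OF q(1)] unfolding outward_unit_normal_def by blast
    have "v \<bullet> \<nu>' q = 0" if "v \<bullet> N q = 0" for v
    proof -
      have "v \<bullet> \<nu> q = 0" using that N_parallel[OF q] by auto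
      then show ?thesis using perp[of v] by (simp only: inner_commute[of v])
    qed
    moreover have "norm (\<nu>' q) = 1" using out qA unfolding outward_unit_normal_def by blast
    ultimately have "\<nu>' q = N q \<or> \<nu>' q = - N q" using unit_normal_unique[OF N(1)[OF q(1)]] by blast
    moreover have "\<nu>' q \<noteq> - N q"
    proof
      assume neg: "\<nu>' q = - N q"
      have "q \<notin> hs_boundary ?A"
        by (rule not_boundary_if_full_tangent(1)[OF qA N(1)[OF q(1)]])
           (use right_curve_frontier_wulff[OF r N(1)[OF q(1)], of _ c] N(2)[OF q(1)] in simp)
      then have "\<forall>\<^sub>F t in at_right 0. q - t *\<^sub>R \<nu>' q \<in> wulff_ball F r c"
        using out qA unfolding outward_unit_normal_def by (auto elim: eventually_mono)
      then obtain b where b: "b > 0" "\<And>t. 0 < t \<Longrightarrow> t < b \<Longrightarrow> q - t *\<^sub>R \<nu>' q \<in> wulff_ball F r c"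
        unfolding eventually_at_right_field by blast
      have "q - (b / 2) *\<^sub>R \<nu>' q \<in> wulff_ball F r c" using b by simp
      then have "c + r *\<^sub>R \<Phi> (N q) + (b / 2) *\<^sub>R N q \<in> wulff_ball F r c"
        unfolding neg N(2)[OF q(1), symmetric] by simp
      then show False using wulff_normal_sides(2)[OF r N(1)[OF q(1)], of "b / 2" c] b(1) by simp
    qed
    ultimately show ?thesis by simp
  qed
  have "continuous_on S \<nu>'"
    by (rule continuous_on_subset[of ?A]) (use out S_eq in \<open>auto simp: outward_unit_normal_def\<close>)
  then have "continuous_on S (\<lambda>q. \<nu>' q - N q)" by (intro continuous_on_diff cont_N)
  then have "\<nu>' p - N p = 0" using above p by (rule zero_if_zero_above)
  then show ?thesis by simp
qed

text \<open>Read off from the contact angle at one point on the plane. It makes the part above the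
  plane correspond exactly to the normals in \<open>cap\<close>.\<close>

lemma center_height: "c \<bullet> E = r * \<omega>0"
proof -
  obtain p where "p \<in> S" "p \<bullet> E = 0" using transv unfolding intersects_plane_transversally_def bounding_plane_def by blast
  then have "\<Phi> (N p) \<bullet> (- E) = \<omega>0" using cap' boundary_iff \<nu>'_eq unfolding aniso_capillary_def by metis
  moreover have "c \<bullet> E + r * (\<Phi> (N p) \<bullet> E) = 0"
    using \<open>p \<bullet> E = 0\<close> by (subst (asm) N(2)[OF \<open>p \<in> S\<close>]) (simp add: inner_add_left)
  ultimately show ?thesis by auto
qed

lemma above_iff:
  assumes "norm z = 1"
  shows "(c + r *\<^sub>R \<Phi> z) \<bullet> E > 0 \<longleftrightarrow> \<Phi> z \<bullet> (- E) < \<omega>0" "(c + r *\<^sub>R \<Phi> z) \<bullet> E > 0 \<Longrightarrow> c + r *\<^sub>R \<Phi> z \<in> S"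
proof -
  have "(c + r *\<^sub>R \<Phi> z) \<bullet> E = r * (\<omega>0 - \<Phi> z \<bullet> (- E))"
    by (simp add: inner_add_left center_height distrib_left)
  then show "(c + r *\<^sub>R \<Phi> z) \<bullet> E > 0 \<longleftrightarrow> \<Phi> z \<bullet> (- E) < \<omega>0" using r by (auto simp: zero_less_mult_iff)
  have "z \<noteq> 0" using assms by auto
  then show "(c + r *\<^sub>R \<Phi> z) \<bullet> E > 0 \<Longrightarrow> c + r *\<^sub>R \<Phi> z \<in> S"
    unfolding S_eq using frontier_wulff_mem[OF r, of z c] by (simp add: closed_half_space_def)
qed

text \<open>A downward normal at the top point would put a vertical ray into the bounded domain.\<close>

lemma top_normal: "\<nu> (c + r *\<^sub>R \<Phi> E) = E"
proof -
  let ?p = "c + r *\<^sub>R \<Phi> E"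
  have "\<Phi> E \<bullet> (- E) < \<omega>0" using \<omega>0(1) Phi_Euler[of E] by simp
  then have pE: "?p \<bullet> E > 0" using above_iff(1)[of E] by simp
  then have pS: "?p \<in> S" using above_iff(2)[of E] by simp
  have NE: "N ?p = E" by (rule wulff_normal[OF r norm_E])
  have "\<nu> ?p \<noteq> - E"
  proof
    assume neg: "\<nu> ?p = - E"
    obtain b where b: "b > 0" "\<And>t. 0 < t \<Longrightarrow> t < b \<Longrightarrow> ?p - t *\<^sub>R \<nu> ?p \<in> \<Omega>"
      using inward_point[OF pS pE] unfolding eventually_at_right_field by blast
    let ?T = "(\<lambda>t. ?p + t *\<^sub>R E) ` {0<..}"
    have "?T \<subseteq> \<Omega>"
    proof (rule connected_in_\<Omega>)
      show "connected ?T" by (intro connected_continuous_image continuous_intros) auto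
      have "?p - (b / 2) *\<^sub>R \<nu> ?p \<in> \<Omega>" using b by simp
      then have "?p + (b / 2) *\<^sub>R E \<in> \<Omega>" unfolding neg by simp
      then have "?p + (b / 2) *\<^sub>R E \<in> ?T \<inter> \<Omega>" using b(1) by (intro IntI image_eqI[OF refl]) auto
      then show "?T \<inter> \<Omega> \<noteq> {}" by blast
      have "?p + t *\<^sub>R E \<notin> S" if "t > 0" for t
        using support_le[OF _ pS, of "?p + t *\<^sub>R E"] that unfolding NE by (auto simp: inner_add_left)
      then show "?T \<inter> S = {}" by blast
      show "x \<bullet> E > 0" if "x \<in> ?T" for x
      proof -
        obtain t where t: "t > 0" "x = ?p + t *\<^sub>R E" using \<open>x \<in> ?T\<close> by blast
        have "x \<bullet> E = ?p \<bullet> E + t" unfolding t(2) inner_add_left[of ?p] by simp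
        then show ?thesis using pE t(1) by linarith
      qed
    qed
    moreover obtain M where M: "\<And>x. x \<in> \<Omega> \<Longrightarrow> norm x \<le> M" using bounded_\<Omega> unfolding bounded_iff by blast
    ultimately have le: "norm (?p + t *\<^sub>R E) \<le> M" if "t > 0" for t using that by blast
    have tM: "t \<le> M" if t: "t > 0" for t
    proof -
      have "t \<le> ?p \<bullet> E + t" using pE by simp
      also have "\<dots> = (?p + t *\<^sub>R E) \<bullet> E" unfolding inner_add_left[of ?p] by simp
      also have "\<dots> \<le> norm (?p + t *\<^sub>R E)" using norm_cauchy_schwarz[of "?p + t *\<^sub>R E" E] by simp
      finally show ?thesis using le[OF t] by simp
    qed
    have "\<bar>M\<bar> + 1 \<le> M" by (rule tM) linarith
    then show False by linarith
  qed
  then show ?thesis using N_parallel[OF pS pE] NE by (metis minus_minus)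
qed

text \<open>\<nu> points out of \<Omega>, while N points out of the Wulff ball. Their inner product
  is a continuous sign on the connected set of upper normals and equals 1 at the top point.\<close>

lemma \<nu>_eq: assumes p: "p \<in> S" shows "\<nu> p = N p"
proof -
  let ?Z = "{z. norm z = 1 \<and> z \<noteq> - E \<and> \<Phi> z \<bullet> (- E) < \<omega>0}"
  let ?s = "\<lambda>z. \<nu> (c + r *\<^sub>R \<Phi> z) \<bullet> z"
  have Zs: "c + r *\<^sub>R \<Phi> z \<in> S" "?s z = 1 \<or> ?s z = - 1" if z: "z \<in> ?Z" for z
  proof -
    have pos: "(c + r *\<^sub>R \<Phi> z) \<bullet> E > 0" using z above_iff(1)[of z] by simp
    then show *: "c + r *\<^sub>R \<Phi> z \<in> S" using z above_iff(2)[of z] by simp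
    have "N (c + r *\<^sub>R \<Phi> z) = z" using wulff_normal[OF r] z by simp
    then have "z = \<nu> (c + r *\<^sub>R \<Phi> z) \<or> z = - \<nu> (c + r *\<^sub>R \<Phi> z)" using N_parallel[OF * pos] by simp
    moreover have "\<nu> (c + r *\<^sub>R \<Phi> z) \<bullet> \<nu> (c + r *\<^sub>R \<Phi> z) = 1" using norm_\<nu>[OF *] by (simp add: dot_square_norm)
    ultimately show "?s z = 1 \<or> ?s z = - 1" by (metis inner_minus_right)
  qed
  have c\<Phi>: "continuous_on ?Z (\<lambda>z. c + r *\<^sub>R \<Phi> z)"
    by (intro continuous_intros continuous_on_subset[OF continuous_on_Phi]) auto
  have "continuous_on ?Z (\<lambda>z. \<nu> (c + r *\<^sub>R \<Phi> z))"
    by (rule continuous_on_compose2[OF cont_\<nu> c\<Phi>]) (use Zs(1) in blast)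
  then have "connected (?s ` ?Z)" by (intro connected_continuous_image connected_upper_normals continuous_on_inner continuous_on_id)
  then have conn: "\<And>x y. x \<in> ?s ` ?Z \<Longrightarrow> y \<in> ?s ` ?Z \<Longrightarrow> {x..y} \<subseteq> ?s ` ?Z" by (rule connected_contains_Icc)
  have "E \<noteq> - E" by (auto simp: E_last_def)
  then have EZ: "E \<in> ?Z" using \<omega>0(1) Phi_Euler[of E] by simp
  have sE: "?s E = 1" using top_normal by simp
  have one: "?s z = 1" if z: "z \<in> ?Z" for z
  proof (rule ccontr)
    assume "?s z \<noteq> 1"
    then have "?s z = - 1" using Zs(2)[OF z] by blast
    then have "- 1 \<in> ?s ` ?Z" by (rule image_eqI[where f = ?s, OF sym z])
    moreover have "1 \<in> ?s ` ?Z" by (rule image_eqI[where f = ?s, OF sE[symmetric] EZ])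
    ultimately have "{- 1..1} \<subseteq> ?s ` ?Z" by (rule conn)
    moreover have "(0::real) \<in> {- 1..1}" by simp
    ultimately have "0 \<in> ?s ` ?Z" by blast
    then obtain y where y: "y \<in> ?Z" "0 = ?s y" by (rule imageE)
    then show False using Zs(2)[OF y(1)] by linarith
  qed
  have "\<nu> q - N q = 0" if q: "q \<in> S" "q \<bullet> E > 0" for q
  proof -
    have "\<Phi> (N q) \<bullet> (- E) < \<omega>0" using above_iff(1)[OF N(1)[OF q(1)]] N(2)[OF q(1)] q(2) by simp
    moreover from this have "N q \<noteq> - E" using \<omega>0(2) Phi_Euler[of "- E"] by auto
    ultimately have "?s (N q) = 1" using N(1)[OF q(1)] by (intro one) simp
    then have "\<nu> q \<bullet> N q = 1" using N(2)[OF q(1)] by simp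
    then have "N q \<noteq> - \<nu> q" using norm_\<nu>[OF q(1)] by (auto simp: dot_square_norm)
    then show ?thesis using N_parallel[OF q] by simp
  qed
  then have "\<nu> p - N p = 0"
    by (rule zero_if_zero_above[OF continuous_on_diff[OF cont_\<nu> cont_N] _ p])
  then show ?thesis by simp
qed

text \<open>On S the anisotropic Gauss map is the homothety x \<mapsto> (x - c) / r, so every point
  is umbilic.\<close>

lemma wulff_curvature:
  assumes p: "p \<in> S" shows "H p = 1 / r" "K p = \<bar>H p\<bar> ^ CARD('n)"
proof -
  obtain B n n' \<rho> a where ext: "normal_ext S \<nu> B n n' \<rho> a" "p \<in> B" using exists_ext[OF p] .
  have D0: "((\<lambda>x. (x - c) /\<^sub>R r) has_derivative (\<lambda>v. v /\<^sub>R r)) (at p within S)"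
    by (auto intro!: derivative_eq_intros)
  have "\<Phi> (\<nu> x) = (x - c) /\<^sub>R r" if "x \<in> S" for x
  proof -
    have "x - c = r *\<^sub>R \<Phi> (\<nu> x)" using N(2)[OF that] \<nu>_eq[OF that] by (metis add_diff_cancel_left')
    then show ?thesis using r by simp
  qed
  then have D: "((\<lambda>x. \<Phi> (\<nu> x)) has_derivative (\<lambda>v. v /\<^sub>R r)) (at p within S)"
    by (rule has_derivative_transform[OF p _ D0])
  have umb: "NF' n n' p v = (1 / r) *\<^sub>R v" if v: "v \<bullet> \<nu> p = 0" for v
    using derivative_within_eq[OF ext(1) p ext(2) D v] by (simp add: divide_inverse)
  show "H p = 1 / r" by (rule K_H_umbilic(1)[OF ext(1) p ext(2) umb])
  then show "K p = \<bar>H p\<bar> ^ CARD('n)" using K_H_umbilic(2)[OF ext(1) p ext(2) umb] by simp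
qed

text \<open>The losses in the inequality disappear: umbilicity gives equality between K and the
  power of H, and the normal determines the point, so the cone volume is exact.\<close>

lemma wulff_equality:
  "1 / (real CARD('n) + 1) * willmore_integral F \<omega>0 S \<nu> = measure lborel (truncated_wulff_ball F \<omega>0)"
proof (rule antisym)
  let ?c = "ennreal (1 / (real CARD('n) + 1))" and ?W = "truncated_wulff_ball F \<omega>0"
  have inj: "inj_on (\<lambda>(p, t). t *\<^sub>R Nrm p) (S \<times> {0<..<1})"
  proof (rule inj_onI, clarify)
    fix p q s t
    assume p: "p \<in> S" and q: "q \<in> S" and s: "s \<in> {0<..<1::real}" and t: "t \<in> {0<..<1::real}" and eq: "s *\<^sub>R Nrm p = t *\<^sub>R Nrm q"
    have "s = t \<and> \<nu> p = \<nu> q"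
      by (rule cap_cone_inj) (use eq s t norm_\<nu>[OF p] norm_\<nu>[OF q] in \<open>simp_all add: Nrm_def\<close>)
    moreover from this have "p = q" using N(2)[OF p] N(2)[OF q] \<nu>_eq[OF p] \<nu>_eq[OF q] by metis
    ultimately show "p = q \<and> s = t" by simp
  qed
  \<comment> \<open>The cone over the points on the plane lies in the bounding plane, a null
    set.\<close>
  have sub: "gcone S \<subseteq> ?W \<union> {x. E \<bullet> x = 0}"
  proof
    fix x assume "x \<in> gcone S"
    then obtain t p where x: "x = t *\<^sub>R (\<Phi> (\<nu> p) + shift)" "0 < t" "t < 1" and p: "p \<in> S"
      unfolding gcone_def Nrm_def by blast
    show "x \<in> ?W \<union> {x. E \<bullet> x = 0}"
    proof (cases "p \<bullet> E > 0")
      case True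
      then have "\<nu> p \<in> cap" using above_iff(1)[OF N(1)[OF p]] N[OF p] \<nu>_eq[OF p] by (simp add: cap_def)
      then show ?thesis using cap_cone_in_truncated x by blast
    next
      case False
      then have "p \<bullet> E = 0" using height_nonneg[OF p] by simp
      then have "c \<bullet> E + r * (\<Phi> (\<nu> p) \<bullet> E) = 0"
        by (subst (asm) N(2)[OF p]) (simp add: inner_add_left \<nu>_eq[OF p])
      then have "r * (\<omega>0 + \<Phi> (\<nu> p) \<bullet> E) = 0" by (simp add: center_height distrib_left)
      then have "x \<bullet> E = 0" using r x(1) shift_E by (simp add: inner_add_left)
      then show ?thesis by (simp add: inner_commute)
    qed
  qed
  have null: "{x. E \<bullet> x = 0} \<in> null_sets lebesgue"
    using negligible_hyperplane[of E 0] by (simp add: negligible_iff_null_sets)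
  have Wl: "?W \<in> sets lebesgue" using truncated_borel by simp
  have "ennreal (1 / (real CARD('n) + 1) * willmore_integral F \<omega>0 S \<nu>) = ?c * (\<integral>\<^sup>+p\<in>S. ennreal (\<Theta> p * \<bar>H p\<bar> ^ CARD('n)) \<partial>\<mu>)"
    unfolding willmore_eq_nn_integral[symmetric] using willmore_nonneg by (intro ennreal_mult) auto
  also have "(\<integral>\<^sup>+p\<in>S. ennreal (\<Theta> p * \<bar>H p\<bar> ^ CARD('n)) \<partial>\<mu>) = (\<integral>\<^sup>+p\<in>S. ennreal (\<Theta> p * K p) \<partial>\<mu>)"
    using wulff_curvature(2) by (intro nn_integral_cong) (simp split: split_indicator)
  also have "?c * \<dots> = emeasure lebesgue (gcone S)"
    by (rule cone_volume(3)[OF S_borel order_refl inj, symmetric])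
  also have "\<dots> \<le> emeasure lebesgue (?W \<union> {x. E \<bullet> x = 0})"
    using sub Wl null by (intro emeasure_mono) auto
  also have "\<dots> = emeasure lebesgue ?W" by (rule emeasure_Un_null_set[OF Wl null])
  also have "\<dots> = emeasure lborel ?W" using truncated_borel by simp
  also have "\<dots> = ennreal (measure lborel ?W)" by (rule willmore_inequality(1)[symmetric])
  finally show "1 / (real CARD('n) + 1) * willmore_integral F \<omega>0 S \<nu> \<le> measure lborel ?W"
    by (simp add: ennreal_le_iff)
qed (rule willmore_inequality(3))

end

theorem equality_if_wulff:
  assumes "capillary_wulff_shape F \<omega>0 S"
  shows "1 / (real CARD('n) + 1) * willmore_integral F \<omega>0 S \<nu> = measure lborel (truncated_wulff_ball F \<omega>0)"
proof -
  obtain r c \<nu>' where "r > 0" "S = frontier (wulff_ball F r c) \<inter> closed_half_space"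
    "outward_unit_normal (frontier (wulff_ball F r c)) (wulff_ball F r c) \<nu>'" "aniso_capillary F \<omega>0 S \<nu>'"
    using assms unfolding capillary_wulff_shape_def by (elim exE conjE)
  then show ?thesis by (rule wulff_equality)
qed

end

theorem theorem1p4:
  fixes F :: "'n::finite ambient \<Rightarrow> real"
    and \<omega>0 :: real
    and \<Sigma> \<Omega> :: "'n ambient set"
    and \<nu> :: "'n ambient \<Rightarrow> 'n ambient"
  assumes "CARD('n) \<ge> 2"
    and "minkowski_norm F"
    and "- F E_last < \<omega>0" and "\<omega>0 < F (- E_last)"
    and "compact \<Sigma>" and "C2_hypersurface \<Sigma>"
    and "\<Sigma> \<subseteq> closed_half_space"
    and "hs_boundary \<Sigma> \<subseteq> bounding_plane"
    and "intersects_plane_transversally \<Sigma>"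
    and "enclosed_domain \<Sigma> \<Omega>"
    and "outward_unit_normal \<Sigma> \<Omega> \<nu>"
    and "\<forall>x\<in>hs_boundary \<Sigma>. Phi F (\<nu> x) \<bullet> (- E_last) \<ge> \<omega>0"
  shows "1 / (real CARD('n) + 1) * willmore_integral F \<omega>0 \<Sigma> \<nu>
           \<ge> measure lborel (truncated_wulff_ball F \<omega>0)
       \<and> (1 / (real CARD('n) + 1) * willmore_integral F \<omega>0 \<Sigma> \<nu>
             = measure lborel (truncated_wulff_ball F \<omega>0)
           \<longleftrightarrow> capillary_wulff_shape F \<omega>0 \<Sigma>)"
proof -
  have \<nu>: "continuous_on \<Sigma> \<nu>" "\<And>p. p \<in> \<Sigma> \<Longrightarrow> norm (\<nu> p) = 1"
    "\<And>p v. p \<in> \<Sigma> \<Longrightarrow> v \<in> tangent_space \<Sigma> p \<Longrightarrow> \<nu> p \<bullet> v = 0"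
    using assms(11) unfolding outward_unit_normal_def by blast+
  have angle: "\<And>p. p \<in> hs_boundary \<Sigma> \<Longrightarrow> Phi F (\<nu> p) \<bullet> (- E_last) \<ge> \<omega>0" using assms(12) by (rule bspec)
  interpret willmore_problem F \<omega>0 \<Sigma> \<nu> \<Omega>
    by unfold_locales (rule assms(2-11) \<nu> angle, (assumption+)?)+
  show ?thesis
  proof (intro conjI iffI)
    show "1 / (real CARD('n) + 1) * willmore_integral F \<omega>0 \<Sigma> \<nu> \<ge> measure lborel (truncated_wulff_ball F \<omega>0)"
      by (rule willmore_inequality(3))
  next
    assume eq: "1 / (real CARD('n) + 1) * willmore_integral F \<omega>0 \<Sigma> \<nu> = measure lborel (truncated_wulff_ball F \<omega>0)"
    interpret willmore_equality F \<omega>0 \<Sigma> \<nu> \<Omega> by unfold_locales (use assms(1) eq in auto)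
    show "capillary_wulff_shape F \<omega>0 \<Sigma>" by (rule rigidity)
  next
    assume "capillary_wulff_shape F \<omega>0 \<Sigma>"
    then show "1 / (real CARD('n) + 1) * willmore_integral F \<omega>0 \<Sigma> \<nu> = measure lborel (truncated_wulff_ball F \<omega>0)"
      by (rule equality_if_wulff)
  qed
qed

end
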